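(* Let $n\ge 3$, and let $\Omega\subset\mathbb R^n$ be a bounded, smooth, uniformly convex domain. Let $u\in C^\infty(\Omega)\cap C^{1,1}(\overline{\Omega})$ be such that its graph is $\Gamma_2$-admissible in $\Omega$, $u$ satisfies $$\sigma_2(\kappa[u])=(1+|Du|^2)^{-2}\quad\text{in }\Omega,$$ and $u=0$ on $\partial\Omega$. Set $v=-\sqrt{-u}$. Then $u<0$ in $\Omega$, and $v$ is strictly convex in $\Omega$.
   Context: For a function $u$ on $\Omega\subset\mathbb R^n$, $\kappa[u]=(\kappa_1[u],\ldots,\kappa_n[u])$ denotes the principal curvatures of the graph $\{(x,u(x)):x\in\Omega\}\subset\mathbb R^{n+1}$, i.e. the eigenvalues of the symmetric matrix $$\frac{1}{\sqrt{1+|Du|^2}}\,(I+Du\otimes Du)^{-1/2}\,D^2u\,(I+Du\otimes Du)^{-1/2}.$$ For $\lambda\in\mathbb R^n$, $\sigma_1(\lambda)=\sum_i\lambda_i$ and $\sigma_2(\lambda)=\sum_{i<j}\lambda_i\lambda_j$. The Gårding cone is $\Gamma_2=\{\lambda\in\mathbb R^n:\sigma_1(\lambda)>0,\ \sigma_2(\lambda)>0\}$. The graph of $u$ is called $\Gamma_2$-admissible if $\kappa[u](x)\in\Gamma_2$ at every point $x$. A smooth bounded domain is uniformly convex if all principal curvatures of its boundary are bounded below by a positive constant. Strict convexity of $v$ in $\Omega$ is understood in the sense $D^2v>0$ (positive definite) at every point of $\Omega$. *)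

theory Defs
  imports "HOL-Analysis.Analysis"
begin

section \<open>Differentiability classes\<close>

text \<open>The \<open>C^k\<close> and \<open>C^\<infinity>\<close> notions below are intended for open sets \<open>S\<close>.\<close>

primrec Ck_on :: "nat \<Rightarrow> 'a::real_normed_vector set \<Rightarrow> ('a \<Rightarrow> 'b::real_normed_vector) \<Rightarrow> bool" where
  "Ck_on 0 S f \<longleftrightarrow> continuous_on S f"
| "Ck_on (Suc k) S f \<longleftrightarrow>
     (\<forall>x\<in>S. f differentiable (at x)) \<and>
     (\<forall>h. Ck_on k S (\<lambda>x. frechet_derivative f (at x) h))"

definition smooth_on :: "'a::real_normed_vector set \<Rightarrow> ('a \<Rightarrow> 'b::real_normed_vector) \<Rightarrow> bool" where
  "smooth_on S f \<longleftrightarrow> (\<forall>k. Ck_on k S f)"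

definition gradient :: "(real^'n \<Rightarrow> real) \<Rightarrow> real^'n \<Rightarrow> real^'n" where
  "gradient f x = (\<chi> i. frechet_derivative f (at x) (axis i 1))"

definition hessian :: "(real^'n \<Rightarrow> real) \<Rightarrow> real^'n \<Rightarrow> real^'n^'n" where
  "hessian f x = matrix (frechet_derivative (gradient f) (at x))"

text \<open>\<open>u \<in> C^{1,1}\<close> of the closure of the open set \<open>\<Omega>\<close>: \<open>u\<close> is continuous up to the boundary,
  differentiable in \<open>\<Omega>\<close>, and its gradient extends to a Lipschitz field on the closure.\<close>

definition C11_closure :: "(real^'n) set \<Rightarrow> (real^'n \<Rightarrow> real) \<Rightarrow> bool" where
  "C11_closure \<Omega> u \<longleftrightarrow>
     continuous_on (closure \<Omega>) u \<and>
     (\<forall>x\<in>\<Omega>. u differentiable (at x)) \<and>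
     (\<exists>L G. L-lipschitz_on (closure \<Omega>) G \<and> (\<forall>x\<in>\<Omega>. G x = gradient u x))"

section \<open>Smooth uniformly convex domains\<close>

definition local_defining_function ::
    "(real^'n) set \<Rightarrow> real^'n \<Rightarrow> (real^'n) set \<Rightarrow> (real^'n \<Rightarrow> real) \<Rightarrow> bool" where
  "local_defining_function \<Omega> p U \<rho> \<longleftrightarrow>
     open U \<and> p \<in> U \<and> smooth_on U \<rho> \<and> (\<forall>x\<in>U. gradient \<rho> x \<noteq> 0) \<and>
     \<Omega> \<inter> U = {x\<in>U. \<rho> x < 0}"

definition smooth_boundary :: "(real^'n) set \<Rightarrow> bool" where
  "smooth_boundary \<Omega> \<longleftrightarrow> (\<forall>p\<in>frontier \<Omega>. \<exists>U \<rho>. local_defining_function \<Omega> p U \<rho>)"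

text \<open>Principal curvatures of the boundary at \<open>p\<close> are the eigenvalues of the Weingarten map, the
  differential of the outward unit normal \<open>D\<rho> / |D\<rho>|\<close> on the tangent space
  \<open>D\<rho>(p)\<^sup>\<bottom>\<close>. With this sign a sphere of radius \<open>R\<close> has curvatures \<open>1/R\<close>.
  Only tangential derivatives of the normal enter, so the choice of \<open>\<rho>\<close> is irrelevant.\<close>

definition boundary_principal_curvatures :: "(real^'n) set \<Rightarrow> real^'n \<Rightarrow> real set" where
  "boundary_principal_curvatures \<Omega> p =
     {k. \<exists>U \<rho> X. local_defining_function \<Omega> p U \<rho> \<and>
            X \<noteq> 0 \<and> X \<bullet> gradient \<rho> p = 0 \<and>
            frechet_derivative (\<lambda>x. gradient \<rho> x /\<^sub>R norm (gradient \<rho> x)) (at p) X = k *\<^sub>R X}"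

definition uniformly_convex :: "(real^'n) set \<Rightarrow> bool" where
  "uniformly_convex \<Omega> \<longleftrightarrow>
     (\<exists>c>0. \<forall>p\<in>frontier \<Omega>. \<forall>k\<in>boundary_principal_curvatures \<Omega> p. c \<le> k)"

section \<open>Principal curvatures of a graph\<close>

definition pos_def :: "real^'n^'n \<Rightarrow> bool" where
  "pos_def A \<longleftrightarrow> transpose A = A \<and> (\<forall>x. x \<noteq> 0 \<longrightarrow> x \<bullet> (A *v x) > 0)"

definition sqrt_matrix :: "real^'n^'n \<Rightarrow> real^'n^'n" where
  "sqrt_matrix A = (THE B. pos_def B \<and> B ** B = A)"

definition tensor :: "real^'n \<Rightarrow> real^'n \<Rightarrow> real^'n^'n" where
  "tensor p q = (\<chi> i j. p $ i * q $ j)"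

definition graph_curvature_matrix :: "(real^'n \<Rightarrow> real) \<Rightarrow> real^'n \<Rightarrow> real^'n^'n" where
  "graph_curvature_matrix u x =
     (let M = matrix_inv (sqrt_matrix (mat 1 + tensor (gradient u x) (gradient u x)))
      in (1 / sqrt (1 + (norm (gradient u x))\<^sup>2)) *\<^sub>R (M ** hessian u x ** M))"

text \<open>The eigenvalues with multiplicity, as a vector in an unspecified order. The characteristic
  polynomial of a symmetric matrix splits over the reals, so a choice exists; \<open>\<sigma>\<^sub>1\<close> and
  \<open>\<sigma>\<^sub>2\<close> below are symmetric and do not depend on it.\<close>

definition eigenvalue_vector :: "real^'n^'n \<Rightarrow> real^'n" where
  "eigenvalue_vector A = (SOME l. \<forall>t. det (mat t - A) = (\<Prod>i\<in>UNIV. t - l $ i))"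

definition graph_curvatures :: "(real^'n \<Rightarrow> real) \<Rightarrow> real^'n \<Rightarrow> real^'n" where
  "graph_curvatures u x = eigenvalue_vector (graph_curvature_matrix u x)"

definition sigma1 :: "real^'n \<Rightarrow> real" where
  "sigma1 l = (\<Sum>i\<in>UNIV. l $ i)"

text \<open>The index type carries no order, so the pairs \<open>i < j\<close> are rendered as two-element sets.\<close>

definition sigma2 :: "real^'n \<Rightarrow> real" where
  "sigma2 l = (\<Sum>S | card S = 2. \<Prod>i\<in>S. l $ i)"

definition Gamma2 :: "(real^'n) set" where
  "Gamma2 = {l. sigma1 l > 0 \<and> sigma2 l > 0}"

definition Gamma2_admissible :: "(real^'n) set \<Rightarrow> (real^'n \<Rightarrow> real) \<Rightarrow> bool" where
  "Gamma2_admissible \<Omega> u \<longleftrightarrow> (\<forall>x\<in>\<Omega>. graph_curvatures u x \<in> Gamma2)"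

text \<open>Strict convexity in the sense of a positive definite Hessian.\<close>

definition strictly_convex_in :: "(real^'n) set \<Rightarrow> (real^'n \<Rightarrow> real) \<Rightarrow> bool" where
  "strictly_convex_in \<Omega> v \<longleftrightarrow> (\<forall>x\<in>\<Omega>. pos_def (hessian v x))"

end

theory Submission
  imports Defs "HOL-Computational_Algebra.Polynomial"
begin

text \<open>
  In terms of \<open>t = -v\<close>, \<open>q = Dv\<close> and \<open>B = D\<^sup>2v\<close> the equation becomes \<open>F(q, t, B) = 1\<close>, and the
  sublevel sets of \<open>F\<close> have a convexity property: for fixed \<open>q\<close>, if \<open>F(q, t\<^sub>i, B\<^sub>i) \<le> c\<close>,
  \<open>t = \<Sum>w\<^sub>i t\<^sub>i\<close>, and \<open>z \<bullet> B z \<le> \<Sum>w\<^sub>i z\<^sub>i \<bullet> B\<^sub>i z\<^sub>i\<close> whenever \<open>z = \<Sum>w\<^sub>i z\<^sub>i\<close>, then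
  \<open>F(q, t, B) \<le> c\<close>. This is used twice. First, if \<open>v\<close> were not convex, \<open>u(x) + \<theta>s\<^sup>2\<close> would have a
  positive maximum on the convex hull of the graph of \<open>v\<close>, and the second order conditions there
  contradict this property; the boundary is excluded because \<open>v\<close> has infinite slope there. Secondly,
  its infinitesimal form shows that \<open>S = P - P (D\<^sup>2v + P)\<^sup>-\<^sup>1 P\<close>, with \<open>P\<close> the projection to the kernel
  of \<open>D\<^sup>2v\<close> at a given point, satisfies a linear elliptic differential inequality, so that \<open>S\<close>
  vanishes near that point by a strong minimum principle and the rank of \<open>D\<^sup>2v\<close> is locally constant.
  The rank is full where \<open>v - \<epsilon>|x|\<^sup>2\<close> has its minimum, hence everywhere.\<close>

section \<open>Iterated directional derivatives\<close>

text \<open>The right-hand side matches the metric: after multiplication by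
  \<open>(1 + |Du|\<^sup>2)\<^sup>2\<close> the equation is polynomial in gradient and Hessian. Its
  derivatives are then polynomials too, and error terms are estimated by Lipschitz constants on
  bounded sets. The convexity property of \<open>F\<close> rests on a division by the trace of
  \<open>B\<close> on the orthogonal complement of the direction of \<open>q\<close>. The terms
  quadratic in \<open>B\<close> become sums of minima of jointly convex expressions, while the
  reciprocal of that trace, which then multiplies the level \<open>c\<close>, is concave. The
  obstacle to showing that the rank is constant is that eigenvalues are not smooth. The matrix
  \<open>S\<close> is smooth, but the inequality for its second derivatives contains all of its
  first derivatives, whereas at a minimum of a scalar comparison function built from the trace of
  \<open>S\<close> only the derivative of that trace would be known. This is why the minimum
  principle also minimises over an auxiliary matrix, whose variation yields the missing
  information.\<close>

definition dirD :: "('a::real_normed_vector \<Rightarrow> 'b::real_normed_vector) \<Rightarrow> 'a \<Rightarrow> 'a \<Rightarrow> 'b" where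
  "dirD f h = (\<lambda>x. frechet_derivative f (at x) h)"

lemma Ck_on_Suc:
  "Ck_on (Suc k) S f \<longleftrightarrow> (\<forall>x\<in>S. f differentiable (at x)) \<and> (\<forall>h. Ck_on k S (dirD f h))"
  by (simp add: dirD_def)

declare Ck_on.simps(2) [simp del]

lemma Ck_on_SucD: "Ck_on (Suc k) S f \<Longrightarrow> Ck_on k S f"
proof (induction k arbitrary: f)
  case 0
  then show ?case
    by (meson Ck_on.simps(1) Ck_on_Suc continuous_at_imp_continuous_on differentiable_imp_continuous_within)
next
  case (Suc k)
  from Suc.prems have d: "\<forall>x\<in>S. f differentiable (at x)" and "\<forall>h. Ck_on (Suc k) S (dirD f h)"
    using Ck_on_Suc[of "Suc k" S f] by blast+
  then show ?case using Ck_on_Suc[of k S f] Suc.IH by blast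
qed

lemma Ck_on_mono: "Ck_on k S f \<Longrightarrow> j \<le> k \<Longrightarrow> Ck_on j S f"
proof (induction k)
  case (Suc k)
  then show ?case using Ck_on_SucD[of k S f] by (cases "j = Suc k") auto
qed simp

lemma Ck_on_imp_continuous_on: "Ck_on k S f \<Longrightarrow> continuous_on S f"
  using Ck_on_mono[of k S f 0] by simp

lemma dirD_cong_open:
  assumes "open S" "x \<in> S" "\<And>y. y \<in> S \<Longrightarrow> f y = g y" "f differentiable (at x)"
  shows "dirD f h x = dirD g h x"
  using frechet_derivative_transform_within_open[of f x S g] assms by (simp add: dirD_def)

lemma differentiable_cong_open:
  assumes "open S" "x \<in> S" "\<And>y. y \<in> S \<Longrightarrow> f y = g y" "f differentiable (at x)"
  shows "g differentiable (at x)"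
  using assms(4) has_derivative_transform_within_open[of f _ x UNIV S g] assms(1-3)
  by (auto simp: differentiable_def)

lemma Ck_on_cong_open:
  assumes "open S" "\<And>y. y \<in> S \<Longrightarrow> f y = g y" "Ck_on k S f"
  shows "Ck_on k S g"
  using assms(2,3)
proof (induction k arbitrary: f g)
  case 0
  then show ?case by (metis Ck_on.simps(1) continuous_on_cong)
next
  case (Suc k)
  have "Ck_on k S (dirD g h)" for h
  proof (rule Suc.IH)
    show "Ck_on k S (dirD f h)" using Suc.prems by (simp add: Ck_on_Suc)
    show "dirD f h y = dirD g h y" if "y \<in> S" for y
      using Suc.prems that by (intro dirD_cong_open[OF assms(1)]) (auto simp: Ck_on_Suc)
  qed
  moreover have "g differentiable (at x)" if "x \<in> S" for x
    by (rule differentiable_cong_open[OF assms(1) that Suc.prems(1)])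
       (use Suc.prems that in \<open>auto simp: Ck_on_Suc\<close>)
  ultimately show ?case by (simp add: Ck_on_Suc)
qed

lemma dirD_eq: "(f has_derivative f') (at x) \<Longrightarrow> dirD f h x = f' h"
  by (simp add: dirD_def frechet_derivative_at[symmetric])

lemma has_derivative_dirD:
  "f differentiable (at x) \<Longrightarrow> (f has_derivative (\<lambda>h. dirD f h x)) (at x)"
  by (simp add: dirD_def frechet_derivative_works)

lemma dirD_scale [simp]:
  "f differentiable (at x) \<Longrightarrow> dirD f (c *\<^sub>R h) x = c *\<^sub>R dirD f h x"
  by (simp add: dirD_def linear_cmul linear_frechet_derivative)

lemma Ck_on_const: "Ck_on k S (\<lambda>x::'a::real_normed_vector. c::'b::real_normed_vector)"
proof (induction k arbitrary: c)
  case (Suc k)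
  have "dirD (\<lambda>x::'a. c) h = (\<lambda>x. 0)" for h
    by (auto simp: fun_eq_iff intro!: dirD_eq derivative_eq_intros)
  then show ?case using Suc by (simp add: Ck_on_Suc)
qed simp

lemma Ck_on_add:
  assumes "open S" "Ck_on k S f" "Ck_on k S g"
  shows "Ck_on k S (\<lambda>x. f x + g x)"
  using assms(2,3)
proof (induction k arbitrary: f g)
  case 0 then show ?case by (simp add: continuous_on_add)
next
  case (Suc k)
  have "Ck_on k S (dirD (\<lambda>x. f x + g x) h)" for h
  proof (rule Ck_on_cong_open[OF assms(1)])
    show "Ck_on k S (\<lambda>x. dirD f h x + dirD g h x)"
      using Suc by (auto simp: Ck_on_Suc)
    show "dirD f h y + dirD g h y = dirD (\<lambda>x. f x + g x) h y" if "y \<in> S" for y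
      using Suc.prems that
      by (intro dirD_eq[symmetric] has_derivative_add has_derivative_dirD) (auto simp: Ck_on_Suc)
  qed
  then show ?case using Suc.prems by (auto simp: Ck_on_Suc)
qed

lemma Ck_on_mult:
  fixes f g :: "'a::real_normed_vector \<Rightarrow> real"
  assumes "open S" "Ck_on k S f" "Ck_on k S g"
  shows "Ck_on k S (\<lambda>x. f x * g x)"
  using assms(2,3)
proof (induction k arbitrary: f g)
  case 0 then show ?case by (simp add: continuous_on_mult)
next
  case (Suc k)
  have "Ck_on k S (dirD (\<lambda>x. f x * g x) h)" for h
  proof (rule Ck_on_cong_open[OF assms(1)])
    show "Ck_on k S (\<lambda>x. f x * dirD g h x + dirD f h x * g x)"
      using Suc Ck_on_SucD[OF Suc.prems(1)] Ck_on_SucD[OF Suc.prems(2)]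
      by (intro Ck_on_add[OF assms(1)] Suc.IH) (auto simp: Ck_on_Suc)
    show "f y * dirD g h y + dirD f h y * g y = dirD (\<lambda>x. f x * g x) h y" if "y \<in> S" for y
      using Suc.prems that
      by (intro dirD_eq[symmetric] has_derivative_mult has_derivative_dirD) (auto simp: Ck_on_Suc)
  qed
  then show ?case using Suc.prems by (auto simp: Ck_on_Suc)
qed

lemma DERIV_line:
  fixes f :: "'a::real_normed_vector \<Rightarrow> real"
  assumes "f differentiable (at (x + s *\<^sub>R h))"
  shows "((\<lambda>s. f (x + s *\<^sub>R h)) has_real_derivative dirD f h (x + s *\<^sub>R h)) (at s)"
proof -
  have "((\<lambda>s. f (x + s *\<^sub>R h)) has_derivative (\<lambda>r. dirD f (r *\<^sub>R h) (x + s *\<^sub>R h))) (at s)"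
    by (rule has_derivative_compose[where g = f and f = "\<lambda>s. x + s *\<^sub>R h" and x = s and s = UNIV
          and f' = "\<lambda>r. r *\<^sub>R h" and g' = "\<lambda>h'. dirD f h' (x + s *\<^sub>R h)"])
       (auto intro!: derivative_eq_intros has_derivative_dirD assms)
  then show ?thesis
    using assms by (simp add: has_field_derivative_def mult_commute_abs)
qed

text \<open>The mean value theorem is applied in the direction \<open>h\<close> to the difference of
  \<open>f\<close> at points shifted by \<open>s *\<^sub>R k\<close>, then in the direction
  \<open>k\<close> to the derivative. The left side is symmetric in \<open>h\<close> and
  \<open>k\<close>; the symmetry of second derivatives follows by letting \<open>s\<close> be
  small.\<close>

lemma second_difference_mvt:
  fixes f :: "'a::real_normed_vector \<Rightarrow> real"
  assumes f: "\<And>a b. 0 \<le> a \<Longrightarrow> a \<le> s \<Longrightarrow> 0 \<le> b \<Longrightarrow> b \<le> s \<Longrightarrow> x + a *\<^sub>R h + b *\<^sub>R k \<in> S"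
    and C: "Ck_on 2 S f" and s: "s > 0"
  obtains a b where "0 < a" "a < s" "0 < b" "b < s"
    "f (x + s *\<^sub>R h + s *\<^sub>R k) - f (x + s *\<^sub>R h) - f (x + s *\<^sub>R k) + f x
       = s\<^sup>2 * dirD (dirD f h) k (x + a *\<^sub>R h + b *\<^sub>R k)"
proof -
  have d1: "f differentiable (at y)" and d2: "dirD f h differentiable (at y)" if "y \<in> S" for y
    using C that by (auto simp: numeral_2_eq_2 Ck_on_Suc)
  define \<phi> where "\<phi> r = f ((x + s *\<^sub>R k) + r *\<^sub>R h) - f (x + r *\<^sub>R h)" for r
  have "(\<phi> has_real_derivative dirD f h ((x + s *\<^sub>R k) + r *\<^sub>R h) - dirD f h (x + r *\<^sub>R h)) (at r)"
    if "0 \<le> r" "r \<le> s" for r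
    unfolding \<phi>_def using f[of r s] f[of r 0] that s
    by (intro DERIV_diff DERIV_line d1) (auto simp: algebra_simps)
  from MVT2[OF s this] obtain a where a: "0 < a" "a < s"
    "\<phi> s - \<phi> 0 = (s - 0) * (dirD f h ((x + s *\<^sub>R k) + a *\<^sub>R h) - dirD f h (x + a *\<^sub>R h))"
    by auto
  have "((\<lambda>r. dirD f h ((x + a *\<^sub>R h) + r *\<^sub>R k)) has_real_derivative
      dirD (dirD f h) k ((x + a *\<^sub>R h) + r *\<^sub>R k)) (at r)" if "0 \<le> r" "r \<le> s" for r
    using f[of a r] that a by (intro DERIV_line d2) auto
  from MVT2[OF s this] obtain b where b: "0 < b" "b < s"
    "dirD f h ((x + a *\<^sub>R h) + s *\<^sub>R k) - dirD f h ((x + a *\<^sub>R h) + 0 *\<^sub>R k)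
       = (s - 0) * dirD (dirD f h) k ((x + a *\<^sub>R h) + b *\<^sub>R k)"
    by auto
  have "f (x + s *\<^sub>R h + s *\<^sub>R k) - f (x + s *\<^sub>R h) - f (x + s *\<^sub>R k) + f x = \<phi> s - \<phi> 0"
    by (simp add: \<phi>_def algebra_simps)
  also have "\<dots> = s * (s * dirD (dirD f h) k (x + a *\<^sub>R h + b *\<^sub>R k))"
    using a(3) b(3) by (simp add: algebra_simps)
  finally show ?thesis using that[OF a(1,2) b(1,2)] by (simp add: power2_eq_square)
qed

lemma dirD_commute:
  fixes f :: "'a::real_normed_vector \<Rightarrow> real"
  assumes S: "open S" "x \<in> S" and C: "Ck_on 2 S f"
  shows "dirD (dirD f h) k x = dirD (dirD f k) h x"
proof (rule ccontr)
  let ?a = "dirD (dirD f h) k" and ?b = "dirD (dirD f k) h"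
  assume ne: "?a x \<noteq> ?b x"
  define e where "e = \<bar>?a x - ?b x\<bar> / 2"
  have e: "e > 0" using ne by (simp add: e_def)
  have "continuous_on S ?a" "continuous_on S ?b"
    using C by (auto simp: numeral_2_eq_2 Ck_on_Suc)
  then have "isCont ?a x" "isCont ?b x"
    using S by (auto simp: continuous_on_eq_continuous_at)
  then obtain d1 d2 where d: "d1 > 0" "d2 > 0"
    "\<And>y. dist y x < d1 \<Longrightarrow> dist (?a y) (?a x) < e" "\<And>y. dist y x < d2 \<Longrightarrow> dist (?b y) (?b x) < e"
    using e continuous_at_eps_delta[of x ?a] continuous_at_eps_delta[of x ?b] by (metis (no_types))
  obtain d3 where d3: "d3 > 0" "ball x d3 \<subseteq> S" using S openE by blast
  define d where "d = min d1 (min d2 d3)"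
  define s where "s = d / (2 * (norm h + norm k + 1))"
  have pos: "norm h + norm k + 1 > 0" using norm_ge_zero[of h] norm_ge_zero[of k] by linarith
  have d0: "d > 0" using d d3 by (simp add: d_def)
  have s: "s > 0" using d0 pos by (simp add: s_def)
  have near: "dist (x + a *\<^sub>R h + b *\<^sub>R k) x < d" if "0 \<le> a" "a \<le> s" "0 \<le> b" "b \<le> s" for a b
  proof -
    have "dist (x + a *\<^sub>R h + b *\<^sub>R k) x = norm (a *\<^sub>R h + b *\<^sub>R k)" by (simp add: dist_norm)
    also have "\<dots> \<le> a * norm h + b * norm k"
      using norm_triangle_ineq[of "a *\<^sub>R h" "b *\<^sub>R k"] that by simp
    also have "\<dots> \<le> s * norm h + s * norm k" using that by (intro add_mono mult_right_mono) auto
    also have "\<dots> \<le> s * (norm h + norm k + 1)" using s by (simp add: algebra_simps)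
    also have "\<dots> = d / 2" using pos by (simp add: s_def divide_simps)
    also have "\<dots> < d" using d0 by simp
    finally show ?thesis .
  qed
  have inS: "x + a *\<^sub>R h + b *\<^sub>R k \<in> S" "x + b *\<^sub>R k + a *\<^sub>R h \<in> S"
    if "0 \<le> a" "a \<le> s" "0 \<le> b" "b \<le> s" for a b
  proof -
    show "x + a *\<^sub>R h + b *\<^sub>R k \<in> S"
      using near[OF that] d3(2) by (auto simp: d_def dist_commute mem_ball)
    then show "x + b *\<^sub>R k + a *\<^sub>R h \<in> S" by (simp add: algebra_simps)
  qed
  obtain a b where ab: "0 < a" "a < s" "0 < b" "b < s"
    "f (x + s *\<^sub>R h + s *\<^sub>R k) - f (x + s *\<^sub>R h) - f (x + s *\<^sub>R k) + f x = s\<^sup>2 * ?a (x + a *\<^sub>R h + b *\<^sub>R k)"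
    by (rule second_difference_mvt[where x = x and h = h and k = k and s = s and f = f and S = S])
       (auto intro: inS C s)
  obtain a' b' where ab': "0 < a'" "a' < s" "0 < b'" "b' < s"
    "f (x + s *\<^sub>R k + s *\<^sub>R h) - f (x + s *\<^sub>R k) - f (x + s *\<^sub>R h) + f x = s\<^sup>2 * ?b (x + a' *\<^sub>R k + b' *\<^sub>R h)"
    by (rule second_difference_mvt[where x = x and h = k and k = h and s = s and f = f and S = S])
       (auto intro: inS C s)
  have "s\<^sup>2 * ?a (x + a *\<^sub>R h + b *\<^sub>R k) = s\<^sup>2 * ?b (x + a' *\<^sub>R k + b' *\<^sub>R h)"
    using ab(5) ab'(5) by (simp add: algebra_simps)
  then have eq: "?a (x + a *\<^sub>R h + b *\<^sub>R k) = ?b (x + a' *\<^sub>R k + b' *\<^sub>R h)"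
    using s by simp
  have "dist (?a (x + a *\<^sub>R h + b *\<^sub>R k)) (?a x) < e"
    using near[of a b] ab by (intro d(3)) (auto simp: d_def)
  moreover have "dist (?b (x + a' *\<^sub>R k + b' *\<^sub>R h)) (?b x) < e"
    using near[of b' a'] ab' by (intro d(4)) (auto simp: d_def algebra_simps)
  ultimately have "\<bar>?a x - ?b x\<bar> < 2 * e" unfolding eq dist_real_def by linarith
  then show False by (simp add: e_def)
qed

text \<open>Necessary conditions at maxima in several variables are drawn from here by restriction
  to lines or curves. If \<open>l\<close> were positive, \<open>f'\<close> would be positive to the
  right of 0 and \<open>f\<close> would exceed \<open>f 0\<close> there.\<close>

lemma second_derivative_max:
  fixes f :: "real \<Rightarrow> real"
  assumes "d > 0" and f: "\<And>s. \<bar>s\<bar> < d \<Longrightarrow> (f has_real_derivative f' s) (at s)"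
    and f': "(f' has_real_derivative l) (at 0)" and max: "\<And>s. \<bar>s\<bar> < d \<Longrightarrow> f s \<le> f 0"
  shows "f' 0 = 0" "l \<le> 0"
proof -
  show 0: "f' 0 = 0"
    by (rule DERIV_local_max[OF f[of 0] \<open>d > 0\<close>]) (use assms in auto)
  show "l \<le> 0"
  proof (rule ccontr)
    assume "\<not> l \<le> 0"
    then obtain e where e: "e > 0" "\<And>h. 0 < h \<Longrightarrow> h < e \<Longrightarrow> f' 0 < f' (0 + h)"
      using DERIV_pos_inc_right[OF f'] by auto
    define s where "s = min d e / 2"
    have s: "0 < s" "s < d" "s < e" using \<open>d > 0\<close> e by (auto simp: s_def)
    obtain z where z: "0 < z" "z < s" "f s - f 0 = (s - 0) * f' z"
      using MVT2[OF s(1), of f f'] f s by force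
    have "f' z > 0" using e(2)[of z] z s 0 by auto
    then have "s * f' z > 0" using s by simp
    then have "f s > f 0" using z by simp
    then show False using max[of s] s by simp
  qed
qed

section \<open>Symmetric matrices\<close>

lemma inner_matrix_vector: "x \<bullet> (A *v y) = (\<Sum>i\<in>UNIV. \<Sum>j\<in>UNIV. x $ i * A $ i $ j * y $ j)"
  for A :: "real^'n^'n"
  by (simp add: inner_vec_def matrix_vector_mult_def sum_distrib_left mult.assoc)

lemma inner_axis_matrix: "axis i 1 \<bullet> (A *v axis j 1) = A $ i $ j" for A :: "real^'n^'n"
  by (simp add: inner_axis' matrix_vector_mult_basis column_def)

lemma sym_matrix_inner: "transpose A = A \<Longrightarrow> x \<bullet> (A *v y) = y \<bullet> (A *v x)" for A :: "real^'n^'n"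
  by (metis dot_lmul_matrix inner_commute transpose_matrix_vector)

lemma inner_transpose_matrix: "x \<bullet> (transpose A *v y) = (A *v x) \<bullet> y" for A :: "real^'n^'n"
  using dot_lmul_matrix[of x "transpose A" y] by simp

lemma matrix_eq_inner: "(\<And>x y. x \<bullet> (A *v y) = x \<bullet> (B *v y)) \<Longrightarrow> A = B" for A B :: "real^'n^'n"
  by (simp add: vec_eq_iff inner_axis_matrix[symmetric])

lemma sym_matrix_iff: "transpose A = A \<longleftrightarrow> (\<forall>x y. x \<bullet> (A *v y) = y \<bullet> (A *v x))" for A :: "real^'n^'n"
  by (metis matrix_eq_inner dot_lmul_matrix inner_commute transpose_matrix_vector)

lemma norm_matrix_vector_le: "norm (A *v x) \<le> norm A * norm x" for A :: "real^'n^'n"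
proof -
  have "(norm (A *v x))\<^sup>2 = (\<Sum>i\<in>UNIV. ((A $ i) \<bullet> x)\<^sup>2)"
    by (simp add: norm_vec_def L2_set_def sum_nonneg matrix_vector_mult_def inner_vec_def)
  also have "\<dots> \<le> (\<Sum>i\<in>UNIV. (norm (A $ i))\<^sup>2 * (norm x)\<^sup>2)"
    by (intro sum_mono) (metis Cauchy_Schwarz_ineq power2_norm_eq_inner)
  also have "\<dots> = (norm A * norm x)\<^sup>2"
    by (simp add: norm_vec_def[of A] L2_set_def sum_nonneg power_mult_distrib sum_distrib_right)
  finally show ?thesis by (rule power2_le_imp_le) simp
qed

lemma bounded_bilinear_matrix_vector: "bounded_bilinear ((*v) :: real^'n^'n \<Rightarrow> real^'n \<Rightarrow> real^'n)"
proof (rule bounded_bilinear.intro)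
  show "\<exists>K. \<forall>(A :: real^'n^'n) (x :: real^'n). norm (A *v x) \<le> norm A * norm x * K"
    using norm_matrix_vector_le by (intro exI[of _ 1]) auto
qed (simp_all add: vec_eq_iff matrix_vector_mult_def sum.distrib sum_distrib_left algebra_simps)

lemma norm_matrix_matrix_le: "norm (A ** B) \<le> norm A * norm B" for A B :: "real^'n^'n"
proof -
  have "(A ** B) $ i = transpose B *v (A $ i)" for i
    by (simp add: vec_eq_iff matrix_matrix_mult_def matrix_vector_mult_def transpose_def mult.commute)
  moreover have "norm (transpose B) = norm B"
  proof -
    have "(norm (transpose B))\<^sup>2 = (\<Sum>i\<in>UNIV. \<Sum>j\<in>UNIV. (B $ j $ i)\<^sup>2)"
      unfolding power2_norm_eq_inner by (simp add: inner_vec_def transpose_def power2_eq_square)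
    also have "\<dots> = (norm B)\<^sup>2"
      unfolding power2_norm_eq_inner
      by (subst sum.swap) (simp add: inner_vec_def power2_eq_square)
    finally show ?thesis by simp
  qed
  ultimately have row: "norm ((A ** B) $ i) \<le> norm B * norm (A $ i)" for i
    by (metis norm_matrix_vector_le)
  have "(norm (A ** B))\<^sup>2 = (\<Sum>i\<in>UNIV. (norm ((A ** B) $ i))\<^sup>2)"
    by (simp add: norm_vec_def[of "A ** B"] L2_set_def sum_nonneg)
  also have "\<dots> \<le> (\<Sum>i\<in>UNIV. (norm B * norm (A $ i))\<^sup>2)"
    by (intro sum_mono power_mono row) auto
  also have "\<dots> = (norm A * norm B)\<^sup>2"
    by (simp add: norm_vec_def[of A] L2_set_def sum_nonneg power_mult_distrib sum_distrib_left mult.commute)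
  finally show ?thesis by (rule power2_le_imp_le) simp
qed

lemma bounded_bilinear_matrix_matrix:
  "bounded_bilinear ((**) :: real^'n^'n \<Rightarrow> real^'n^'n \<Rightarrow> real^'n^'n)"
proof (rule bounded_bilinear.intro)
  show "\<exists>K. \<forall>(A :: real^'n^'n) (B :: real^'n^'n). norm (A ** B) \<le> norm A * norm B * K"
    using norm_matrix_matrix_le by (intro exI[of _ 1]) auto
qed (simp_all add: vec_eq_iff matrix_matrix_mult_def sum.distrib sum_distrib_left algebra_simps)

text \<open>Maximisation of the form on the unit sphere of \<open>N\<close>; the last clause is the
  first order condition in directions orthogonal to \<open>e\<close>. It serves the spectral theorem
  and, applied to a negative Hessian, the smallest principal curvature of the boundary.\<close>

lemma exists_maximal_direction:
  fixes A :: "real^'n^'n"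
  assumes N: "subspace N" "N \<noteq> {0}" and A: "transpose A = A"
  shows "\<exists>e\<in>N. norm e = 1 \<and> (\<forall>x\<in>N. x \<bullet> (A *v x) \<le> (e \<bullet> (A *v e)) * (norm x)\<^sup>2) \<and>
    (\<forall>x\<in>N. x \<bullet> e = 0 \<longrightarrow> x \<bullet> (A *v e) = 0)"
proof -
  let ?q = "\<lambda>x. x \<bullet> (A *v x)"
  let ?S = "N \<inter> sphere 0 1"
  obtain y where y: "y \<in> N" "y \<noteq> 0" using N subspace_0 by blast
  have "y /\<^sub>R norm y \<in> ?S" using y N by (simp add: subspace_scale)
  then have ne: "?S \<noteq> {}" by blast
  have cp: "compact ?S" using closed_subspace[OF N(1)] by (simp add: closed_Int_compact)
  have ct: "continuous_on ?S ?q" by (intro continuous_intros)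
  obtain e where e: "e \<in> ?S" "\<And>x. x \<in> ?S \<Longrightarrow> ?q x \<le> ?q e"
    using continuous_attains_sup[OF cp ne ct] by blast
  have e1: "e \<in> N" "norm e = 1" using e by auto
  have le: "?q x \<le> ?q e * (norm x)\<^sup>2" if "x \<in> N" for x
  proof (cases "x = 0")
    case False
    have "x /\<^sub>R norm x \<in> ?S" using that N False by (simp add: subspace_scale)
    from e(2)[OF this] have "inverse (norm x) * (inverse (norm x) * ?q x) \<le> ?q e"
      by (simp add: matrix_vector_mult_scaleR)
    then show ?thesis using False by (simp add: field_simps power2_eq_square)
  qed simp
  have "x \<bullet> (A *v e) = 0" if x: "x \<in> N" "x \<bullet> e = 0" for x
  proof -
    \<comment> \<open>Subtracting \<open>?q e\<close> times the squared norm makes maximality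
      homogeneous, so that \<open>e + s *\<^sub>R x\<close> need not be normalised.\<close>
    have "((\<lambda>s. ?q (e + s *\<^sub>R x) - ?q e * (norm (e + s *\<^sub>R x))\<^sup>2) has_real_derivative 2 * (x \<bullet> (A *v e))) (at 0)"
    proof -
      have nn: "(norm (e + s *\<^sub>R x))\<^sup>2 = 1 + s\<^sup>2 * (norm x)\<^sup>2" for s
        using x e1 unfolding power2_norm_eq_inner
        by (simp add: inner_add_left inner_add_right inner_commute[of e x] norm_eq_1 power2_eq_square)
      have qq: "?q (e + s *\<^sub>R x) = ?q e + 2 * s * (x \<bullet> (A *v e)) + s\<^sup>2 * ?q x" for s
        using sym_matrix_inner[OF A, of e x]
        by (simp add: matrix_vector_right_distrib matrix_vector_mult_scaleR inner_add_left
            inner_add_right algebra_simps power2_eq_square)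
      show ?thesis unfolding nn qq by (auto intro!: derivative_eq_intros)
    qed
    then have "2 * (x \<bullet> (A *v e)) = 0"
    proof (rule DERIV_local_max[of _ _ _ 1])
      show "\<forall>y. \<bar>0 - y\<bar> < 1 \<longrightarrow> ?q (e + y *\<^sub>R x) - ?q e * (norm (e + y *\<^sub>R x))\<^sup>2
              \<le> ?q (e + 0 *\<^sub>R x) - ?q e * (norm (e + 0 *\<^sub>R x))\<^sup>2"
        using le[OF subspace_add[OF N(1) e1(1) subspace_scale[OF N(1) x(1)]]] e1 by simp
    qed simp
    then show ?thesis by simp
  qed
  then show ?thesis using e1 le by blast
qed

text \<open>Induction on the dimension: a maximal direction \<open>e\<close> is split off, and the
  form is diagonalised on the part of \<open>N\<close> orthogonal to \<open>e\<close>, which the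
  first order condition uncouples from \<open>e\<close>.\<close>

lemma spectral_subspace:
  fixes A :: "real^'n^'n"
  assumes A: "transpose A = A" and N: "subspace N"
  shows "\<exists>E. E \<subseteq> N \<and> span E = N \<and> pairwise orthogonal E \<and> (\<forall>e\<in>E. norm e = 1) \<and>
     (\<forall>e\<in>E. \<forall>f\<in>E. e \<noteq> f \<longrightarrow> f \<bullet> (A *v e) = 0)"
  using N
proof (induction "dim N" arbitrary: N)
  case 0
  then have "N = {0}" using dim_eq_0[of N] subspace_0[OF 0(2)] by auto
  then show ?case by (intro exI[of _ "{}"]) auto
next
  case (Suc d)
  then have "N \<noteq> {0}" by auto
  obtain e where e: "e \<in> N" "norm e = 1"
    and e3: "\<And>x. x \<in> N \<Longrightarrow> x \<bullet> e = 0 \<Longrightarrow> x \<bullet> (A *v e) = 0"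
    using exists_maximal_direction[OF Suc.prems \<open>N \<noteq> {0}\<close> A] by blast
  define M where "M = {y \<in> N. \<forall>x\<in>{e}. orthogonal x y}"
  have M: "M = {y \<in> N. y \<bullet> e = 0}" by (auto simp: M_def orthogonal_def inner_commute)
  have subM: "subspace M" using Suc.prems unfolding M subspace_def by (auto simp: inner_add_left)
  have "dim {y \<in> N. \<forall>x\<in>span {e}. orthogonal x y} + dim (span {e}) = dim N"
    by (rule dim_subspace_orthogonal_to_vectors[OF subspace_span Suc.prems])
       (use e(1) Suc.prems in \<open>simp add: span_minimal\<close>)
  moreover have "{y \<in> N. \<forall>x\<in>span {e}. orthogonal x y} = M"
    by (auto simp: M_def span_singleton orthogonal_def intro: exI[of _ 1])
  moreover have "dim (span {e}) = 1" using e(2) by (auto simp: dim_singleton)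
  ultimately have "d = dim M" using Suc.hyps(2) by simp
  from Suc.hyps(1)[OF this subM] obtain E where E: "E \<subseteq> M" "span E = M" "pairwise orthogonal E"
    "\<forall>e\<in>E. norm e = 1" "\<forall>e\<in>E. \<forall>f\<in>E. e \<noteq> f \<longrightarrow> f \<bullet> (A *v e) = 0" by blast
  have "span (insert e E) = N"
  proof
    show "span (insert e E) \<subseteq> N" using e(1) E(1) M Suc.prems by (intro span_minimal) auto
    show "N \<subseteq> span (insert e E)"
    proof
      fix x assume x: "x \<in> N"
      have "x - (x \<bullet> e) *\<^sub>R e \<in> M" using x e Suc.prems
        by (auto simp: M inner_diff_left norm_eq_1 subspace_diff subspace_scale)
      then have "x - (x \<bullet> e) *\<^sub>R e \<in> span (insert e E)"
        using E(2) span_mono[of E "insert e E"] by blast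
      moreover have "(x \<bullet> e) *\<^sub>R e \<in> span (insert e E)" by (simp add: span_base span_scale)
      ultimately show "x \<in> span (insert e E)" using span_add by fastforce
    qed
  qed
  moreover have "f \<bullet> (A *v e) = 0 \<and> e \<bullet> (A *v f) = 0" if "f \<in> E" for f
    using e3[of f] that E(1) sym_matrix_inner[OF A, of f e] by (auto simp: M)
  moreover have "orthogonal e f \<and> orthogonal f e" if "f \<in> E" for f
    using that E(1) by (auto simp: M orthogonal_def inner_commute)
  ultimately show ?case using e E
    by (intro exI[of _ "insert e E"]) (auto simp: M pairwise_insert)
qed

text \<open>A set rather than an indexed family, so that eigenbases need no enumeration by the index
  type.\<close>

definition orthonormal_basis :: "(real^'n) set \<Rightarrow> bool" where
  "orthonormal_basis E \<longleftrightarrow> finite E \<and> span E = UNIV \<and> pairwise orthogonal E \<and> (\<forall>e\<in>E. norm e = 1)"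

lemma orthonormal_basis_expand:
  assumes "orthonormal_basis E"
  shows "(\<Sum>e\<in>E. (x \<bullet> e) *\<^sub>R e) = x"
proof -
  let ?y = "x - (\<Sum>e\<in>E. (x \<bullet> e) *\<^sub>R e)"
  have "orthogonal ?y f" if f: "f \<in> E" for f
  proof -
    have "(\<Sum>e\<in>E. (x \<bullet> e) * (e \<bullet> f)) = (\<Sum>e\<in>E. if e = f then x \<bullet> f else 0)"
      using assms f unfolding orthonormal_basis_def
      by (intro sum.cong) (auto simp: pairwise_def orthogonal_def norm_eq_1)
    then show ?thesis using assms f
      by (simp add: orthonormal_basis_def orthogonal_def inner_diff_left inner_sum_left sum.delta)
  qed
  then have "orthogonal ?y ?y"
    using assms orthogonal_to_span[of ?y E ?y] by (simp add: orthonormal_basis_def)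
  then show ?thesis by (simp add: orthogonal_self)
qed

lemma inner_orthonormal_basis:
  assumes "orthonormal_basis E"
  shows "x \<bullet> y = (\<Sum>e\<in>E. (x \<bullet> e) * (y \<bullet> e))"
proof -
  have "x \<bullet> y = (\<Sum>e\<in>E. (x \<bullet> e) *\<^sub>R e) \<bullet> y" by (simp add: orthonormal_basis_expand[OF assms])
  then show ?thesis by (simp add: inner_sum_left inner_commute[of y])
qed

lemma trace_orthonormal_basis:
  fixes A :: "real^'n^'n"
  assumes "orthonormal_basis E"
  shows "trace A = (\<Sum>e\<in>E. e \<bullet> (A *v e))"
proof -
  have e: "(\<Sum>i\<in>UNIV. (e $ i) *\<^sub>R (A *v axis i 1)) = A *v e" for e
  proof -
    have "(\<Sum>i\<in>UNIV. (e $ i) *\<^sub>R (A *v axis i 1)) = A *v (\<Sum>i\<in>UNIV. (e $ i) *s axis i 1)"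
      by (simp add: scalar_mult_eq_scaleR linear_sum[OF matrix_vector_mul_linear]
          matrix_vector_mult_scaleR)
    then show ?thesis by (simp only: basis_expansion)
  qed
  have "trace A = (\<Sum>i\<in>UNIV. axis i 1 \<bullet> (A *v axis i 1))"
    by (simp add: trace_def inner_axis_matrix)
  also have "\<dots> = (\<Sum>i\<in>UNIV. \<Sum>e\<in>E. (e $ i) * (e \<bullet> (A *v axis i 1)))"
  proof (rule sum.cong[OF refl])
    fix i
    show "axis i 1 \<bullet> (A *v axis i 1) = (\<Sum>e\<in>E. (e $ i) * (e \<bullet> (A *v axis i 1)))"
      unfolding inner_orthonormal_basis[OF assms, of "axis i 1" "A *v axis i 1"]
      by (simp add: inner_axis' inner_commute[of _ "A *v _"])
  qed
  also have "\<dots> = (\<Sum>e\<in>E. e \<bullet> (\<Sum>i\<in>UNIV. (e $ i) *\<^sub>R (A *v axis i 1)))"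
    by (subst sum.swap) (simp add: inner_sum_right)
  finally show ?thesis by (simp add: e)
qed

lemma spectral_theorem:
  fixes A :: "real^'n^'n"
  assumes A: "transpose A = A"
  obtains E where "orthonormal_basis E" "\<And>e. e \<in> E \<Longrightarrow> A *v e = (e \<bullet> (A *v e)) *\<^sub>R e"
proof -
  obtain E where E: "span E = UNIV" "pairwise orthogonal E" "\<forall>e\<in>E. norm e = 1"
     "\<forall>e\<in>E. \<forall>f\<in>E. e \<noteq> f \<longrightarrow> f \<bullet> (A *v e) = 0"
    using spectral_subspace[OF A subspace_UNIV] by blast
  then have o: "orthonormal_basis E"
    using pairwise_orthogonal_imp_finite[OF E(2)] by (simp add: orthonormal_basis_def)
  have "A *v e = (e \<bullet> (A *v e)) *\<^sub>R e" if e: "e \<in> E" for e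
  proof -
    have "A *v e = (\<Sum>f\<in>E. ((A *v e) \<bullet> f) *\<^sub>R f)" by (simp add: orthonormal_basis_expand[OF o])
    also have "\<dots> = (\<Sum>f\<in>E. if f = e then (e \<bullet> (A *v e)) *\<^sub>R e else 0)"
      using E(4) e by (intro sum.cong) (auto simp: inner_commute)
    finally show ?thesis using o e by (simp add: orthonormal_basis_def sum.delta)
  qed
  then show ?thesis using that o by blast
qed

lemma inner_matrix_trace: "A \<bullet> Z = trace (transpose A ** Z)" for A Z :: "real^'n^'n"
  by (simp add: trace_def inner_vec_def matrix_matrix_mult_def transpose_def)
     (rule sum.swap)

lemma inner_matrix_orthonormal_basis:
  fixes A Z :: "real^'n^'n"
  assumes "orthonormal_basis E"
  shows "A \<bullet> Z = (\<Sum>e\<in>E. (A *v e) \<bullet> (Z *v e))"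
  unfolding inner_matrix_trace trace_orthonormal_basis[OF assms]
  by (simp only: matrix_vector_mul_assoc[symmetric] inner_transpose_matrix)

lemma inner_matrix_spectral:
  fixes A Z :: "real^'n^'n"
  assumes "orthonormal_basis E" "\<And>e. e \<in> E \<Longrightarrow> A *v e = (e \<bullet> (A *v e)) *\<^sub>R e"
  shows "A \<bullet> Z = (\<Sum>e\<in>E. (e \<bullet> (A *v e)) * (e \<bullet> (Z *v e)))"
  unfolding inner_matrix_orthonormal_basis[OF assms(1)]
proof (rule sum.cong[OF refl])
  fix e assume "e \<in> E"
  then show "(A *v e) \<bullet> (Z *v e) = (e \<bullet> (A *v e)) * (e \<bullet> (Z *v e))"
    using inner_scaleR_left[of "e \<bullet> (A *v e)" e "Z *v e"] assms(2)[of e] by metis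
qed

text \<open>The norm is the Euclidean norm of the entries, hence of the eigenvalues; for nonnegative
  numbers it is at most their sum.\<close>

lemma norm_le_trace_psd:
  fixes A :: "real^'n^'n"
  assumes A: "transpose A = A" and psd: "\<And>x. 0 \<le> x \<bullet> (A *v x)"
  shows "norm A \<le> trace A"
proof -
  obtain E where E: "orthonormal_basis E" "\<And>e. e \<in> E \<Longrightarrow> A *v e = (e \<bullet> (A *v e)) *\<^sub>R e"
    using spectral_theorem[OF A] by blast
  have f: "finite E" using E(1) by (simp add: orthonormal_basis_def)
  have "(norm A)\<^sup>2 = (\<Sum>e\<in>E. (e \<bullet> (A *v e))\<^sup>2)"
    using inner_matrix_spectral[OF E, of A] by (simp only: power2_norm_eq_inner power2_eq_square[symmetric])
  also have "\<dots> \<le> (\<Sum>e\<in>E. e \<bullet> (A *v e))\<^sup>2"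
  proof -
    have "(\<Sum>e\<in>E. (e \<bullet> (A *v e))\<^sup>2) \<le> (\<Sum>e\<in>E. (e \<bullet> (A *v e)) * (\<Sum>e\<in>E. e \<bullet> (A *v e)))"
      unfolding power2_eq_square
      by (intro sum_mono mult_left_mono psd member_le_sum f)
    then show ?thesis by (simp add: power2_eq_square sum_distrib_right)
  qed
  finally have "(norm A)\<^sup>2 \<le> (trace A)\<^sup>2" using trace_orthonormal_basis[OF E(1)] by simp
  moreover have "0 \<le> trace A" using trace_orthonormal_basis[OF E(1)] psd by (simp add: sum_nonneg)
  ultimately show ?thesis by (rule power2_le_imp_le)
qed

section \<open>Positive definite inverses and orthogonal projections\<close>

lemma pos_def_invertible:
  fixes A :: "real^'n^'n"
  assumes "pos_def A"
  shows "A ** matrix_inv A = mat 1" "matrix_inv A ** A = mat 1"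
proof -
  have "inj ((*v) A)"
  proof (rule injI)
    fix x y assume "A *v x = A *v y"
    then have "(x - y) \<bullet> (A *v (x - y)) = 0" by (simp add: matrix_vector_mult_diff_distrib)
    then show "x = y" using assms unfolding pos_def_def by (metis less_irrefl right_minus_eq)
  qed
  then have "invertible A" by (simp add: invertible_left_inverse matrix_left_invertible_injective)
  then show "A ** matrix_inv A = mat 1" "matrix_inv A ** A = mat 1"
    unfolding invertible_def matrix_inv_def by (metis (mono_tags, lifting) someI_ex)+
qed

lemma matrix_inv_eq: "A ** X = mat 1 \<Longrightarrow> X ** A = mat 1 \<Longrightarrow> matrix_inv A = X" for A X :: "real^'n^'n"
  unfolding matrix_inv_def
  by (rule some_equality) (auto, metis matrix_mul_assoc matrix_mul_lid matrix_mul_rid)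

lemma pos_def_matrix_inv:
  fixes A :: "real^'n^'n"
  assumes "pos_def A"
  shows "pos_def (matrix_inv A)"
proof -
  let ?X = "matrix_inv A"
  have sym: "transpose A = A" using assms by (simp add: pos_def_def)
  have "transpose ?X = ?X"
    using pos_def_invertible[OF assms] sym
    by (metis matrix_inv_eq matrix_transpose_mul transpose_mat)
  moreover have "x \<bullet> (?X *v x) > 0" if "x \<noteq> 0" for x
  proof -
    have x: "A *v (?X *v x) = x"
      using pos_def_invertible(1)[OF assms] by (simp add: matrix_vector_mul_assoc)
    then have "?X *v x \<noteq> 0" using that by auto
    then have "(?X *v x) \<bullet> (A *v (?X *v x)) > 0" using assms by (simp add: pos_def_def)
    then show ?thesis by (simp add: x inner_commute)
  qed
  ultimately show ?thesis by (simp add: pos_def_def)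
qed

lemma exists_projection_matrix:
  fixes N :: "(real^'n) set"
  assumes "subspace N"
  obtains P :: "real^'n^'n" where "transpose P = P" "P ** P = P" "\<And>x. P *v x \<in> N" "\<And>x. x \<in> N \<Longrightarrow> P *v x = x"
proof -
  obtain B where B: "B \<subseteq> N" "pairwise orthogonal B" "\<And>x. x \<in> B \<Longrightarrow> norm x = 1" "span B = N"
    using orthonormal_basis_subspace[OF assms] by metis
  have f: "finite B" by (rule pairwise_orthogonal_imp_finite[OF B(2)])
  define P where "P = (\<Sum>b\<in>B. tensor b b)"
  have P: "P *v x = (\<Sum>b\<in>B. (b \<bullet> x) *\<^sub>R b)" for x
    unfolding P_def
    by (simp add: vec_eq_iff matrix_vector_mult_def tensor_def sum_distrib_right sum_distrib_left
        inner_vec_def sum.swap[of _ UNIV B] mult_ac)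
  have 1: "P *v x \<in> N" for x
    unfolding P using B(1) assms by (intro subspace_sum subspace_scale) auto
  have 2: "P *v x = x" if "x \<in> N" for x
  proof -
    have "P *v b = b" if "b \<in> B" for b
    proof -
      have "P *v b = (\<Sum>c\<in>B. if c = b then b else 0)"
        unfolding P using B(2,3) that by (intro sum.cong) (auto simp: pairwise_def orthogonal_def norm_eq_1)
      then show ?thesis using f that by simp
    qed
    then have "b \<in> {x. P *v x = x}" if "b \<in> B" for b using that by simp
    moreover have "subspace {x. P *v x = x}"
      by (simp add: subspace_def matrix_vector_right_distrib matrix_vector_mult_scaleR)
    ultimately have "span B \<subseteq> {x. P *v x = x}" by (intro span_minimal) auto
    then show ?thesis using that B(4) by auto
  qed
  have 3: "P ** P = P" by (simp add: matrix_eq matrix_vector_mul_assoc[symmetric] 1 2)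
  have "transpose P = P" by (simp add: sym_matrix_iff P inner_sum_right mult.commute inner_commute)
  then show ?thesis using that 1 2 3 by blast
qed

section \<open>Concavity structure of the equation\<close>

definition s2 :: "real^'n^'n \<Rightarrow> real" where
  "s2 A = ((trace A)\<^sup>2 - trace (A ** A)) / 2"

lemma trace_square_sym: "transpose A = A \<Longrightarrow> trace (A ** A) = (norm A)\<^sup>2" for A :: "real^'n^'n"
  by (metis inner_matrix_trace power2_norm_eq_inner)

text \<open>For a unit vector \<open>e\<close> and symmetric \<open>B\<close>, \<open>S1 e B\<close>
  and \<open>S2 e B\<close> are the trace and the second elementary symmetric function of
  \<open>B\<close> compressed to the orthogonal complement of \<open>e\<close>. With
  \<open>e\<close> the direction of the gradient, the equation depends on the gradient only through
  these two and its length.\<close>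

definition S1 :: "real^'n \<Rightarrow> real^'n^'n \<Rightarrow> real" where
  "S1 e B = trace B - e \<bullet> (B *v e)"

definition S2 :: "real^'n \<Rightarrow> real^'n^'n \<Rightarrow> real" where
  "S2 e B = s2 B - trace B * (e \<bullet> (B *v e)) + (norm (B *v e))\<^sup>2"

text \<open>For a unit vector \<open>e\<close> the projected coordinate vectors form a Parseval
  frame of its orthogonal complement: traces there are sums over coordinates, with no basis to
  choose.\<close>

definition proj_axis :: "real^'n \<Rightarrow> 'n \<Rightarrow> real^'n" where
  "proj_axis e i = axis i 1 - (e $ i) *\<^sub>R e"

text \<open>\<open>Xi\<close> is a sum of values of the quadratic form \<open>B\<close>, and its minimum over \<open>c \<bottom> e\<close> recovers
  \<open>s2\<close>, \<open>S1\<close> and \<open>S2\<close>. As the minimum over \<open>c\<close> of a jointly convex expression it is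
  jointly convex in \<open>y\<close> and \<open>B\<close>.\<close>

definition Xi :: "real^'n \<Rightarrow> real^'n^'n \<Rightarrow> real^'n \<Rightarrow> real^'n \<Rightarrow> real" where
  "Xi e B y c = y \<bullet> (B *v y) + 2 * (y \<bullet> (B *v c)) + (norm c)\<^sup>2 * S1 e B"

lemma sum_axis: "(\<Sum>i\<in>UNIV. (x $ i) *\<^sub>R axis i (1::real)) = x"
  using basis_expansion[of x] by (simp add: scalar_mult_eq_scaleR)

lemma matrix_vector_sum: "A *v (\<Sum>i\<in>I. f i) = (\<Sum>i\<in>I. A *v f i)" for A :: "real^'n^'n"
  by (rule linear_sum[OF matrix_vector_mul_linear])

lemma trace_axis: "trace B = (\<Sum>i\<in>UNIV. axis i 1 \<bullet> (B *v axis i 1))" for B :: "real^'n^'n"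
  by (simp add: trace_def inner_axis_matrix)

lemma sum_proj_axis_form:
  fixes B :: "real^'n^'n"
  assumes e: "norm e = 1" and B: "transpose B = B"
  shows "(\<Sum>i\<in>UNIV. proj_axis e i \<bullet> (B *v proj_axis e i)) = S1 e B"
proof -
  have "(\<Sum>i\<in>UNIV. proj_axis e i \<bullet> (B *v proj_axis e i)) =
     (\<Sum>i\<in>UNIV. axis i 1 \<bullet> (B *v axis i 1)) - 2 * (\<Sum>i\<in>UNIV. ((e $ i) *\<^sub>R axis i 1) \<bullet> (B *v e))
       + (\<Sum>i\<in>UNIV. (e $ i)\<^sup>2) * (e \<bullet> (B *v e))"
    unfolding sum_distrib_left sum_distrib_right sum.distrib[symmetric] sum_subtractf[symmetric]
    using sym_matrix_inner[OF B]
    by (intro sum.cong) (auto simp: proj_axis_def matrix_vector_mult_diff_distrib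
        matrix_vector_mult_scaleR inner_diff_left inner_diff_right power2_eq_square algebra_simps)
  also have "(\<Sum>i\<in>UNIV. ((e $ i) *\<^sub>R axis i 1) \<bullet> (B *v e)) = e \<bullet> (B *v e)"
    by (simp only: inner_sum_left[symmetric] sum_axis)
  also have "(\<Sum>i\<in>UNIV. (e $ i)\<^sup>2) = 1"
    using e by (simp add: norm_eq_1 inner_vec_def power2_eq_square)
  finally show ?thesis by (simp add: S1_def trace_axis)
qed

lemma sum_proj_axis:
  assumes "c \<bullet> e = 0"
  shows "(\<Sum>i\<in>UNIV. (c $ i) *\<^sub>R proj_axis e i) = c"
proof -
  have "(\<Sum>i\<in>UNIV. (c $ i) *\<^sub>R proj_axis e i) = (\<Sum>i\<in>UNIV. (c $ i) *\<^sub>R axis i 1) - (\<Sum>i\<in>UNIV. (c $ i) * (e $ i)) *\<^sub>R e"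
    by (simp add: proj_axis_def scaleR_diff_right sum_subtractf scaleR_sum_left)
  then show ?thesis using assms by (simp add: sum_axis inner_vec_def)
qed

text \<open>Lagrange's identity: half the double sum equals
  \<open>(norm c)\<^sup>2 * S1 e B - c \<bullet> (B *v c)\<close>. The vectors inserted into the
  form are linear in \<open>y\<close> and \<open>c\<close>, so a domination of forms passes term by
  term to \<open>Xi\<close>.\<close>

lemma Xi_squares:
  fixes B :: "real^'n^'n"
  assumes e: "norm e = 1" and B: "transpose B = B" and c: "c \<bullet> e = 0"
  shows "Xi e B y c = (y + c) \<bullet> (B *v (y + c)) + (\<Sum>i\<in>UNIV. \<Sum>j\<in>UNIV.
     ((c $ j) *\<^sub>R proj_axis e i - (c $ i) *\<^sub>R proj_axis e j) \<bullet>
       (B *v ((c $ j) *\<^sub>R proj_axis e i - (c $ i) *\<^sub>R proj_axis e j))) / 2"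
proof -
  let ?f = "proj_axis e"
  let ?g = "\<lambda>i j. ?f i \<bullet> (B *v ?f j)"
  have cc: "(\<Sum>j\<in>UNIV. (c $ j)\<^sup>2) = (norm c)\<^sup>2"
    unfolding power2_norm_eq_inner by (simp add: inner_vec_def power2_eq_square)
  have "(\<Sum>i\<in>UNIV. \<Sum>j\<in>UNIV. ((c $ j) *\<^sub>R ?f i - (c $ i) *\<^sub>R ?f j) \<bullet> (B *v ((c $ j) *\<^sub>R ?f i - (c $ i) *\<^sub>R ?f j)))
     = (\<Sum>i\<in>UNIV. \<Sum>j\<in>UNIV. (c $ j)\<^sup>2 * ?g i i + (c $ i)\<^sup>2 * ?g j j - 2 * ((c $ i) * (c $ j) * ?g i j))"
    using sym_matrix_inner[OF B]
    by (intro sum.cong) (auto simp: matrix_vector_mult_diff_distrib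
        matrix_vector_mult_scaleR inner_diff_left inner_diff_right power2_eq_square algebra_simps)
  also have "\<dots> = (\<Sum>i\<in>UNIV. \<Sum>j\<in>UNIV. (c $ j)\<^sup>2 * ?g i i) + (\<Sum>i\<in>UNIV. \<Sum>j\<in>UNIV. (c $ i)\<^sup>2 * ?g j j)
      - 2 * (\<Sum>i\<in>UNIV. \<Sum>j\<in>UNIV. (c $ i) * (c $ j) * ?g i j)"
    by (simp add: sum.distrib sum_subtractf sum_distrib_left)
  also have "(\<Sum>i\<in>UNIV. \<Sum>j\<in>UNIV. (c $ j)\<^sup>2 * ?g i i) = (norm c)\<^sup>2 * S1 e B"
    by (simp add: sum_distrib_right[symmetric] sum_distrib_left[symmetric] cc sum_proj_axis_form[OF e B])
  also have "(\<Sum>i\<in>UNIV. \<Sum>j\<in>UNIV. (c $ i)\<^sup>2 * ?g j j) = (norm c)\<^sup>2 * S1 e B"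
    by (simp add: sum_distrib_right[symmetric] sum_distrib_left[symmetric] cc sum_proj_axis_form[OF e B])
  also have "(\<Sum>i\<in>UNIV. \<Sum>j\<in>UNIV. (c $ i) * (c $ j) * ?g i j)
      = (\<Sum>i\<in>UNIV. (c $ i) *\<^sub>R ?f i) \<bullet> (B *v (\<Sum>j\<in>UNIV. (c $ j) *\<^sub>R ?f j))"
    by (subst matrix_vector_sum, subst inner_sum_left)
       (simp add: inner_sum_right matrix_vector_mult_scaleR sum_distrib_left mult_ac)
  also have "\<dots> = c \<bullet> (B *v c)" by (simp only: sum_proj_axis[OF c])
  finally show ?thesis
    using sym_matrix_inner[OF B, of c y]
    by (simp add: Xi_def matrix_vector_right_distrib inner_add_left inner_add_right algebra_simps)
qed

text \<open>For positive definite \<open>Bs i\<close> and positive weights of sum 1, the infimum of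
  the right side over all \<open>z\<close> with prescribed average is the form of the weighted
  harmonic mean of the \<open>Bs i\<close>. The condition compares \<open>B\<close> with this mean
  without inverting matrices that may be degenerate or indefinite.\<close>

definition form_dominated :: "'i set \<Rightarrow> ('i \<Rightarrow> real) \<Rightarrow> ('i \<Rightarrow> real^'n^'n) \<Rightarrow> real^'n^'n \<Rightarrow> bool" where
  "form_dominated I w Bs B \<longleftrightarrow> (\<forall>z. (\<Sum>i\<in>I. w i *\<^sub>R z i) \<bullet> (B *v (\<Sum>i\<in>I. w i *\<^sub>R z i))
     \<le> (\<Sum>i\<in>I. w i * (z i \<bullet> (Bs i *v z i))))"

lemma Xi_convex:
  fixes B :: "real^'n^'n"
  assumes e: "norm e = 1" and B: "transpose B = B" and Bs: "\<And>i. i \<in> I \<Longrightarrow> transpose (Bs i) = Bs i"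
    and dom: "form_dominated I w Bs B" and c: "\<And>i. i \<in> I \<Longrightarrow> c i \<bullet> e = 0"
  shows "Xi e B (\<Sum>i\<in>I. w i *\<^sub>R y i) (\<Sum>i\<in>I. w i *\<^sub>R c i) \<le> (\<Sum>i\<in>I. w i * Xi e (Bs i) (y i) (c i))"
proof -
  let ?u = "\<lambda>c k l. (c $ l) *\<^sub>R proj_axis e k - (c $ k) *\<^sub>R proj_axis e l"
  let ?y = "\<Sum>i\<in>I. w i *\<^sub>R y i" and ?c = "\<Sum>i\<in>I. w i *\<^sub>R c i"
  note d = dom[unfolded form_dominated_def, rule_format]
  have c0: "?c \<bullet> e = 0" by (simp add: inner_sum_left c)
  have u: "?u ?c k l = (\<Sum>i\<in>I. w i *\<^sub>R ?u (c i) k l)" for k l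
    by (simp add: scaleR_diff_right sum_subtractf scaleR_sum_left)
  have yc: "?y + ?c = (\<Sum>i\<in>I. w i *\<^sub>R (y i + c i))"
    by (simp add: scaleR_add_right sum.distrib)
  have "Xi e B ?y ?c \<le> (\<Sum>i\<in>I. w i * ((y i + c i) \<bullet> (Bs i *v (y i + c i))))
     + (\<Sum>k\<in>UNIV. \<Sum>l\<in>UNIV. \<Sum>i\<in>I. w i * (?u (c i) k l \<bullet> (Bs i *v ?u (c i) k l))) / 2"
    unfolding Xi_squares[OF e B c0] u yc
    by (intro add_mono divide_right_mono sum_mono d) auto
  also have "(\<Sum>k\<in>UNIV. \<Sum>l\<in>UNIV. \<Sum>i\<in>I. w i * (?u (c i) k l \<bullet> (Bs i *v ?u (c i) k l)))
     = (\<Sum>k\<in>UNIV. \<Sum>i\<in>I. \<Sum>l\<in>UNIV. w i * (?u (c i) k l \<bullet> (Bs i *v ?u (c i) k l)))"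
    by (intro sum.cong refl sum.swap)
  also have "\<dots> = (\<Sum>i\<in>I. \<Sum>k\<in>UNIV. \<Sum>l\<in>UNIV. w i * (?u (c i) k l \<bullet> (Bs i *v ?u (c i) k l)))"
    by (rule sum.swap)
  also have "(\<Sum>i\<in>I. w i * ((y i + c i) \<bullet> (Bs i *v (y i + c i)))) + \<dots> / 2
     = (\<Sum>i\<in>I. w i * Xi e (Bs i) (y i) (c i))"
    by (subst sum_divide_distrib, subst sum.distrib[symmetric], rule sum.cong[OF refl])
       (simp only: Xi_squares[OF e Bs c] sum_distrib_left[symmetric] distrib_left times_divide_eq_right)
  finally show ?thesis .
qed

text \<open>If \<open>S1 e B\<close> is positive, this is the minimum of \<open>Xi e B y c\<close>
  over \<open>c\<close> orthogonal to \<open>e\<close>. The vector in the norm is the part of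
  \<open>B *v y\<close> orthogonal to \<open>e\<close>, and minus that part divided by
  \<open>S1 e B\<close> is the minimiser.\<close>

definition min_Xi :: "real^'n \<Rightarrow> real^'n^'n \<Rightarrow> real^'n \<Rightarrow> real" where
  "min_Xi e B y = y \<bullet> (B *v y) - (norm (B *v y - (e \<bullet> (B *v y)) *\<^sub>R e))\<^sup>2 / S1 e B"

lemma min_Xi_scale: "min_Xi e B (t *\<^sub>R y) = t\<^sup>2 * min_Xi e B y"
proof -
  have "B *v (t *\<^sub>R y) - (e \<bullet> (B *v (t *\<^sub>R y))) *\<^sub>R e = t *\<^sub>R (B *v y - (e \<bullet> (B *v y)) *\<^sub>R e)"
    by (simp add: matrix_vector_mult_scaleR scaleR_diff_right)
  then show ?thesis
    by (simp add: min_Xi_def power_mult_distrib matrix_vector_mult_scaleR right_diff_distrib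
        power2_eq_square[of t])
qed

lemma min_Xi:
  fixes B :: "real^'n^'n"
  assumes e: "norm e = 1" and B: "transpose B = B" and pos: "S1 e B > 0"
  shows "c \<bullet> e = 0 \<Longrightarrow> min_Xi e B y \<le> Xi e B y c"
    and "\<exists>c. c \<bullet> e = 0 \<and> min_Xi e B y = Xi e B y c"
proof -
  let ?b = "B *v y - (e \<bullet> (B *v y)) *\<^sub>R e"
  have b: "y \<bullet> (B *v c) = ?b \<bullet> c" if "c \<bullet> e = 0" for c
    using sym_matrix_inner[OF B, of y c] that inner_commute[of c e] inner_commute[of c "B *v y"]
    by (simp add: inner_diff_left)
  have sq: "Xi e B y c - min_Xi e B y = (norm (?b + S1 e B *\<^sub>R c))\<^sup>2 / S1 e B" if "c \<bullet> e = 0" for c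
  proof -
    have "(norm (?b + S1 e B *\<^sub>R c))\<^sup>2 = (norm ?b)\<^sup>2 + 2 * S1 e B * (?b \<bullet> c) + (S1 e B)\<^sup>2 * (norm c)\<^sup>2"
      unfolding power2_norm_eq_inner
      by (simp add: inner_add_left inner_add_right inner_commute[of c ?b] power2_eq_square distrib_left)
    then show ?thesis unfolding Xi_def min_Xi_def b[OF that]
      using pos by (simp add: field_simps power2_eq_square)
  qed
  show "min_Xi e B y \<le> Xi e B y c" if "c \<bullet> e = 0"
  proof -
    have "0 \<le> (norm (?b + S1 e B *\<^sub>R c))\<^sup>2 / S1 e B" using pos by simp
    then show ?thesis using sq[OF that] by linarith
  qed
  have "e \<bullet> e = 1" using e by (simp add: norm_eq_1)
  then have "(- (1 / S1 e B) *\<^sub>R ?b) \<bullet> e = 0"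
    by (simp only: inner_scaleR_left inner_diff_left inner_commute[of "B *v y" e]) simp
  from this sq[OF this] pos show "\<exists>c. c \<bullet> e = 0 \<and> min_Xi e B y = Xi e B y c"
    by (intro exI[of _ "- (1 / S1 e B) *\<^sub>R ?b"]) simp
qed

text \<open>Partial minimisation preserves joint convexity: the average of the minimisers for the
  \<open>Bs i\<close> is an admissible competitor for \<open>B\<close>.\<close>

lemma min_Xi_convex:
  fixes B :: "real^'n^'n"
  assumes e: "norm e = 1" and B: "transpose B = B" and Bs: "\<And>i. i \<in> I \<Longrightarrow> transpose (Bs i) = Bs i"
    and dom: "form_dominated I w Bs B"
    and pos: "S1 e B > 0" "\<And>i. i \<in> I \<Longrightarrow> S1 e (Bs i) > 0"
  shows "min_Xi e B (\<Sum>i\<in>I. w i *\<^sub>R y i) \<le> (\<Sum>i\<in>I. w i * min_Xi e (Bs i) (y i))"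
proof -
  have "\<forall>i. \<exists>c. i \<in> I \<longrightarrow> c \<bullet> e = 0 \<and> min_Xi e (Bs i) (y i) = Xi e (Bs i) (y i) c"
    using min_Xi(2)[OF e Bs pos(2)] by blast
  then obtain c where c: "\<And>i. i \<in> I \<Longrightarrow> c i \<bullet> e = 0"
    "\<And>i. i \<in> I \<Longrightarrow> min_Xi e (Bs i) (y i) = Xi e (Bs i) (y i) (c i)" by metis
  have "(\<Sum>i\<in>I. w i *\<^sub>R c i) \<bullet> e = 0" by (simp add: inner_sum_left c)
  then have "min_Xi e B (\<Sum>i\<in>I. w i *\<^sub>R y i) \<le> Xi e B (\<Sum>i\<in>I. w i *\<^sub>R y i) (\<Sum>i\<in>I. w i *\<^sub>R c i)"
    by (rule min_Xi(1)[OF e B pos(1)])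
  also have "\<dots> \<le> (\<Sum>i\<in>I. w i * Xi e (Bs i) (y i) (c i))"
    by (rule Xi_convex[OF e B Bs dom c(1)])
  also have "\<dots> = (\<Sum>i\<in>I. w i * min_Xi e (Bs i) (y i))" by (simp add: c)
  finally show ?thesis .
qed

lemma min_Xi_e:
  fixes B :: "real^'n^'n"
  assumes e: "norm e = 1" and pos: "S1 e B > 0"
  shows "min_Xi e B e = (s2 B - S2 e B) / S1 e B"
proof -
  have "(norm (B *v e - (e \<bullet> (B *v e)) *\<^sub>R e))\<^sup>2 = (norm (B *v e))\<^sup>2 - (e \<bullet> (B *v e))\<^sup>2"
    unfolding power2_norm_eq_inner using e
    by (simp add: inner_diff_left inner_diff_right norm_eq_1 inner_commute power2_eq_square)
  then show ?thesis using pos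
    by (simp add: min_Xi_def S2_def field_simps) (simp add: S1_def algebra_simps power2_eq_square)
qed

text \<open>With \<open>C\<close> the compression of \<open>B\<close> to the complement of
  \<open>e\<close>, the sum is \<open>S1\<close> minus \<open>|C|\<^sup>2 / S1\<close>, and the
  squared trace of \<open>C\<close> minus \<open>|C|\<^sup>2\<close> is \<open>2 * S2\<close>.
  Together with the value at \<open>e\<close> this expresses both \<open>S2 / S1\<close> and
  \<open>s2 / S1\<close> by values of \<open>min_Xi\<close>.\<close>

lemma sum_min_Xi_proj_axis:
  fixes B :: "real^'n^'n"
  assumes e: "norm e = 1" and B: "transpose B = B" and pos: "S1 e B > 0"
  shows "(\<Sum>i\<in>UNIV. min_Xi e B (proj_axis e i)) = 2 * S2 e B / S1 e B"
proof -
  have ee: "e \<bullet> e = 1" using e by (simp add: norm_eq_1)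
  have e2: "(\<Sum>i\<in>UNIV. (e $ i)\<^sup>2) = 1"
    using ee by (simp add: inner_vec_def power2_eq_square)
  have Bi: "axis i 1 \<bullet> (B *v e) = (B *v e) $ i" for i by (simp add: inner_axis')
  have ie: "(norm (B *v proj_axis e i - (e \<bullet> (B *v proj_axis e i)) *\<^sub>R e))\<^sup>2
      = (norm (B *v axis i 1))\<^sup>2 - 2 * ((e $ i) * ((B *v (B *v e)) $ i)) + (e $ i)\<^sup>2 * (norm (B *v e))\<^sup>2
        - ((B *v e) $ i - (e $ i) * (e \<bullet> (B *v e)))\<^sup>2" for i
  proof -
    let ?p = "proj_axis e i"
    have "(norm (B *v ?p - (e \<bullet> (B *v ?p)) *\<^sub>R e))\<^sup>2 = (norm (B *v ?p))\<^sup>2 - (e \<bullet> (B *v ?p))\<^sup>2"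
      unfolding power2_norm_eq_inner using ee
      by (simp add: inner_diff_left inner_diff_right inner_commute power2_eq_square)
    moreover have "e \<bullet> (B *v ?p) = (B *v e) $ i - (e $ i) * (e \<bullet> (B *v e))"
      using sym_matrix_inner[OF B, of e "axis i 1"]
      by (simp add: proj_axis_def matrix_vector_mult_diff_distrib matrix_vector_mult_scaleR
          inner_diff_right Bi)
    moreover have "(norm (B *v ?p))\<^sup>2 = (norm (B *v axis i 1))\<^sup>2 - 2 * ((e $ i) * ((B *v e) \<bullet> (B *v axis i 1)))
        + (e $ i)\<^sup>2 * (norm (B *v e))\<^sup>2"
      unfolding power2_norm_eq_inner
      by (simp add: proj_axis_def matrix_vector_mult_diff_distrib matrix_vector_mult_scaleR
          inner_diff_right inner_diff_left inner_commute power2_eq_square)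
    moreover have "(B *v e) \<bullet> (B *v axis i 1) = (B *v (B *v e)) $ i"
      using sym_matrix_inner[OF B, of "B *v e" "axis i 1"] by (simp add: inner_axis')
    ultimately show ?thesis by simp
  qed
  have BB: "(\<Sum>i\<in>UNIV. (norm (B *v axis i 1))\<^sup>2) = trace (B ** B)"
  proof -
    have "(norm (B *v axis i 1))\<^sup>2 = axis i 1 \<bullet> ((B ** B) *v axis i 1)" for i
      using sym_matrix_inner[OF B, of "axis i 1" "B *v axis i 1"]
      by (simp only: power2_norm_eq_inner matrix_vector_mul_assoc[symmetric])
    then show ?thesis by (simp add: trace_axis)
  qed
  have Be: "(\<Sum>i\<in>UNIV. (e $ i) * ((B *v (B *v e)) $ i)) = (norm (B *v e))\<^sup>2"
    using sym_matrix_inner[OF B, of e "B *v e"]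
    by (simp add: power2_norm_eq_inner inner_vec_def[of e])
  have sq: "(\<Sum>i\<in>UNIV. ((B *v e) $ i - (e $ i) * (e \<bullet> (B *v e)))\<^sup>2) = (norm (B *v e))\<^sup>2 - (e \<bullet> (B *v e))\<^sup>2"
  proof -
    have "(\<Sum>i\<in>UNIV. ((B *v e) $ i - (e $ i) * (e \<bullet> (B *v e)))\<^sup>2)
       = (B *v e - (e \<bullet> (B *v e)) *\<^sub>R e) \<bullet> (B *v e - (e \<bullet> (B *v e)) *\<^sub>R e)"
      by (simp add: inner_vec_def[of "_ - _"] power2_eq_square mult.commute)
    then show ?thesis unfolding power2_norm_eq_inner using ee
      by (simp add: inner_diff_left inner_diff_right inner_commute power2_eq_square)
  qed
  have "(\<Sum>i\<in>UNIV. min_Xi e B (proj_axis e i)) = S1 e B -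
     (trace (B ** B) - 2 * (norm (B *v e))\<^sup>2 + (norm (B *v e))\<^sup>2 - ((norm (B *v e))\<^sup>2 - (e \<bullet> (B *v e))\<^sup>2)) / S1 e B"
    unfolding min_Xi_def ie sum_subtractf sum_proj_axis_form[OF e B] sum_divide_distrib[symmetric] sum.distrib
      sum_distrib_left[symmetric] sum_distrib_right[symmetric] BB Be sq e2 by simp
  also have "\<dots> = 2 * S2 e B / S1 e B"
    using pos by (simp add: S2_def s2_def field_simps) (simp add: S1_def algebra_simps power2_eq_square)
  finally show ?thesis .
qed

text \<open>The domination is tested on \<open>proj_axis e k\<close> scaled by
  \<open>1 / S1 e (Bs i)\<close> and summed over \<open>k\<close>. With \<open>s\<close> the left
  side of the claim this gives \<open>s\<^sup>2 * S1 e B \<le> s\<close>.\<close>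

lemma inverse_S1_concave:
  fixes B :: "real^'n^'n"
  assumes e: "norm e = 1" and B: "transpose B = B" and Bs: "\<And>i. i \<in> I \<Longrightarrow> transpose (Bs i) = Bs i"
    and dom: "form_dominated I w Bs B"
    and pos: "S1 e B > 0" "\<And>i. i \<in> I \<Longrightarrow> S1 e (Bs i) > 0"
    and w: "finite I" "\<And>i. i \<in> I \<Longrightarrow> w i \<ge> 0" "sum w I = 1"
  shows "(\<Sum>i\<in>I. w i / S1 e (Bs i)) \<le> 1 / S1 e B"
proof -
  let ?a = "\<lambda>i. 1 / S1 e (Bs i)"
  let ?s = "\<Sum>i\<in>I. w i * ?a i"
  note d = dom[unfolded form_dominated_def, rule_format]
  have "?s\<^sup>2 * S1 e B = (\<Sum>k\<in>UNIV. (\<Sum>i\<in>I. w i *\<^sub>R (?a i *\<^sub>R proj_axis e k)) \<bullet> (B *v (\<Sum>i\<in>I. w i *\<^sub>R (?a i *\<^sub>R proj_axis e k))))"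
  proof -
    have "(\<Sum>i\<in>I. w i *\<^sub>R (?a i *\<^sub>R proj_axis e k)) = ?s *\<^sub>R proj_axis e k" for k
      by (simp add: scaleR_sum_left)
    then show ?thesis
      by (simp only: matrix_vector_mult_scaleR inner_scaleR_left inner_scaleR_right
          sum_distrib_left[symmetric] sum_proj_axis_form[OF e B] power2_eq_square mult.assoc)
  qed
  also have "\<dots> \<le> (\<Sum>k\<in>UNIV. \<Sum>i\<in>I. w i * ((?a i *\<^sub>R proj_axis e k) \<bullet> (Bs i *v (?a i *\<^sub>R proj_axis e k))))"
    by (intro sum_mono d)
  also have "\<dots> = (\<Sum>i\<in>I. \<Sum>k\<in>UNIV. w i * ((?a i *\<^sub>R proj_axis e k) \<bullet> (Bs i *v (?a i *\<^sub>R proj_axis e k))))"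
    by (rule sum.swap)
  also have "\<dots> = ?s"
  proof (rule sum.cong[OF refl])
    fix i assume i: "i \<in> I"
    have "(\<Sum>k\<in>UNIV. w i * ((?a i *\<^sub>R proj_axis e k) \<bullet> (Bs i *v (?a i *\<^sub>R proj_axis e k)))) = w i * (?a i * (?a i * S1 e (Bs i)))"
      by (simp only: matrix_vector_mult_scaleR inner_scaleR_left inner_scaleR_right
          sum_distrib_left[symmetric] sum_proj_axis_form[OF e Bs[OF i]])
    then show "(\<Sum>k\<in>UNIV. w i * ((?a i *\<^sub>R proj_axis e k) \<bullet> (Bs i *v (?a i *\<^sub>R proj_axis e k)))) = w i * ?a i"
      using pos(2)[OF i] by simp
  qed
  finally have *: "?s * ?s * S1 e B \<le> ?s" by (simp add: power2_eq_square)
  have "?s \<ge> 0" using w(2) pos(2) by (intro sum_nonneg mult_nonneg_nonneg) (auto simp: less_imp_le)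
  then have "?s * S1 e B \<le> 1"
    using * by (cases "?s = 0") (auto simp: mult.assoc mult_le_cancel_left1)
  then show ?thesis using pos(1) by (simp add: field_simps)
qed

lemma weighted_square_le:
  fixes t :: "'i \<Rightarrow> real"
  assumes "finite I" "\<And>i. i \<in> I \<Longrightarrow> w i \<ge> 0" "sum w I = 1"
  shows "(\<Sum>i\<in>I. w i * t i)\<^sup>2 \<le> (\<Sum>i\<in>I. w i * (t i)\<^sup>2)"
proof -
  let ?m = "\<Sum>i\<in>I. w i * t i"
  have "0 \<le> (\<Sum>i\<in>I. w i * (t i - ?m)\<^sup>2)" using assms(2) by (simp add: sum_nonneg)
  also have "\<dots> = (\<Sum>i\<in>I. w i * (t i)\<^sup>2 - 2 * ?m * (w i * t i) + ?m\<^sup>2 * w i)"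
    by (intro sum.cong refl) (simp add: power2_eq_square algebra_simps)
  also have "\<dots> = (\<Sum>i\<in>I. w i * (t i)\<^sup>2) - 2 * ?m * ?m + ?m\<^sup>2"
    by (simp add: sum.distrib sum_subtractf sum_distrib_left[symmetric] assms(3))
  finally show ?thesis by (simp add: power2_eq_square)
qed

text \<open>Divided by \<open>S1\<close>, the hypotheses have a left side made of values of
  \<open>min_Xi\<close> and a term linear in \<open>t\<close>, and a right side with the concave
  factor \<open>1 / S1\<close>; they are averaged and multiplied back. In its uses \<open>a\<close>
  is the squared length of the gradient. The factor \<kappa> accommodates the extra
  \<open>\<theta>\<^sup>2\<close> that appears at a maximum over the hull.\<close>

theorem structural_inequality:
  fixes B :: "real^'n^'n"
  assumes e: "norm e = 1" and B: "transpose B = B" and Bs: "\<And>i. i \<in> I \<Longrightarrow> transpose (Bs i) = Bs i"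
    and dom: "form_dominated I w Bs B"
    and pos: "S1 e B > 0" "\<And>i. i \<in> I \<Longrightarrow> S1 e (Bs i) > 0"
    and w: "finite I" "\<And>i. i \<in> I \<Longrightarrow> w i \<ge> 0" "sum w I = 1"
    and a: "a \<ge> 0" and c: "c \<ge> 0" and \<kappa>: "0 \<le> \<kappa>" "\<kappa> \<le> 1"
    and sign: "S2 e B \<ge> 0 \<or> (\<forall>i\<in>I. S2 e (Bs i) \<ge> 0)"
    and sub: "\<And>i. i \<in> I \<Longrightarrow> 4 * ((t i)\<^sup>2 * s2 (Bs i) - t i * (a * S1 e (Bs i))) + 16 * (t i)^4 * (a * S2 e (Bs i)) \<le> c"
    and T: "T = (\<Sum>i\<in>I. w i * t i)"
  shows "4 * (T\<^sup>2 * s2 B - T * (a * S1 e B)) + \<kappa> * (16 * T^4 * (a * S2 e B)) \<le> c"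
proof -
  note mc = min_Xi_convex[OF e B Bs dom pos]
  let ?S = "S1 e B" and ?Si = "\<lambda>i. S1 e (Bs i)"
  \<comment> \<open>The quartic coefficient is
    \<open>16 * t^4 * a = 4 * a * (2 * t\<^sup>2)\<^sup>2\<close>, so in \<open>half\<close> the
    numbers \<open>2 * (t i)\<^sup>2\<close> take the place of the \<open>t i\<close>.\<close>
  define L where "L = (\<Sum>i\<in>I. w i * (2 * (t i)\<^sup>2))"
  have half: "r\<^sup>2 * (S2 e B / ?S) \<le> (\<Sum>i\<in>I. w i * ((s i)\<^sup>2 * (S2 e (Bs i) / ?Si i)))"
    if r: "r = (\<Sum>i\<in>I. w i * s i)" for r and s :: "'a \<Rightarrow> real"
  proof -
    have "r\<^sup>2 * min_Xi e B (proj_axis e k) \<le> (\<Sum>i\<in>I. w i * ((s i)\<^sup>2 * min_Xi e (Bs i) (proj_axis e k)))" for k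
      using mc[of "\<lambda>i. s i *\<^sub>R proj_axis e k"]
      by (simp add: min_Xi_scale r scaleR_sum_left[symmetric] mult.commute)
    then have "(\<Sum>k\<in>UNIV. r\<^sup>2 * min_Xi e B (proj_axis e k)) \<le> (\<Sum>k\<in>UNIV. \<Sum>i\<in>I. w i * ((s i)\<^sup>2 * min_Xi e (Bs i) (proj_axis e k)))"
      by (intro sum_mono)
    also have "\<dots> = (\<Sum>i\<in>I. \<Sum>k\<in>UNIV. w i * ((s i)\<^sup>2 * min_Xi e (Bs i) (proj_axis e k)))"
      by (rule sum.swap)
    finally have "r\<^sup>2 * (2 * S2 e B / ?S) \<le> (\<Sum>i\<in>I. w i * ((s i)\<^sup>2 * (2 * S2 e (Bs i) / ?Si i)))"
      using sum_min_Xi_proj_axis[OF e B pos(1)] sum_min_Xi_proj_axis[OF e Bs pos(2)]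
      by (simp add: sum_distrib_left[symmetric])
    moreover have "(\<Sum>i\<in>I. w i * ((s i)\<^sup>2 * (2 * S2 e (Bs i) / ?Si i))) = 2 * (\<Sum>i\<in>I. w i * ((s i)\<^sup>2 * (S2 e (Bs i) / ?Si i)))"
      by (simp add: sum_distrib_left algebra_simps)
    moreover have "r\<^sup>2 * (2 * S2 e B / ?S) = 2 * (r\<^sup>2 * (S2 e B / ?S))" by simp
    ultimately have "2 * (r\<^sup>2 * (S2 e B / ?S)) \<le> 2 * (\<Sum>i\<in>I. w i * ((s i)\<^sup>2 * (S2 e (Bs i) / ?Si i)))"
      by metis
    then show ?thesis by (rule mult_left_le_imp_le) simp
  qed
  have h1: "T\<^sup>2 * (s2 B / ?S) \<le> (\<Sum>i\<in>I. w i * ((t i)\<^sup>2 * (s2 (Bs i) / ?Si i)))"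
  proof -
    have "T\<^sup>2 * min_Xi e B e \<le> (\<Sum>i\<in>I. w i * ((t i)\<^sup>2 * min_Xi e (Bs i) e))"
      using mc[of "\<lambda>i. t i *\<^sub>R e"]
      by (simp add: min_Xi_scale T scaleR_sum_left[symmetric] mult.commute)
    also have "\<dots> = (\<Sum>i\<in>I. w i * ((t i)\<^sup>2 * ((s2 (Bs i) - S2 e (Bs i)) / ?Si i)))"
      using min_Xi_e[OF e pos(2)] by (intro sum.cong) auto
    finally have "T\<^sup>2 * min_Xi e B e + T\<^sup>2 * (S2 e B / ?S) \<le>
       (\<Sum>i\<in>I. w i * ((t i)\<^sup>2 * ((s2 (Bs i) - S2 e (Bs i)) / ?Si i))) + (\<Sum>i\<in>I. w i * ((t i)\<^sup>2 * (S2 e (Bs i) / ?Si i)))"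
      using half[OF T] by linarith
    then show ?thesis
      unfolding sum.distrib[symmetric] distrib_left[symmetric] min_Xi_e[OF e pos(1)] add_divide_distrib[symmetric]
      by simp
  qed
  have h2: "L\<^sup>2 * (S2 e B / ?S) \<le> (\<Sum>i\<in>I. w i * ((2 * (t i)\<^sup>2)\<^sup>2 * (S2 e (Bs i) / ?Si i)))"
    by (rule half[OF L_def])
  have h3: "(\<Sum>i\<in>I. w i * (c / ?Si i)) \<le> c / ?S"
    using mult_left_mono[OF inverse_S1_concave[OF e B Bs dom pos w] c]
    by (simp add: sum_distrib_left mult.commute)
  have each: "4 * ((t i)\<^sup>2 * (s2 (Bs i) / ?Si i) - t i * a) + 4 * a * ((2 * (t i)\<^sup>2)\<^sup>2 * (S2 e (Bs i) / ?Si i)) \<le> c / ?Si i"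
    if "i \<in> I" for i
  proof -
    have "4 * ((t i)\<^sup>2 * (s2 (Bs i) / ?Si i) - t i * a) + 4 * a * ((2 * (t i)\<^sup>2)\<^sup>2 * (S2 e (Bs i) / ?Si i))
      = (4 * ((t i)\<^sup>2 * s2 (Bs i) - t i * (a * ?Si i)) + 16 * (t i)^4 * (a * S2 e (Bs i))) / ?Si i"
      using pos(2)[OF that] by (simp add: field_simps power2_eq_square power4_eq_xxxx)
    then show ?thesis using divide_right_mono[OF sub[OF that], of "?Si i"] pos(2)[OF that] by simp
  qed
  let ?X = "\<Sum>i\<in>I. w i * ((t i)\<^sup>2 * (s2 (Bs i) / ?Si i))"
  let ?Y = "\<Sum>i\<in>I. w i * ((2 * (t i)\<^sup>2)\<^sup>2 * (S2 e (Bs i) / ?Si i))"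
  have tot: "4 * (?X - T * a) + 4 * a * ?Y \<le> c / ?S"
  proof -
    have "4 * (?X - T * a) + 4 * a * ?Y =
      (\<Sum>i\<in>I. w i * (4 * ((t i)\<^sup>2 * (s2 (Bs i) / ?Si i) - t i * a) + 4 * a * ((2 * (t i)\<^sup>2)\<^sup>2 * (S2 e (Bs i) / ?Si i))))"
      unfolding T sum_distrib_left sum_distrib_right sum.distrib[symmetric] sum_subtractf[symmetric]
      by (intro sum.cong) (auto simp: algebra_simps)
    also have "\<dots> \<le> (\<Sum>i\<in>I. w i * (c / ?Si i))"
      using each w(2) by (intro sum_mono mult_left_mono) auto
    finally show ?thesis using h3 by linarith
  qed
  have "4 * (T\<^sup>2 * (s2 B / ?S) - T * a) + \<kappa> * (16 * T^4 * a * (S2 e B / ?S)) \<le> c / ?S"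
  \<comment> \<open>If \<open>S2 e B\<close> is nonnegative, \<open>L\<close> may be lowered to
    \<open>2 * T\<^sup>2\<close>. If it is negative, the quartic term on the left is at most 0, and
    \<open>sign\<close> makes the average \<open>?Y\<close> nonnegative.\<close>
  proof (cases "S2 e B \<ge> 0")
    case True
    have L: "2 * T\<^sup>2 \<le> L"
      using weighted_square_le[OF w, of t] unfolding L_def T
      by (simp add: sum_distrib_left[symmetric] mult.left_commute[of _ 2])
    have "(2 * T\<^sup>2)\<^sup>2 \<le> L\<^sup>2" using L by (intro power_mono) auto
    then have "4 * T^4 \<le> L\<^sup>2" by (simp add: power_mult_distrib)
    then have "(4 * T^4) * (S2 e B / ?S) \<le> L\<^sup>2 * (S2 e B / ?S)"
      using True pos(1) by (intro mult_right_mono) auto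
    then have "4 * a * ((4 * T^4) * (S2 e B / ?S)) \<le> 4 * a * ?Y"
      using h2 a by (intro mult_left_mono) auto
    moreover have "\<kappa> * (16 * T^4 * a * (S2 e B / ?S)) \<le> 1 * (16 * T^4 * a * (S2 e B / ?S))"
      using True pos(1) a \<kappa> by (intro mult_right_mono) auto
    moreover have "16 * T^4 * a * (S2 e B / ?S) = 4 * a * ((4 * T^4) * (S2 e B / ?S))" by simp
    ultimately show ?thesis using tot h1 by argo
  next
    case False
    then have "\<kappa> * (16 * T^4 * a * (S2 e B / ?S)) \<le> 0"
      using pos(1) a \<kappa> by (intro mult_nonneg_nonpos) (auto simp: divide_nonpos_pos)
    moreover have "0 \<le> ?Y" using False sign pos(2) w(2)
      by (intro sum_nonneg mult_nonneg_nonneg) (auto simp: less_imp_le)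
    then have "0 \<le> 4 * a * ?Y" using a by simp
    ultimately show ?thesis using tot h1 by argo
  qed
  then have "(4 * (T\<^sup>2 * (s2 B / ?S) - T * a) + \<kappa> * (16 * T^4 * a * (S2 e B / ?S))) * ?S \<le> (c / ?S) * ?S"
    using pos(1) by (intro mult_right_mono) auto
  moreover have "(c / ?S) * ?S = c" using pos(1) by simp
  moreover have "(4 * (T\<^sup>2 * (s2 B / ?S) - T * a) + \<kappa> * (16 * T^4 * a * (S2 e B / ?S))) * ?S
      = 4 * (T\<^sup>2 * s2 B - T * (a * ?S)) + \<kappa> * (16 * T^4 * (a * S2 e B))"
    using pos(1) by (simp add: field_simps)
  ultimately show ?thesis by simp
qed

section \<open>The curvature operator\<close>

lemmas matrix_mult_simps =
  bounded_bilinear.add_left[OF bounded_bilinear_matrix_matrix]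
  bounded_bilinear.add_right[OF bounded_bilinear_matrix_matrix]
  bounded_bilinear.diff_left[OF bounded_bilinear_matrix_matrix]
  bounded_bilinear.diff_right[OF bounded_bilinear_matrix_matrix]
  bounded_bilinear.scaleR_left[OF bounded_bilinear_matrix_matrix]
  bounded_bilinear.scaleR_right[OF bounded_bilinear_matrix_matrix]

lemmas matrix_vector_simps =
  bounded_bilinear.add_left[OF bounded_bilinear_matrix_vector]
  bounded_bilinear.add_right[OF bounded_bilinear_matrix_vector]
  bounded_bilinear.diff_left[OF bounded_bilinear_matrix_vector]
  bounded_bilinear.diff_right[OF bounded_bilinear_matrix_vector]
  bounded_bilinear.scaleR_left[OF bounded_bilinear_matrix_vector]
  bounded_bilinear.scaleR_right[OF bounded_bilinear_matrix_vector]

section \<open>Algebra of rank one matrices, traces and transposes\<close>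

lemma tensor_mult_vector: "tensor p q *v x = (q \<bullet> x) *\<^sub>R p"
  by (simp add: vec_eq_iff tensor_def matrix_vector_mult_def inner_vec_def sum_distrib_left mult_ac)

lemma trace_tensor: "trace (tensor p q) = p \<bullet> q"
  by (simp add: trace_def tensor_def inner_vec_def)

lemma matrix_mult_tensor: "A ** tensor p q = tensor (A *v p) q"
  by (simp add: vec_eq_iff tensor_def matrix_matrix_mult_def matrix_vector_mult_def sum_distrib_left mult_ac)

lemma tensor_mult_matrix: "tensor p q ** A = tensor p (transpose A *v q)"
  by (simp add: vec_eq_iff tensor_def matrix_matrix_mult_def vector_matrix_mult_def sum_distrib_left mult_ac)

lemma transpose_tensor: "transpose (tensor p q) = tensor q p"
  by (simp add: vec_eq_iff tensor_def transpose_def mult.commute)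

lemma trace_scaleR: "trace (c *\<^sub>R A) = c * trace A" for A :: "real^'n^'n"
  by (simp add: trace_def sum_distrib_left)

lemma transpose_scaleR: "transpose (c *\<^sub>R A) = c *\<^sub>R transpose A" for A :: "real^'n^'n"
  by (simp add: vec_eq_iff transpose_def)

lemma transpose_add: "transpose (A + B) = transpose A + transpose B" for A B :: "real^'n^'n"
  by (simp add: vec_eq_iff transpose_def)

lemma transpose_diff: "transpose (A - B) = transpose A - transpose B" for A B :: "real^'n^'n"
  by (simp add: vec_eq_iff transpose_def)

lemma mat_mult_vector: "mat t *v x = t *\<^sub>R x" for x :: "real^'n"
  by (simp add: vec_eq_iff mat_def matrix_vector_mult_def if_distrib[of "\<lambda>a. a * _"] sum.delta cong: if_cong)

section \<open>Symmetric functions of the eigenvalues as traces\<close>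

lemma charpoly_symmetric:
  fixes A :: "real^'n^'n"
  assumes A: "transpose A = A"
  obtains d :: "real^'n" where "\<And>t. det (mat t - A) = (\<Prod>i\<in>UNIV. t - d $ i)"
    "(\<Sum>i\<in>UNIV. d $ i) = trace A" "(\<Sum>i\<in>UNIV. (d $ i)\<^sup>2) = trace (A ** A)"
proof -
  obtain E where E: "orthonormal_basis E" "\<And>e. e \<in> E \<Longrightarrow> A *v e = (e \<bullet> (A *v e)) *\<^sub>R e"
    using spectral_theorem[OF A] by blast
  have fE: "finite E" "span E = UNIV" "pairwise orthogonal E" "\<And>e. e \<in> E \<Longrightarrow> norm e = 1"
    using E(1) by (auto simp: orthonormal_basis_def)
  have "0 \<notin> E" using fE(4) by force
  then have "independent E" using pairwise_orthogonal_independent[OF fE(3)] by blast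
  then have "card E = CARD('n)" using fE(2) indep_card_eq_dim_span[of E] by (simp add: dim_UNIV)
  then obtain b where b: "bij_betw b (UNIV :: 'n set) E"
    using finite_same_card_bij[OF finite fE(1)] by metis
  have bE: "b i \<in> E" for i using b by (auto simp: bij_betw_def)
  have bo: "b i \<bullet> b j = (if i = j then 1 else 0)" for i j
  proof (cases "i = j")
    case False
    then have "b i \<noteq> b j" using b by (auto simp: bij_betw_def inj_def)
    then show ?thesis using False fE(3) bE by (simp add: pairwise_def orthogonal_def)
  qed (use fE(4)[OF bE[of i]] in \<open>simp add: norm_eq_1\<close>)
  define Q where "Q = (\<chi> i. b i)"
  have ent: "(Q ** Z ** transpose Q) $ i $ j = b i \<bullet> (Z *v b j)" for Z i j
    unfolding inner_matrix_vector
    by (simp add: Q_def matrix_matrix_mult_def transpose_def sum_distrib_right) (rule sum.swap)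
  have QQ: "Q ** transpose Q = mat 1"
  proof -
    have "(Q ** transpose Q) $ i $ j = (mat 1 :: real^'n^'n) $ i $ j" for i j
      using ent[of "mat 1" i j] by (simp only: matrix_mul_rid matrix_vector_mul_lid bo) (simp add: mat_def)
    then show ?thesis by (simp add: vec_eq_iff)
  qed
  have dQ: "det Q * det Q = 1"
    using arg_cong[OF QQ, of det] by (simp add: det_mul)
  define l where "l e = e \<bullet> (A *v e)" for e
  have lb: "A *v b j = l (b j) *\<^sub>R b j" for j using E(2)[OF bE] by (simp add: l_def)
  define d :: "real^'n" where "d = (\<chi> i. l (b i))"
  have re: "(\<Sum>i\<in>UNIV. h (b i)) = (\<Sum>e\<in>E. h e)" for h :: "real^'n \<Rightarrow> real"
    by (rule sum.reindex_bij_betw[OF b])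
  have "det (mat t - A) = (\<Prod>i\<in>UNIV. t - d $ i)" for t
  proof -
    have e: "(Q ** (mat t - A) ** transpose Q) $ i $ j = (if i = j then t - d $ i else 0)" for i j
      by (simp add: ent matrix_vector_mult_diff_rdistrib mat_mult_vector lb inner_diff_right bo d_def)
    have "det (mat t - A) = det Q * det Q * det (mat t - A)" by (simp add: dQ)
    also have "\<dots> = det (Q ** (mat t - A) ** transpose Q)" by (simp add: det_mul)
    also have "\<dots> = (\<Prod>i\<in>UNIV. (Q ** (mat t - A) ** transpose Q) $ i $ i)"
      by (rule det_diagonal) (simp add: e)
    finally show ?thesis by (simp add: e)
  qed
  moreover have "(\<Sum>i\<in>UNIV. d $ i) = trace A"
    using re[of l] by (simp add: d_def trace_orthonormal_basis[OF E(1)] l_def)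
  moreover have "(\<Sum>i\<in>UNIV. (d $ i)\<^sup>2) = trace (A ** A)"
  proof -
    have "trace (A ** A) = (\<Sum>i\<in>UNIV. b i \<bullet> ((A ** A) *v b i))"
      using re[of "\<lambda>e. e \<bullet> ((A ** A) *v e)"] by (simp add: trace_orthonormal_basis[OF E(1)])
    also have "\<dots> = (\<Sum>i\<in>UNIV. (d $ i)\<^sup>2)"
      by (intro sum.cong) (simp_all add: matrix_vector_mul_assoc[symmetric] lb matrix_vector_mult_scaleR
          bo d_def power2_eq_square)
    finally show ?thesis by simp
  qed
  ultimately show ?thesis using that by blast
qed

lemma sum_mset_sum_singletons:
  "finite A \<Longrightarrow> sum_mset (image_mset f (\<Sum>i\<in>A. {#g i#})) = (\<Sum>i\<in>A. f (g i))"
  by (induction A rule: finite_induct) auto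

text \<open>Equal polynomials have equal multisets of roots. This makes power sums of
  \<open>eigenvalue_vector\<close>, an arbitrary choice of ordering, computable from an
  eigenbasis.\<close>

lemma prod_linear_factors_unique:
  fixes l d :: "real^'n" and f :: "real \<Rightarrow> real"
  assumes "\<And>t. (\<Prod>i\<in>UNIV. t - l $ i) = (\<Prod>i\<in>UNIV. t - d $ i)"
  shows "(\<Sum>i\<in>UNIV. f (l $ i)) = (\<Sum>i\<in>UNIV. f (d $ i))"
proof -
  have *: "proots (\<Prod>i\<in>UNIV. [:- l $ i, 1:]) = (\<Sum>i\<in>UNIV. {#l $ i#})" for l :: "real^'n"
    by (subst proots_prod) auto
  have "poly (\<Prod>i\<in>UNIV. [:- l $ i, 1:]) = poly (\<Prod>i\<in>UNIV. [:- d $ i, 1:])"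
    using assms by (auto simp: fun_eq_iff poly_prod)
  then have "(\<Sum>i\<in>UNIV. {#l $ i#}) = (\<Sum>i\<in>UNIV. {#d $ i#})"
    by (simp add: poly_eq_poly_eq_iff *[symmetric])
  then show ?thesis
    using sum_mset_sum_singletons[of UNIV f "\<lambda>i. l $ i"] sum_mset_sum_singletons[of UNIV f "\<lambda>i. d $ i"]
    by simp
qed

text \<open>The squared sum is expanded over ordered pairs; off the diagonal every two-element set
  arises from exactly two of them.\<close>

lemma sigma2_power_sums: "2 * sigma2 l = (\<Sum>i\<in>UNIV. l $ i)\<^sup>2 - (\<Sum>i\<in>UNIV. (l $ i)\<^sup>2)"
proof -
  let ?D = "{(i :: 'a, j). i \<noteq> j}"
  let ?h = "\<lambda>(i, j). l $ i * l $ j"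
  let ?g = "\<lambda>(i, j). {i, j}"
  have im: "?g ` ?D = {S. card S = 2}"
    by (auto simp: card_2_iff image_iff)
  have "(\<Sum>p\<in>?D. ?h p) = (\<Sum>S\<in>?g ` ?D. \<Sum>p\<in>{p \<in> ?D. ?g p = S}. ?h p)"
    by (rule sum.image_gen) simp
  also have "\<dots> = (\<Sum>S | card S = 2. 2 * (\<Prod>i\<in>S. l $ i))"
    unfolding im
  proof (rule sum.cong[OF refl])
    fix S :: "'a set" assume "S \<in> {S. card S = 2}"
    then obtain a b where ab: "S = {a, b}" "a \<noteq> b" by (auto simp: card_2_iff)
    have "{p \<in> ?D. ?g p = S} = {(a, b), (b, a)}" using ab by (auto simp: doubleton_eq_iff)
    then show "(\<Sum>p\<in>{p \<in> ?D. ?g p = S}. ?h p) = 2 * (\<Prod>i\<in>S. l $ i)"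
      using ab by (simp add: mult.commute)
  qed
  finally have D: "(\<Sum>p\<in>?D. ?h p) = 2 * sigma2 l" by (simp add: sigma2_def sum_distrib_left)
  have "(\<Sum>i\<in>UNIV. l $ i)\<^sup>2 = (\<Sum>p\<in>UNIV. ?h p)"
    by (simp add: power2_eq_square sum_product sum.cartesian_product UNIV_Times_UNIV)
  also have "\<dots> = (\<Sum>p\<in>?D. ?h p) + (\<Sum>p\<in>{(i, j). i = j}. ?h p)"
    by (subst sum.union_disjoint[symmetric]) (auto intro!: sum.cong)
  also have "(\<Sum>p\<in>{(i, j). i = j}. ?h p) = (\<Sum>i\<in>UNIV. (l $ i)\<^sup>2)"
    by (rule sum.reindex_cong[of "\<lambda>i. (i, i)"]) (auto simp: inj_on_def power2_eq_square)
  finally show ?thesis using D by simp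
qed

lemma sigma_eigenvalue_vector:
  fixes A :: "real^'n^'n"
  assumes A: "transpose A = A"
  shows "sigma1 (eigenvalue_vector A) = trace A" "sigma2 (eigenvalue_vector A) = s2 A"
proof -
  obtain d :: "real^'n" where d: "\<And>t. det (mat t - A) = (\<Prod>i\<in>UNIV. t - d $ i)"
    "(\<Sum>i\<in>UNIV. d $ i) = trace A" "(\<Sum>i\<in>UNIV. (d $ i)\<^sup>2) = trace (A ** A)"
    using charpoly_symmetric[OF A] by blast
  have "\<exists>l :: real^'n. \<forall>t. det (mat t - A) = (\<Prod>i\<in>UNIV. t - l $ i)" using d(1) by blast
  then have l: "\<forall>t. det (mat t - A) = (\<Prod>i\<in>UNIV. t - eigenvalue_vector A $ i)"
    unfolding eigenvalue_vector_def by (rule someI_ex)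
  have f: "(\<Sum>i\<in>UNIV. f (eigenvalue_vector A $ i)) = (\<Sum>i\<in>UNIV. f (d $ i))" for f :: "real \<Rightarrow> real"
    by (rule prod_linear_factors_unique) (metis l d(1))
  show "sigma1 (eigenvalue_vector A) = trace A" using f[of "\<lambda>x. x"] d(2) by (simp add: sigma1_def)
  show "sigma2 (eigenvalue_vector A) = s2 A"
    using f[of "\<lambda>x. x"] f[of "\<lambda>x. x\<^sup>2"] d sigma2_power_sums[of "eigenvalue_vector A"]
    by (simp add: s2_def)
qed

text \<open>If \<open>C\<close> is another positive definite root, \<open>D = C - B\<close>
  satisfies \<open>C ** D + D ** B = 0\<close>. The trace of \<open>D\<close> times this matrix is
  the sum of the values of the two positive forms on the columns of \<open>D\<close>, so every
  column vanishes.\<close>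

lemma sqrt_matrix_eq:
  fixes A B :: "real^'n^'n"
  assumes B: "pos_def B" "B ** B = A"
  shows "sqrt_matrix A = B"
  unfolding sqrt_matrix_def
proof (rule the_equality)
  fix C assume C: "pos_def C \<and> C ** C = A"
  define D where "D = C - B"
  have s: "transpose C = C" "transpose B = B" using B C by (auto simp: pos_def_def)
  have D: "transpose D = D" by (simp add: D_def transpose_diff s)
  have z: "C ** D + D ** B = 0" using B C by (simp add: D_def matrix_mult_simps)
  have "trace (D ** (C ** D)) + trace (D ** (D ** B)) = trace (D ** (C ** D + D ** B))"
    by (simp only: matrix_mult_simps(2) trace_add)
  then have "trace (D ** (C ** D)) + trace (D ** (D ** B)) = 0" unfolding z by (simp add: trace_def)
  moreover have "trace (D ** (D ** B)) = trace (D ** (B ** D))"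
    by (subst trace_mul_sym) (simp only: matrix_mul_assoc)
  moreover have "trace (D ** (Z ** D)) = (\<Sum>i\<in>UNIV. (D *v axis i 1) \<bullet> (Z *v (D *v axis i 1)))" for Z
  proof -
    have "y \<bullet> ((D ** (Z ** D)) *v y) = (D *v y) \<bullet> (Z *v (D *v y))" for y
      using sym_matrix_inner[OF D, of y "Z *v (D *v y)"] inner_commute[of "Z *v (D *v y)" "D *v y"]
      by (simp only: matrix_vector_mul_assoc[symmetric])
    then show ?thesis by (simp only: trace_axis)
  qed
  ultimately have zero: "(\<Sum>i\<in>UNIV. (D *v axis i 1) \<bullet> (C *v (D *v axis i 1))
      + (D *v axis i 1) \<bullet> (B *v (D *v axis i 1))) = 0"
    by (simp only: sum.distrib)
  have nn: "0 \<le> y \<bullet> (C *v y) + y \<bullet> (B *v y)" for y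
    using B C unfolding pos_def_def by (cases "y = 0") (auto simp: less_imp_le add_nonneg_nonneg)
  have e0: "(D *v axis i 1) \<bullet> (C *v (D *v axis i 1)) + (D *v axis i 1) \<bullet> (B *v (D *v axis i 1)) = 0" for i
    by (rule sum_nonneg_0[OF finite nn zero UNIV_I])
  have "D *v axis i 1 = 0" for i
  proof (rule ccontr)
    assume "D *v axis i 1 \<noteq> 0"
    then have "(D *v axis i 1) \<bullet> (C *v (D *v axis i 1)) > 0" "(D *v axis i 1) \<bullet> (B *v (D *v axis i 1)) > 0"
      using B C unfolding pos_def_def by blast+
    then show False using e0[of i] by linarith
  qed
  then have "D *v y = 0" for y
    using matrix_vector_sum[of D "\<lambda>i. (y $ i) *\<^sub>R axis i 1" UNIV]
    by (simp add: sum_axis matrix_vector_simps)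
  then have "D = 0" by (simp add: matrix_eq)
  then show "C = B" by (simp add: D_def)
qed (use B in auto)

text \<open>With \<open>A\<close> the Hessian and \<open>p\<close> the gradient of \<open>u\<close>,
  this is \<open>(1 + |p|\<^sup>2)\<^sup>2\<close> times the second symmetric function of the
  principal curvatures, free of square roots. The equation becomes
  \<open>Fop A p = 1\<close>.\<close>

definition Fop :: "real^'n^'n \<Rightarrow> real^'n \<Rightarrow> real" where
  "Fop A p = (1 + (norm p)\<^sup>2) * s2 A - trace A * (p \<bullet> (A *v p)) + (norm (A *v p))\<^sup>2"

text \<open>Affine in \<open>r\<close>, because the second symmetric function of a rank one matrix
  is 0.\<close>

lemma s2_add_tensor:
  fixes K :: "real^'n^'n"
  assumes K: "transpose K = K"
  shows "s2 (K + r *\<^sub>R tensor h h) = s2 K + r * (trace K * (norm h)\<^sup>2 - h \<bullet> (K *v h))"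
proof -
  have "trace ((K + r *\<^sub>R tensor h h) ** (K + r *\<^sub>R tensor h h)) =
     trace (K ** K) + 2 * r * (h \<bullet> (K *v h)) + r\<^sup>2 * (norm h)^4"
    using K sym_matrix_inner[OF K, of h h]
    by (simp add: matrix_mult_simps trace_add trace_scaleR matrix_mult_tensor
        tensor_mult_matrix trace_tensor tensor_mult_vector inner_commute dot_square_norm matrix_vector_simps
        power2_eq_square power4_eq_xxxx algebra_simps)
  moreover have "trace (K + r *\<^sub>R tensor h h) = trace K + r * (norm h)\<^sup>2"
    by (simp add: trace_add trace_scaleR trace_tensor power2_norm_eq_inner)
  ultimately show ?thesis
    by (simp add: s2_def power2_eq_square power4_eq_xxxx field_simps)
qed

text \<open>In the cone \<open>norm K < trace K\<close>, and the norm bounds the form. Combined with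
  the rank one formula above, this is the ellipticity of \<open>s2\<close> at
  \<open>K\<close>.\<close>

lemma Gamma2_form_less_trace:
  fixes K :: "real^'n^'n"
  assumes K: "transpose K = K" and pos: "trace K > 0" "s2 K > 0" and z: "z \<noteq> 0"
  shows "z \<bullet> (K *v z) < trace K * (norm z)\<^sup>2"
proof -
  have "(norm K)\<^sup>2 < (trace K)\<^sup>2" using pos(2) trace_square_sym[OF K] by (simp add: s2_def)
  then have "norm K < trace K" using pos(1) by (metis less_imp_le power2_less_imp_less)
  have "z \<bullet> (K *v z) \<le> norm z * norm (K *v z)" by (rule norm_cauchy_schwarz)
  also have "\<dots> \<le> norm z * (norm K * norm z)" by (intro mult_left_mono norm_matrix_vector_le) auto
  also have "\<dots> = norm K * (norm z)\<^sup>2" by (simp add: power2_eq_square)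
  also have "\<dots> < trace K * (norm z)\<^sup>2" using \<open>norm K < trace K\<close> z by simp
  finally show ?thesis .
qed

text \<open>All matrices involved have the form \<open>mat 1 + a *\<^sub>R tensor p p\<close>, and
  \<open>p \<bullet> p = (w - 1) * (w + 1)\<close>; this makes the square root, its inverse
  \<open>M\<close> and \<open>M ** M\<close> explicit.\<close>

lemma graph_metric_matrices:
  fixes p :: "real^'n"
  defines "w \<equiv> sqrt (1 + (norm p)\<^sup>2)"
  defines "M \<equiv> mat 1 - (1 / (w * (w + 1))) *\<^sub>R tensor p p"
  shows "matrix_inv (sqrt_matrix (mat 1 + tensor p p)) = M" "transpose M = M"
    "M ** M = mat 1 - (1 / w\<^sup>2) *\<^sub>R tensor p p" "w \<ge> 1" "w\<^sup>2 = 1 + (norm p)\<^sup>2"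
    "norm (M *v z) \<le> norm z" "z \<noteq> 0 \<Longrightarrow> M *v z \<noteq> 0" "p = r *\<^sub>R e \<Longrightarrow> norm e = 1 \<Longrightarrow> M *v e = (1 / w) *\<^sub>R e"
proof -
  show w1: "w \<ge> 1" unfolding w_def by simp
  show w2: "w\<^sup>2 = 1 + (norm p)\<^sup>2" unfolding w_def by (simp add: add_nonneg_nonneg)
  have pp: "p \<bullet> p = (w - 1) * (w + 1)"
    using w2 by (simp add: dot_square_norm algebra_simps power2_eq_square)
  let ?S = "mat 1 + (1 / (w + 1)) *\<^sub>R tensor p p"
  have TT: "tensor p p ** tensor p p = ((w - 1) * (w + 1)) *\<^sub>R tensor p p"
    unfolding matrix_mult_tensor tensor_mult_vector pp
    by (simp add: vec_eq_iff tensor_def mult_ac)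
  have tensor_comb: "(mat 1 + a *\<^sub>R tensor p p) ** (mat 1 + b *\<^sub>R tensor p p)
      = mat 1 + (a + b + a * b * ((w - 1) * (w + 1))) *\<^sub>R tensor p p" for a b
    by (simp add: matrix_mult_simps TT algebra_simps)
  have Mf: "M = mat 1 + (- (1 / (w * (w + 1)))) *\<^sub>R tensor p p" by (simp add: M_def)
  have "?S ** ?S = mat 1 + tensor p p"
  proof -
    define a where "a = 1 / (w + 1)"
    have a: "a * (w + 1) = 1" using w1 by (simp add: a_def)
    have "a + a + a * a * ((w - 1) * (w + 1)) = 2 * a + a * (w - 1) * (a * (w + 1))"
      by (simp add: algebra_simps)
    also have "\<dots> = 1" using a by (simp add: algebra_simps)
    finally have "1 / (w + 1) + 1 / (w + 1) + 1 / (w + 1) * (1 / (w + 1)) * ((w - 1) * (w + 1)) = 1"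
      using a by (simp add: a_def)
    then show ?thesis by (simp add: tensor_comb)
  qed
  moreover have "pos_def ?S"
  proof -
    have "x \<bullet> (?S *v x) > 0" if "x \<noteq> 0" for x
    proof -
      have "x \<bullet> (?S *v x) = x \<bullet> x + (p \<bullet> x)\<^sup>2 / (w + 1)"
        by (simp add: matrix_vector_simps tensor_mult_vector inner_add_right inner_commute[of x p] power2_eq_square)
      moreover have "x \<bullet> x > 0" using that by simp
      moreover have "(p \<bullet> x)\<^sup>2 / (w + 1) \<ge> 0" using w1 by simp
      ultimately show ?thesis by linarith
    qed
    then show ?thesis by (simp add: pos_def_def transpose_add transpose_scaleR transpose_tensor transpose_mat)
  qed
  ultimately have S: "sqrt_matrix (mat 1 + tensor p p) = ?S" by (rule sqrt_matrix_eq[rotated])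
  define a b where "a = 1 / (w + 1)" and "b = 1 / (w * (w + 1))"
  have a: "a * (w + 1) = 1" and b: "b * w = a" using w1 by (simp_all add: a_def b_def)
  have "a + - b + a * - b * ((w - 1) * (w + 1)) = a - b - b * (w - 1) * (a * (w + 1))"
    by (simp add: algebra_simps)
  then have ab: "a + - b + a * - b * ((w - 1) * (w + 1)) = 0" "- b + a + - b * a * ((w - 1) * (w + 1)) = 0"
    using b unfolding a by (simp_all add: algebra_simps)
  have SM: "?S ** M = mat 1" "M ** ?S = mat 1"
    unfolding Mf a_def[symmetric] b_def[symmetric] tensor_comb ab by simp_all
  show "matrix_inv (sqrt_matrix (mat 1 + tensor p p)) = M"
    unfolding S by (rule matrix_inv_eq[OF SM])
  show "transpose M = M" by (simp add: M_def transpose_diff transpose_scaleR transpose_tensor transpose_mat)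
  have "- (1 / (w * (w + 1))) + - (1 / (w * (w + 1))) + - (1 / (w * (w + 1))) * - (1 / (w * (w + 1))) * ((w - 1) * (w + 1)) = - (1 / w\<^sup>2)"
  proof -
    have "- (2 / (w * (w + 1))) + (w - 1) / (w\<^sup>2 * (w + 1)) = - (1 / w\<^sup>2)"
      using w1 by (simp add: divide_simps) (simp add: power2_eq_square algebra_simps)
    moreover have "(1 / (w * (w + 1))) * (1 / (w * (w + 1))) * ((w - 1) * (w + 1)) = (w - 1) / (w\<^sup>2 * (w + 1))"
      using w1 by (simp add: divide_simps power2_eq_square)
    ultimately show ?thesis by simp
  qed
  then show "M ** M = mat 1 - (1 / w\<^sup>2) *\<^sub>R tensor p p"
    unfolding Mf tensor_comb by simp
  have Mz: "M *v z = z - ((p \<bullet> z) / (w * (w + 1))) *\<^sub>R p" for z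
    by (simp add: M_def matrix_vector_simps tensor_mult_vector)
  show "norm (M *v z) \<le> norm z"
  proof -
    have "(norm (M *v z))\<^sup>2 = (norm z)\<^sup>2 - (p \<bullet> z)\<^sup>2 / w\<^sup>2"
    proof -
      have "(norm (M *v z))\<^sup>2 = z \<bullet> ((M ** M) *v z)"
        using inner_transpose_matrix[of z M "M *v z"] \<open>transpose M = M\<close>
        by (simp only: power2_norm_eq_inner matrix_vector_mul_assoc[symmetric])
      then show ?thesis unfolding \<open>M ** M = _\<close>
        by (simp add: matrix_vector_simps tensor_mult_vector inner_diff_right inner_commute[of z p]
            dot_square_norm power2_eq_square)
    qed
    then have "(norm (M *v z))\<^sup>2 \<le> (norm z)\<^sup>2" by simp
    then show ?thesis by (rule power2_le_imp_le) simp
  qed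
  show "M *v z \<noteq> 0" if "z \<noteq> 0"
  proof
    assume "M *v z = 0"
    then have "?S *v (M *v z) = 0" by simp
    then show False using that by (simp only: matrix_vector_mul_assoc SM(1) matrix_vector_mul_lid)
  qed
  show "M *v e = (1 / w) *\<^sub>R e" if p: "p = r *\<^sub>R e" and e: "norm e = 1"
  proof -
    have "p \<bullet> e = r" using p e by (simp add: norm_eq_1)
    moreover have "r * r = (w - 1) * (w + 1)" using pp p e by (simp add: norm_eq_1)
    ultimately have "(p \<bullet> e) / (w * (w + 1)) * r = ((w - 1) * (w + 1)) / (w * (w + 1))" by simp
    also have "\<dots> = (w - 1) / w" using w1 by (intro nonzero_mult_divide_mult_cancel_right) simp
    finally have "(p \<bullet> e) / (w * (w + 1)) * r = (w - 1) / w" .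
    moreover have "((p \<bullet> e) / (w * (w + 1))) *\<^sub>R p = ((p \<bullet> e) / (w * (w + 1)) * r) *\<^sub>R e"
      by (subst (2) p) simp
    ultimately have "M *v e = (1 - (w - 1) / w) *\<^sub>R e"
      unfolding Mz by (simp add: scaleR_diff_left)
    then show ?thesis using w1 by (simp add: field_simps)
  qed
qed

text \<open>What is used of the curvature equation: its polynomial form, a positive trace orthogonal
  to the gradient, strict monotonicity in rank one directions, and the fact that a Hessian bounded
  above by a small multiple of the identity forces a large gradient. The last comes from
  \<open>2 * s2 K \<le> (trace K)\<^sup>2\<close>.\<close>

lemma curvature_facts:
  fixes A :: "real^'n^'n" and p :: "real^'n"
  defines "w \<equiv> sqrt (1 + (norm p)\<^sup>2)"
  defines "M \<equiv> matrix_inv (sqrt_matrix (mat 1 + tensor p p))"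
  defines "K \<equiv> (1 / w) *\<^sub>R (M ** A ** M)"
  assumes A: "transpose A = A" and adm: "eigenvalue_vector K \<in> Gamma2"
    and eq: "sigma2 (eigenvalue_vector K) = (1 + (norm p)\<^sup>2) powi (-2)"
  shows "Fop A p = 1"
    and "\<And>r e. p = r *\<^sub>R e \<Longrightarrow> norm e = 1 \<Longrightarrow> S1 e A > 0"
    and "\<And>g. g \<noteq> 0 \<Longrightarrow> \<exists>d>0. \<forall>\<tau>. Fop (A + \<tau> *\<^sub>R tensor g g) p = Fop A p + \<tau> * d"
    and "\<And>\<epsilon>. 0 \<le> \<epsilon> \<Longrightarrow> (\<And>z. z \<bullet> (A *v z) \<le> \<epsilon> * (norm z)\<^sup>2) \<Longrightarrow>
       1 / (1 + (norm p)\<^sup>2)\<^sup>2 \<le> (real CARD('n) * \<epsilon>)\<^sup>2"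
proof -
  note gm = graph_metric_matrices[where p = p, folded w_def]
  have M: "M = mat 1 - (1 / (w * (w + 1))) *\<^sub>R tensor p p" unfolding M_def by (rule gm(1))
  note gm = gm(2-)[folded M]
  have w: "w > 0" "w \<noteq> 0" using gm(3) by auto
  have Kq: "x \<bullet> (K *v y) = (1 / w) * ((M *v x) \<bullet> (A *v (M *v y)))" for x y
    using inner_transpose_matrix[of x M "A *v (M *v y)"] gm(1)
    by (simp add: K_def matrix_vector_simps matrix_vector_mul_assoc[symmetric])
  have K: "transpose K = K"
    unfolding sym_matrix_iff Kq using sym_matrix_inner[OF A] by simp
  have trK: "trace (c *\<^sub>R (M ** Z ** M)) = c * (trace Z - (p \<bullet> (Z *v p)) / w\<^sup>2)" for Z c
  proof -
    have "trace (M ** Z ** M) = trace (Z ** (M ** M))"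
      by (metis matrix_mul_assoc trace_mul_sym)
    then show ?thesis
      by (simp add: trace_scaleR gm(2) matrix_mult_simps trace_sub matrix_mult_tensor trace_tensor inner_commute)
  qed
  have s2K: "s2 K = Fop A p / w^4" if A: "transpose A = A" and K: "K = (1 / w) *\<^sub>R (M ** A ** M)" for A K
  proof -
    have "K ** K = (1 / w\<^sup>2) *\<^sub>R (M ** (A ** (M ** M) ** A) ** M)"
      by (simp add: K matrix_mult_simps matrix_mul_assoc power2_eq_square)
    then have "trace (K ** K) = (1 / w\<^sup>2) * (trace (A ** (M ** M) ** A) - (p \<bullet> ((A ** (M ** M) ** A) *v p)) / w\<^sup>2)"
      by (simp only: trK)
    moreover have "trace (A ** (M ** M) ** A) = trace (A ** A) - (norm (A *v p))\<^sup>2 / w\<^sup>2"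
      unfolding gm(2) using A
      by (simp add: matrix_mult_simps trace_sub trace_scaleR matrix_mult_tensor tensor_mult_matrix
          trace_tensor power2_norm_eq_inner A del: transpose_matrix_vector)
    moreover have "p \<bullet> ((A ** (M ** M) ** A) *v p) = (norm (A *v p))\<^sup>2 - (p \<bullet> (A *v p))\<^sup>2 / w\<^sup>2"
    proof -
      have "p \<bullet> ((A ** (M ** M) ** A) *v p) = (A *v p) \<bullet> ((M ** M) *v (A *v p))"
        using sym_matrix_inner[OF A, of p "(M ** M) *v (A *v p)"]
        by (simp only: matrix_vector_mul_assoc[symmetric] inner_commute)
      then show ?thesis unfolding gm(2)
        by (simp add: matrix_vector_simps tensor_mult_vector inner_diff_right dot_square_norm
            power2_eq_square inner_commute[of "A *v p" p])
    qed
    ultimately have tKK: "trace (K ** K) = (1 / w\<^sup>2) * (trace (A ** A) - 2 * (norm (A *v p))\<^sup>2 / w\<^sup>2 + (p \<bullet> (A *v p))\<^sup>2 / w^4)"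
      by (simp add: add_divide_distrib diff_divide_distrib power2_eq_square power4_eq_xxxx mult.assoc)
    have tK: "trace K = (1 / w) * (trace A - (p \<bullet> (A *v p)) / w\<^sup>2)" unfolding K by (rule trK)
    have W: "1 + (norm p)\<^sup>2 = w\<^sup>2" using gm(4) by simp
    show ?thesis
      unfolding s2_def[of K] tK tKK Fop_def W s2_def[of A] using w
      by (simp add: field_simps power2_eq_square power4_eq_xxxx)
  qed
  have sK: "s2 K = Fop A p / w^4" by (rule s2K[OF A]) (simp add: K_def)
  have pos: "trace K > 0" "s2 K > 0"
    using adm sigma_eigenvalue_vector[OF K] by (auto simp: Gamma2_def)
  have s2v: "s2 K = 1 / (1 + (norm p)\<^sup>2)\<^sup>2"
    using eq sigma_eigenvalue_vector[OF K] by (simp add: power_int_minus field_simps)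
  have w4: "(1 + (norm p)\<^sup>2)\<^sup>2 = w^4" unfolding gm(4)[symmetric] by simp
  show "Fop A p = 1" using sK s2v w4 w by simp
  note less = Gamma2_form_less_trace[OF K pos]
  show "S1 e A > 0" if p: "p = r *\<^sub>R e" and e: "norm e = 1" for r e
  proof -
    \<comment> \<open>As \<open>e\<close> is an eigenvector of \<open>M\<close>, the two occurrences
      of \<open>e \<bullet> (A *v e)\<close> carry, up to the common factor \<open>1 / w\<close>,
      the weights \<open>1 / w\<^sup>2\<close> and \<open>(norm p)\<^sup>2 / w\<^sup>2\<close>,
      which add up to 1.\<close>
    have "e \<bullet> (K *v e) < trace K" using less[of e] e by force
    moreover have "e \<bullet> (K *v e) = (1 / w) * ((1 / w\<^sup>2) * (e \<bullet> (A *v e)))"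
      unfolding Kq gm(7)[OF p e] by (simp add: matrix_vector_simps power2_eq_square)
    moreover have "trace K = (1 / w) * (trace A - (norm p)\<^sup>2 * (e \<bullet> (A *v e)) / w\<^sup>2)"
      using e by (simp add: K_def trK p matrix_vector_simps power2_eq_square)
    ultimately have "(1 / w) * ((1 / w\<^sup>2) * (e \<bullet> (A *v e))) < (1 / w) * (trace A - (norm p)\<^sup>2 * (e \<bullet> (A *v e)) / w\<^sup>2)"
      by simp
    then have "(1 / w\<^sup>2) * (e \<bullet> (A *v e)) < trace A - (norm p)\<^sup>2 * (e \<bullet> (A *v e)) / w\<^sup>2"
      by (rule mult_left_less_imp_less) (use w in simp)
    then have "(1 + (norm p)\<^sup>2) / w\<^sup>2 * (e \<bullet> (A *v e)) < trace A"
      by (simp add: add_divide_distrib distrib_right)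
    then show ?thesis unfolding gm(4)[symmetric] S1_def using w by simp
  qed
  show "\<exists>d>0. \<forall>\<tau>. Fop (A + \<tau> *\<^sub>R tensor g g) p = Fop A p + \<tau> * d" if g: "g \<noteq> 0" for g
  proof -
    let ?h = "M *v g"
    let ?d = "w^3 * (trace K * (norm ?h)\<^sup>2 - ?h \<bullet> (K *v ?h))"
    have "Fop (A + \<tau> *\<^sub>R tensor g g) p = Fop A p + \<tau> * ?d" for \<tau>
    proof -
      have "(1 / w) *\<^sub>R (M ** (A + \<tau> *\<^sub>R tensor g g) ** M) = K + (\<tau> / w) *\<^sub>R tensor ?h ?h"
        using gm(1) by (simp add: K_def matrix_mult_simps scaleR_add_right matrix_mult_tensor
            tensor_mult_matrix del: transpose_matrix_vector)
      moreover have "transpose (A + \<tau> *\<^sub>R tensor g g) = A + \<tau> *\<^sub>R tensor g g"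
        by (simp add: transpose_add transpose_scaleR transpose_tensor A)
      ultimately have "s2 (K + (\<tau> / w) *\<^sub>R tensor ?h ?h) = Fop (A + \<tau> *\<^sub>R tensor g g) p / w^4"
        using s2K by metis
      then show ?thesis unfolding s2_add_tensor[OF K] sK using w
        by (simp add: field_simps power4_eq_xxxx power3_eq_cube)
    qed
    moreover have "?d > 0" using less[OF gm(6)[OF g]] w by simp
    ultimately show ?thesis by blast
  qed
  show "1 / (1 + (norm p)\<^sup>2)\<^sup>2 \<le> (real CARD('n) * \<epsilon>)\<^sup>2"
    if \<epsilon>: "0 \<le> \<epsilon>" "\<And>z. z \<bullet> (A *v z) \<le> \<epsilon> * (norm z)\<^sup>2" for \<epsilon>
  proof -
    have "trace K = (\<Sum>i\<in>UNIV. axis i 1 \<bullet> (K *v axis i 1))" by (rule trace_axis)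
    also have "\<dots> \<le> (\<Sum>i\<in>(UNIV::'n set). \<epsilon>)"
    proof (rule sum_mono)
      fix i :: 'n
      let ?z = "M *v axis i 1"
      have "axis i 1 \<bullet> (K *v axis i 1) \<le> (1 / w) * (\<epsilon> * (norm ?z)\<^sup>2)"
        unfolding Kq using w by (intro mult_left_mono \<epsilon>) auto
      also have "\<dots> \<le> 1 * (\<epsilon> * 1)"
        using gm(3) \<epsilon>(1) gm(5)[of "axis i 1"]
        by (intro mult_mono) (auto simp: abs_square_le_1)
      finally show "axis i 1 \<bullet> (K *v axis i 1) \<le> \<epsilon>" by simp
    qed
    finally have "trace K \<le> real CARD('n) * \<epsilon>" by simp
    then have "(trace K)\<^sup>2 \<le> (real CARD('n) * \<epsilon>)\<^sup>2" using pos(1) by (intro power_mono) auto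
    moreover have "2 * s2 K \<le> (trace K)\<^sup>2" using trace_square_sym[OF K] by (simp add: s2_def)
    ultimately show ?thesis using s2v pos(2) by linarith
  qed
qed

section \<open>Gradient and Hessian\<close>

lemma gradient_inner:
  assumes "f differentiable (at x)"
  shows "gradient f x \<bullet> h = dirD f h x"
proof -
  have l: "linear (\<lambda>h. dirD f h x)"
    using assms by (simp add: dirD_def linear_frechet_derivative)
  have "dirD f h x = dirD f (\<Sum>i\<in>UNIV. (h $ i) *\<^sub>R axis i 1) x" by (simp only: sum_axis)
  also have "\<dots> = (\<Sum>i\<in>UNIV. (h $ i) *\<^sub>R dirD f (axis i 1) x)"
    by (simp add: linear_sum[OF l] linear_cmul[OF l])
  finally show ?thesis by (simp add: inner_vec_def gradient_def dirD_def mult.commute)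
qed

lemma gradient_has_derivative:
  assumes S: "open S" "x \<in> S" and C: "Ck_on 2 S f"
  shows "(gradient f has_derivative (\<lambda>h. hessian f x *v h)) (at x)"
    and "a \<bullet> (hessian f x *v b) = dirD (dirD f a) b x"
    and "transpose (hessian f x) = hessian f x"
proof -
  have d1: "f differentiable (at y)" and d2: "dirD f h differentiable (at y)" if "y \<in> S" for y h
    using C that by (auto simp: numeral_2_eq_2 Ck_on_Suc)
  have "((\<lambda>y. gradient f y $ i) has_derivative (\<lambda>h. dirD (dirD f (axis i 1)) h x)) (at x)" for i
    using has_derivative_dirD[OF d2[OF S(2), of "axis i 1"]] by (simp add: gradient_def dirD_def)
  then have g: "(gradient f has_derivative (\<lambda>h. \<chi> i. dirD (dirD f (axis i 1)) h x)) (at x)"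
    by (subst has_derivative_componentwise_within) (auto simp: Basis_vec_def inner_axis)
  then have l: "linear (\<lambda>h. \<chi> i. dirD (dirD f (axis i 1)) h x)" by (rule has_derivative_linear)
  have hv: "hessian f x *v h = (\<chi> i. dirD (dirD f (axis i 1)) h x)" for h
    unfolding hessian_def frechet_derivative_at[OF g, symmetric] using l by simp
  show "(gradient f has_derivative (\<lambda>h. hessian f x *v h)) (at x)" using g by (simp add: hv)
  show inn: "a \<bullet> (hessian f x *v b) = dirD (dirD f a) b x" for a b
  proof -
    have l: "linear (\<lambda>a. dirD (dirD f b) a x)"
      using d2[OF S(2)] by (simp add: dirD_def linear_frechet_derivative)
    have "dirD (dirD f a) b x = dirD (dirD f b) (\<Sum>i\<in>UNIV. (a $ i) *\<^sub>R axis i 1) x"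
      by (simp only: sum_axis dirD_commute[OF S C, of a b])
    also have "\<dots> = (\<Sum>i\<in>UNIV. (a $ i) *\<^sub>R dirD (dirD f b) (axis i 1) x)"
      by (simp add: linear_sum[OF l] linear_cmul[OF l])
    finally show ?thesis by (simp add: hv inner_vec_def dirD_commute[OF S C, of b])
  qed
  show "transpose (hessian f x) = hessian f x"
    unfolding sym_matrix_iff inn using dirD_commute[OF S C] by blast
qed

lemma hessian_entry:
  assumes "open S" "x \<in> S" "Ck_on 2 S f"
  shows "hessian f x $ i $ j = dirD (dirD f (axis i 1)) (axis j 1) x"
  using gradient_has_derivative(2)[OF assms, of "axis i 1" "axis j 1"] by (simp add: inner_axis_matrix)

lemma continuous_on_gradient: "Ck_on 1 S f \<Longrightarrow> continuous_on S (gradient f)"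
  unfolding gradient_def dirD_def[symmetric]
  by (intro continuous_on_vec_lambda) (auto simp: Ck_on_Suc dirD_def)

lemma continuous_on_hessian:
  assumes "open S" "Ck_on 2 S f"
  shows "continuous_on S (hessian f)"
proof -
  have "continuous_on S (\<lambda>x. \<chi> i j. dirD (dirD f (axis i 1)) (axis j 1) x)"
    using assms(2) by (intro continuous_on_vec_lambda) (auto simp: numeral_2_eq_2 Ck_on_Suc)
  then show ?thesis
    by (rule continuous_on_eq) (simp add: vec_eq_iff hessian_entry[OF assms(1) _ assms(2)])
qed

lemma DERIV_line_gradient:
  assumes "open S" "x + s *\<^sub>R h \<in> S" "Ck_on 2 S f"
  shows "((\<lambda>s. f (x + s *\<^sub>R h)) has_real_derivative gradient f (x + s *\<^sub>R h) \<bullet> h) (at s)"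
    and "((\<lambda>s. gradient f (x + s *\<^sub>R h) \<bullet> h) has_real_derivative h \<bullet> (hessian f (x + s *\<^sub>R h) *v h)) (at s)"
proof -
  have d1: "f differentiable (at y)" and d2: "dirD f h differentiable (at y)" if "y \<in> S" for y h
    using assms(3) that by (auto simp: numeral_2_eq_2 Ck_on_Suc)
  show "((\<lambda>s. f (x + s *\<^sub>R h)) has_real_derivative gradient f (x + s *\<^sub>R h) \<bullet> h) (at s)"
    unfolding gradient_inner[OF d1[OF assms(2)]] by (rule DERIV_line[OF d1[OF assms(2)]])
  have "((\<lambda>s. gradient f (x + s *\<^sub>R h)) has_derivative (\<lambda>r. hessian f (x + s *\<^sub>R h) *v (r *\<^sub>R h))) (at s)"
    by (rule has_derivative_compose[where g = "gradient f" and f = "\<lambda>s. x + s *\<^sub>R h" and x = s and s = UNIV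
          and f' = "\<lambda>r. r *\<^sub>R h" and g' = "\<lambda>h'. hessian f (x + s *\<^sub>R h) *v h'"])
       (auto intro!: derivative_eq_intros gradient_has_derivative(1)[OF assms])
  then have "((\<lambda>s. gradient f (x + s *\<^sub>R h) \<bullet> h) has_derivative (\<lambda>r. (hessian f (x + s *\<^sub>R h) *v (r *\<^sub>R h)) \<bullet> h)) (at s)"
    by (rule has_derivative_inner_left)
  then show "((\<lambda>s. gradient f (x + s *\<^sub>R h) \<bullet> h) has_real_derivative h \<bullet> (hessian f (x + s *\<^sub>R h) *v h)) (at s)"
    by (simp add: has_field_derivative_def matrix_vector_simps inner_commute mult_commute_abs)
qed

lemma open_line_segment:
  fixes x h :: "'a::real_normed_vector"
  assumes "open S" "x \<in> S"
  obtains d where "d > 0" "\<And>s. \<bar>s\<bar> < d \<Longrightarrow> x + s *\<^sub>R h \<in> S"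
proof -
  obtain e where e: "e > 0" "ball x e \<subseteq> S" using assms openE by blast
  have pos: "norm h + 1 > 0" using norm_ge_zero[of h] by linarith
  have "x + s *\<^sub>R h \<in> S" if "\<bar>s\<bar> < e / (norm h + 1)" for s
  proof -
    have "\<bar>s\<bar> * norm h \<le> \<bar>s\<bar> * (norm h + 1)" by (intro mult_left_mono) auto
    also have "\<dots> < e" using that pos by (simp add: field_simps)
    finally show ?thesis using e(2) by (auto simp: dist_norm mem_ball subset_iff)
  qed
  then show ?thesis using that[of "e / (norm h + 1)"] e(1) pos by simp
qed

lemma second_order_upper_bound:
  assumes U: "open U" "p \<in> U" and C: "Ck_on 2 U f"
  obtains K r where "K \<ge> 0" "r > 0" "cball p r \<subseteq> U"
    "\<And>x. x \<in> cball p r \<Longrightarrow> f x \<le> f p + gradient f p \<bullet> (x - p) + K * (norm (x - p))\<^sup>2"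
proof -
  obtain r where r: "r > 0" "cball p r \<subseteq> U" using U open_contains_cball by blast
  have "continuous_on (cball p r) (hessian f)"
    using continuous_on_hessian[OF U(1) C] r(2) continuous_on_subset by blast
  then have "bounded (hessian f ` cball p r)"
    using compact_continuous_image[OF _ compact_cball] compact_imp_bounded by blast
  then obtain K where K: "\<And>x. x \<in> cball p r \<Longrightarrow> norm (hessian f x) \<le> K"
    unfolding bounded_iff by blast
  have "norm (hessian f p) \<le> K" using K[of p] r(1) by simp
  then have K0: "K \<ge> 0" using norm_ge_zero order_trans by blast
  have "f x \<le> f p + gradient f p \<bullet> (x - p) + K * (norm (x - p))\<^sup>2" if x: "x \<in> cball p r" for x
  proof -
    let ?h = "x - p"
    have inb: "p + s *\<^sub>R ?h \<in> cball p r" if "0 \<le> s" "s \<le> 1" for s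
    proof -
      have "s * norm ?h \<le> 1 * norm ?h" using that by (intro mult_right_mono) auto
      then show ?thesis using x that by (simp add: dist_norm norm_minus_commute)
    qed
    have inU: "p + s *\<^sub>R ?h \<in> U" if "0 \<le> s" "s \<le> 1" for s using inb[OF that] r(2) by blast
    obtain \<xi> where \<xi>: "0 < \<xi>" "\<xi> < 1" "f (p + 1 *\<^sub>R ?h) - f (p + 0 *\<^sub>R ?h) = (1 - 0) * (gradient f (p + \<xi> *\<^sub>R ?h) \<bullet> ?h)"
      using MVT2[of 0 1 "\<lambda>s. f (p + s *\<^sub>R ?h)" "\<lambda>s. gradient f (p + s *\<^sub>R ?h) \<bullet> ?h"]
        DERIV_line_gradient(1)[OF U(1) inU C] by auto
    obtain \<eta> where \<eta>: "0 < \<eta>" "\<eta> < \<xi>" "gradient f (p + \<xi> *\<^sub>R ?h) \<bullet> ?h - gradient f (p + 0 *\<^sub>R ?h) \<bullet> ?h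
        = (\<xi> - 0) * (?h \<bullet> (hessian f (p + \<eta> *\<^sub>R ?h) *v ?h))"
      using MVT2[of 0 \<xi> "\<lambda>s. gradient f (p + s *\<^sub>R ?h) \<bullet> ?h" "\<lambda>s. ?h \<bullet> (hessian f (p + s *\<^sub>R ?h) *v ?h)"]
        DERIV_line_gradient(2)[OF U(1) inU C] \<xi> by auto
    let ?q = "?h \<bullet> (hessian f (p + \<eta> *\<^sub>R ?h) *v ?h)"
    have "\<bar>?q\<bar> \<le> norm ?h * (norm (hessian f (p + \<eta> *\<^sub>R ?h)) * norm ?h)"
      by (rule order_trans[OF Cauchy_Schwarz_ineq2]) (intro mult_left_mono norm_matrix_vector_le, simp)
    also have "\<dots> \<le> norm ?h * (K * norm ?h)"
      using \<eta> \<xi> by (intro mult_left_mono mult_right_mono K inb) auto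
    finally have q: "\<bar>?q\<bar> \<le> K * (norm ?h)\<^sup>2" by (simp add: power2_eq_square mult_ac)
    have "\<xi> * ?q \<le> \<xi> * \<bar>?q\<bar>" using \<xi> by (intro mult_left_mono) auto
    also have "\<dots> \<le> 1 * \<bar>?q\<bar>" using \<xi> by (intro mult_right_mono) auto
    finally have "\<xi> * ?q \<le> K * (norm ?h)\<^sup>2" using q by linarith
    then show ?thesis using \<xi>(3) \<eta>(3) by simp
  qed
  then show ?thesis using that K0 r by blast
qed

section \<open>Geometry of the domain\<close>

text \<open>A unit tangent vector \<open>e\<close> minimising the Hessian of \<rho> is an
  eigenvector up to a multiple of the gradient, so the unit normal changes along \<open>e\<close> by
  \<open>?\<mu> / ?n\<close> times \<open>e\<close>. This number is therefore a principal curvature,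
  hence positive.\<close>

lemma tangential_second_derivative_pos:
  fixes \<Omega> :: "(real^'n) set"
  assumes ldf: "local_defining_function \<Omega> p U \<rho>" and p: "p \<in> frontier \<Omega>"
    and uc: "uniformly_convex \<Omega>" and X: "X \<noteq> 0" "X \<bullet> gradient \<rho> p = 0"
  shows "X \<bullet> (hessian \<rho> p *v X) > 0"
proof -
  let ?g = "gradient \<rho> p" and ?H = "hessian \<rho> p"
  have U: "open U" "p \<in> U" "Ck_on 2 U \<rho>" "?g \<noteq> 0"
    using ldf by (auto simp: local_defining_function_def smooth_on_def)
  note gd = gradient_has_derivative[OF U(1-3)]
  let ?N = "{X. X \<bullet> ?g = 0}"
  have N: "subspace ?N" by (simp add: subspace_def inner_add_left)
  have "?N \<noteq> {0}" using X by blast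
  moreover have "transpose (- ?H) = - ?H" using gd(3) by (simp add: vec_eq_iff transpose_def)
  ultimately obtain e where e: "e \<bullet> ?g = 0" "norm e = 1"
    "\<forall>x\<in>?N. x \<bullet> (- ?H *v x) \<le> (e \<bullet> (- ?H *v e)) * (norm x)\<^sup>2"
    "\<forall>x\<in>?N. x \<bullet> e = 0 \<longrightarrow> x \<bullet> (- ?H *v e) = 0"
    using exists_maximal_direction[OF N, of "- ?H"] by blast
  have neg: "- ?H *v x = - (?H *v x)" for x
    by (simp add: vec_eq_iff matrix_vector_mult_def sum_negf)
  let ?\<mu> = "e \<bullet> (?H *v e)"
  \<comment> \<open>The difference of the two sides is tangential and orthogonal to
    \<open>e\<close>. Extremality makes it orthogonal to \<open>?H *v e\<close>, hence to
    itself.\<close>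
  have He: "?H *v e = ?\<mu> *\<^sub>R e + ((?g \<bullet> (?H *v e)) / (?g \<bullet> ?g)) *\<^sub>R ?g" (is "_ = _ + ?c *\<^sub>R ?g")
  proof -
    let ?y = "?H *v e - ?\<mu> *\<^sub>R e - ?c *\<^sub>R ?g"
    have ee: "e \<bullet> e = 1" using e(2) by (simp add: norm_eq_1)
    have gg: "?g \<bullet> ?g \<noteq> 0" using U(4) by simp
    have y1: "?y \<bullet> ?g = 0"
      using e(1) gg by (simp add: inner_diff_left inner_commute[of "?H *v e"])
    have y2: "?y \<bullet> e = 0"
      using e(1) ee by (simp add: inner_diff_left inner_commute[of "?H *v e"] inner_commute[of ?g e])
    have "?y \<bullet> (?H *v e) = 0" using e(4) y1 y2 neg by (simp add: inner_minus_right)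
    then have "?y \<bullet> ?y = 0" using y1 y2
      by (simp only: inner_diff_right[of ?y] inner_scaleR_right)
    then have "?y = 0" by (simp only: inner_eq_zero_iff)
    then show ?thesis by (simp only: diff_diff_eq right_minus_eq)
  qed
  let ?n = "norm ?g"
  have n: "?n > 0" using U(4) by simp
  have dn: "((\<lambda>x. gradient \<rho> x /\<^sub>R norm (gradient \<rho> x)) has_derivative
      (\<lambda>h. inverse ?n *\<^sub>R (?H *v h) + (- (inverse ?n * ((?H *v h) \<bullet> sgn ?g) * inverse ?n)) *\<^sub>R ?g)) (at p)"
  proof -
    have "(norm has_derivative (\<lambda>h. h \<bullet> sgn ?g)) (at ?g)"
      by (rule has_derivative_norm[OF U(4)])
    from has_derivative_compose[OF gd(1) this]
    have "((\<lambda>x. norm (gradient \<rho> x)) has_derivative (\<lambda>h. (?H *v h) \<bullet> sgn ?g)) (at p)" .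
    from Deriv.has_derivative_inverse[OF _ this]
    have "((\<lambda>x. inverse (norm (gradient \<rho> x))) has_derivative
        (\<lambda>h. - (inverse ?n * ((?H *v h) \<bullet> sgn ?g) * inverse ?n))) (at p)"
      using n by simp
    from has_derivative_scaleR[OF this gd(1)] show ?thesis by simp
  qed
  have eig: "inverse ?n *\<^sub>R (?H *v e) + (- (inverse ?n * ((?H *v e) \<bullet> sgn ?g) * inverse ?n)) *\<^sub>R ?g = (?\<mu> / ?n) *\<^sub>R e"
  proof -
    have "(?H *v e) \<bullet> sgn ?g = (?g \<bullet> (?H *v e)) / ?n"
      by (simp add: sgn_div_norm inner_commute divide_inverse)
    then have "inverse ?n * ((?H *v e) \<bullet> sgn ?g) * inverse ?n = inverse ?n * ?c"
      using n by (simp add: dot_square_norm power2_eq_square divide_inverse)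
    then have "inverse ?n *\<^sub>R (?H *v e) + (- (inverse ?n * ((?H *v e) \<bullet> sgn ?g) * inverse ?n)) *\<^sub>R ?g
       = inverse ?n *\<^sub>R (?H *v e - ?c *\<^sub>R ?g)"
      by (simp add: scaleR_diff_right)
    also have "?H *v e - ?c *\<^sub>R ?g = ?\<mu> *\<^sub>R e" using He by (metis add_diff_cancel_right')
    finally show ?thesis by (simp add: divide_inverse mult.commute)
  qed
  have "e \<noteq> 0" using e(2) by auto
  then have "?\<mu> / ?n \<in> boundary_principal_curvatures \<Omega> p"
    unfolding boundary_principal_curvatures_def mem_Collect_eq
    using ldf e(1) fun_cong[OF frechet_derivative_at[OF dn], of e, unfolded eig, symmetric]
    by (intro exI[of _ U] exI[of _ \<rho>] exI[of _ e] conjI)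
  then obtain c where "c > 0" "c \<le> ?\<mu> / ?n" using uc p unfolding uniformly_convex_def by blast
  then have \<mu>: "?\<mu> > 0" using n by (metis less_le_trans zero_less_divide_iff less_asym)
  have "?\<mu> * (norm X)\<^sup>2 \<le> X \<bullet> (?H *v X)" using e(3) X(2) neg by (simp add: inner_minus_right)
  moreover have "?\<mu> * (norm X)\<^sup>2 > 0" using \<mu> X(1) by simp
  ultimately show ?thesis by linarith
qed

lemma local_defining_function_le_0:
  assumes ldf: "local_defining_function \<Omega> p U \<rho>" and x: "x \<in> closure \<Omega>" "x \<in> U"
  shows "\<rho> x \<le> 0"
proof (rule ccontr)
  have U: "open U" "Ck_on 0 U \<rho>" "\<Omega> \<inter> U = {x\<in>U. \<rho> x < 0}"
    using ldf unfolding local_defining_function_def smooth_on_def by blast+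
  assume "\<not> \<rho> x \<le> 0"
  moreover have "open (U \<inter> \<rho> -` {0<..})"
    using U(1,2) by (intro continuous_open_preimage) auto
  ultimately have "\<Omega> \<inter> (U \<inter> \<rho> -` {0<..}) \<noteq> {}"
    using x by (metis (no_types, lifting) IntI closure_iff_nhds_not_empty greaterThan_iff not_le order_refl vimageI2 disjoint_iff)
  then show False using U(3) by force
qed

text \<open>For fixed \<open>x\<close>, the points whose segment to \<open>x\<close> lies in
  \<Omega> form an open and relatively closed subset of \<Omega>. If a segment stayed in the closure
  but touched the boundary, a defining function would have a maximum along it at the touching point;
  the direction would be tangential, against the positive second derivative there.\<close>

theorem convex_domain:
  fixes \<Omega> :: "(real^'n) set"
  assumes \<Omega>: "open \<Omega>" "connected \<Omega>" and sm: "smooth_boundary \<Omega>" and uc: "uniformly_convex \<Omega>"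
  shows "convex \<Omega>"
proof -
  have "closed_segment x y \<subseteq> \<Omega>" if x: "x \<in> \<Omega>" and y: "y \<in> \<Omega>" for x y
  proof -
    let ?S = "{y. closed_segment x y \<subseteq> \<Omega>}"
    let ?T = "{y. \<exists>t\<in>{0..1}. x + t *\<^sub>R (y - x) \<notin> closure \<Omega>}"
    have oS: "open ?S"
      unfolding open_contains_ball
    proof
      fix y assume "y \<in> ?S"
      then obtain e where e: "e > 0" "(\<Union>z\<in>closed_segment x y. ball z e) \<subseteq> \<Omega>"
        using compact_subset_open_imp_ball_epsilon_subset[OF compact_segment \<Omega>(1)] by blast
      have "z \<in> ?S" if z: "z \<in> ball y e" for z
      proof -
        have "w \<in> \<Omega>" if w: "w \<in> closed_segment x z" for w
        proof -
          obtain t where t: "0 \<le> t" "t \<le> 1" "w = (1 - t) *\<^sub>R x + t *\<^sub>R z"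
            using w by (auto simp: in_segment)
          have "(1 - t) *\<^sub>R x + t *\<^sub>R y \<in> closed_segment x y" using t by (auto simp: in_segment)
          moreover have "w \<in> ball ((1 - t) *\<^sub>R x + t *\<^sub>R y) e"
          proof -
            have "dist ((1 - t) *\<^sub>R x + t *\<^sub>R y) w = t * dist y z"
              using t(1) by (simp add: t(3) dist_norm scaleR_diff_right[symmetric])
            also have "\<dots> \<le> 1 * dist y z" using t by (intro mult_right_mono) auto
            finally show ?thesis using z by simp
          qed
          ultimately show ?thesis using e(2) by blast
        qed
        then show ?thesis by blast
      qed
      then show "\<exists>e>0. ball y e \<subseteq> ?S" using e(1) by blast
    qed
    have oT: "open ?T"
    proof -
      have "open ((\<lambda>y. x + t *\<^sub>R (y - x)) -` (- closure \<Omega>))" for t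
        by (intro open_vimage) (auto intro!: continuous_intros)
      then have "open (\<Union>t\<in>{0..1}. (\<lambda>y. x + t *\<^sub>R (y - x)) -` (- closure \<Omega>))" by blast
      moreover have "?T = (\<Union>t\<in>{0..1}. (\<lambda>y. x + t *\<^sub>R (y - x)) -` (- closure \<Omega>))" by auto
      ultimately show ?thesis by simp
    qed
    have cover: "\<Omega> \<subseteq> ?S \<union> ?T"
    proof
      fix y assume y: "y \<in> \<Omega>"
      show "y \<in> ?S \<union> ?T"
      proof (rule ccontr)
        assume "y \<notin> ?S \<union> ?T"
        then have cl: "\<And>t. 0 \<le> t \<Longrightarrow> t \<le> 1 \<Longrightarrow> x + t *\<^sub>R (y - x) \<in> closure \<Omega>"
          and "\<not> closed_segment x y \<subseteq> \<Omega>" by auto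
        from this(2) obtain t0 where t0: "0 \<le> t0" "t0 \<le> 1" "x + t0 *\<^sub>R (y - x) \<notin> \<Omega>"
        proof -
          assume *: "\<And>t0. 0 \<le> t0 \<Longrightarrow> t0 \<le> 1 \<Longrightarrow> x + t0 *\<^sub>R (y - x) \<notin> \<Omega> \<Longrightarrow> thesis"
          from \<open>\<not> closed_segment x y \<subseteq> \<Omega>\<close> obtain w where w: "w \<in> closed_segment x y" "w \<notin> \<Omega>" by blast
          from w(1) obtain t where "0 \<le> t" "t \<le> 1" "w = (1 - t) *\<^sub>R x + t *\<^sub>R y"
            unfolding in_segment by blast
          with w(2) have "0 \<le> t" "t \<le> 1" "(1 - t) *\<^sub>R x + t *\<^sub>R y \<notin> \<Omega>" by simp_all
          moreover have "(1 - t) *\<^sub>R x + t *\<^sub>R y = x + t *\<^sub>R (y - x)" by (simp add: algebra_simps)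
          ultimately show thesis using * by metis
        qed
        define p where "p = x + t0 *\<^sub>R (y - x)"
        have p: "p \<in> frontier \<Omega>" "p \<notin> \<Omega>"
          using cl[OF t0(1,2)] t0(3) \<Omega>(1) by (auto simp: p_def frontier_def interior_open)
        have t01: "0 < t0" "t0 < 1"
          using t0 x y by (auto intro!: le_neq_trans)
        have X: "y - x \<noteq> 0" using p(2) x by (auto simp: p_def)
        obtain U \<rho> where ldf: "local_defining_function \<Omega> p U \<rho>"
          using sm p(1) unfolding smooth_boundary_def by blast
        have U: "open U" "p \<in> U" "Ck_on 2 U \<rho>" "\<Omega> \<inter> U = {x\<in>U. \<rho> x < 0}"
          using ldf unfolding local_defining_function_def smooth_on_def by blast+
        obtain d where d: "d > 0" "\<And>s. \<bar>s\<bar> < d \<Longrightarrow> p + s *\<^sub>R (y - x) \<in> U"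
          using open_line_segment[OF U(1,2)] by blast
        let ?d = "min d (min t0 (1 - t0))"
        have dU: "p + s *\<^sub>R (y - x) \<in> U" if "\<bar>s\<bar> < ?d" for s using d(2) that by simp
        have "?d > 0" using d(1) t01 by simp
        moreover have "((\<lambda>s. gradient \<rho> (p + s *\<^sub>R (y - x)) \<bullet> (y - x)) has_real_derivative
            (y - x) \<bullet> (hessian \<rho> (p + 0 *\<^sub>R (y - x)) *v (y - x))) (at 0)"
          by (rule DERIV_line_gradient(2)[OF U(1) _ U(3)]) (use U(2) in simp)
        moreover have "\<rho> (p + s *\<^sub>R (y - x)) \<le> \<rho> (p + 0 *\<^sub>R (y - x))" if s: "\<bar>s\<bar> < ?d" for s
        proof -
          have "p + s *\<^sub>R (y - x) = x + (t0 + s) *\<^sub>R (y - x)" by (simp add: p_def algebra_simps)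
          then have "p + s *\<^sub>R (y - x) \<in> closure \<Omega>" using cl[of "t0 + s"] s by (simp add: abs_less_iff)
          then have "\<rho> (p + s *\<^sub>R (y - x)) \<le> 0" using local_defining_function_le_0[OF ldf] dU[OF s] by blast
          moreover have "\<not> \<rho> p < 0" using U(2,4) p(2) by blast
          ultimately show ?thesis by simp
        qed
        ultimately have "gradient \<rho> (p + 0 *\<^sub>R (y - x)) \<bullet> (y - x) = 0"
          "(y - x) \<bullet> (hessian \<rho> (p + 0 *\<^sub>R (y - x)) *v (y - x)) \<le> 0"
          using second_derivative_max[where f = "\<lambda>s. \<rho> (p + s *\<^sub>R (y - x))" and d = ?d
              and f' = "\<lambda>s. gradient \<rho> (p + s *\<^sub>R (y - x)) \<bullet> (y - x)"]
            DERIV_line_gradient(1)[OF U(1) dU U(3)] by blast+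
        then show False
          using tangential_second_derivative_pos[OF ldf p(1) uc X] by (simp add: inner_commute)
      qed
    qed
    have "z \<notin> ?T" if "z \<in> ?S" for z
    proof -
      have "x + t *\<^sub>R (z - x) \<in> closed_segment x z" if "t \<in> {0..1}" for t
        using that by (auto simp: in_segment algebra_simps intro!: exI[of _ t])
      then show ?thesis using that closure_subset by blast
    qed
    then have "?S \<inter> ?T \<inter> \<Omega> = {}" by blast
    then have "?S \<inter> \<Omega> = {} \<or> ?T \<inter> \<Omega> = {}"
      by (rule connectedD[OF \<Omega>(2) oS oT _ cover])
    moreover have "x \<in> ?S \<inter> \<Omega>" using x by simp
    ultimately have "?T \<inter> \<Omega> = {}" by blast
    then show ?thesis using cover y by blast
  qed
  then show ?thesis by (simp add: convex_contains_segment)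
qed

text \<open>In a ball of radius \<open>s\<close> tangent at \<open>p\<close>, a point
  \<open>x\<close> lies at depth at least \<open>|x - p|\<^sup>2 / (2 * s)\<close> below the tangent
  plane. For small \<open>s\<close> the linear term of the defining function then outweighs its
  quadratic remainder.\<close>

lemma interior_ball:
  fixes \<Omega> :: "(real^'n) set"
  assumes sm: "smooth_boundary \<Omega>" and p: "p \<in> frontier \<Omega>"
  obtains z r where "r > 0" "norm (p - z) = r" "cball z r - {p} \<subseteq> \<Omega>"
proof -
  obtain U \<rho> where ldf: "local_defining_function \<Omega> p U \<rho>"
    using sm p unfolding smooth_boundary_def by blast
  have U: "open U" "p \<in> U" "Ck_on 2 U \<rho>" "\<Omega> \<inter> U = {x\<in>U. \<rho> x < 0}" "gradient \<rho> p \<noteq> 0"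
    using ldf unfolding local_defining_function_def smooth_on_def by blast+
  obtain K r where K: "K \<ge> 0" "r > 0" "cball p r \<subseteq> U"
    "\<And>x. x \<in> cball p r \<Longrightarrow> \<rho> x \<le> \<rho> p + gradient \<rho> p \<bullet> (x - p) + K * (norm (x - p))\<^sup>2"
    using second_order_upper_bound[OF U(1-3)] by blast
  have "\<rho> p \<le> 0" using local_defining_function_le_0[OF ldf] p U(2) by (auto simp: frontier_def)
  let ?g = "norm (gradient \<rho> p)"
  have g: "?g > 0" using U(5) by simp
  \<comment> \<open>The first bound keeps the ball within distance \<open>r\<close> of
    \<open>p\<close>, the second gives \<open>2 * s * K < ?g\<close>; \<open>K + 1\<close> is used
    since \<open>K\<close> may be 0.\<close>
  define s where "s = min (r / 2) (?g / (2 * (K + 1)))"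
  have s: "s > 0" "2 * s \<le> r" using K g by (auto simp: s_def)
  have sK: "2 * s * K < ?g"
  proof -
    have "s \<le> ?g / (2 * (K + 1))" by (simp add: s_def)
    then have "s * (2 * (K + 1)) \<le> ?g" using K(1) by (simp add: pos_le_divide_eq)
    then have "2 * s * (K + 1) \<le> ?g" by (simp add: mult_ac)
    then show ?thesis using s(1) by (simp add: algebra_simps)
  qed
  define N where "N = gradient \<rho> p /\<^sub>R ?g"
  have N: "norm N = 1" "gradient \<rho> p = ?g *\<^sub>R N" using g by (auto simp: N_def)
  define z where "z = p - s *\<^sub>R N"
  have "x \<in> \<Omega>" if x: "x \<in> cball z s" "x \<noteq> p" for x
  proof -
    let ?h = "x - p"
    have h0: "(norm ?h)\<^sup>2 > 0" using x(2) by simp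
    have nz: "norm (?h + s *\<^sub>R N) \<le> s"
      using x(1) by (simp add: z_def dist_norm norm_minus_commute algebra_simps)
    then have "(norm (?h + s *\<^sub>R N))\<^sup>2 \<le> s\<^sup>2" by (intro power_mono) auto
    moreover have "(norm (?h + s *\<^sub>R N))\<^sup>2 = (norm ?h)\<^sup>2 + 2 * s * (N \<bullet> ?h) + s\<^sup>2"
      unfolding power2_norm_eq_inner using N(1)
      by (simp add: inner_add_left inner_add_right norm_eq_1 inner_commute power2_eq_square)
    ultimately have "(norm ?h)\<^sup>2 + 2 * s * (N \<bullet> ?h) \<le> 0" by linarith
    then have Nh: "N \<bullet> ?h \<le> - (norm ?h)\<^sup>2 / (2 * s)" using s(1) by (simp add: field_simps)
    have "norm ?h \<le> norm (?h + s *\<^sub>R N) + norm (s *\<^sub>R N)"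
      using norm_triangle_ineq4[of "?h + s *\<^sub>R N" "s *\<^sub>R N"] by simp
    then have "norm ?h \<le> r" using nz N(1) s by simp
    then have xr: "x \<in> cball p r" by (simp add: dist_norm norm_minus_commute)
    have "\<rho> x \<le> ?g * (N \<bullet> ?h) + K * (norm ?h)\<^sup>2"
      using K(4)[OF xr] \<open>\<rho> p \<le> 0\<close> by (subst (asm) N(2)) simp
    also have "\<dots> \<le> ?g * (- (norm ?h)\<^sup>2 / (2 * s)) + K * (norm ?h)\<^sup>2"
      using Nh g by (intro add_mono mult_left_mono order_refl) auto
    also have "\<dots> = (norm ?h)\<^sup>2 * ((2 * s * K - ?g) / (2 * s))"
      using s(1) by (simp add: field_simps)
    also have "\<dots> < 0" using h0 sK s(1) by (intro mult_pos_neg divide_neg_pos) auto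
    finally show ?thesis using U(4) K(3) xr by blast
  qed
  moreover have "norm (p - z) = s" using N(1) s(1) by (simp add: z_def)
  ultimately show ?thesis using that[of s z] s(1) by blast
qed

section \<open>Sign and boundary decay of the solution\<close>

text \<open>Four derivatives of \<open>u\<close> are recorded because the Hessian of
  \<open>v\<close> will be differentiated twice.\<close>

locale curvature_solution =
  fixes \<Omega> :: "(real^'n) set" and u :: "real^'n \<Rightarrow> real"
  assumes open_dom: "open \<Omega>" and conn: "connected \<Omega>" and nonempty: "\<Omega> \<noteq> {}" and bdd: "bounded \<Omega>"
    and conv: "convex \<Omega>" and smb: "smooth_boundary \<Omega>"
    and smooth_u: "Ck_on 4 \<Omega> u" and cont_u: "continuous_on (closure \<Omega>) u"
    and adm: "Gamma2_admissible \<Omega> u"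
    and eq: "\<And>x. x \<in> \<Omega> \<Longrightarrow> sigma2 (graph_curvatures u x) = (1 + (norm (gradient u x))\<^sup>2) powi (-2)"
    and bc: "\<And>x. x \<in> frontier \<Omega> \<Longrightarrow> u x = 0"
begin

lemma C2_u: "Ck_on 2 \<Omega> u"
  by (rule Ck_on_mono[OF smooth_u]) simp

lemma compact_cl: "compact (closure \<Omega>)"
  using bdd by (simp add: compact_closure)

lemma closure_cases: "x \<in> closure \<Omega> \<Longrightarrow> x \<in> \<Omega> \<or> x \<in> frontier \<Omega>"
  using open_dom by (auto simp: frontier_def interior_open)

lemma pde:
  assumes x: "x \<in> \<Omega>"
  shows "Fop (hessian u x) (gradient u x) = 1"
    and "\<And>r e. gradient u x = r *\<^sub>R e \<Longrightarrow> norm e = 1 \<Longrightarrow> S1 e (hessian u x) > 0"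
    and "\<And>g. g \<noteq> 0 \<Longrightarrow> \<exists>d>0. \<forall>\<tau>. Fop (hessian u x + \<tau> *\<^sub>R tensor g g) (gradient u x) = Fop (hessian u x) (gradient u x) + \<tau> * d"
    and "\<And>\<epsilon>. 0 \<le> \<epsilon> \<Longrightarrow> (\<And>z. z \<bullet> (hessian u x *v z) \<le> \<epsilon> * (norm z)\<^sup>2) \<Longrightarrow>
       1 / (1 + (norm (gradient u x))\<^sup>2)\<^sup>2 \<le> (real CARD('n) * \<epsilon>)\<^sup>2"
proof -
  have K: "graph_curvatures u x = eigenvalue_vector ((1 / sqrt (1 + (norm (gradient u x))\<^sup>2)) *\<^sub>R
      (matrix_inv (sqrt_matrix (mat 1 + tensor (gradient u x) (gradient u x))) ** hessian u x **
       matrix_inv (sqrt_matrix (mat 1 + tensor (gradient u x) (gradient u x)))))"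
    by (simp add: graph_curvatures_def graph_curvature_matrix_def Let_def)
  have "graph_curvatures u x \<in> Gamma2" using adm x by (simp add: Gamma2_admissible_def)
  note cf = curvature_facts[OF gradient_has_derivative(3)[OF open_dom x C2_u] this[unfolded K] eq[OF x, unfolded K]]
  show "Fop (hessian u x) (gradient u x) = 1" by (rule cf(1))
  show "\<And>r e. gradient u x = r *\<^sub>R e \<Longrightarrow> norm e = 1 \<Longrightarrow> S1 e (hessian u x) > 0" by (rule cf(2))
  show "\<And>g. g \<noteq> 0 \<Longrightarrow> \<exists>d>0. \<forall>\<tau>. Fop (hessian u x + \<tau> *\<^sub>R tensor g g) (gradient u x) = Fop (hessian u x) (gradient u x) + \<tau> * d"
    by (rule cf(3))
  show "\<And>\<epsilon>. 0 \<le> \<epsilon> \<Longrightarrow> (\<And>z. z \<bullet> (hessian u x *v z) \<le> \<epsilon> * (norm z)\<^sup>2) \<Longrightarrow>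
       1 / (1 + (norm (gradient u x))\<^sup>2)\<^sup>2 \<le> (real CARD('n) * \<epsilon>)\<^sup>2"
    by (rule cf(4))
qed

lemma touching_paraboloid:
  assumes x: "x \<in> \<Omega>" and d: "d > 0"
    and max: "\<And>y. y \<in> \<Omega> \<Longrightarrow> dist x y < d \<Longrightarrow> u y - \<epsilon> / 2 * (norm (y - z))\<^sup>2 \<le> u x - \<epsilon> / 2 * (norm (x - z))\<^sup>2"
  shows "gradient u x = \<epsilon> *\<^sub>R (x - z)" "h \<bullet> (hessian u x *v h) \<le> \<epsilon> * (norm h)\<^sup>2"
proof -
  have *: "gradient u x \<bullet> h = \<epsilon> * ((x - z) \<bullet> h) \<and> h \<bullet> (hessian u x *v h) \<le> \<epsilon> * (norm h)\<^sup>2" for h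
  proof -
    have "open (\<Omega> \<inter> ball x d)" "x \<in> \<Omega> \<inter> ball x d" using open_dom x d by auto
    then obtain e where e: "e > 0" "\<And>s. \<bar>s\<bar> < e \<Longrightarrow> x + s *\<^sub>R h \<in> \<Omega> \<inter> ball x d"
      using open_line_segment by blast
    let ?f = "\<lambda>s. u (x + s *\<^sub>R h) - \<epsilon> / 2 * (norm (x + s *\<^sub>R h - z))\<^sup>2"
    let ?f' = "\<lambda>s. gradient u (x + s *\<^sub>R h) \<bullet> h - \<epsilon> * ((x - z) \<bullet> h + s * (norm h)\<^sup>2)"
    have n: "(norm (x + s *\<^sub>R h - z))\<^sup>2 = (norm (x - z))\<^sup>2 + 2 * s * ((x - z) \<bullet> h) + s\<^sup>2 * (norm h)\<^sup>2" for s
    proof -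
      define y where "y = x - z"
      have xs: "x + s *\<^sub>R h - z = y + s *\<^sub>R h" by (simp add: y_def)
      show ?thesis unfolding xs y_def[symmetric] power2_norm_eq_inner
        by (simp add: inner_add_left inner_add_right inner_commute[of h y] power2_eq_square distrib_left)
    qed
    have "(?f has_real_derivative ?f' s) (at s)" if "\<bar>s\<bar> < e" for s
      unfolding n using e(2)[OF that]
      by (auto intro!: derivative_eq_intros DERIV_line_gradient(1)[OF open_dom _ C2_u] simp: algebra_simps)
    moreover have "(?f' has_real_derivative h \<bullet> (hessian u (x + 0 *\<^sub>R h) *v h) - \<epsilon> * (norm h)\<^sup>2) (at 0)"
      using x by (auto intro!: derivative_eq_intros DERIV_line_gradient(2)[OF open_dom _ C2_u])
    moreover have "?f s \<le> ?f 0" if "\<bar>s\<bar> < e" for s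
      using max[of "x + s *\<^sub>R h"] e(2)[OF that] by simp
    ultimately have "?f' 0 = 0" "h \<bullet> (hessian u (x + 0 *\<^sub>R h) *v h) - \<epsilon> * (norm h)\<^sup>2 \<le> 0"
      using second_derivative_max[OF e(1), of ?f ?f'] by blast+
    then show ?thesis by simp
  qed
  then show "h \<bullet> (hessian u x *v h) \<le> \<epsilon> * (norm h)\<^sup>2" by blast
  have "(gradient u x - \<epsilon> *\<^sub>R (x - z)) \<bullet> h = 0" for h
    using *[of h] by (simp add: inner_diff_left)
  then have "gradient u x - \<epsilon> *\<^sub>R (x - z) = 0" by (metis inner_eq_zero_iff)
  then show "gradient u x = \<epsilon> *\<^sub>R (x - z)" by simp
qed

text \<open>Otherwise \<open>u\<close> has an interior maximum. The gradient vanishes there, so any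
  unit vector counts as its direction, and the trace of the Hessian orthogonal to it would be both
  positive and nonpositive.\<close>

lemma u_neg: assumes x: "x \<in> \<Omega>" shows "u x < 0"
proof (rule ccontr)
  assume "\<not> u x < 0"
  obtain y where y: "y \<in> closure \<Omega>" "\<And>w. w \<in> closure \<Omega> \<Longrightarrow> u w \<le> u y"
    using continuous_attains_sup[OF compact_cl _ cont_u] nonempty by auto
  have "\<exists>y\<in>\<Omega>. \<forall>w\<in>closure \<Omega>. u w \<le> u y"
  proof (cases "y \<in> \<Omega>")
    case False
    then have "u y = 0" using y(1) closure_cases bc by blast
    then have "u w \<le> u x" if "w \<in> closure \<Omega>" for w using y(2)[OF that] \<open>\<not> u x < 0\<close> by linarith
    then show ?thesis using x by blast
  qed (use y in blast)
  then obtain y where y: "y \<in> \<Omega>" "\<And>w. w \<in> closure \<Omega> \<Longrightarrow> u w \<le> u y" by blast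
  have g: "gradient u y = 0" "\<And>h. h \<bullet> (hessian u y *v h) \<le> 0"
    using touching_paraboloid[OF y(1) zero_less_one, of 0] y(2) closure_subset by auto
  define e :: "real^'n" where "e = axis undefined 1"
  have e: "norm e = 1" by (simp add: e_def)
  have "S1 e (hessian u y) > 0" using pde(2)[OF y(1), of 0 e] g(1) e by simp
  moreover have "S1 e (hessian u y) \<le> 0"
    unfolding sum_proj_axis_form[OF e gradient_has_derivative(3)[OF open_dom y(1) C2_u], symmetric]
    by (intro sum_nonpos g(2))
  ultimately show False by linarith
qed

lemma u_nonpos: "x \<in> closure \<Omega> \<Longrightarrow> u x \<le> 0"
  using u_neg bc closure_cases by force

text \<open>Comparison with a paraboloid too flat for the equation: where \<open>u\<close> minus the
  paraboloid is maximal, the gradient of \<open>u\<close> is at most 1 in norm and its Hessian at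
  most \<epsilon> times the identity, so the curvature bound would give
  \<open>1 / 4 \<le> 1 / 16\<close>.\<close>

lemma ball_barrier:
  assumes r: "r > 0" and sub: "ball z r \<subseteq> \<Omega>"
  obtains k where "k > 0" "\<And>x. x \<in> cball z r \<Longrightarrow> u x \<le> k * ((norm (x - z))\<^sup>2 - r\<^sup>2)"
proof -
  define n where "n = real CARD('n)"
  have n: "n \<ge> 1" by (simp add: n_def Suc_leI)
  \<comment> \<open>Small enough both for \<open>\<epsilon> * r \<le> 1\<close>, which bounds the
    gradient, and for \<open>n * \<epsilon> \<le> 1 / 4\<close>; the summand 1 in
    \<open>r + 1\<close> takes care of small radii.\<close>
  define \<epsilon> where "\<epsilon> = 1 / (4 * n * (r + 1))"
  have \<epsilon>: "\<epsilon> > 0" using n r by (simp add: \<epsilon>_def)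
  have er: "\<epsilon> * r \<le> 1" "n * \<epsilon> \<le> 1 / 4"
  proof -
    have "\<epsilon> * (r + 1) * (4 * n) = 1" using n r by (simp add: \<epsilon>_def)
    have a: "n * \<epsilon> * (r + 1) = 1 / 4" using n r by (simp add: \<epsilon>_def)
    have "n * \<epsilon> * 1 \<le> n * \<epsilon> * (r + 1)" using n r \<epsilon> by (intro mult_left_mono) auto
    then show "n * \<epsilon> \<le> 1 / 4" using a by simp
    have "1 * (\<epsilon> * r) \<le> n * (\<epsilon> * r)" using n r \<epsilon> by (intro mult_right_mono) auto
    also have "\<dots> \<le> n * \<epsilon> * (r + 1)" using n \<epsilon> by (simp add: algebra_simps)
    finally show "\<epsilon> * r \<le> 1" using a by simp
  qed
  have cl: "cball z r \<subseteq> closure \<Omega>"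
    using closure_mono[OF sub] r by simp
  let ?\<psi> = "\<lambda>x. \<epsilon> / 2 * ((norm (x - z))\<^sup>2 - r\<^sup>2)"
  let ?f = "\<lambda>x. u x - \<epsilon> / 2 * (norm (x - z))\<^sup>2"
  have "u x \<le> ?\<psi> x" if x: "x \<in> cball z r" for x
  proof (rule ccontr)
    assume "\<not> u x \<le> ?\<psi> x"
    have "continuous_on (cball z r) ?f"
      using continuous_on_subset[OF cont_u cl] by (intro continuous_intros) auto
    then obtain y where y: "y \<in> cball z r" "\<And>w. w \<in> cball z r \<Longrightarrow> ?f w \<le> ?f y"
      using continuous_attains_sup[OF compact_cball, of z r ?f] r by auto
    have fy: "?f y > - \<epsilon> / 2 * r\<^sup>2"
      using y(2)[OF x] \<open>\<not> u x \<le> ?\<psi> x\<close> by (simp add: algebra_simps)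
    have yb: "norm (y - z) < r"
    proof (rule ccontr)
      assume "\<not> norm (y - z) < r"
      then have "norm (y - z) = r" using y(1) by (simp add: dist_norm norm_minus_commute)
      then show False using fy u_nonpos[of y] y(1) cl by auto
    qed
    then have y\<Omega>: "y \<in> \<Omega>" using sub by (auto simp: dist_norm norm_minus_commute mem_ball subset_iff)
    have "u w - \<epsilon> / 2 * (norm (w - z))\<^sup>2 \<le> u y - \<epsilon> / 2 * (norm (y - z))\<^sup>2" if "w \<in> \<Omega>" "dist y w < r - norm (y - z)" for w
    proof (rule y(2))
      have "dist z w \<le> dist z y + dist y w" by (rule dist_triangle)
      then show "w \<in> cball z r" using that(2) by (simp add: dist_norm norm_minus_commute)
    qed
    then have g: "gradient u y = \<epsilon> *\<^sub>R (y - z)" "\<And>h. h \<bullet> (hessian u y *v h) \<le> \<epsilon> * (norm h)\<^sup>2"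
      using touching_paraboloid[OF y\<Omega>, of "r - norm (y - z)" \<epsilon> z] yb by auto
    have "norm (gradient u y) \<le> 1"
    proof -
      have "norm (gradient u y) = \<epsilon> * norm (y - z)" using \<epsilon> by (simp add: g(1))
      also have "\<dots> \<le> \<epsilon> * r" using yb \<epsilon> by (intro mult_left_mono) auto
      finally show ?thesis using er by linarith
    qed
    then have "(norm (gradient u y))\<^sup>2 \<le> 1" by (simp add: abs_square_le_1)
    then have "(1 + (norm (gradient u y))\<^sup>2)\<^sup>2 \<le> 2\<^sup>2" by (intro power_mono) auto
    moreover have "1 + (norm (gradient u y))\<^sup>2 > 0" by (simp add: add_pos_nonneg)
    ultimately have "1 / 4 \<le> 1 / (1 + (norm (gradient u y))\<^sup>2)\<^sup>2"
      by (intro divide_left_mono mult_pos_pos zero_less_power) auto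
    also have "\<dots> \<le> (n * \<epsilon>)\<^sup>2"
      unfolding n_def using pde(4)[OF y\<Omega> less_imp_le[OF \<epsilon>] g(2)] .
    also have "\<dots> \<le> (1 / 4)\<^sup>2" using er n \<epsilon> by (intro power_mono) auto
    finally show False by (simp add: power2_eq_square)
  qed
  then show ?thesis using that[of "\<epsilon> / 2"] \<epsilon> by simp
qed

text \<open>The barrier in an interior ball gives a linear rate along the inner normal, since
  \<open>(1 - \<tau>)\<^sup>2 - 1 \<le> - \<tau>\<close>. For the negative root of
  \<open>- u\<close> a linear rate means infinite slope.\<close>

lemma boundary_decay:
  assumes p: "p \<in> frontier \<Omega>"
  shows "\<exists>d k. k > 0 \<and> (\<forall>\<tau>. 0 < \<tau> \<and> \<tau> \<le> 1 \<longrightarrow> p + \<tau> *\<^sub>R d \<in> \<Omega> \<and> u (p + \<tau> *\<^sub>R d) \<le> - k * \<tau>)"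
proof -
  obtain z r where z: "r > 0" "norm (p - z) = r" "cball z r - {p} \<subseteq> \<Omega>"
    using interior_ball[OF smb p] by blast
  have "ball z r \<subseteq> cball z r - {p}" using z(2) by (auto simp: dist_norm norm_minus_commute)
  then have "ball z r \<subseteq> \<Omega>" using z(3) by blast
  then obtain k where k: "k > 0" "\<And>x. x \<in> cball z r \<Longrightarrow> u x \<le> k * ((norm (x - z))\<^sup>2 - r\<^sup>2)"
    using ball_barrier[OF z(1)] by blast
  let ?d = "z - p"
  have nrm: "norm (p + \<tau> *\<^sub>R ?d - z) = (1 - \<tau>) * r" if "0 < \<tau>" "\<tau> \<le> 1" for \<tau>
  proof -
    have "p + \<tau> *\<^sub>R ?d - z = (1 - \<tau>) *\<^sub>R (p - z)" by (simp add: algebra_simps)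
    then show ?thesis using that z(2) by simp
  qed
  have inb: "p + \<tau> *\<^sub>R ?d \<in> cball z r" if "0 < \<tau>" "\<tau> \<le> 1" for \<tau>
    using nrm[OF that] that z(1) by (simp add: dist_norm norm_minus_commute mult_left_le_one_le)
  have "p + \<tau> *\<^sub>R ?d \<in> \<Omega>" if "0 < \<tau>" "\<tau> \<le> 1" for \<tau>
  proof -
    have "z \<noteq> p" using z(1,2) by auto
    then have "p + \<tau> *\<^sub>R ?d \<noteq> p" using that by simp
    then show ?thesis using inb[OF that] z(3) by blast
  qed
  moreover have "u (p + \<tau> *\<^sub>R ?d) \<le> - (k * r\<^sup>2) * \<tau>" if "0 < \<tau>" "\<tau> \<le> 1" for \<tau>
  proof -
    have "u (p + \<tau> *\<^sub>R ?d) \<le> k * (((1 - \<tau>) * r)\<^sup>2 - r\<^sup>2)"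
      using k(2)[OF inb[OF that]] nrm[OF that] by simp
    also have "\<dots> = - (k * r\<^sup>2) * \<tau> - k * r\<^sup>2 * \<tau> * (1 - \<tau>)"
      by (simp add: power2_eq_square algebra_simps)
    also have "\<dots> \<le> - (k * r\<^sup>2) * \<tau>" using that k(1) by simp
    finally show ?thesis .
  qed
  moreover have "k * r\<^sup>2 > 0" using k(1) z(1) by simp
  ultimately show ?thesis by blast
qed

end

section \<open>The equation for the square root\<close>

text \<open>The reciprocal root is preferred to the root because its derivative is a polynomial in
  itself and the derivative of \<open>f\<close>; the induction then needs products only.\<close>

lemma Ck_on_inverse_sqrt:
  fixes f :: "'a::real_normed_vector \<Rightarrow> real"
  assumes S: "open S" and f: "Ck_on k S f" and pos: "\<And>x. x \<in> S \<Longrightarrow> f x > 0"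
  shows "Ck_on k S (\<lambda>x. 1 / sqrt (f x))"
  using f
proof (induction k)
  case 0
  have "sqrt (f x) \<noteq> 0" if "x \<in> S" for x using pos[OF that] by simp
  then show ?case using 0 by (simp add: continuous_on_divide continuous_on_real_sqrt)
next
  case (Suc k)
  let ?w = "\<lambda>x. 1 / sqrt (f x)"
  have w: "Ck_on k S ?w" using Suc.IH Ck_on_SucD[OF Suc.prems] by blast
  have d: "(?w has_derivative (\<lambda>h. - (1 / 2) * (dirD f h x * (?w x * (?w x * ?w x))))) (at x)" if "x \<in> S" for x
  proof -
    have "f differentiable (at x)" using Suc.prems that by (simp add: Ck_on_Suc)
    moreover have "((\<lambda>y. 1 / sqrt y) has_real_derivative - (1 / 2) * (1 / sqrt (f x) * (1 / sqrt (f x) * (1 / sqrt (f x))))) (at (f x))"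
      using pos[OF that]
      by (auto intro!: derivative_eq_intros simp: divide_simps)
    ultimately show ?thesis
      using DERIV_compose_FDERIV[OF _ has_derivative_dirD] by (fastforce simp: mult_ac)
  qed
  have "Ck_on k S (dirD ?w h)" for h
  proof (rule Ck_on_cong_open[OF S])
    show "Ck_on k S (\<lambda>x. - (1 / 2) * (dirD f h x * (?w x * (?w x * ?w x))))"
      using Suc.prems w by (intro Ck_on_mult[OF S] Ck_on_const) (auto simp: Ck_on_Suc)
    show "- (1 / 2) * (dirD f h y * (?w y * (?w y * ?w y))) = dirD ?w h y" if "y \<in> S" for y
      using dirD_eq[OF d[OF that]] by simp
  qed
  moreover have "?w differentiable (at x)" if "x \<in> S" for x
    using d[OF that] by (rule differentiableI)
  ultimately show ?case by (simp add: Ck_on_Suc)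
qed

text \<open>The function \<open>F\<close> of the overview: \<open>Fop\<close> evaluated at the
  gradient \<open>2tq\<close> and the Hessian \<open>2(tB - tensor q q)\<close> of
  \<open>u = - t\<^sup>2\<close>.\<close>

definition FF :: "real^'n \<Rightarrow> real \<Rightarrow> real^'n^'n \<Rightarrow> real" where
  "FF q t B = 4 * (t\<^sup>2 * s2 B - t * ((norm q)\<^sup>2 * trace B - q \<bullet> (B *v q)))
     + 16 * t^4 * ((norm q)\<^sup>2 * s2 B - trace B * (q \<bullet> (B *v q)) + (norm (B *v q))\<^sup>2)"

lemma s2_scaleR: "s2 (c *\<^sub>R A) = c\<^sup>2 * s2 A" for A :: "real^'n^'n"
  by (simp add: s2_def matrix_mult_simps trace_scaleR power2_eq_square algebra_simps)

text \<open>The two powers of \<theta> show that the equation is not homogeneous: \<theta> = 1 gives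
  \<open>FF\<close>, and a smaller \<theta> occurs at a maximum over the hull. The contributions of
  \<open>tensor q q\<close> cancel in the quartic part, which only sees the complement of
  \<open>q\<close>.\<close>

lemma Fop_scaled:
  fixes B :: "real^'n^'n"
  assumes B: "transpose B = B"
  shows "Fop (\<theta> *\<^sub>R (2 *\<^sub>R (t *\<^sub>R B - tensor q q))) (\<theta> *\<^sub>R ((2 * t) *\<^sub>R q)) =
    \<theta>\<^sup>2 * (4 * (t\<^sup>2 * s2 B - t * ((norm q)\<^sup>2 * trace B - q \<bullet> (B *v q)))
     + \<theta>\<^sup>2 * (16 * t^4 * ((norm q)\<^sup>2 * s2 B - trace B * (q \<bullet> (B *v q)) + (norm (B *v q))\<^sup>2)))"
proof -
  let ?C = "t *\<^sub>R B - tensor q q"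
  define a where "a = (norm q)\<^sup>2"
  define b where "b = q \<bullet> (B *v q)"
  have a: "q \<bullet> q = a" by (simp add: a_def dot_square_norm)
  have tB: "transpose (t *\<^sub>R B) = t *\<^sub>R B" by (simp add: transpose_scaleR B)
  have "s2 (t *\<^sub>R B + (-1) *\<^sub>R tensor q q) = s2 (t *\<^sub>R B) + (-1) * (trace (t *\<^sub>R B) * (norm q)\<^sup>2 - q \<bullet> ((t *\<^sub>R B) *v q))"
    by (rule s2_add_tensor[OF tB])
  then have s: "s2 ?C = t\<^sup>2 * s2 B - t * (a * trace B - b)"
    by (simp add: s2_scaleR trace_scaleR matrix_vector_simps a_def b_def algebra_simps)
  have tr: "trace ?C = t * trace B - a" by (simp add: trace_sub trace_scaleR trace_tensor a)
  have Cq: "?C *v q = t *\<^sub>R (B *v q) - a *\<^sub>R q"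
    by (simp add: matrix_vector_simps tensor_mult_vector a)
  have qC: "q \<bullet> (?C *v q) = t * b - a\<^sup>2" unfolding Cq
    by (simp add: inner_diff_right a b_def power2_eq_square)
  have nC: "(norm (?C *v q))\<^sup>2 = t\<^sup>2 * (norm (B *v q))\<^sup>2 - 2 * t * a * b + a^3"
    unfolding Cq power2_norm_eq_inner
    by (simp add: inner_diff_left inner_diff_right a inner_commute[of "B *v q" q] b_def[symmetric]
        power2_eq_square power3_eq_cube algebra_simps)
  have "Fop (\<theta> *\<^sub>R (2 *\<^sub>R ?C)) (\<theta> *\<^sub>R ((2 * t) *\<^sub>R q)) =
     (1 + \<theta>\<^sup>2 * (4 * t\<^sup>2 * a)) * (\<theta>\<^sup>2 * (4 * s2 ?C)) - (\<theta> * (2 * trace ?C)) * (\<theta>^3 * (8 * t\<^sup>2 * (q \<bullet> (?C *v q))))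
     + \<theta>^4 * (16 * t\<^sup>2 * (norm (?C *v q))\<^sup>2)"
    by (simp add: Fop_def s2_scaleR trace_scaleR bounded_bilinear.scaleR_left[OF bounded_bilinear_matrix_vector]
        bounded_bilinear.scaleR_right[OF bounded_bilinear_matrix_vector]
        power_mult_distrib a_def power2_eq_square power3_eq_cube power4_eq_xxxx mult_ac)
  also have "\<dots> = \<theta>\<^sup>2 * (4 * (t\<^sup>2 * s2 B - t * (a * trace B - b))
     + \<theta>\<^sup>2 * (16 * t^4 * (a * s2 B - trace B * b + (norm (B *v q))\<^sup>2)))"
    unfolding s tr qC nC by (simp add: power2_eq_square power3_eq_cube power4_eq_xxxx algebra_simps)
  finally show ?thesis by (simp add: a_def b_def)
qed

lemma Fop_FF: "transpose B = B \<Longrightarrow> Fop (2 *\<^sub>R (t *\<^sub>R B - tensor q q)) ((2 * t) *\<^sub>R q) = FF q t B"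
  using Fop_scaled[of B 1 t q] by (simp add: FF_def)

lemma direction_forms:
  fixes B :: "real^'n^'n"
  assumes q: "q = r *\<^sub>R e" "norm e = 1"
  shows "(norm q)\<^sup>2 * trace B - q \<bullet> (B *v q) = (norm q)\<^sup>2 * S1 e B"
    and "(norm q)\<^sup>2 * s2 B - trace B * (q \<bullet> (B *v q)) + (norm (B *v q))\<^sup>2 = (norm q)\<^sup>2 * S2 e B"
  using q by (simp_all add: S1_def S2_def matrix_vector_simps power_mult_distrib power2_eq_square algebra_simps)

text \<open>For \<open>q = 0\<close> any unit vector serves, so statements about the direction of
  the gradient need no case distinction.\<close>

lemma exists_direction: "\<exists>r e. q = r *\<^sub>R e \<and> norm e = 1" for q :: "real^'n"
proof (cases "q = 0")
  case True
  then show ?thesis by (intro exI[of _ 0] exI[of _ "axis undefined 1"]) simp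
next
  case False
  then show ?thesis by (intro exI[of _ "norm q"] exI[of _ "q /\<^sub>R norm q"]) simp
qed

lemma S1_square_root:
  fixes B :: "real^'n^'n"
  assumes q: "q = r *\<^sub>R e" "norm e = 1"
  shows "S1 e (c *\<^sub>R (t *\<^sub>R B - tensor q q)) = c * t * S1 e B"
proof -
  have "q \<bullet> q = (q \<bullet> e) * (q \<bullet> e)" using q by (simp add: norm_eq_1)
  then show ?thesis
    by (simp add: S1_def trace_scaleR trace_sub trace_tensor matrix_vector_simps tensor_mult_vector
        inner_diff_right inner_commute[of e q] algebra_simps)
qed

text \<open>Both bounds concern the compression \<open>?C\<close>: \<open>S2\<close> is half of its
  squared trace minus its squared norm, and for a positive semidefinite matrix the norm lies between
  0 and the trace.\<close>

lemma S2_bounds_psd: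
  fixes B :: "real^'n^'n"
  assumes e: "norm e = 1" and B: "transpose B = B" and psd: "\<And>x. 0 \<le> x \<bullet> (B *v x)"
  shows "0 \<le> S2 e B" "S2 e B \<le> (S1 e B)\<^sup>2 / 2"
proof -
  let ?P = "mat 1 - tensor e e"
  let ?C = "?P ** B ** ?P"
  have ee: "e \<bullet> e = 1" using e by (simp add: norm_eq_1)
  have P: "transpose ?P = ?P" by (simp add: transpose_diff transpose_tensor transpose_mat)
  have Pe: "?P *v e = 0" by (simp add: matrix_vector_simps tensor_mult_vector ee)
  have "tensor (0 :: real^'n) e = 0" by (simp add: vec_eq_iff tensor_def)
  then have "?P ** tensor e e = 0" by (simp only: matrix_mult_tensor Pe)
  moreover have "?P ** ?P = ?P ** mat 1 - ?P ** tensor e e" by (simp only: matrix_mult_simps(4))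
  ultimately have PP: "?P ** ?P = ?P" by simp
  have Cq: "x \<bullet> (?C *v y) = (?P *v x) \<bullet> (B *v (?P *v y))" for x y
    using inner_transpose_matrix[of x ?P "B *v (?P *v y)"] unfolding P
    by (simp only: matrix_vector_mul_assoc[symmetric])
  have C: "transpose ?C = ?C" unfolding sym_matrix_iff Cq using sym_matrix_inner[OF B] by blast
  have "0 \<le> x \<bullet> (?C *v x)" for x unfolding Cq by (rule psd)
  then have le: "norm ?C \<le> trace ?C" by (rule norm_le_trace_psd[OF C])
  have trC: "trace (?P ** Z ** ?P) = trace Z - e \<bullet> (Z *v e)" for Z
  proof -
    have "trace (?P ** Z ** ?P) = trace (Z ** (?P ** ?P))"
      by (metis matrix_mul_assoc trace_mul_sym)
    then show ?thesis unfolding PP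
      by (simp add: matrix_mult_simps trace_sub matrix_mult_tensor trace_tensor inner_commute)
  qed
  have "?C ** ?C = ?P ** (B ** ?P ** B) ** ?P"
  proof -
    have ZPP: "Z ** ?P ** ?P = Z ** ?P" for Z :: "real^'n^'n"
      by (simp only: matrix_mul_assoc[symmetric] PP)
    show ?thesis by (simp only: matrix_mul_assoc ZPP)
  qed
  then have "trace (?C ** ?C) = trace (B ** ?P ** B) - e \<bullet> ((B ** ?P ** B) *v e)" by (simp only: trC)
  moreover have "trace (B ** ?P ** B) = trace (B ** B) - (norm (B *v e))\<^sup>2"
    by (simp add: matrix_mult_simps trace_sub matrix_mult_tensor tensor_mult_matrix
        trace_tensor dot_square_norm B del: transpose_matrix_vector)
  moreover have "e \<bullet> ((B ** ?P ** B) *v e) = (norm (B *v e))\<^sup>2 - (e \<bullet> (B *v e))\<^sup>2"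
  proof -
    have "e \<bullet> ((B ** ?P ** B) *v e) = (B *v e) \<bullet> (?P *v (B *v e))"
      using sym_matrix_inner[OF B, of e "?P *v (B *v e)"] inner_commute[of "?P *v (B *v e)"]
      by (simp only: matrix_vector_mul_assoc[symmetric])
    then show ?thesis
      by (simp add: matrix_vector_simps tensor_mult_vector inner_diff_right dot_square_norm
          power2_eq_square inner_commute[of "B *v e" e])
  qed
  ultimately have tr2: "trace (?C ** ?C) = trace (B ** B) - 2 * (norm (B *v e))\<^sup>2 + (e \<bullet> (B *v e))\<^sup>2" by simp
  have "trace (?C ** ?C) \<le> (trace ?C)\<^sup>2"
    unfolding trace_square_sym[OF C] using le by (intro power_mono) auto
  then show "0 \<le> S2 e B" unfolding tr2 trC
    by (simp add: S2_def s2_def power2_eq_square field_simps)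
  have "0 \<le> trace (?C ** ?C)" unfolding trace_square_sym[OF C] by simp
  then show "S2 e B \<le> (S1 e B)\<^sup>2 / 2" unfolding tr2
    by (simp add: S2_def s2_def S1_def power2_eq_square field_simps)
qed

context curvature_solution
begin

section \<open>Regularity, derivatives and equation of the square root\<close>

definition v :: "real^'n \<Rightarrow> real" where "v = (\<lambda>x. - sqrt (- u x))"

lemma v_neg: "x \<in> \<Omega> \<Longrightarrow> v x < 0"
  using u_neg by (simp add: v_def)

lemma v_nonpos: "x \<in> closure \<Omega> \<Longrightarrow> v x \<le> 0"
  using u_nonpos by (simp add: v_def)

lemma v_sq: "x \<in> closure \<Omega> \<Longrightarrow> (v x)\<^sup>2 = - u x"
  using u_nonpos by (simp add: v_def)

lemma v_frontier: "x \<in> frontier \<Omega> \<Longrightarrow> v x = 0"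
  using bc by (simp add: v_def)

lemma cont_v: "continuous_on (closure \<Omega>) v"
  unfolding v_def using cont_u by (intro continuous_intros) auto

lemma C4_v: "Ck_on 4 \<Omega> v"
proof (rule Ck_on_cong_open[OF open_dom])
  have n: "Ck_on 4 \<Omega> (\<lambda>x. (-1) * u x)"
    by (intro Ck_on_mult[OF open_dom] Ck_on_const smooth_u)
  show "Ck_on 4 \<Omega> (\<lambda>x. u x * (1 / sqrt ((-1) * u x)))"
    by (intro Ck_on_mult[OF open_dom] smooth_u Ck_on_inverse_sqrt[OF open_dom n]) (use u_neg in auto)
  show "u y * (1 / sqrt ((-1) * u y)) = v y" if "y \<in> \<Omega>" for y
    using u_neg[OF that] real_sqrt_mult_self[of "- u y"]
    by (simp add: v_def field_simps)
qed

lemma C2_v: "Ck_on 2 \<Omega> v"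
  by (rule Ck_on_mono[OF C4_v]) simp

lemma derivatives_u_v:
  assumes x: "x \<in> \<Omega>"
  shows "gradient u x = (2 * - v x) *\<^sub>R gradient v x"
    and "hessian u x = 2 *\<^sub>R ((- v x) *\<^sub>R hessian v x - tensor (gradient v x) (gradient v x))"
proof -
  have d1: "v differentiable (at y)" and d2: "dirD v h differentiable (at y)" if "y \<in> \<Omega>" for y h
    using C2_v that by (auto simp: numeral_2_eq_2 Ck_on_Suc)
  have u1: "u differentiable (at y)" and u2: "dirD u h differentiable (at y)" if "y \<in> \<Omega>" for y h
    using C2_u that by (auto simp: numeral_2_eq_2 Ck_on_Suc)
  have uv: "u y = - (v y * v y)" if "y \<in> \<Omega>" for y
    using v_sq[of y] that closure_subset[of \<Omega>] by (auto simp: power2_eq_square)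
  have D1: "dirD u h y = -2 * (v y * dirD v h y)" if "y \<in> \<Omega>" for y h
  proof -
    have "dirD u h y = dirD (\<lambda>y. - (v y * v y)) h y"
      by (rule dirD_cong_open[OF open_dom that uv u1[OF that]])
    also have "\<dots> = - (v y * dirD v h y + dirD v h y * v y)"
      by (rule dirD_eq) (intro has_derivative_minus has_derivative_mult has_derivative_dirD d1 that)
    finally show ?thesis by simp
  qed
  have D2: "dirD (dirD u h) k x = -2 * (v x * dirD (dirD v h) k x + dirD v k x * dirD v h x)" for h k
  proof -
    have "dirD (dirD u h) k x = dirD (\<lambda>y. -2 * (v y * dirD v h y)) k x"
      by (rule dirD_cong_open[OF open_dom x D1 u2[OF x]])
    also have "\<dots> = -2 * (v x * dirD (dirD v h) k x + dirD v k x * dirD v h x)"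
      by (rule dirD_eq) (intro has_derivative_mult_right has_derivative_mult has_derivative_dirD d1 d2 x)
    finally show ?thesis .
  qed
  show "gradient u x = (2 * - v x) *\<^sub>R gradient v x"
    using D1[OF x] by (simp add: vec_eq_iff gradient_def dirD_def)
  have gc: "gradient v x $ i = dirD v (axis i 1) x" for i by (simp add: gradient_def dirD_def)
  show "hessian u x = 2 *\<^sub>R ((- v x) *\<^sub>R hessian v x - tensor (gradient v x) (gradient v x))"
    by (simp add: vec_eq_iff hessian_entry[OF open_dom x C2_u] hessian_entry[OF open_dom x C2_v] D2
        tensor_def gc algebra_simps)
qed

lemma hessian_v_sym: "x \<in> \<Omega> \<Longrightarrow> transpose (hessian v x) = hessian v x"
  by (rule gradient_has_derivative(3)[OF open_dom _ C2_v])

lemma pde_v: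
  assumes x: "x \<in> \<Omega>"
  shows "FF (gradient v x) (- v x) (hessian v x) = 1"
    and "\<And>r e. gradient v x = r *\<^sub>R e \<Longrightarrow> norm e = 1 \<Longrightarrow> S1 e (hessian v x) > 0"
    and "\<And>g. g \<noteq> 0 \<Longrightarrow> \<exists>d>0. \<forall>\<tau>. FF (gradient v x) (- v x) (hessian v x + \<tau> *\<^sub>R tensor g g) = 1 + \<tau> * d"
proof -
  note D = derivatives_u_v[OF x]
  note sym = hessian_v_sym[OF x]
  show 1: "FF (gradient v x) (- v x) (hessian v x) = 1"
    using pde(1)[OF x] Fop_FF[OF sym, of "- v x" "gradient v x"] unfolding D by simp
  show "S1 e (hessian v x) > 0" if q: "gradient v x = r *\<^sub>R e" "norm e = 1" for r e
  proof -
    have "gradient u x = (2 * - v x * r) *\<^sub>R e" unfolding D q(1) by simp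
    from pde(2)[OF x this q(2)] have "0 < 2 * (- v x) * S1 e (hessian v x)"
      unfolding D S1_square_root[OF q] .
    then show ?thesis using v_neg[OF x] by (auto simp: zero_less_mult_iff mult_less_0_iff)
  qed
  show "\<exists>d>0. \<forall>\<tau>. FF (gradient v x) (- v x) (hessian v x + \<tau> *\<^sub>R tensor g g) = 1 + \<tau> * d" if g: "g \<noteq> 0" for g
  proof -
    obtain d where d: "d > 0" "\<And>\<tau>. Fop (hessian u x + \<tau> *\<^sub>R tensor g g) (gradient u x) = Fop (hessian u x) (gradient u x) + \<tau> * d"
      using pde(3)[OF x g] by blast
    have "FF (gradient v x) (- v x) (hessian v x + \<tau> *\<^sub>R tensor g g) = 1 + \<tau> * (2 * - v x * d)" for \<tau>
    proof -
      have s: "transpose (hessian v x + \<tau> *\<^sub>R tensor g g) = hessian v x + \<tau> *\<^sub>R tensor g g"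
        by (simp add: transpose_add transpose_scaleR transpose_tensor sym)
      have "2 *\<^sub>R ((- v x) *\<^sub>R (hessian v x + \<tau> *\<^sub>R tensor g g) - tensor (gradient v x) (gradient v x))
          = hessian u x + (2 * - v x * \<tau>) *\<^sub>R tensor g g"
        unfolding D by (simp add: algebra_simps)
      then have "FF (gradient v x) (- v x) (hessian v x + \<tau> *\<^sub>R tensor g g)
          = Fop (hessian u x + (2 * - v x * \<tau>) *\<^sub>R tensor g g) (gradient u x)"
        unfolding Fop_FF[OF s, symmetric] by (simp add: D(1))
      then show ?thesis using d(2)[of "2 * - v x * \<tau>"] pde(1)[OF x] by (simp add: mult_ac)
    qed
    moreover have "2 * - v x * d > 0" using v_neg[OF x] d(1) by (intro mult_pos_pos) auto
    ultimately show ?thesis by blast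
  qed
qed

lemma midpoint_imp_psd:
  assumes x: "x \<in> \<Omega>" and d: "d > 0"
    and mid: "\<And>s. \<bar>s\<bar> < d \<Longrightarrow> 2 * v x \<le> v (x + s *\<^sub>R h) + v (x - s *\<^sub>R h)"
  shows "0 \<le> h \<bullet> (hessian v x *v h)"
proof -
  obtain e where e: "e > 0" "\<And>s. \<bar>s\<bar> < e \<Longrightarrow> x + s *\<^sub>R h \<in> \<Omega>"
    using open_line_segment[OF open_dom x] by blast
  let ?f = "\<lambda>s. - (v (x + s *\<^sub>R h) + v (x + (- s) *\<^sub>R h))"
  let ?f' = "\<lambda>s. - (gradient v (x + s *\<^sub>R h) \<bullet> h + - (gradient v (x + (- s) *\<^sub>R h) \<bullet> h))"
  have D1: "((\<lambda>s. v (x + (- s) *\<^sub>R h)) has_real_derivative - (gradient v (x + (- s) *\<^sub>R h) \<bullet> h)) (at s)"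
    if "\<bar>s\<bar> < e" for s
    using DERIV_chain2[where f = "\<lambda>s. v (x + s *\<^sub>R h)" and g = uminus and x = s and Db = "-1" and s = UNIV,
        OF DERIV_line_gradient(1)[OF open_dom e(2)[of "- s"] C2_v]] that
    by (simp add: DERIV_minus[OF DERIV_ident])
  have D2: "((\<lambda>s. gradient v (x + (- s) *\<^sub>R h) \<bullet> h) has_real_derivative - (h \<bullet> (hessian v (x + (- 0) *\<^sub>R h) *v h))) (at 0)"
    using DERIV_chain2[where f = "\<lambda>s. gradient v (x + s *\<^sub>R h) \<bullet> h" and g = uminus and x = 0 and Db = "-1" and s = UNIV,
        OF DERIV_line_gradient(2)[OF open_dom e(2)[of "- 0"] C2_v]] e(1)
    by (simp add: DERIV_minus[OF DERIV_ident])
  have m: "min d e > 0" using d e by simp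
  have "(?f has_real_derivative ?f' s) (at s)" if "\<bar>s\<bar> < min d e" for s
    using that by (intro DERIV_minus DERIV_add D1 DERIV_line_gradient(1)[OF open_dom e(2) C2_v]) auto
  moreover have "(?f' has_real_derivative - (h \<bullet> (hessian v (x + 0 *\<^sub>R h) *v h) + - (- (h \<bullet> (hessian v (x + (- 0) *\<^sub>R h) *v h))))) (at 0)"
    using x by (intro DERIV_minus DERIV_add D2 DERIV_line_gradient(2)[OF open_dom _ C2_v]) auto
  moreover have "?f s \<le> ?f 0" if "\<bar>s\<bar> < min d e" for s
    using mid[of s] that by simp
  ultimately have "- (h \<bullet> (hessian v (x + 0 *\<^sub>R h) *v h) + - (- (h \<bullet> (hessian v (x + (- 0) *\<^sub>R h) *v h)))) \<le> 0"
    by (rule second_derivative_max(2)[OF m])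
  then show ?thesis by simp
qed

end

section \<open>Convexity of the square root\<close>

lemma average_reflection: "(1 / 2) *\<^sub>R (x + h) + (1 / 2) *\<^sub>R (x - h) = x" for x h :: "'a::real_vector"
proof -
  have "(1 / 2) *\<^sub>R (x + h) + (1 / 2) *\<^sub>R (x - h) = (1 / 2) *\<^sub>R (x + x)"
    by (simp only: scaleR_add_right[symmetric]) simp
  then show ?thesis by simp
qed

context curvature_solution
begin

text \<open>Second coordinates in the hull are nonpositive, so a large square means a low point.
  Over each \<open>x\<close> the lowest point is the value of the convex envelope of
  \<open>v\<close>.\<close>

definition graph_hull :: "((real^'n) \<times> real) set" where
  "graph_hull = convex hull ((\<lambda>x. (x, v x)) ` closure \<Omega>)"

lemma compact_graph_hull: "compact graph_hull"
  unfolding graph_hull_def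
  by (intro compact_convex_hull compact_continuous_image compact_cl continuous_intros cont_v)

lemma graph_hull_sum:
  assumes "finite I" "\<And>i. i \<in> I \<Longrightarrow> w i \<ge> 0" "sum w I = 1" "\<And>i. i \<in> I \<Longrightarrow> Y i \<in> closure \<Omega>"
  shows "(\<Sum>i\<in>I. w i *\<^sub>R Y i, \<Sum>i\<in>I. w i * v (Y i)) \<in> graph_hull"
proof -
  have "(\<Sum>i\<in>I. w i *\<^sub>R (Y i, v (Y i))) \<in> graph_hull"
    using assms unfolding graph_hull_def
    by (intro convex_sum convex_convex_hull hull_inc imageI) auto
  moreover have "(\<Sum>i\<in>I. w i *\<^sub>R (Y i, v (Y i))) = (\<Sum>i\<in>I. w i *\<^sub>R Y i, \<Sum>i\<in>I. w i * v (Y i))"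
    by (simp add: prod_eq_iff fst_sum snd_sum)
  ultimately show ?thesis by simp
qed

lemma graph_hull_subset: "graph_hull \<subseteq> closure \<Omega> \<times> {..0}"
  unfolding graph_hull_def
  by (rule hull_minimal) (auto simp: v_nonpos intro: convex_Times convex_closure conv)

text \<open>The graph points themselves serve as indices. Points of weight 0 are dropped, because
  later variations divide by the weights.\<close>

lemma graph_hull_representation:
  assumes "z \<in> graph_hull"
  shows "\<exists>(I :: ((real^'n) \<times> real) set) w. finite I \<and> (\<forall>i\<in>I. w i > 0 \<and> fst i \<in> closure \<Omega>) \<and> sum w I = 1 \<and>
    fst z = (\<Sum>i\<in>I. w i *\<^sub>R fst i) \<and> snd z = (\<Sum>i\<in>I. w i * v (fst i))"
proof -
  obtain S w where S: "finite S" "S \<subseteq> (\<lambda>x. (x, v x)) ` closure \<Omega>" "\<forall>x\<in>S. 0 \<le> w x" "sum w S = 1"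
    "(\<Sum>x\<in>S. w x *\<^sub>R x) = z"
    using assms unfolding graph_hull_def convex_hull_explicit by blast
  let ?I = "{i \<in> S. w i > 0}"
  have eqI: "(\<Sum>i\<in>?I. f i) = (\<Sum>i\<in>S. f i)" if "\<And>i. i \<in> S \<Longrightarrow> w i = 0 \<Longrightarrow> f i = 0"
    for f :: "(real^'n) \<times> real \<Rightarrow> 'b::comm_monoid_add"
  proof (rule sum.mono_neutral_left)
    show "\<forall>i\<in>S - ?I. f i = 0" using S(3) that by (auto simp: less_le)
  qed (use S(1) in auto)
  have "sum w ?I = 1" using eqI[of w] S(4) by simp
  moreover have "fst z = (\<Sum>i\<in>?I. w i *\<^sub>R fst i)"
    using eqI[of "\<lambda>i. w i *\<^sub>R fst i"] S(5) by (simp add: fst_sum[symmetric] flip: fst_scaleR)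
  moreover have "snd z = (\<Sum>i\<in>?I. w i * v (fst i))"
  proof -
    have "snd z = (\<Sum>i\<in>S. w i * snd i)" using S(5) by (auto simp: snd_sum)
    also have "\<dots> = (\<Sum>i\<in>S. w i * v (fst i))" using S(2) by (intro sum.cong) auto
    finally show ?thesis using eqI[of "\<lambda>i. w i * v (fst i)"] by simp
  qed
  ultimately show ?thesis using S(1,2) by (intro exI[of _ ?I] exI[of _ w]) auto
qed

end

text \<open>The hull contains a point with \<open>u + s\<^sup>2 > 0\<close> exactly if \<open>v\<close> is not convex. The factor
  \<open>\<theta> < 1\<close> turns the non-strict structural inequality into a contradiction, since the equation is
  not homogeneous.\<close>

locale hull_maximum = curvature_solution \<Omega> u for \<Omega> :: "(real^'n) set" and u +
  fixes \<theta> :: real and I :: "'i set" and w :: "'i \<Rightarrow> real" and y :: "'i \<Rightarrow> real^'n" and xm :: "real^'n" and sm :: real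
  assumes \<theta>: "0 < \<theta>" "\<theta> < 1" and finI: "finite I" and w: "\<And>i. i \<in> I \<Longrightarrow> w i > 0" "sum w I = 1"
    and y: "\<And>i. i \<in> I \<Longrightarrow> y i \<in> closure \<Omega>"
    and xm: "xm = (\<Sum>i\<in>I. w i *\<^sub>R y i)" and sm: "sm = (\<Sum>i\<in>I. w i * v (y i))"
    and maximal: "\<And>x s. (x, s) \<in> graph_hull \<Longrightarrow> u x + \<theta> * s\<^sup>2 \<le> u xm + \<theta> * sm\<^sup>2"
    and positive: "u xm + \<theta> * sm\<^sup>2 > 0"
begin

section \<open>The points entering the maximum are interior\<close>

lemma w0: "i \<in> I \<Longrightarrow> w i \<ge> 0"
  using w(1) by (simp add: less_imp_le)

lemma xm_hull: "(xm, sm) \<in> graph_hull"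
  unfolding xm sm by (intro graph_hull_sum finI w0 w(2) y)

lemma sm_neg: "sm < 0"
proof -
  have "xm \<in> closure \<Omega>" "sm \<le> 0" using xm_hull graph_hull_subset by auto
  moreover have "sm \<noteq> 0" using positive u_nonpos[OF \<open>xm \<in> closure \<Omega>\<close>] by auto
  ultimately show ?thesis by simp
qed

lemma hull_sum: "(\<And>i. i \<in> I \<Longrightarrow> Y i \<in> closure \<Omega>) \<Longrightarrow> (\<Sum>i\<in>I. w i *\<^sub>R Y i, \<Sum>i\<in>I. w i * v (Y i)) \<in> graph_hull"
  by (intro graph_hull_sum finI w0 w(2))

lemma sum_update: "i \<in> I \<Longrightarrow> (\<Sum>j\<in>I. w j *\<^sub>R (if j = i then a else f j)) = (\<Sum>j\<in>I. w j *\<^sub>R f j) + w i *\<^sub>R (a - f i)"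
  for f :: "'i \<Rightarrow> 'b::real_vector"
  using finI by (simp add: sum.remove[of I i] scaleR_diff_right)

lemma hull_update:
  assumes i: "i \<in> I" and a: "a \<in> closure \<Omega>"
  shows "(xm + w i *\<^sub>R (a - y i), sm + w i * (v a - v (y i))) \<in> graph_hull"
proof -
  have "(\<Sum>j\<in>I. w j *\<^sub>R (if j = i then a else y j), \<Sum>j\<in>I. w j * v (if j = i then a else y j)) \<in> graph_hull"
    using y a by (intro hull_sum) auto
  moreover have "(\<Sum>j\<in>I. w j * v (if j = i then a else y j)) = (\<Sum>j\<in>I. w j *\<^sub>R (if j = i then v a else v (y j)))"
    by (intro sum.cong) auto
  ultimately show ?thesis using sum_update[OF i, of a y] sum_update[OF i, of "v a" "\<lambda>j. v (y j)"]
    by (simp add: xm sm)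
qed

text \<open>As \<open>sm\<close> is negative, some \<open>y i\<close> is interior. Moving that point
  alone moves the average through a full ball about \<open>xm\<close>, which therefore lies in the
  closure of the domain.\<close>

lemma xm_in: "xm \<in> \<Omega>"
proof -
  have "\<exists>i\<in>I. y i \<in> \<Omega>"
  proof (rule ccontr)
    assume "\<not> (\<exists>i\<in>I. y i \<in> \<Omega>)"
    then have "v (y i) = 0" if "i \<in> I" for i using y[OF that] closure_cases v_frontier that by blast
    then show False using sm_neg sm by simp
  qed
  then obtain i where i: "i \<in> I" "y i \<in> \<Omega>" by blast
  then obtain e where e: "e > 0" "ball (y i) e \<subseteq> \<Omega>" using open_dom openE by blast
  have "ball xm (w i * e) \<subseteq> closure \<Omega>"
  proof
    fix x assume x: "x \<in> ball xm (w i * e)"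
    let ?a = "y i + (1 / w i) *\<^sub>R (x - xm)"
    have wi: "w i > 0" by (rule w(1)[OF i(1)])
    have "norm ((1 / w i) *\<^sub>R (x - xm)) < e"
      using x wi by (simp add: dist_norm norm_minus_commute divide_less_eq mult.commute)
    then have "?a \<in> ball (y i) e" by (simp add: dist_norm)
    then have "?a \<in> closure \<Omega>" using e(2) closure_subset by blast
    from hull_update[OF i(1) this] have "(x, sm + w i * (v ?a - v (y i))) \<in> graph_hull"
      using wi by simp
    then show "x \<in> closure \<Omega>" using graph_hull_subset by auto
  qed
  moreover have "w i * e > 0" using w(1)[OF i(1)] e(1) by simp
  ultimately have "xm \<in> interior (closure \<Omega>)" by (auto simp: mem_interior)
  then show ?thesis using convex_interior_closure[OF conv] open_dom by (simp add: interior_open)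
qed

text \<open>If \<open>y i\<close> were on the boundary, moving it inwards by \<tau> would lower the
  second coordinate by a multiple of \<open>sqrt \<tau>\<close>, while \<open>u\<close> at the first
  coordinate could decrease only at the rate \<tau>. For small \<tau> the maximum would be
  exceeded.\<close>

lemma y_in: assumes i: "i \<in> I" shows "y i \<in> \<Omega>"
proof (rule ccontr)
  assume "y i \<notin> \<Omega>"
  then have fr: "y i \<in> frontier \<Omega>" using y[OF i] closure_cases by blast
  obtain d k where k: "k > 0" "\<And>\<tau>. 0 < \<tau> \<Longrightarrow> \<tau> \<le> 1 \<Longrightarrow> y i + \<tau> *\<^sub>R d \<in> \<Omega>"
    "\<And>\<tau>. 0 < \<tau> \<Longrightarrow> \<tau> \<le> 1 \<Longrightarrow> u (y i + \<tau> *\<^sub>R d) \<le> - k * \<tau>"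
    using boundary_decay[OF fr] by blast
  let ?h = "w i *\<^sub>R d"
  \<comment> \<open>The gain of \<open>\<theta> * s\<^sup>2\<close> per \<open>sqrt \<tau>\<close>:
    the linear term of the square with \<open>v ?a \<le> - sqrt (k * \<tau>)\<close>.\<close>
  define c where "c = 2 * \<theta> * (- sm) * w i * sqrt k"
  have c: "c > 0" using \<theta> sm_neg w(1)[OF i] k(1) unfolding c_def by (intro mult_pos_pos) auto
  have drop: "u (xm + \<tau> *\<^sub>R ?h) - u xm \<le> - c * sqrt \<tau>" if \<tau>: "0 < \<tau>" "\<tau> \<le> 1" for \<tau>
  proof -
    let ?a = "y i + \<tau> *\<^sub>R d"
    have "sqrt (k * \<tau>) \<le> sqrt (- u ?a)" using k(3)[OF \<tau>] by (intro real_sqrt_le_mono) simp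
    then have va: "v ?a \<le> - sqrt (k * \<tau>)" by (simp add: v_def)
    have "?a \<in> closure \<Omega>" using k(2)[OF \<tau>] closure_subset by blast
    from maximal[OF hull_update[OF i this]] v_frontier[OF fr]
    have m: "u (xm + \<tau> *\<^sub>R ?h) + \<theta> * (sm + w i * v ?a)\<^sup>2 \<le> u xm + \<theta> * sm\<^sup>2"
      by (simp add: mult.commute)
    have "w i * v ?a \<le> w i * - sqrt (k * \<tau>)" by (intro mult_left_mono va w0 i)
    then have "(- sm) * (w i * sqrt (k * \<tau>)) \<le> (- sm) * (- (w i * v ?a))"
      using sm_neg by (intro mult_left_mono) auto
    then have "2 * (- sm) * (w i * sqrt (k * \<tau>)) \<le> 2 * sm * (w i * v ?a)" by simp
    also have "\<dots> \<le> (sm + w i * v ?a)\<^sup>2 - sm\<^sup>2" by (simp add: power2_sum)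
    finally have "\<theta> * (2 * (- sm) * (w i * sqrt (k * \<tau>))) \<le> \<theta> * ((sm + w i * v ?a)\<^sup>2 - sm\<^sup>2)"
      using \<theta> by (intro mult_left_mono) auto
    moreover have "\<theta> * (2 * (- sm) * (w i * sqrt (k * \<tau>))) = c * sqrt \<tau>"
      by (simp add: c_def real_sqrt_mult)
    ultimately show ?thesis using m by (simp add: right_diff_distrib)
  qed
  let ?D = "gradient u xm \<bullet> ?h"
  have "((\<lambda>s. u (xm + s *\<^sub>R ?h)) has_real_derivative gradient u (xm + 0 *\<^sub>R ?h) \<bullet> ?h) (at 0)"
    by (rule DERIV_line_gradient(1)[OF open_dom _ C2_u]) (use xm_in in simp)
  then have "(\<lambda>s. (u (xm + (0 + s) *\<^sub>R ?h) - u (xm + 0 *\<^sub>R ?h)) / s) \<midarrow>0\<rightarrow> ?D"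
    unfolding DERIV_def by simp
  then have "eventually (\<lambda>s. (u (xm + (0 + s) *\<^sub>R ?h) - u (xm + 0 *\<^sub>R ?h)) / s > ?D - 1) (at 0)"
    by (rule order_tendstoD) simp
  then obtain \<delta> where \<delta>: "\<delta> > 0" "\<And>s. s \<noteq> 0 \<Longrightarrow> \<bar>s\<bar> < \<delta> \<Longrightarrow> (u (xm + s *\<^sub>R ?h) - u xm) / s > ?D - 1"
    unfolding eventually_at by (auto simp: dist_real_def)
  define M where "M = \<bar>?D\<bar> + 1"
  have M: "M > 0" by (simp add: M_def)
  \<comment> \<open>The last entry of the minimum yields
    \<open>M * \<tau> \<le> c * sqrt \<tau>\<close>, and \<open>- M\<close> does not exceed
    \<open>?D - 1\<close>, the lower bound of the difference quotients.\<close>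
  define \<tau> where "\<tau> = min (min 1 (\<delta> / 2)) ((c / M)\<^sup>2)"
  have \<tau>: "0 < \<tau>" "\<tau> \<le> 1" "\<tau> < \<delta>" "\<tau> \<le> (c / M)\<^sup>2" using \<delta>(1) c M by (auto simp: \<tau>_def)
  have "sqrt \<tau> \<le> c / M" using real_sqrt_le_mono[OF \<tau>(4)] c M by simp
  then have "M * sqrt \<tau> \<le> c" using M by (simp add: field_simps)
  then have "M * sqrt \<tau> * sqrt \<tau> \<le> c * sqrt \<tau>" using \<tau>(1) by (intro mult_right_mono) auto
  then have "M * \<tau> \<le> c * sqrt \<tau>" using \<tau>(1) by (simp add: mult.assoc)
  then have "u (xm + \<tau> *\<^sub>R ?h) - u xm \<le> - M * \<tau>" using drop[OF \<tau>(1,2)] by simp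
  then have "(u (xm + \<tau> *\<^sub>R ?h) - u xm) / \<tau> \<le> - M" using \<tau>(1) by (simp add: divide_le_eq)
  moreover have "(u (xm + \<tau> *\<^sub>R ?h) - u xm) / \<tau> > ?D - 1" using \<delta>(2)[of \<tau>] \<tau> by simp
  ultimately show False by (simp add: M_def abs_if split: if_splits)
qed

text \<open>First and second order conditions along the curve in the hull on which every
  \<open>y i\<close> moves with velocity \<open>\<xi> i\<close> and the weights stay fixed.\<close>

lemma variation:
  fixes \<xi> :: "'i \<Rightarrow> real^'n"
  defines "\<zeta> \<equiv> \<Sum>i\<in>I. w i *\<^sub>R \<xi> i"
  shows "gradient u xm \<bullet> \<zeta> + 2 * \<theta> * sm * (\<Sum>i\<in>I. w i * (gradient v (y i) \<bullet> \<xi> i)) = 0"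
    and "\<zeta> \<bullet> (hessian u xm *v \<zeta>) + 2 * \<theta> * (\<Sum>i\<in>I. w i * (gradient v (y i) \<bullet> \<xi> i))\<^sup>2
      + 2 * \<theta> * sm * (\<Sum>i\<in>I. w i * (\<xi> i \<bullet> (hessian v (y i) *v \<xi> i))) \<le> 0"
proof -
  have "\<exists>d>0. \<forall>i\<in>I. \<forall>s. \<bar>s\<bar> < d \<longrightarrow> y i + s *\<^sub>R \<xi> i \<in> \<Omega>"
    using finI y_in
  proof (induction I rule: finite_induct)
    case empty
    show ?case by (intro exI[of _ 1]) auto
  next
    case (insert i J)
    then obtain d where d: "d > 0" "\<forall>i\<in>J. \<forall>s. \<bar>s\<bar> < d \<longrightarrow> y i + s *\<^sub>R \<xi> i \<in> \<Omega>" by auto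
    obtain e where e: "e > 0" "\<And>s. \<bar>s\<bar> < e \<Longrightarrow> y i + s *\<^sub>R \<xi> i \<in> \<Omega>"
      using open_line_segment[OF open_dom, of "y i"] insert.prems by blast
    show ?case using d e by (intro exI[of _ "min d e"]) auto
  qed
  then obtain d1 where d1: "d1 > 0" "\<And>i s. i \<in> I \<Longrightarrow> \<bar>s\<bar> < d1 \<Longrightarrow> y i + s *\<^sub>R \<xi> i \<in> \<Omega>" by blast
  obtain d2 where d2: "d2 > 0" "\<And>s. \<bar>s\<bar> < d2 \<Longrightarrow> xm + s *\<^sub>R \<zeta> \<in> \<Omega>"
    using open_line_segment[OF open_dom xm_in] by blast
  let ?V = "\<lambda>s. \<Sum>i\<in>I. w i * v (y i + s *\<^sub>R \<xi> i)"
  let ?V' = "\<lambda>s. \<Sum>i\<in>I. w i * (gradient v (y i + s *\<^sub>R \<xi> i) \<bullet> \<xi> i)"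
  let ?f = "\<lambda>s. u (xm + s *\<^sub>R \<zeta>) + \<theta> * (?V s * ?V s)"
  let ?f' = "\<lambda>s. gradient u (xm + s *\<^sub>R \<zeta>) \<bullet> \<zeta> + \<theta> * (?V s * ?V' s + ?V' s * ?V s)"
  let ?V'' = "\<Sum>i\<in>I. w i * (\<xi> i \<bullet> (hessian v (y i + 0 *\<^sub>R \<xi> i) *v \<xi> i))"
  have dV: "(?V has_real_derivative ?V' s) (at s)" if "\<bar>s\<bar> < min d1 d2" for s
    using that by (intro DERIV_sum DERIV_cmult DERIV_line_gradient(1)[OF open_dom d1(2) C2_v]) auto
  have dV': "(?V' has_real_derivative ?V'') (at 0)"
    using d1(1) by (intro DERIV_sum DERIV_cmult DERIV_line_gradient(2)[OF open_dom d1(2) C2_v]) auto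
  have m: "min d1 d2 > 0" using d1 d2 by simp
  have df: "(?f has_real_derivative ?f' s) (at s)" if "\<bar>s\<bar> < min d1 d2" for s
    using that by (intro DERIV_add DERIV_cmult DERIV_mult' dV DERIV_line_gradient(1)[OF open_dom d2(2) C2_u]) auto
  have df': "(?f' has_real_derivative \<zeta> \<bullet> (hessian u (xm + 0 *\<^sub>R \<zeta>) *v \<zeta>) +
      \<theta> * ((?V 0 * ?V'' + ?V' 0 * ?V' 0) + (?V' 0 * ?V' 0 + ?V'' * ?V 0))) (at 0)"
    using d1(1) d2(1) m
    by (intro DERIV_add DERIV_cmult DERIV_mult' dV dV' DERIV_line_gradient(2)[OF open_dom d2(2) C2_u]) auto
  have mx: "?f s \<le> ?f 0" if s: "\<bar>s\<bar> < min d1 d2" for s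
  proof -
    have "(\<Sum>i\<in>I. w i *\<^sub>R (y i + s *\<^sub>R \<xi> i), ?V s) \<in> graph_hull"
      using d1(2) s closure_subset by (intro hull_sum) force
    moreover have "(\<Sum>i\<in>I. w i *\<^sub>R (y i + s *\<^sub>R \<xi> i)) = xm + s *\<^sub>R \<zeta>"
      by (simp add: xm \<zeta>_def scaleR_add_right sum.distrib scaleR_sum_right mult.commute)
    ultimately show ?thesis using maximal by (simp add: sm power2_eq_square)
  qed
  have z: "?V 0 = sm" "?V' 0 = (\<Sum>i\<in>I. w i * (gradient v (y i) \<bullet> \<xi> i))"
    "?V'' = (\<Sum>i\<in>I. w i * (\<xi> i \<bullet> (hessian v (y i) *v \<xi> i)))" by (simp_all add: sm)
  show "gradient u xm \<bullet> \<zeta> + 2 * \<theta> * sm * (\<Sum>i\<in>I. w i * (gradient v (y i) \<bullet> \<xi> i)) = 0"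
    using second_derivative_max(1)[OF m df df' mx] unfolding z by (simp add: algebra_simps)
  show "\<zeta> \<bullet> (hessian u xm *v \<zeta>) + 2 * \<theta> * (\<Sum>i\<in>I. w i * (gradient v (y i) \<bullet> \<xi> i))\<^sup>2
      + 2 * \<theta> * sm * (\<Sum>i\<in>I. w i * (\<xi> i \<bullet> (hessian v (y i) *v \<xi> i))) \<le> 0"
    using second_derivative_max(2)[OF m df df' mx] unfolding z by (simp add: algebra_simps power2_eq_square)
qed

text \<open>Variation of a single point. Consequently the gradients of \<open>v\<close> at all
  \<open>y i\<close> agree, which permits a structural inequality with one fixed
  \<open>q\<close>.\<close>

lemma gradient_common:
  assumes i: "i \<in> I"
  shows "gradient u xm = (2 * \<theta> * (- sm)) *\<^sub>R gradient v (y i)"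
proof -
  have "(gradient u xm - (2 * \<theta> * (- sm)) *\<^sub>R gradient v (y i)) \<bullet> h = 0" for h
  proof -
    let ?\<xi> = "\<lambda>j. if j = i then h else 0"
    have 1: "(\<Sum>j\<in>I. w j *\<^sub>R ?\<xi> j) = w i *\<^sub>R h"
      using finI i by (simp add: sum.remove[of I i])
    have 2: "(\<Sum>j\<in>I. w j * (gradient v (y j) \<bullet> ?\<xi> j)) = w i * (gradient v (y i) \<bullet> h)"
      using finI i by (simp add: sum.remove[of I i])
    have "w i * (gradient u xm \<bullet> h + 2 * \<theta> * sm * (gradient v (y i) \<bullet> h)) = 0"
      using variation(1)[of ?\<xi>] unfolding 1 2 by (simp add: algebra_simps)
    then show ?thesis using w(1)[OF i] by (simp add: inner_diff_left inner_add_left)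
  qed
  then have "gradient u xm - (2 * \<theta> * (- sm)) *\<^sub>R gradient v (y i) = 0" by (metis inner_eq_zero_iff)
  then show ?thesis by (simp only: right_minus_eq)
qed

text \<open>If \<open>v (y i)\<close> exceeded the average of \<open>v\<close> at
  \<open>y i + s *\<^sub>R h\<close> and \<open>y i - s *\<^sub>R h\<close>, splitting
  \<open>y i\<close> into these two points would keep \<open>xm\<close> and lower \<open>sm\<close>,
  thus raising \<open>sm\<^sup>2\<close>.\<close>

lemma hessian_psd: assumes i: "i \<in> I" shows "0 \<le> h \<bullet> (hessian v (y i) *v h)"
proof -
  obtain d where d: "d > 0" "\<And>s. \<bar>s\<bar> < d \<Longrightarrow> y i + s *\<^sub>R h \<in> \<Omega>"
    using open_line_segment[OF open_dom y_in[OF i]] by blast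
  have "2 * v (y i) \<le> v (y i + s *\<^sub>R h) + v (y i - s *\<^sub>R h)" if s: "\<bar>s\<bar> < d" for s
  proof (rule ccontr)
    assume less: "\<not> ?thesis"
    let ?a = "y i + s *\<^sub>R h" and ?b = "y i - s *\<^sub>R h"
    have ab: "?a \<in> closure \<Omega>" "?b \<in> closure \<Omega>"
      using d(2)[of s] d(2)[of "- s"] s closure_subset by auto
    let ?z = "(xm + w i *\<^sub>R (?a - y i), sm + w i * (v ?a - v (y i)))"
    let ?z' = "(xm + w i *\<^sub>R (?b - y i), sm + w i * (v ?b - v (y i)))"
    have "(1 / 2) *\<^sub>R ?z + (1 / 2) *\<^sub>R ?z' \<in> graph_hull"
      using hull_update[OF i ab(1)] hull_update[OF i ab(2)]
      unfolding graph_hull_def by (intro convexD[OF convex_convex_hull]) auto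
    moreover have "(1 / 2) *\<^sub>R ?z + (1 / 2) *\<^sub>R ?z' = (xm, sm + w i * ((v ?a + v ?b) / 2 - v (y i)))"
      using average_reflection[of xm "w i *\<^sub>R (s *\<^sub>R h)"] by (simp add: field_simps)
    ultimately have "(xm, sm + w i * ((v ?a + v ?b) / 2 - v (y i))) \<in> graph_hull" by (simp only:)
    then have "u xm + \<theta> * (sm + w i * ((v ?a + v ?b) / 2 - v (y i)))\<^sup>2 \<le> u xm + \<theta> * sm\<^sup>2"
      by (rule maximal)
    then have "(sm + w i * ((v ?a + v ?b) / 2 - v (y i)))\<^sup>2 \<le> sm\<^sup>2" using \<theta> by simp
    moreover have "w i * ((v ?a + v ?b) / 2 - v (y i)) < 0"
      using less w(1)[OF i] by (intro mult_pos_neg) auto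
    ultimately show False using sm_neg
      by (simp add: abs_le_square_iff[symmetric])
  qed
  then show ?thesis by (rule midpoint_imp_psd[OF y_in[OF i] d(1)])
qed

text \<open>\<open>B\<close> is chosen so that gradient and Hessian of \<open>u\<close> at
  \<open>xm\<close> are \<theta> times those belonging to \<open>(q, T, B)\<close>. The second
  variation then says that \<open>B\<close> is dominated by the Hessians at the \<open>y i\<close>.
  The structural inequality bounds the bracket of \<open>Fop_scaled\<close> by 1, whereas the
  equation at \<open>xm\<close> makes it \<open>1 / \<theta>\<^sup>2\<close>.\<close>

lemma contradiction: False
proof -
  obtain i0 where i0: "i0 \<in> I" using w(2) by force
  define T where "T = - sm"
  have T: "T > 0" "T = (\<Sum>i\<in>I. w i * (- v (y i)))" using sm_neg by (simp_all add: T_def sm sum_negf)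
  define q where "q = gradient v (y i0)"
  have gu: "gradient u xm = (2 * \<theta> * T) *\<^sub>R q" using gradient_common[OF i0] by (simp add: T_def q_def)
  have q: "gradient v (y i) = q" if "i \<in> I" for i
    using gradient_common[OF that] gu \<theta> T(1) by (simp add: T_def)
  obtain r e where re: "q = r *\<^sub>R e" "norm e = 1" using exists_direction by blast
  define B where "B = (1 / T) *\<^sub>R ((1 / (2 * \<theta>)) *\<^sub>R hessian u xm + tensor q q)"
  note uS = gradient_has_derivative(3)[OF open_dom xm_in C2_u]
  have B: "transpose B = B"
    by (simp add: B_def transpose_scaleR transpose_add transpose_tensor uS)
  have hu: "hessian u xm = \<theta> *\<^sub>R (2 *\<^sub>R (T *\<^sub>R B - tensor q q))"
    using T(1) \<theta> by (simp add: B_def)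
  have Bs: "transpose (hessian v (y i)) = hessian v (y i)" if "i \<in> I" for i
    by (rule hessian_v_sym[OF y_in[OF that]])
  have "form_dominated I w (\<lambda>i. hessian v (y i)) B"
    unfolding form_dominated_def
  proof
    fix z
    let ?z = "\<Sum>i\<in>I. w i *\<^sub>R z i" and ?S = "\<Sum>i\<in>I. w i * (z i \<bullet> (hessian v (y i) *v z i))"
    have g: "(\<Sum>i\<in>I. w i * (gradient v (y i) \<bullet> z i)) = q \<bullet> ?z"
      by (simp add: q inner_sum_right)
    have "?z \<bullet> (hessian u xm *v ?z) + 2 * \<theta> * (q \<bullet> ?z)\<^sup>2 - 2 * \<theta> * T * ?S \<le> 0"
      using variation(2)[of z] unfolding g by (simp add: T_def)
    moreover have "?z \<bullet> (hessian u xm *v ?z) = 2 * \<theta> * (T * (?z \<bullet> (B *v ?z)) - (q \<bullet> ?z)\<^sup>2)"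
      unfolding hu by (simp add: matrix_vector_simps tensor_mult_vector inner_diff_right power2_eq_square
          inner_commute[of "\<Sum>i\<in>I. w i *\<^sub>R z i" q])
    ultimately have "2 * \<theta> * T * (?z \<bullet> (B *v ?z)) \<le> 2 * \<theta> * T * ?S" by (simp add: algebra_simps)
    then show "?z \<bullet> (B *v ?z) \<le> ?S" using \<theta> T(1) by simp
  qed
  moreover have "S1 e B > 0"
  proof -
    have "gradient u xm = (2 * \<theta> * T * r) *\<^sub>R e" unfolding gu re(1) by simp
    from pde(2)[OF xm_in this re(2)] have "S1 e (hessian u xm) > 0" .
    then have "0 < (\<theta> * 2) * T * S1 e B" using S1_square_root[OF re, of "\<theta> * 2" T B] by (simp add: hu)
    moreover have "(\<theta> * 2) * T > 0" using \<theta> T(1) by simp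
    ultimately show ?thesis by (simp only: zero_less_mult_pos)
  qed
  moreover have "S1 e (hessian v (y i)) > 0" if "i \<in> I" for i
    using pde_v(2)[OF y_in[OF that], of r e] q[OF that] re by simp
  moreover have "\<forall>i\<in>I. 0 \<le> S2 e (hessian v (y i))"
    using S2_bounds_psd(1)[OF re(2) Bs hessian_psd] by blast
  moreover have "4 * ((- v (y i))\<^sup>2 * s2 (hessian v (y i)) - - v (y i) * ((norm q)\<^sup>2 * S1 e (hessian v (y i))))
     + 16 * (- v (y i))^4 * ((norm q)\<^sup>2 * S2 e (hessian v (y i))) \<le> 1" if "i \<in> I" for i
    using pde_v(1)[OF y_in[OF that]] unfolding q[OF that] FF_def direction_forms[OF re] by linarith
  moreover have "\<theta>\<^sup>2 \<le> 1" using \<theta> by (simp add: abs_square_le_1)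
  ultimately have le: "4 * (T\<^sup>2 * s2 B - T * ((norm q)\<^sup>2 * S1 e B)) + \<theta>\<^sup>2 * (16 * T^4 * ((norm q)\<^sup>2 * S2 e B)) \<le> 1"
    using structural_inequality[OF re(2) B Bs _ _ _ finI w0 w(2), where a = "(norm q)\<^sup>2" and c = 1 and \<kappa> = "\<theta>\<^sup>2"
        and t = "\<lambda>i. - v (y i)" and T = T] T(2) by simp
  have "1 = \<theta>\<^sup>2 * (4 * (T\<^sup>2 * s2 B - T * ((norm q)\<^sup>2 * S1 e B)) + \<theta>\<^sup>2 * (16 * T^4 * ((norm q)\<^sup>2 * S2 e B)))"
  proof -
    have "gradient u xm = \<theta> *\<^sub>R ((2 * T) *\<^sub>R q)" unfolding gu by simp
    then show ?thesis
      using pde(1)[OF xm_in] Fop_scaled[OF B, of \<theta> T q] unfolding hu direction_forms[OF re] by simp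
  qed
  also have "\<dots> \<le> \<theta>\<^sup>2 * 1" using le by (intro mult_left_mono) auto
  also have "\<dots> < 1" using \<theta> by (simp add: power2_eq_square mult_less_cancel_left1 mult_strict_mono'[of \<theta> 1 \<theta> 1, simplified])
  finally show False by simp
qed

end

context curvature_solution
begin

section \<open>Convexity of the square root and a point of full rank\<close>

lemma hull_bound:
  assumes z: "(x, s) \<in> graph_hull"
  shows "u x + s\<^sup>2 \<le> 0"
proof (rule ccontr)
  assume pos: "\<not> u x + s\<^sup>2 \<le> 0"
  have "x \<in> closure \<Omega>" using z graph_hull_subset by auto
  then have ux: "u x \<le> 0" by (rule u_nonpos)
  \<comment> \<open>The mean of 1 and the value at which \<open>u x + \<theta> * s\<^sup>2\<close>
    vanishes.\<close>
  define \<theta> where "\<theta> = (- u x / s\<^sup>2 + 1) / 2"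
  have s2: "s\<^sup>2 > 0" using pos ux by (smt (verit) zero_le_power2)
  have "- u x / s\<^sup>2 < 1" "0 \<le> - u x / s\<^sup>2" using pos ux s2 by (simp_all add: divide_simps)
  then have \<theta>: "0 < \<theta>" "\<theta> < 1" by (simp_all add: \<theta>_def)
  have "\<theta> * s\<^sup>2 = (- u x + s\<^sup>2) / 2" using s2 by (simp add: \<theta>_def field_simps)
  then have ppos: "u x + \<theta> * s\<^sup>2 > 0" using pos by simp
  let ?\<Phi> = "\<lambda>z. u (fst z) + \<theta> * (snd z)\<^sup>2"
  have "continuous_on graph_hull ?\<Phi>"
    using graph_hull_subset
    by (intro continuous_intros continuous_on_compose2[OF cont_u]) auto
  from continuous_attains_sup[OF compact_graph_hull _ this] z
  obtain m where m: "m \<in> graph_hull" "\<And>z. z \<in> graph_hull \<Longrightarrow> ?\<Phi> z \<le> ?\<Phi> m"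
    by blast
  obtain I :: "((real^'n) \<times> real) set" and w where I: "finite I" "\<forall>i\<in>I. w i > 0 \<and> fst i \<in> closure \<Omega>" "sum w I = 1"
    "fst m = (\<Sum>i\<in>I. w i *\<^sub>R fst i)" "snd m = (\<Sum>i\<in>I. w i * v (fst i))"
    using graph_hull_representation[OF m(1)] by blast
  interpret hull_maximum \<Omega> u \<theta> I w fst "fst m" "snd m"
  proof unfold_locales
    show "u x + \<theta> * s\<^sup>2 \<le> u (fst m) + \<theta> * (snd m)\<^sup>2" if "(x, s) \<in> graph_hull" for x s
      using m(2)[OF that] by simp
    show "u (fst m) + \<theta> * (snd m)\<^sup>2 > 0" using m(2)[OF z] ppos by simp
  qed (use \<theta> I in auto)
  show False by (rule contradiction)
qed

text \<open>The midpoint of a chord of the graph lies in the hull, and the bound there says that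
  \<open>v\<close> is not above the chord.\<close>

theorem v_convex:
  assumes x: "x \<in> \<Omega>"
  shows "0 \<le> h \<bullet> (hessian v x *v h)"
proof -
  obtain d where d: "d > 0" "\<And>s. \<bar>s\<bar> < d \<Longrightarrow> x + s *\<^sub>R h \<in> \<Omega>"
    using open_line_segment[OF open_dom x] by blast
  have "2 * v x \<le> v (x + s *\<^sub>R h) + v (x - s *\<^sub>R h)" if s: "\<bar>s\<bar> < d" for s
  proof -
    let ?a = "x + s *\<^sub>R h" and ?b = "x - s *\<^sub>R h"
    have ab: "?a \<in> closure \<Omega>" "?b \<in> closure \<Omega>"
      using d(2)[of s] d(2)[of "- s"] s closure_subset by auto
    have "(1 / 2) *\<^sub>R (?a, v ?a) + (1 / 2) *\<^sub>R (?b, v ?b) \<in> graph_hull"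
      unfolding graph_hull_def using ab
      by (intro convexD[OF convex_convex_hull] hull_inc imageI) auto
    moreover have "(1 / 2) *\<^sub>R (?a, v ?a) + (1 / 2) *\<^sub>R (?b, v ?b) = (x, (v ?a + v ?b) / 2)"
      using average_reflection[of x "s *\<^sub>R h"] by (simp add: field_simps)
    ultimately have "(x, (v ?a + v ?b) / 2) \<in> graph_hull" by (simp only:)
    then have "u x + ((v ?a + v ?b) / 2)\<^sup>2 \<le> 0" by (rule hull_bound)
    then have "((v ?a + v ?b) / 2)\<^sup>2 \<le> (v x)\<^sup>2" using v_sq[of x] x closure_subset[of \<Omega>] by auto
    then show ?thesis using v_neg[OF x] by (simp add: abs_le_square_iff[symmetric])
  qed
  then show ?thesis by (rule midpoint_imp_psd[OF x d(1)])
qed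

lemma exists_pos_def_point: "\<exists>x\<in>\<Omega>. pos_def (hessian v x)"
proof -
  obtain x0 where x0: "x0 \<in> \<Omega>" using nonempty by blast
  obtain R where R: "R > 0" "\<And>x. x \<in> closure \<Omega> \<Longrightarrow> norm x \<le> R"
    using compact_imp_bounded[OF compact_cl] bounded_pos by blast
  \<comment> \<open>With this value \<open>\<epsilon> * (norm x)\<^sup>2\<close> stays below
    \<open>- v x0\<close> on the closure, so no boundary point, where \<open>v\<close> vanishes, can
    be extremal.\<close>
  define \<epsilon> where "\<epsilon> = - v x0 / (2 * R\<^sup>2)"
  have \<epsilon>: "\<epsilon> > 0" "\<epsilon> * R\<^sup>2 < - v x0"
    using v_neg[OF x0] R(1) by (simp_all add: \<epsilon>_def divide_simps)
  let ?f = "\<lambda>x. \<epsilon> * (norm x)\<^sup>2 - v x"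
  have "continuous_on (closure \<Omega>) ?f" using cont_v by (intro continuous_intros) auto
  then obtain x where x: "x \<in> closure \<Omega>" "\<And>y. y \<in> closure \<Omega> \<Longrightarrow> ?f y \<le> ?f x"
    using continuous_attains_sup[OF compact_cl, of ?f] nonempty by auto
  have x\<Omega>: "x \<in> \<Omega>"
  proof (rule ccontr)
    assume "x \<notin> \<Omega>"
    then have "v x = 0" using x(1) closure_cases v_frontier by blast
    moreover have "\<epsilon> * (norm x)\<^sup>2 \<le> \<epsilon> * R\<^sup>2" using R(2)[OF x(1)] \<epsilon> by (intro mult_left_mono power_mono) auto
    moreover have "?f x0 \<le> ?f x" using x(2)[of x0] x0 closure_subset by blast
    moreover have "0 \<le> \<epsilon> * (norm x0)\<^sup>2" using \<epsilon> by simp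
    ultimately show False using \<epsilon>(2) by linarith
  qed
  have "2 * \<epsilon> * (norm h)\<^sup>2 \<le> h \<bullet> (hessian v x *v h)" for h
  proof -
    obtain d where d: "d > 0" "\<And>s. \<bar>s\<bar> < d \<Longrightarrow> x + s *\<^sub>R h \<in> \<Omega>"
      using open_line_segment[OF open_dom x\<Omega>] by blast
    let ?g = "\<lambda>s. \<epsilon> * ((norm x)\<^sup>2 + 2 * s * (x \<bullet> h) + s\<^sup>2 * (norm h)\<^sup>2) - v (x + s *\<^sub>R h)"
    let ?g' = "\<lambda>s. \<epsilon> * (2 * (x \<bullet> h) + 2 * s * (norm h)\<^sup>2) - gradient v (x + s *\<^sub>R h) \<bullet> h"
    have n: "(norm (x + s *\<^sub>R h))\<^sup>2 = (norm x)\<^sup>2 + 2 * s * (x \<bullet> h) + s\<^sup>2 * (norm h)\<^sup>2" for s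
      unfolding power2_norm_eq_inner
      by (simp add: inner_add_left inner_add_right inner_commute[of h x] power2_eq_square distrib_left)
    have "(?g has_real_derivative ?g' s) (at s)" if "\<bar>s\<bar> < d" for s
      using d(2)[OF that]
      by (auto intro!: derivative_eq_intros DERIV_line_gradient(1)[OF open_dom _ C2_v])
    moreover have "(?g' has_real_derivative \<epsilon> * (2 * (norm h)\<^sup>2) - h \<bullet> (hessian v (x + 0 *\<^sub>R h) *v h)) (at 0)"
      using x\<Omega> by (auto intro!: derivative_eq_intros DERIV_line_gradient(2)[OF open_dom _ C2_v])
    moreover have "?g s \<le> ?g 0" if "\<bar>s\<bar> < d" for s
      using x(2)[of "x + s *\<^sub>R h"] d(2)[OF that] closure_subset[of \<Omega>] by (auto simp: n)
    ultimately have "\<epsilon> * (2 * (norm h)\<^sup>2) - h \<bullet> (hessian v (x + 0 *\<^sub>R h) *v h) \<le> 0"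
      by (rule second_derivative_max(2)[OF d(1)])
    then show ?thesis by simp
  qed
  then have "0 < h \<bullet> (hessian v x *v h)" if "h \<noteq> 0" for h
    using that \<epsilon>(1) by (smt (verit) mult_pos_pos zero_less_norm_iff zero_less_power)
  then show ?thesis using x\<Omega> hessian_v_sym[OF x\<Omega>] by (auto simp: pos_def_def)
qed

end

section \<open>Second-order jets of polynomial functions\<close>

text \<open>\<open>f1\<close> and \<open>f2\<close> are the first two derivatives of \<open>f\<close> along a curve, as functions of the
  position, velocity and acceleration.\<close>

definition jet :: "('a::real_normed_vector \<Rightarrow> real) \<Rightarrow> ('a \<Rightarrow> 'a \<Rightarrow> real) \<Rightarrow> ('a \<Rightarrow> 'a \<Rightarrow> 'a \<Rightarrow> real) \<Rightarrow> bool" where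
  "jet f f1 f2 \<longleftrightarrow>
     real_polynomial_function (\<lambda>z. f1 (fst z) (snd z)) \<and>
     real_polynomial_function (\<lambda>z. f2 (fst z) (fst (snd z)) (snd (snd z))) \<and>
     (\<forall>\<gamma> a s. (\<gamma> has_vector_derivative a) (at s) \<longrightarrow>
        ((\<lambda>s. f (\<gamma> s)) has_real_derivative f1 (\<gamma> s) a) (at s)) \<and>
     (\<forall>\<gamma> \<gamma>1 b s. (\<gamma> has_vector_derivative \<gamma>1 s) (at s) \<longrightarrow> (\<gamma>1 has_vector_derivative b) (at s) \<longrightarrow>
        ((\<lambda>s. f1 (\<gamma> s) (\<gamma>1 s)) has_real_derivative f2 (\<gamma> s) (\<gamma>1 s) b) (at s)) \<and>
     (\<forall>z z1 z2. f2 z z1 z2 = f2 z z1 0 + f1 z z2) \<and> (\<forall>z. linear (f1 z))"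

lemma jetD:
  assumes "jet f f1 f2"
  shows "real_polynomial_function (\<lambda>z. f1 (fst z) (snd z))"
    and "real_polynomial_function (\<lambda>z. f2 (fst z) (fst (snd z)) (snd (snd z)))"
    and "(\<gamma> has_vector_derivative a) (at s) \<Longrightarrow> ((\<lambda>s. f (\<gamma> s)) has_real_derivative f1 (\<gamma> s) a) (at s)"
    and "(\<gamma> has_vector_derivative \<gamma>1 s) (at s) \<Longrightarrow> (\<gamma>1 has_vector_derivative b) (at s) \<Longrightarrow>
        ((\<lambda>s. f1 (\<gamma> s) (\<gamma>1 s)) has_real_derivative f2 (\<gamma> s) (\<gamma>1 s) b) (at s)"
    and "f2 z z1 z2 = f2 z z1 0 + f1 z z2"
    and "linear (f1 z)"
  using assms unfolding jet_def by (elim conjE, assumption | elim conjE allE; fast)+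

lemma real_polynomial_function_linear_comp:
  "real_polynomial_function f \<Longrightarrow> bounded_linear h \<Longrightarrow> real_polynomial_function (\<lambda>x. f (h x))"
  using real_polynomial_function_compose[OF polynomial_function_bounded_linear, of h f] by (simp add: o_def)

text \<open>Sum and product rule, by induction over polynomial functions. That \<open>f1\<close> and
  \<open>f2\<close> are again polynomials matters because they are then Lipschitz on bounded sets
  with constants depending only on the bound.\<close>

lemma jet_exists: "real_polynomial_function f \<Longrightarrow> \<exists>f1 f2. jet f f1 f2"
proof (induction f rule: real_polynomial_function.induct)
  case (linear g)
  note blg = linear
  interpret bounded_linear g by (rule blg)
  have bl: "bounded_linear (\<lambda>z :: 'a \<times> 'a. g (snd z))" "bounded_linear (\<lambda>z :: 'a \<times> 'a \<times> 'a. g (snd (snd z)))"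
    by (intro bounded_linear_compose[OF blg] bounded_linear_snd bounded_linear_compose[OF bounded_linear_snd])+
  have "((\<lambda>s. g (\<gamma> s)) has_real_derivative g a) (at s)" if "(\<gamma> has_vector_derivative a) (at s)" for \<gamma> a s
    using has_vector_derivative[OF that] by (simp add: has_real_derivative_iff_has_vector_derivative)
  then have "jet g (\<lambda>z z1. g z1) (\<lambda>z z1 z2. g z2)"
    using bl linear_axioms unfolding jet_def by (auto intro: real_polynomial_function.intros(1) simp: zero)
  then show ?case by blast
next
  case (const c)
  have "jet (\<lambda>x. c) (\<lambda>z z1. 0) (\<lambda>z z1 z2. 0)"
    unfolding jet_def by (auto intro: real_polynomial_function.intros(2) simp: linear_iff)
  then show ?case by blast
next
  case (add f g)
  then obtain f1 f2 g1 g2 where fg: "jet f f1 f2" "jet g g1 g2" by blast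
  have "jet (\<lambda>x. f x + g x) (\<lambda>z z1. f1 z z1 + g1 z z1) (\<lambda>z z1 z2. f2 z z1 z2 + g2 z z1 z2)"
    unfolding jet_def
  proof (intro conjI allI impI)
    show "f2 z z1 z2 + g2 z z1 z2 = f2 z z1 0 + g2 z z1 0 + (f1 z z2 + g1 z z2)" for z z1 z2
    proof -
      have "f2 z z1 z2 = f2 z z1 0 + f1 z z2" "g2 z z1 z2 = g2 z z1 0 + g1 z z2"
        by (rule jetD(5)[OF fg(1)], rule jetD(5)[OF fg(2)])
      then show ?thesis by simp
    qed
    show "linear (\<lambda>z1. f1 z z1 + g1 z z1)" for z
      by (intro linear_compose_add jetD(6)[OF fg(1)] jetD(6)[OF fg(2)])
  qed (use real_polynomial_function.intros(3)[OF jetD(1)[OF fg(1)] jetD(1)[OF fg(2)]]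
      real_polynomial_function.intros(3)[OF jetD(2)[OF fg(1)] jetD(2)[OF fg(2)]] in
      \<open>simp_all add: DERIV_add[OF jetD(3)[OF fg(1)] jetD(3)[OF fg(2)]] DERIV_add[OF jetD(4)[OF fg(1)] jetD(4)[OF fg(2)]]\<close>)
  then show ?case by blast
next
  case (mult f g)
  then obtain f1 f2 g1 g2 where fg: "jet f f1 f2" "jet g g1 g2" by blast
  let ?h1 = "\<lambda>z z1. f1 z z1 * g z + f z * g1 z z1"
  let ?h2 = "\<lambda>z z1 z2. (f2 z z1 z2 * g z + 2 * (f1 z z1 * g1 z z1)) + f z * g2 z z1 z2"
  have 1: "real_polynomial_function (\<lambda>z. ?h1 (fst z) (snd z))"
    using jetD(1)[OF fg(1)] jetD(1)[OF fg(2)]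
    by (intro real_polynomial_function.intros(3) real_polynomial_function.intros(4)
        real_polynomial_function_linear_comp[OF mult.hyps(1) bounded_linear_fst]
        real_polynomial_function_linear_comp[OF mult.hyps(2) bounded_linear_fst]) auto
  have bl: "bounded_linear (\<lambda>z :: 'a \<times> 'a \<times> 'a. (fst z, fst (snd z)))"
    by (intro bounded_linear_Pair bounded_linear_fst bounded_linear_compose[OF bounded_linear_fst] bounded_linear_snd)
  have f1: "real_polynomial_function (\<lambda>z :: 'a \<times> 'a \<times> 'a. f1 (fst z) (fst (snd z)))"
    and g1: "real_polynomial_function (\<lambda>z :: 'a \<times> 'a \<times> 'a. g1 (fst z) (fst (snd z)))"
    using real_polynomial_function_linear_comp[OF jetD(1)[OF fg(1)] bl]
      real_polynomial_function_linear_comp[OF jetD(1)[OF fg(2)] bl] by simp_all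
  have 2: "real_polynomial_function (\<lambda>z. ?h2 (fst z) (fst (snd z)) (snd (snd z)))"
    using jetD(1,2)[OF fg(1)] jetD(1,2)[OF fg(2)]
    by (intro real_polynomial_function.intros(3) real_polynomial_function.intros(4) real_polynomial_function.intros(2) f1 g1
        real_polynomial_function_linear_comp[OF mult.hyps(1) bounded_linear_fst]
        real_polynomial_function_linear_comp[OF mult.hyps(2) bounded_linear_fst]) auto
  have 3: "((\<lambda>s. f (\<gamma> s) * g (\<gamma> s)) has_real_derivative ?h1 (\<gamma> s) a) (at s)"
    if "(\<gamma> has_vector_derivative a) (at s)" for \<gamma> a s
    using DERIV_mult[OF jetD(3)[OF fg(1) that] jetD(3)[OF fg(2) that]] by (simp add: mult.commute)
  have 4: "((\<lambda>s. ?h1 (\<gamma> s) (\<gamma>1 s)) has_real_derivative ?h2 (\<gamma> s) (\<gamma>1 s) b) (at s)"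
    if \<gamma>: "(\<gamma> has_vector_derivative \<gamma>1 s) (at s)" "(\<gamma>1 has_vector_derivative b) (at s)" for \<gamma> \<gamma>1 b s
  proof -
    have "((\<lambda>s. f (\<gamma> s)) has_real_derivative f1 (\<gamma> s) (\<gamma>1 s)) (at s)"
      "((\<lambda>s. g (\<gamma> s)) has_real_derivative g1 (\<gamma> s) (\<gamma>1 s)) (at s)"
      "((\<lambda>s. f1 (\<gamma> s) (\<gamma>1 s)) has_real_derivative f2 (\<gamma> s) (\<gamma>1 s) b) (at s)"
      "((\<lambda>s. g1 (\<gamma> s) (\<gamma>1 s)) has_real_derivative g2 (\<gamma> s) (\<gamma>1 s) b) (at s)"
      using jetD(3)[OF fg(1) \<gamma>(1)] jetD(3)[OF fg(2) \<gamma>(1)] jetD(4)[OF fg(1) \<gamma>] jetD(4)[OF fg(2) \<gamma>]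
      by simp_all
    from DERIV_add[OF DERIV_mult[OF this(3,2)] DERIV_mult[OF this(1,4)]]
    show ?thesis by (simp add: algebra_simps)
  qed
  have 5: "?h2 z z1 z2 = ?h2 z z1 0 + ?h1 z z2" for z z1 z2
  proof -
    have "f2 z z1 z2 = f2 z z1 0 + f1 z z2" "g2 z z1 z2 = g2 z z1 0 + g1 z z2"
      by (rule jetD(5)[OF fg(1)], rule jetD(5)[OF fg(2)])
    then show ?thesis by (simp add: algebra_simps)
  qed
  have 6: "linear (?h1 z)" for z
    using jetD(6)[OF fg(1), of z] jetD(6)[OF fg(2), of z] unfolding linear_iff by (simp add: algebra_simps)
  have "jet (\<lambda>x. f x * g x) ?h1 ?h2"
    unfolding jet_def using 1 2 3 4 5 6 by blast
  then show ?case by blast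
qed

lemma real_polynomial_function_lipschitz_bounded:
  fixes f :: "'a::real_normed_vector \<Rightarrow> real"
  assumes "real_polynomial_function f"
  shows "\<exists>L\<ge>0. \<forall>x y. norm x \<le> R \<longrightarrow> norm y \<le> R \<longrightarrow> \<bar>f x - f y\<bar> \<le> L * norm (x - y)"
  using assms
proof (induction f rule: real_polynomial_function.induct)
  case (linear g)
  then obtain K where "K \<ge> 0" "\<And>x. norm (g x) \<le> norm x * K" using bounded_linear.nonneg_bounded by metis
  then show ?case using linear
    by (intro exI[of _ K]) (metis bounded_linear.linear linear_diff mult.commute real_norm_def)
next
  case (const c)
  then show ?case by (intro exI[of _ 0]) auto
next
  case (add f g)
  then obtain L M where "L \<ge> 0" "\<And>x y. norm x \<le> R \<Longrightarrow> norm y \<le> R \<Longrightarrow> \<bar>f x - f y\<bar> \<le> L * norm (x - y)"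
    "M \<ge> 0" "\<And>x y. norm x \<le> R \<Longrightarrow> norm y \<le> R \<Longrightarrow> \<bar>g x - g y\<bar> \<le> M * norm (x - y)" by metis
  then show ?case by (intro exI[of _ "L + M"]) (fastforce simp: distrib_right)
next
  case (mult f g)
  then obtain L M where L: "L \<ge> 0" "\<And>x y. norm x \<le> R \<Longrightarrow> norm y \<le> R \<Longrightarrow> \<bar>f x - f y\<bar> \<le> L * norm (x - y)"
    and M: "M \<ge> 0" "\<And>x y. norm x \<le> R \<Longrightarrow> norm y \<le> R \<Longrightarrow> \<bar>g x - g y\<bar> \<le> M * norm (x - y)" by metis
  define A where "A = \<bar>f 0\<bar> + L * \<bar>R\<bar>"
  define B where "B = \<bar>g 0\<bar> + M * \<bar>R\<bar>"
  have fA: "\<bar>f x\<bar> \<le> A" if "norm x \<le> R" for x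
  proof -
    have "norm (0 :: 'a) \<le> R" using order_trans[OF norm_ge_zero that] by simp
    from L(2)[OF that this] have "\<bar>f x - f 0\<bar> \<le> L * norm x" by simp
    also have "\<dots> \<le> L * \<bar>R\<bar>" using L(1) that by (intro mult_left_mono) auto
    finally show ?thesis by (simp add: A_def)
  qed
  have gB: "\<bar>g x\<bar> \<le> B" if "norm x \<le> R" for x
  proof -
    have "norm (0 :: 'a) \<le> R" using order_trans[OF norm_ge_zero that] by simp
    from M(2)[OF that this] have "\<bar>g x - g 0\<bar> \<le> M * norm x" by simp
    also have "\<dots> \<le> M * \<bar>R\<bar>" using M(1) that by (intro mult_left_mono) auto
    finally show ?thesis by (simp add: B_def)
  qed
  have AB: "A \<ge> 0" "B \<ge> 0" using L(1) M(1) by (simp_all add: A_def B_def)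
  have "\<bar>f x * g x - f y * g y\<bar> \<le> (A * M + B * L) * norm (x - y)" if "norm x \<le> R" "norm y \<le> R" for x y
  proof -
    have "f x * g x - f y * g y = f x * (g x - g y) + (f x - f y) * g y" by (simp add: algebra_simps)
    also have "\<bar>\<dots>\<bar> \<le> \<bar>f x\<bar> * \<bar>g x - g y\<bar> + \<bar>f x - f y\<bar> * \<bar>g y\<bar>"
      using abs_triangle_ineq[of "f x * (g x - g y)" "(f x - f y) * g y"] by (simp add: abs_mult)
    also have "\<dots> \<le> A * (M * norm (x - y)) + (L * norm (x - y)) * B"
      using fA[OF that(1)] gB[OF that(2)] L M that AB
      by (intro add_mono mult_mono) auto
    finally show ?thesis by (simp add: algebra_simps)
  qed
  then show ?case using AB L(1) M(1) by (intro exI[of _ "A * M + B * L"]) auto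
qed

section \<open>The equation as a polynomial in gradient, value and Hessian\<close>

definition FFz :: "(real^'n) \<times> real \<times> (real^'n^'n) \<Rightarrow> real" where
  "FFz z = FF (fst z) (fst (snd z)) (snd (snd z))"

lemma FFz_polynomial: "real_polynomial_function (FFz :: (real^'n) \<times> real \<times> (real^'n^'n) \<Rightarrow> real)"
proof -
  have q: "real_polynomial_function (\<lambda>z :: (real^'n) \<times> real \<times> (real^'n^'n). fst z $ i)" for i
    by (intro real_polynomial_function.intros(1) bounded_linear_compose[OF bounded_linear_vec_nth] bounded_linear_fst)
  have t: "real_polynomial_function (\<lambda>z :: (real^'n) \<times> real \<times> (real^'n^'n). fst (snd z))"
    by (intro real_polynomial_function.intros(1) bounded_linear_compose[OF bounded_linear_fst] bounded_linear_snd)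
  have B: "real_polynomial_function (\<lambda>z :: (real^'n) \<times> real \<times> (real^'n^'n). snd (snd z) $ i $ j)" for i j
    by (intro real_polynomial_function.intros(1) bounded_linear_compose[OF bounded_linear_vec_nth]
        bounded_linear_compose[OF bounded_linear_snd] bounded_linear_snd)
  have FF: "FF q t B = 4 * (t^2 * (((\<Sum>i\<in>UNIV. B $ i $ i)^2 - (\<Sum>i\<in>UNIV. \<Sum>k\<in>UNIV. B $ i $ k * B $ k $ i)) / 2)
       - t * ((\<Sum>i\<in>UNIV. q $ i * q $ i) * (\<Sum>i\<in>UNIV. B $ i $ i) - (\<Sum>i\<in>UNIV. \<Sum>j\<in>UNIV. q $ i * B $ i $ j * q $ j)))
     + 16 * t^4 * ((\<Sum>i\<in>UNIV. q $ i * q $ i) * (((\<Sum>i\<in>UNIV. B $ i $ i)^2 - (\<Sum>i\<in>UNIV. \<Sum>k\<in>UNIV. B $ i $ k * B $ k $ i)) / 2)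
       - (\<Sum>i\<in>UNIV. B $ i $ i) * (\<Sum>i\<in>UNIV. \<Sum>j\<in>UNIV. q $ i * B $ i $ j * q $ j)
       + (\<Sum>i\<in>UNIV. (\<Sum>j\<in>UNIV. B $ i $ j * q $ j)^2))" for q :: "real^'n" and t B
  proof -
    have "(norm q)\<^sup>2 = (\<Sum>i\<in>UNIV. q $ i * q $ i)" unfolding power2_norm_eq_inner by (simp add: inner_vec_def)
    moreover have "(norm (B *v q))\<^sup>2 = (\<Sum>i\<in>UNIV. (\<Sum>j\<in>UNIV. B $ i $ j * q $ j)^2)"
      unfolding power2_norm_eq_inner by (simp add: inner_vec_def matrix_vector_mult_def power2_eq_square)
    ultimately show ?thesis
      unfolding FF_def s2_def trace_def inner_matrix_vector by (simp add: matrix_matrix_mult_def)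
  qed
  show ?thesis unfolding FFz_def FF
    by (intro real_polynomial_function.intros(3) real_polynomial_function.intros(4) real_polynomial_function.intros(2)
        real_polynomial_function_diff real_polynomial_function_divide real_polynomial_function_power
        real_polynomial_function_sum q t B) auto
qed

lemma has_vector_derivative_Pair:
  "(f has_vector_derivative a) (at x) \<Longrightarrow> (g has_vector_derivative b) (at x) \<Longrightarrow>
   ((\<lambda>s. (f s, g s)) has_vector_derivative (a, b)) (at x)"
  unfolding has_vector_derivative_def by (drule (1) has_derivative_Pair) simp

lemma second_derivative_neg:
  fixes f :: "real \<Rightarrow> real"
  assumes d: "d > 0" and f: "\<And>s. \<bar>s\<bar> < d \<Longrightarrow> (f has_real_derivative f' s) (at s)"
    and f': "(f' has_real_derivative l) (at 0)" and l: "f' 0 = 0" "l < 0"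
  shows "\<exists>e>0. \<forall>s. 0 < \<bar>s\<bar> \<and> \<bar>s\<bar> < e \<longrightarrow> f s < f 0"
proof -
  obtain e1 where e1: "e1 > 0" "\<And>h. 0 < h \<Longrightarrow> h < e1 \<Longrightarrow> f' (0 + h) < f' 0"
    using DERIV_neg_dec_right[OF f' l(2)] by auto
  obtain e2 where e2: "e2 > 0" "\<And>h. 0 < h \<Longrightarrow> h < e2 \<Longrightarrow> f' 0 < f' (0 - h)"
    using DERIV_neg_dec_left[OF f' l(2)] by auto
  let ?e = "min d (min e1 e2)"
  have "f s < f 0" if s: "0 < \<bar>s\<bar>" "\<bar>s\<bar> < ?e" for s
  proof (cases "s > 0")
    case True
    obtain z where z: "0 < z" "z < s" "f s - f 0 = (s - 0) * f' z"
      using MVT2[OF True, of f f'] f s by force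
    have "f' z < 0" using e1(2)[of z] z s True l by auto
    then have "s * f' z < 0" using True by (simp add: mult_pos_neg)
    then show ?thesis using z by simp
  next
    case False
    then have s0: "s < 0" using s by simp
    obtain z where z: "s < z" "z < 0" "f 0 - f s = (0 - s) * f' z"
      using MVT2[OF s0, of f f'] f s s0 by force
    have "f' z > 0" using e2(2)[of "- z"] z s s0 l by auto
    then have "- s * f' z > 0" using s0 by (intro mult_pos_pos) auto
    then show ?thesis using z by simp
  qed
  then show ?thesis using d e1(1) e2(1) by (intro exI[of _ ?e]) auto
qed

section \<open>Infinitesimal form of the structural inequality\<close>

lemma S1_nonneg_psd:
  fixes B :: "real^'n^'n"
  assumes "norm e = 1" "transpose B = B" "\<And>x. 0 \<le> x \<bullet> (B *v x)"
  shows "0 \<le> S1 e B"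
  unfolding sum_proj_axis_form[OF assms(1,2), symmetric] by (intro sum_nonneg assms(3))

lemma FF_direction:
  assumes "q = r *\<^sub>R e" "norm e = 1"
  shows "FF q t B = 4 * (t\<^sup>2 * s2 B - t * ((norm q)\<^sup>2 * S1 e B)) + 16 * t^4 * ((norm q)\<^sup>2 * S2 e B)"
  unfolding FF_def direction_forms[OF assms] ..

text \<open>If the trace orthogonal to \<open>e\<close> were 0, then \<open>S2\<close> would vanish
  by the bounds above and \<open>s2 B = (e \<bullet> (B *v e))\<^sup>2 - (norm (B *v e))\<^sup>2
  \<le> 0\<close>, so \<open>FF\<close> could not be positive. Applied to matrices that need not be
  Hessians of the solution.\<close>

lemma S1_pos_psd:
  fixes B :: "real^'n^'n"
  assumes q: "q = r *\<^sub>R e" "norm e = 1" and B: "transpose B = B" "\<And>x. 0 \<le> x \<bullet> (B *v x)"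
    and FF: "FF q t B > 0"
  shows "S1 e B > 0"
proof (rule ccontr)
  assume "\<not> S1 e B > 0"
  then have S1: "S1 e B = 0" using S1_nonneg_psd[OF q(2) B] by linarith
  then have S2: "S2 e B = 0" using S2_bounds_psd[OF q(2) B] by simp
  have tr: "trace B = e \<bullet> (B *v e)" using S1 by (simp add: S1_def)
  have "\<bar>e \<bullet> (B *v e)\<bar> \<le> norm (B *v e)" using Cauchy_Schwarz_ineq2[of e "B *v e"] q(2) by simp
  from power_mono[OF this, of 2] have "(e \<bullet> (B *v e))\<^sup>2 \<le> (norm (B *v e))\<^sup>2" by simp
  then have "s2 B \<le> 0" using S2 by (simp add: S2_def tr power2_eq_square)
  then have "4 * (t\<^sup>2 * s2 B) \<le> 0" by (simp add: mult_nonneg_nonpos)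
  then show False using FF unfolding FF_direction[OF q] S1 S2 by simp
qed

lemma has_vector_derivative_quadratic_curve:
  fixes a :: "'a::real_normed_vector"
  shows "((\<lambda>s. a + s *\<^sub>R b + (s\<^sup>2) *\<^sub>R c) has_vector_derivative b + (2 * s) *\<^sub>R c) (at s)"
  by (auto intro!: derivative_eq_intros simp: has_vector_derivative_def scaleR_add_right algebra_simps)

text \<open>Along \<open>B\<^sub>0 + s Z + s\<^sup>2 C\<close> the matrices at \<open>\<plusminus>s\<close> dominate \<open>B\<^sub>0\<close> in the sense of
  \<open>form_dominated\<close>, so a critical point at \<open>s = 0\<close> cannot be a strict local maximum.\<close>

lemma infinitesimal_structural_inequality:
  fixes Bh X \<Theta> :: "real^'n^'n"
  assumes jet: "jet FFz f1 f2" and Bh: "pos_def Bh" "Bh ** X = mat 1" "X ** Bh = mat 1"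
    and Y: "transpose Y = Y"
    and pos: "FF q t (transpose \<Theta> ** Bh ** \<Theta>) > 0"
    and crit: "f1 (q, t, transpose \<Theta> ** Bh ** \<Theta>) (0, t1, transpose \<Theta> ** Y ** \<Theta>) = 0"
  shows "0 \<le> f2 (q, t, transpose \<Theta> ** Bh ** \<Theta>) (0, t1, transpose \<Theta> ** Y ** \<Theta>)
              (0, 0, 2 *\<^sub>R (transpose \<Theta> ** (Y ** X ** Y) ** \<Theta>))"
proof (rule ccontr)
  define B0 Z C where "B0 = transpose \<Theta> ** Bh ** \<Theta>" and "Z = transpose \<Theta> ** Y ** \<Theta>"
    and "C = transpose \<Theta> ** (Y ** X ** Y) ** \<Theta>"
  assume "\<not> ?thesis"
  then have neg: "f2 (q, t, B0) (0, t1, Z) (0, 0, 2 *\<^sub>R C) < 0" by (simp add: B0_def Z_def C_def)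
  have form: "x \<bullet> ((transpose \<Theta> ** M ** \<Theta>) *v y) = (\<Theta> *v x) \<bullet> (M *v (\<Theta> *v y))" for M x y
    using inner_transpose_matrix[of x \<Theta> "M *v (\<Theta> *v y)"] by (simp only: matrix_vector_mul_assoc[symmetric])
  have symBh: "transpose Bh = Bh" using Bh(1) by (simp add: pos_def_def)
  have posX: "pos_def X" using pos_def_matrix_inv[OF Bh(1)] matrix_inv_eq[OF Bh(2,3)] by simp
  have symX: "transpose X = X" using posX by (simp add: pos_def_def)
  have psd: "0 \<le> x \<bullet> (M *v x)" if "pos_def M" for M :: "real^'n^'n" and x
    using that unfolding pos_def_def by (cases "x = 0") (auto simp: less_imp_le)
  have YXY: "x \<bullet> ((Y ** X ** Y) *v y) = (Y *v x) \<bullet> (X *v (Y *v y))" for x y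
    using sym_matrix_inner[OF Y, of x "X *v (Y *v y)"] inner_commute[of "X *v (Y *v y)" "Y *v x"]
    by (simp only: matrix_vector_mul_assoc[symmetric])
  have symB0: "transpose B0 = B0" unfolding B0_def sym_matrix_iff form using sym_matrix_inner[OF symBh] by blast
  have symZ: "transpose Z = Z" unfolding Z_def sym_matrix_iff form using sym_matrix_inner[OF Y] by blast
  have symC: "transpose C = C" unfolding C_def sym_matrix_iff form YXY using sym_matrix_inner[OF symX] by blast
  have psdB0: "0 \<le> x \<bullet> (B0 *v x)" for x unfolding B0_def form by (rule psd[OF Bh(1)])
  have psdC: "0 \<le> x \<bullet> (C *v x)" for x unfolding C_def form YXY by (rule psd[OF posX])
  define Bs where "Bs s = B0 + s *\<^sub>R Z + (s\<^sup>2) *\<^sub>R C" for s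
  have symBs: "transpose (Bs s) = Bs s" for s by (simp add: Bs_def transpose_add transpose_scaleR symB0 symZ symC)
  \<comment> \<open>The form \<open>Bh\<close> evaluated at
    \<open>?a + s *\<^sub>R (X *v ?b)\<close>. Its quadratic term is the reason for the correction
    \<open>(s\<^sup>2) *\<^sub>R C\<close> in the curve.\<close>
  have square: "0 \<le> x \<bullet> (B0 *v x) + 2 * s * (y \<bullet> (Z *v x)) + s\<^sup>2 * (y \<bullet> (C *v y))" for x y s
  proof -
    let ?a = "\<Theta> *v x" and ?b = "Y *v (\<Theta> *v y)"
    have B1: "Bh *v (X *v ?b) = ?b" using matrix_vector_mul_assoc[of Bh X ?b] Bh(2) by simp
    have B2: "(X *v ?b) \<bullet> (Bh *v ?a) = ?a \<bullet> ?b"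
      using sym_matrix_inner[OF symBh, of "X *v ?b" ?a] B1 by simp
    have "(?a + s *\<^sub>R (X *v ?b)) \<bullet> (Bh *v (?a + s *\<^sub>R (X *v ?b)))
       = ?a \<bullet> (Bh *v ?a) + 2 * s * (?a \<bullet> ?b) + s\<^sup>2 * (?b \<bullet> (X *v ?b))"
      using B1 B2 by (simp add: matrix_vector_simps inner_add_left inner_add_right power2_eq_square
          distrib_left inner_commute[of "X *v ?b" ?b])
    moreover have "0 \<le> (?a + s *\<^sub>R (X *v ?b)) \<bullet> (Bh *v (?a + s *\<^sub>R (X *v ?b)))" by (rule psd[OF Bh(1)])
    moreover have "y \<bullet> (Z *v x) = ?a \<bullet> ?b"
      unfolding Z_def form using sym_matrix_inner[OF Y, of "\<Theta> *v y" ?a] by simp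
    ultimately show ?thesis unfolding B0_def C_def form YXY by simp
  qed
  define J where "J s = FF q (t + s * t1) (Bs s)" for s
  let ?z = "\<lambda>s. (q, t + s * t1, Bs s)" and ?z' = "\<lambda>s. (0 :: real^'n, t1, Z + (2 * s) *\<^sub>R C)"
  have z: "(?z has_vector_derivative ?z' s) (at s)" for s
    unfolding Bs_def
    by (intro has_vector_derivative_Pair has_vector_derivative_quadratic_curve)
       (auto intro!: derivative_eq_intros simp: has_real_derivative_iff_has_vector_derivative[symmetric])
  have z': "(?z' has_vector_derivative (0, 0, 2 *\<^sub>R C)) (at s)" for s
    by (intro has_vector_derivative_Pair)
       (auto intro!: derivative_eq_intros simp: has_vector_derivative_def)
  have J: "J = (\<lambda>s. FFz (?z s))" by (simp add: J_def FFz_def fun_eq_iff)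
  have dJ: "(J has_real_derivative f1 (?z s) (?z' s)) (at s)" for s
    unfolding J by (rule jetD(3)[OF jet z])
  have dJ': "((\<lambda>s. f1 (?z s) (?z' s)) has_real_derivative f2 (?z 0) (?z' 0) (0, 0, 2 *\<^sub>R C)) (at 0)"
    by (rule jetD(4)[OF jet, of ?z ?z' 0, OF z z'[of 0]])
  have Bs0: "Bs 0 = B0" by (simp add: Bs_def)
  have "f1 (?z 0) (?z' 0) = 0" using crit by (simp add: Bs0 B0_def Z_def)
  moreover have "f2 (?z 0) (?z' 0) (0, 0, 2 *\<^sub>R C) < 0" using neg by (simp add: Bs0)
  ultimately obtain \<epsilon> where \<epsilon>: "\<epsilon> > 0" "\<And>s. 0 < \<bar>s\<bar> \<Longrightarrow> \<bar>s\<bar> < \<epsilon> \<Longrightarrow> J s < J 0"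
    using second_derivative_neg[OF zero_less_one dJ dJ'] by blast
  obtain r e where re: "q = r *\<^sub>R e" "norm e = 1" using exists_direction by blast
  have S1B0: "S1 e B0 > 0" using S1_pos_psd[OF re symB0 psdB0] pos by (simp add: B0_def)
  have "continuous (at 0) (\<lambda>s. S1 e (Bs s))"
    unfolding S1_def Bs_def trace_def by (simp add: matrix_vector_simps)
  then have "((\<lambda>s. S1 e (Bs s)) \<longlongrightarrow> S1 e B0) (at 0)" by (simp add: continuous_at Bs0)
  then have "eventually (\<lambda>s. S1 e (Bs s) > 0) (at 0)" using S1B0 by (rule order_tendstoD)
  then obtain \<delta> where \<delta>: "\<delta> > 0" "\<And>s. s \<noteq> 0 \<Longrightarrow> \<bar>s\<bar> < \<delta> \<Longrightarrow> S1 e (Bs s) > 0"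
    unfolding eventually_at by (auto simp: dist_real_def)
  define \<sigma> where "\<sigma> = min \<epsilon> \<delta> / 2"
  have \<sigma>: "\<sigma> > 0" "\<sigma> < \<epsilon>" "\<sigma> < \<delta>" using \<epsilon>(1) \<delta>(1) by (auto simp: \<sigma>_def)
  define sg where "sg i = (if i then \<sigma> else - \<sigma>)" for i :: bool
  have sg: "0 < \<bar>sg i\<bar>" "\<bar>sg i\<bar> < \<epsilon>" "\<bar>sg i\<bar> < \<delta>" "sg i \<noteq> 0" "(sg i)\<^sup>2 = \<sigma>\<^sup>2" for i
    using \<sigma> by (auto simp: sg_def)
  \<comment> \<open>The maximum with 0 meets the sign condition on the level; it remains below
    \<open>J 0\<close> because \<open>J 0\<close> is positive.\<close>
  define c where "c = max 0 (max (J (sg True)) (J (sg False)))"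
  have J0: "J 0 > 0" using pos by (simp add: J_def Bs0 B0_def)
  have cJ: "c < J 0" using \<epsilon>(2)[OF sg(1,2)] J0 by (simp add: c_def)
  have "form_dominated UNIV (\<lambda>_. 1 / 2) (\<lambda>i. Bs (sg i)) B0"
    unfolding form_dominated_def
  proof
    fix z :: "bool \<Rightarrow> real^'n"
    let ?m = "(1 / 2) *\<^sub>R (z True + z False)" and ?o = "(1 / 2) *\<^sub>R (z True - z False)"
    have zz: "z True = ?m + ?o" "z False = ?m - ?o"
      by (simp_all add: scaleR_add_right[symmetric] scaleR_diff_right[symmetric])
    have form2: "(a + b) \<bullet> (M *v (a + b)) + (a - b) \<bullet> (M *v (a - b)) = 2 * (a \<bullet> (M *v a)) + 2 * (b \<bullet> (M *v b))"
      "transpose M = M \<Longrightarrow> (a + b) \<bullet> (M *v (a + b)) - (a - b) \<bullet> (M *v (a - b)) = 4 * (a \<bullet> (M *v b))"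
      for M :: "real^'n^'n" and a b
      using sym_matrix_inner[of M a b]
      by (simp_all add: matrix_vector_simps inner_add_left inner_add_right inner_diff_left inner_diff_right)
    \<comment> \<open>In terms of the mean \<open>?m\<close> and the half difference
      \<open>?o\<close> of the two test vectors, the bracket is the expression in
      \<open>square\<close>, and the last term is nonnegative since \<open>C\<close> is positive
      semidefinite.\<close>
    have "(\<Sum>i\<in>UNIV. 1 / 2 * (z i \<bullet> (Bs (sg i) *v z i))) =
        ?m \<bullet> (B0 *v ?m) + (?o \<bullet> (B0 *v ?o) + 2 * \<sigma> * (?m \<bullet> (Z *v ?o)) + \<sigma>\<^sup>2 * (?m \<bullet> (C *v ?m))) + \<sigma>\<^sup>2 * (?o \<bullet> (C *v ?o))"
    proof -
      have "(\<Sum>i\<in>UNIV. 1 / 2 * (z i \<bullet> (Bs (sg i) *v z i))) =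
         (1 / 2) * ((?m + ?o) \<bullet> (Bs \<sigma> *v (?m + ?o)) + (?m - ?o) \<bullet> (Bs (- \<sigma>) *v (?m - ?o)))"
        unfolding zz(1)[symmetric] zz(2)[symmetric] by (simp add: UNIV_bool sg_def)
      also have "\<dots> = (1 / 2) * (((?m + ?o) \<bullet> (B0 *v (?m + ?o)) + (?m - ?o) \<bullet> (B0 *v (?m - ?o)))
          + \<sigma> * ((?m + ?o) \<bullet> (Z *v (?m + ?o)) - (?m - ?o) \<bullet> (Z *v (?m - ?o)))
          + \<sigma>\<^sup>2 * ((?m + ?o) \<bullet> (C *v (?m + ?o)) + (?m - ?o) \<bullet> (C *v (?m - ?o))))"
        by (simp only: Bs_def bounded_bilinear.add_left[OF bounded_bilinear_matrix_vector]
            bounded_bilinear.scaleR_left[OF bounded_bilinear_matrix_vector] inner_add_right[of _ "_ *v _"]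
            inner_scaleR_right power2_minus) (simp add: algebra_simps)
      finally show ?thesis unfolding form2(1) form2(2)[OF symZ] by (simp add: algebra_simps)
    qed
    moreover have "0 \<le> \<sigma>\<^sup>2 * (?o \<bullet> (C *v ?o))" by (rule mult_nonneg_nonneg[OF zero_le_power2 psdC])
    moreover have "(\<Sum>i\<in>UNIV. (1 / 2) *\<^sub>R z i) = ?m" by (simp add: UNIV_bool scaleR_add_right add.commute)
    ultimately show "(\<Sum>i\<in>UNIV. (1 / 2) *\<^sub>R z i) \<bullet> (B0 *v (\<Sum>i\<in>UNIV. (1 / 2) *\<^sub>R z i))
        \<le> (\<Sum>i\<in>UNIV. 1 / 2 * (z i \<bullet> (Bs (sg i) *v z i)))"
      using square[of ?o \<sigma> ?m] by simp
  qed
  moreover have "4 * ((t + sg i * t1)\<^sup>2 * s2 (Bs (sg i)) - (t + sg i * t1) * ((norm q)\<^sup>2 * S1 e (Bs (sg i))))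
      + 16 * (t + sg i * t1)^4 * ((norm q)\<^sup>2 * S2 e (Bs (sg i))) \<le> c" for i
    unfolding FF_direction[OF re, symmetric] J_def[symmetric] by (cases i) (auto simp: c_def)
  moreover have "t = (\<Sum>i\<in>UNIV. 1 / 2 * (t + sg i * t1))" by (simp add: UNIV_bool sg_def field_simps)
  moreover have "c \<ge> 0" by (simp add: c_def)
  ultimately have "4 * (t\<^sup>2 * s2 B0 - t * ((norm q)\<^sup>2 * S1 e B0)) + 1 * (16 * t^4 * ((norm q)\<^sup>2 * S2 e B0)) \<le> c"
    using structural_inequality[OF re(2) symB0, where I = "UNIV :: bool set" and w = "\<lambda>_. 1 / 2" and Bs = "\<lambda>i. Bs (sg i)"
        and a = "(norm q)\<^sup>2" and c = c and \<kappa> = 1 and t = "\<lambda>i. t + sg i * t1" and T = t]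
      symBs S1B0 \<delta>(2)[OF sg(4,3)] S2_bounds_psd(1)[OF re(2) symB0 psdB0]
    by (simp add: UNIV_bool)
  then have "J 0 \<le> c" unfolding J_def Bs0 using FF_direction[OF re, of t B0] by simp
  then show False using cJ by simp
qed

lemma norm_transpose: "norm (transpose A) = norm A" for A :: "real^'n^'n"
proof -
  have "A \<bullet> A = transpose A \<bullet> transpose A"
    unfolding inner_matrix_trace by (simp add: trace_mul_sym[of A "transpose A"])
  then show ?thesis by (simp add: norm_eq_sqrt_inner)
qed

text \<open>Along \<open>s *\<^sub>R B\<close> the function is \<open>s\<^sup>2 * Q - s * L\<close>
  with \<open>L \<ge> 0\<close>, so its derivative at 1 is \<open>2 * FF q t B + L\<close>. This
  keeps the denominator of the multiple \<open>c\<close> in the next lemma away from 0.\<close>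

lemma FFz_radial_derivative:
  fixes B :: "real^'n^'n"
  assumes jet: "jet FFz f1 f2" and B: "transpose B = B" "\<And>x. 0 \<le> x \<bullet> (B *v x)"
    and t: "t > 0" and FF: "FF q t B \<ge> 1 / 2"
  shows "f1 (q, t, B) (0, 0, B) \<ge> 1 / 2"
proof -
  define Q where "Q = 4 * t\<^sup>2 * s2 B + 16 * t^4 * ((norm q)\<^sup>2 * s2 B - trace B * (q \<bullet> (B *v q)) + (norm (B *v q))\<^sup>2)"
  define L where "L = 4 * t * ((norm q)\<^sup>2 * trace B - q \<bullet> (B *v q))"
  have FFs: "FF q t (s *\<^sub>R B) = s\<^sup>2 * Q - s * L" for s
    unfolding FF_def s2_scaleR trace_scaleR
    by (simp add: Q_def L_def matrix_vector_simps power_mult_distrib power2_eq_square algebra_simps)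
  have "((\<lambda>s. (q, t, B + (s - 1) *\<^sub>R B)) has_vector_derivative (0, 0, B)) (at 1)"
    by (intro has_vector_derivative_Pair)
       (auto intro!: derivative_eq_intros simp: has_vector_derivative_def)
  from jetD(3)[OF jet this] have "((\<lambda>s. FF q t (s *\<^sub>R B)) has_real_derivative f1 (q, t, B) (0, 0, B)) (at 1)"
    by (simp add: FFz_def scaleR_diff_left)
  moreover have "((\<lambda>s. FF q t (s *\<^sub>R B)) has_real_derivative 2 * Q - L) (at 1)"
    unfolding FFs by (auto intro!: derivative_eq_intros)
  ultimately have "f1 (q, t, B) (0, 0, B) = 2 * Q - L" by (rule DERIV_unique)
  moreover have "L \<ge> 0"
  proof -
    obtain r e where re: "q = r *\<^sub>R e" "norm e = 1" using exists_direction by blast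
    show ?thesis unfolding L_def direction_forms(1)[OF re] using t S1_nonneg_psd[OF re(2) B] by simp
  qed
  ultimately show ?thesis using FF FFs[of 1] by simp
qed

text \<open>With \<open>\<Theta> = 1 - X P\<close> one has \<open>\<Theta>\<^sup>T (B + P) \<Theta> = B - S\<close> for \<open>S = P - P X P\<close>. The twice
  differentiated equation at \<open>B\<close> is compared with the infinitesimal structural inequality at
  \<open>B - S\<close>; subtracting a multiple \<open>c = O(|S| + |Y X P|)\<close> of \<open>B + P\<close> from \<open>Y\<close> restores the
  criticality that the passage to \<open>B - S\<close> destroys.\<close>

lemma key_inequality:
  assumes jet: "jet (FFz :: (real^'n) \<times> real \<times> (real^'n^'n) \<Rightarrow> real) f1 f2" and R: "R \<ge> 0"
  shows "\<exists>C\<ge>0. \<forall>q t B P X Y W b. norm q \<le> R \<and> norm t \<le> R \<and> norm B \<le> R \<and> norm P \<le> R \<and> norm X \<le> R \<and> norm Y \<le> R \<and>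
    norm b \<le> 1 \<and> t > 0 \<and> transpose P = P \<and> transpose Y = Y \<and> P ** P = P \<and>
    pos_def (B + P) \<and> (B + P) ** X = mat 1 \<and> X ** (B + P) = mat 1 \<and> FF q t (B - (P - P ** X ** P)) \<ge> 1 / 2 \<and>
    f1 (q, t, B) (B *v (X *v (P *v b)), - (q \<bullet> (X *v (P *v b))), Y) = 0 \<and>
    f2 (q, t, B) (B *v (X *v (P *v b)), - (q \<bullet> (X *v (P *v b))), Y)
       (Y *v (X *v (P *v b)), - ((X *v (P *v b)) \<bullet> (B *v (X *v (P *v b)))), W) = 0 \<longrightarrow>
    f1 (q, t, B) (0, 0, W - 2 *\<^sub>R (Y ** X ** Y)) \<le> C * (norm (P - P ** X ** P) + norm (Y ** X ** P))"
proof -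
  have mm: "norm (M ** N) \<le> a * b" if "norm M \<le> a" "norm N \<le> b" for M N :: "real^'n^'n" and a b
    by (rule order_trans[OF norm_matrix_matrix_le mult_mono])
       (use that norm_ge_zero[of M] order_trans[OF norm_ge_zero that(1)] in auto)
  have mv: "norm (M *v x) \<le> a * b" if "norm M \<le> a" "norm x \<le> b" for M :: "real^'n^'n" and x a b
    by (rule order_trans[OF norm_matrix_vector_le mult_mono])
       (use that norm_ge_zero[of M] order_trans[OF norm_ge_zero that(1)] in auto)
  have ns: "norm (c *\<^sub>R x) \<le> a * b" if "\<bar>c\<bar> \<le> a" "norm x \<le> b" for c a b and x :: "real^'n^'n"
    unfolding norm_scaleR by (rule mult_mono) (use that in auto)
  have ni: "norm (x \<bullet> y) \<le> a * b" if "norm x \<le> a" "norm y \<le> b" for x y :: "real^'n" and a b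
    unfolding real_norm_def by (rule order_trans[OF Cauchy_Schwarz_ineq2 mult_mono])
       (use that order_trans[OF norm_ge_zero that(1)] in auto)
  have nt: "norm (transpose x) \<le> a" if "norm x \<le> a" for x :: "real^'n^'n" and a
    using that by (simp add: norm_transpose)
  have nd: "norm (x - y) \<le> a + b" if "norm x \<le> a" "norm y \<le> b" for x y :: "real^'n^'n" and a b
    using norm_triangle_ineq4[of x y] that by linarith
  have na: "norm (x + y) \<le> a + b" if "norm x \<le> a" "norm y \<le> b" for x y :: "real^'n^'n" and a b
    using norm_triangle_ineq[of x y] that by linarith
  have np: "norm (x, y) \<le> a + b" if "norm x \<le> a" "norm y \<le> b" for x :: "'x::real_normed_vector" and y :: "'y::real_normed_vector" and a b
    using norm_Pair_le[of x y] that by linarith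
  \<comment> \<open>\<open>D\<close> will bound \<open>norm S + norm U\<close>, \<open>YB\<close>
    the conjugated matrix \<open>Y - F\<close>, \<open>K\<close> the ratio of \<open>c\<close> to
    \<delta>, and \<open>M1\<close>, \<open>M2\<close> the arguments at which \<open>f1\<close> and
    \<open>f2\<close> are compared.\<close>
  define D where "D = R + R * R * R + R * R * R"
  define YB where "YB = R + (D + D + R * R * D)"
  define M1 where "M1 = (R + (R + (R + D))) + (D + (R * (R * (R * 1)) + YB))"
  obtain L1 where L1: "L1 \<ge> 0"
    "\<And>z z1 z' z1'. norm (z, z1) \<le> M1 \<Longrightarrow> norm (z', z1') \<le> M1 \<Longrightarrow> \<bar>f1 z z1 - f1 z' z1'\<bar> \<le> L1 * norm ((z, z1) - (z', z1'))"
    using real_polynomial_function_lipschitz_bounded[OF jetD(1)[OF jet], of M1] by (metis fst_conv snd_conv)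
  define K where "K = 2 * L1 * (4 + R * R)"
  define ZB where "ZB = YB + K * D * (R + D)"
  define EK where "EK = R * R + R * R + R * D + 2 * (K * YB) + K * (K * D) * (R + D)"
  define M2 where "M2 = (R + (R + (R + D))) + ((D + (R * (R * (R * 1)) + ZB))
     + (D + ((R * (R * 1)) * D + 2 * (R * R * R + EK * D))))"
  obtain L2 where L2: "L2 \<ge> 0"
    "\<And>z z1 z2 z' z1' z2'. norm (z, z1, z2) \<le> M2 \<Longrightarrow> norm (z', z1', z2') \<le> M2 \<Longrightarrow>
      \<bar>f2 z z1 z2 - f2 z' z1' z2'\<bar> \<le> L2 * norm ((z, z1, z2) - (z', z1', z2'))"
    using real_polynomial_function_lipschitz_bounded[OF jetD(2)[OF jet], of M2] by (metis fst_conv snd_conv)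
  define C where "C = L2 * (1 + ((1 + ((2 + R * R) + K * (R + D))) + (1 + (R * R + 2 * EK))))"
  have D0: "D \<ge> 0" "YB \<ge> R" "K \<ge> 0" using R L1(1) by (simp_all add: D_def YB_def K_def)
  then have EK0: "EK \<ge> 0" "ZB \<ge> YB" using R by (simp_all add: EK_def ZB_def)
  show ?thesis
  proof (intro exI[of _ C] conjI allI impI)
    show "C \<ge> 0" unfolding C_def using L2(1) R D0 EK0 by simp
    fix q :: "real^'n" and t :: real and B P X Y W :: "real^'n^'n" and b :: "real^'n"
    define S U w where "S = P - P ** X ** P" and "U = Y ** X ** P" and "w = X *v (P *v b)"
    assume "norm q \<le> R \<and> norm t \<le> R \<and> norm B \<le> R \<and> norm P \<le> R \<and> norm X \<le> R \<and> norm Y \<le> R \<and>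
      norm b \<le> 1 \<and> t > 0 \<and> transpose P = P \<and> transpose Y = Y \<and> P ** P = P \<and>
      pos_def (B + P) \<and> (B + P) ** X = mat 1 \<and> X ** (B + P) = mat 1 \<and> FF q t (B - (P - P ** X ** P)) \<ge> 1 / 2 \<and>
      f1 (q, t, B) (B *v (X *v (P *v b)), - (q \<bullet> (X *v (P *v b))), Y) = 0 \<and>
      f2 (q, t, B) (B *v (X *v (P *v b)), - (q \<bullet> (X *v (P *v b))), Y)
         (Y *v (X *v (P *v b)), - ((X *v (P *v b)) \<bullet> (B *v (X *v (P *v b)))), W) = 0"
    then have nq: "norm q \<le> R" "norm t \<le> R" "norm B \<le> R" "norm P \<le> R" "norm X \<le> R" "norm Y \<le> R" "norm b \<le> 1"
      and t: "t > 0" and sym: "transpose P = P" "transpose Y = Y" and PP: "P ** P = P"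
      and Bh: "pos_def (B + P)" "(B + P) ** X = mat 1" "X ** (B + P) = mat 1"
      and FF: "FF q t (B - S) \<ge> 1 / 2"
      and pde1: "f1 (q, t, B) (B *v w, - (q \<bullet> w), Y) = 0"
      and pde2: "f2 (q, t, B) (B *v w, - (q \<bullet> w), Y) (Y *v w, - (w \<bullet> (B *v w)), W) = 0"
      unfolding S_def w_def by blast+
    define H where "H = B + P"
    note Hh = Bh[folded H_def]
    have symX: "transpose X = X" using pos_def_matrix_inv[OF Bh(1)] matrix_inv_eq[OF Bh(2,3)] by (simp add: pos_def_def)
    have can: "P ** (P ** M) = P ** M" "X ** (H ** M) = M" "H ** (X ** M) = M" for M
      using PP Hh(2,3) by (simp_all add: matrix_mul_assoc)
    have canv: "H *v (X *v z) = z" for z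
      using Hh(2) by (simp add: matrix_vector_mul_assoc)
    have PPv: "P *v (P *v z) = P *v z" for z
      using PP by (simp add: matrix_vector_mul_assoc)
    define \<Theta> where "\<Theta> = mat 1 - X ** P"
    have T\<Theta>: "transpose \<Theta> = mat 1 - P ** X"
      by (simp add: \<Theta>_def transpose_diff matrix_transpose_mul sym symX)
    note ms = matrix_mult_simps matrix_mul_assoc[symmetric] can PP
    have tU: "transpose U = P ** (X ** Y)" by (simp add: U_def matrix_transpose_mul sym symX)
    have B: "B = H - P" by (simp add: H_def)
    have conjH: "transpose \<Theta> ** H ** \<Theta> = B - S"
      unfolding T\<Theta> unfolding \<Theta>_def S_def B by (simp add: ms Hh)
    define F where "F = U + transpose U - P ** X ** U"
    have conjY: "transpose \<Theta> ** Y ** \<Theta> = Y - F"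
      unfolding T\<Theta> F_def tU unfolding \<Theta>_def U_def by (simp add: ms)
    \<comment> \<open>Along \<open>w\<close> the gradient component moves with velocity
      \<open>S *v b\<close>. Replacing it by 0, as the infinitesimal inequality with fixed
      \<open>q\<close> requires, thus costs only a multiple of \<open>norm S\<close>.\<close>
    have Bw: "B *v w = S *v b"
      unfolding B w_def S_def by (simp add: matrix_vector_simps canv PPv matrix_vector_mul_assoc[symmetric])
    have Yw: "Y *v w = U *v b" unfolding w_def U_def by (simp add: matrix_vector_mul_assoc[symmetric])
    define t1 where "t1 = - (q \<bullet> w)"
    define \<delta> where "\<delta> = norm S + norm U"
    have \<delta>: "norm S \<le> \<delta>" "norm U \<le> \<delta>" "\<delta> \<ge> 0" by (simp_all add: \<delta>_def)
    have SD: "norm S \<le> R + R * R * R" "norm U \<le> R * R * R"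
      unfolding S_def U_def by (intro nd mm nq)+
    have \<delta>D: "\<delta> \<le> D" using SD by (simp add: \<delta>_def D_def)
    have nw: "norm w \<le> R * (R * 1)" unfolding w_def by (intro mv nq)
    have nt1: "norm t1 \<le> R * (R * (R * 1))" unfolding t1_def norm_minus_cancel by (intro ni nq nw)
    have nSb: "norm (S *v b) \<le> \<delta>" "norm (U *v b) \<le> \<delta>" 
      using mv[OF \<delta>(1) nq(7)] mv[OF \<delta>(2) nq(7)] by simp_all
    have nF: "norm F \<le> \<delta> + \<delta> + R * R * \<delta>"
      unfolding F_def by (intro nd na mm nt \<delta> nq)
    have nBS: "norm (B - S) \<le> R + D" using nd[OF nq(3) \<delta>(1)] \<delta>D by linarith
    have "norm F \<le> D + D + R * R * D"
      using nF \<delta>D mult_left_mono[OF \<delta>D, of "R * R"] R by auto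
    then have nYF: "norm (Y - F) \<le> YB" unfolding YB_def by (intro nd nq)
    \<comment> \<open>The quotient for which \<open>f1\<close> vanishes at \<open>(0, t1, Z)\<close>
      below. Its numerator is of order \<delta>, because it differs by that much from the once
      differentiated equation.\<close>
    define c where "c = f1 (q, t, B - S) (0, t1, Y - F) / f1 (q, t, B - S) (0, 0, B - S)"
    have den: "f1 (q, t, B - S) (0, 0, B - S) \<ge> 1 / 2"
    proof (rule FFz_radial_derivative[OF jet _ _ t FF])
      have form: "x \<bullet> ((transpose \<Theta> ** H ** \<Theta>) *v y) = (\<Theta> *v x) \<bullet> (H *v (\<Theta> *v y))" for x y
        using inner_transpose_matrix[of x \<Theta> "H *v (\<Theta> *v y)"] by (simp only: matrix_vector_mul_assoc[symmetric])
      show "0 \<le> x \<bullet> ((B - S) *v x)" for x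
        using Hh(1) unfolding conjH[symmetric] form pos_def_def by (cases "\<Theta> *v x = 0") (auto simp: less_imp_le)
      have "transpose H = H" using Hh(1) by (simp add: pos_def_def)
      then show "transpose (B - S) = B - S"
        unfolding sym_matrix_iff conjH[symmetric] form using sym_matrix_inner by blast
    qed
    have "\<bar>f1 (q, t, B - S) (0, t1, Y - F)\<bar> \<le> L1 * ((4 + R * R) * \<delta>)"
    proof -
      have "norm ((q, t, B - S), (0 :: real^'n, t1, Y - F)) \<le> M1" unfolding M1_def
        by (intro np nq nBS nt1 nYF) (simp add: D0)
      moreover have "norm ((q, t, B), (S *v b, t1, Y)) \<le> M1" unfolding M1_def
        by (intro np nq nt1 order_trans[OF nq(3)] order_trans[OF nSb(1)] order_trans[OF nq(6)]) (simp_all add: D0 \<delta>D)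
      moreover have "f1 (q, t, B) (S *v b, t1, Y) = 0" using pde1 by (simp only: Bw t1_def)
      ultimately have "\<bar>f1 (q, t, B - S) (0, t1, Y - F)\<bar>
          \<le> L1 * norm (((q, t, B - S), (0, t1, Y - F)) - ((q, t, B), (S *v b, t1, Y)))"
        using L1(2)[of "(q, t, B - S)" "(0, t1, Y - F)" "(q, t, B)" "(S *v b, t1, Y)"] by simp
      also have "((q, t, B - S), (0, t1, Y - F)) - ((q, t, B), (S *v b, t1, Y)) = - ((0, 0, S), (S *v b, 0, F))"
        by simp
      also have "norm (- ((0 :: real^'n, 0 :: real, S), (S *v b, 0 :: real, F))) \<le> (0 + (0 + \<delta>)) + (\<delta> + (0 + (\<delta> + \<delta> + R * R * \<delta>)))"
        unfolding norm_minus_cancel by (intro np \<delta> nSb nF) simp_all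
      also have "\<dots> = (4 + R * R) * \<delta>" by (simp add: algebra_simps)
      finally show ?thesis using L1(1) by (simp add: mult_left_mono)
    qed
    moreover have "\<bar>c\<bar> \<le> 2 * \<bar>f1 (q, t, B - S) (0, t1, Y - F)\<bar>"
      using den mult_left_mono[OF den, of "2 * \<bar>f1 (q, t, B - S) (0, t1, Y - F)\<bar>"]
      unfolding c_def abs_divide by (simp add: divide_le_eq)
    ultimately have c: "\<bar>c\<bar> \<le> K * \<delta>" by (simp add: K_def algebra_simps)
    have cD: "\<bar>c\<bar> \<le> K * D" using c mult_left_mono[OF \<delta>D D0(3)] by linarith
    define Z where "Z = Y - F - c *\<^sub>R (B - S)"
    have nZ: "norm Z \<le> ZB" unfolding Z_def ZB_def by (intro nd ns nYF cD nBS)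
    have nYZ: "norm (Y - Z) \<le> (\<delta> + \<delta> + R * R * \<delta>) + K * \<delta> * (R + D)"
    proof -
      have "Y - Z = F + c *\<^sub>R (B - S)" by (simp add: Z_def)
      then show ?thesis using na[OF nF ns[OF c nBS]] by simp
    qed
    define Yh where "Yh = Y - c *\<^sub>R H"
    have symYh: "transpose Yh = Yh" using Hh(1) by (simp add: Yh_def transpose_diff transpose_scaleR sym pos_def_def)
    have conjYh: "transpose \<Theta> ** Yh ** \<Theta> = Z"
      unfolding Yh_def Z_def conjY[symmetric] conjH[symmetric] by (simp add: matrix_mult_simps)
    \<comment> \<open>The amount by which the conjugate of \<open>Yh ** X ** Yh\<close> falls short
      of \<open>Y ** X ** Y\<close>. Every summand contains \<open>U\<close> or \<open>c\<close> and
      is therefore of order \<delta>.\<close>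
    define E where "E = transpose U ** X ** Y + Y ** X ** U - transpose U ** X ** U + (2 * c) *\<^sub>R (Y - F) - (c * c) *\<^sub>R (B - S)"
    have conjYXY: "transpose \<Theta> ** (Yh ** X ** Yh) ** \<Theta> = Y ** X ** Y - E"
    proof -
      have "Yh ** X ** Yh = Y ** X ** Y - (2 * c) *\<^sub>R Y + (c * c) *\<^sub>R H"
      proof -
        have "Yh ** X ** Yh = Y ** (X ** Y) - c *\<^sub>R Y - c *\<^sub>R (Y - c *\<^sub>R H)"
          unfolding Yh_def by (simp add: ms Hh)
        then show ?thesis
          unfolding mult_2 scaleR_add_left scaleR_diff_right by (simp add: matrix_mul_assoc)
      qed
      moreover have "transpose \<Theta> ** (Y ** X ** Y) ** \<Theta> = Y ** X ** Y - (transpose U ** X ** Y + Y ** X ** U - transpose U ** X ** U)"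
        unfolding T\<Theta> tU unfolding \<Theta>_def U_def by (simp add: ms)
      ultimately show ?thesis
        unfolding E_def conjY[symmetric] conjH[symmetric] by (simp add: matrix_mult_simps)
    qed
    have nE: "norm E \<le> EK * \<delta>"
    proof -
      have "norm E \<le> \<delta> * R * R + R * R * \<delta> + \<delta> * R * D + 2 * (K * \<delta>) * YB + K * \<delta> * (K * D) * (R + D)"
        unfolding E_def
      proof (intro nd na mm nt ns nq \<delta> nYF nBS)
        show "norm S \<le> D" using \<delta>(1) \<delta>D by linarith
        show "norm U \<le> D" using \<delta>(2) \<delta>D by linarith
        show "\<bar>2 * c\<bar> \<le> 2 * (K * \<delta>)" using c by simp
        show "\<bar>c * c\<bar> \<le> K * \<delta> * (K * D)"
          unfolding abs_mult using c cD order_trans[OF abs_ge_zero c] by (intro mult_mono) auto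
      qed
      then show ?thesis by (simp add: EK_def algebra_simps)
    qed
    let ?a = "U *v b" and ?\<tau> = "- (w \<bullet> (S *v b))" and ?V = "Y ** X ** Y"
    have n\<tau>: "norm ?\<tau> \<le> R * (R * 1) * \<delta>" unfolding norm_minus_cancel by (intro ni nw nSb)
    have main: "0 \<le> f2 (q, t, B - S) (0, t1, Z) (0, 0, 2 *\<^sub>R (?V - E))"
    proof -
      have "f1 (q, t, B - S) (0, t1, Z) = f1 (q, t, B - S) ((0, t1, Y - F) - c *\<^sub>R (0, 0, B - S))" by (simp add: Z_def)
      also have "\<dots> = f1 (q, t, B - S) (0, t1, Y - F) - c * f1 (q, t, B - S) (0, 0, B - S)"
        using jetD(6)[OF jet] by (simp only: linear_diff linear_cmul real_scaleR_def)
      also have "\<dots> = 0" using den by (simp add: c_def)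
      finally have "f1 (q, t, B - S) (0, t1, Z) = 0" .
      then show ?thesis
        using infinitesimal_structural_inequality[OF jet Hh symYh, of q t \<Theta> t1] FF
        unfolding conjH conjYh conjYXY by simp
    qed
    \<comment> \<open>\<open>f2\<close> is affine in the acceleration with linear part
      \<open>f1\<close>, so the twice differentiated equation eliminates \<open>W\<close>. What
      remains is minus a value of \<open>f2\<close>, compared with the nonnegative value in
      \<open>main\<close>.\<close>
    have "f1 (q, t, B) (0, 0, W - 2 *\<^sub>R ?V) = f1 (q, t, B) ((?a, ?\<tau>, W) - (?a, ?\<tau>, 2 *\<^sub>R ?V))" by simp
    also have "\<dots> = f1 (q, t, B) (?a, ?\<tau>, W) - f1 (q, t, B) (?a, ?\<tau>, 2 *\<^sub>R ?V)"
      using jetD(6)[OF jet] by (rule linear_diff)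
    also have "\<dots> = - f2 (q, t, B) (S *v b, t1, Y) (?a, ?\<tau>, 2 *\<^sub>R ?V)"
      using pde2 jetD(5)[OF jet, of "(q, t, B)" "(S *v b, t1, Y)" "(?a, ?\<tau>, W)"]
        jetD(5)[OF jet, of "(q, t, B)" "(S *v b, t1, Y)" "(?a, ?\<tau>, 2 *\<^sub>R ?V)"]
      unfolding Bw Yw t1_def by linarith
    also have "\<dots> \<le> \<bar>f2 (q, t, B) (S *v b, t1, Y) (?a, ?\<tau>, 2 *\<^sub>R ?V) - f2 (q, t, B - S) (0, t1, Z) (0, 0, 2 *\<^sub>R (?V - E))\<bar>"
      using main by linarith
    also have "\<dots> \<le> L2 * norm (((q, t, B), (S *v b, t1, Y), (?a, ?\<tau>, 2 *\<^sub>R ?V)) - ((q, t, B - S), (0, t1, Z), (0, 0, 2 *\<^sub>R (?V - E))))"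
    proof (rule L2(2))
      have nV: "norm ?V \<le> R * R * R" by (intro mm nq)
      have ED: "EK * \<delta> \<le> EK * D" using \<delta>D EK0(1) by (rule mult_left_mono)
      have "norm (?V - E) \<le> R * R * R + EK * D" using nd[OF nV nE] ED by linarith
      then have n1: "norm (2 *\<^sub>R (?V - E)) \<le> 2 * (R * R * R + EK * D)" by simp
      have "0 \<le> EK * D" using EK0 D0 by simp
      then have n2: "norm (2 *\<^sub>R ?V) \<le> 2 * (R * R * R + EK * D)" using nV by simp
      have n3: "norm ?\<tau> \<le> R * (R * 1) * D" using n\<tau> mult_left_mono[OF \<delta>D, of "R * (R * 1)"] R by auto
      have n4: "norm B \<le> R + D" "norm Y \<le> ZB" "norm (S *v b) \<le> D" "norm (U *v b) \<le> D" "norm (0 :: real^'n) \<le> D"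
        "norm (0 :: real) \<le> R * (R * 1) * D"
        using nq(3,6) D0 EK0 nSb \<delta>D R by simp_all
      show "norm ((q, t, B), (S *v b, t1, Y), (?a, ?\<tau>, 2 *\<^sub>R ?V)) \<le> M2"
        unfolding M2_def by (intro np nq nt1 n2 n3 n4)
      show "norm ((q, t, B - S), (0 :: real^'n, t1, Z), (0 :: real^'n, 0 :: real, 2 *\<^sub>R (?V - E))) \<le> M2"
        unfolding M2_def by (intro np nq nt1 nZ nBS n1 n4)
    qed
    also have "((q, t, B), (S *v b, t1, Y), (?a, ?\<tau>, 2 *\<^sub>R ?V)) - ((q, t, B - S), (0, t1, Z), (0, 0, 2 *\<^sub>R (?V - E)))
       = ((0, 0, S), (S *v b, 0, Y - Z), (?a, ?\<tau>, 2 *\<^sub>R E))" by (simp add: scaleR_diff_right)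
    also have "norm ((0 :: real^'n, 0 :: real, S), (S *v b, 0 :: real, Y - Z), (?a, ?\<tau>, 2 *\<^sub>R E))
       \<le> (0 + (0 + \<delta>)) + ((\<delta> + (0 + ((\<delta> + \<delta> + R * R * \<delta>) + K * \<delta> * (R + D)))) + (\<delta> + (R * (R * 1) * \<delta> + 2 * (EK * \<delta>))))"
      by (intro np \<delta> nSb nYZ n\<tau> ns nE) simp_all
    also have "\<dots> = (1 + ((1 + ((2 + R * R) + K * (R + D))) + (1 + (R * R + 2 * EK)))) * \<delta>" by (simp add: algebra_simps)
    finally have "f1 (q, t, B) (0, 0, W - 2 *\<^sub>R ?V) \<le> C * \<delta>"
      using L2(1) by (simp add: C_def mult_left_mono mult.assoc)
    then show "f1 (q, t, B) (0, 0, W - 2 *\<^sub>R (Y ** X ** Y)) \<le> C * (norm (P - P ** X ** P) + norm (Y ** X ** P))"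
      by (simp only: \<delta>_def S_def U_def)
  qed
qed

section \<open>A strong minimum principle for positive semidefinite matrix functions\<close>

text \<open>For positive semidefinite \<open>S\<close> the minimum of \<open>penalty M S\<close> over \<open>M\<close> is
  \<open>trace S - |S|\<^sup>2 / (4 trace S)\<close>, attained at \<open>M = S / trace S\<close>. Its concavity in the directions
  transversal to \<open>S\<close> produces the good term that absorbs first derivatives of \<open>S\<close>.\<close>

definition penalty :: "real^'n^'n \<Rightarrow> real^'n^'n \<Rightarrow> real" where
  "penalty M S = (1 + M \<bullet> M / 4) * (mat 1 \<bullet> S) - (M \<bullet> S) / 2"

lemma inner_mat_1: "mat 1 \<bullet> S = trace S" for S :: "real^'n^'n"
  by (simp add: inner_matrix_trace)

lemma has_real_derivative_inner:
  assumes "(a has_vector_derivative a') (at x)" "(b has_vector_derivative b') (at x)"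
  shows "((\<lambda>s. a s \<bullet> b s) has_real_derivative a x \<bullet> b' + a' \<bullet> b x) (at x)"
  using bounded_bilinear.has_vector_derivative[OF bounded_bilinear_inner assms]
  by (simp add: has_real_derivative_iff_has_vector_derivative)

text \<open>With \<open>m = norm M\<close> and \<open>norm S \<le> trace S\<close>, the factor of
  the trace is at least
  \<open>1 + m\<^sup>2 / 4 - m / 2 = 3 / 4 + (m - 1)\<^sup>2 / 4\<close>.\<close>

lemma penalty_ge:
  fixes S :: "real^'n^'n"
  assumes "transpose S = S" "\<And>x. 0 \<le> x \<bullet> (S *v x)"
  shows "3 / 4 * trace S \<le> penalty M S"
proof -
  have S: "norm S \<le> trace S" by (rule norm_le_trace_psd[OF assms])
  have "M \<bullet> S \<le> norm M * norm S" by (rule norm_cauchy_schwarz)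
  also have "\<dots> \<le> norm M * trace S" using S by (simp add: mult_left_mono)
  finally have "penalty M S \<ge> (1 + (norm M)\<^sup>2 / 4) * trace S - norm M * trace S / 2"
    by (simp add: penalty_def inner_mat_1 power2_norm_eq_inner)
  moreover have "(1 + (norm M)\<^sup>2 / 4) * trace S - norm M * trace S / 2 = 3 / 4 * trace S + (norm M - 1)\<^sup>2 / 4 * trace S"
    by (simp add: power2_eq_square field_simps)
  moreover have "0 \<le> trace S" using S norm_ge_zero[of S] by linarith
  then have "0 \<le> (norm M - 1)\<^sup>2 / 4 * trace S" by simp
  ultimately show ?thesis by linarith
qed

lemma penalty_min:
  fixes S :: "real^'n^'n"
  assumes "trace S > 0" "trace S *\<^sub>R M = S"
  shows "penalty M S \<le> penalty N S"
proof -
  let ?s = "trace S"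
  have "N \<bullet> S = ?s * (N \<bullet> M)" "M \<bullet> S = ?s * (M \<bullet> M)" by (metis assms(2) inner_scaleR_right)+
  then have "penalty N S - penalty M S = ?s / 4 * ((N - M) \<bullet> (N - M))"
    by (simp add: penalty_def inner_mat_1 inner_diff_left inner_diff_right inner_commute[of M N] field_simps)
  moreover have "0 \<le> ?s / 4 * ((N - M) \<bullet> (N - M))" using assms(1) by simp
  ultimately show ?thesis by linarith
qed

text \<open>The matrix moves along with the point, as \<open>M + \<sigma> *\<^sub>R K\<close>. In
  the second derivative the terms with \<open>K\<close> add up to
  \<open>s * (K \<bullet> K) / 2 - K \<bullet> R\<close>, smallest for
  \<open>K = (1 / s) *\<^sub>R R\<close>; this value is the additional negative term.\<close>

lemma penalty_variation:
  fixes Sc :: "real \<Rightarrow> real^'n^'n"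
  assumes d: "d > 0" and S: "\<And>s. \<bar>s\<bar> < d \<Longrightarrow> (Sc has_vector_derivative Sc' s) (at s)"
    and S': "(Sc' has_vector_derivative l) (at 0)"
    and h: "\<And>s. \<bar>s\<bar> < d \<Longrightarrow> (h has_real_derivative h' s) (at s)" and h': "(h' has_real_derivative k) (at 0)"
    and M: "trace (Sc 0) > 0" "trace (Sc 0) *\<^sub>R M = Sc 0" "norm M \<le> 1"
    and min: "\<And>s N. \<bar>s\<bar> < d \<Longrightarrow> norm N \<le> 2 \<Longrightarrow> penalty M (Sc 0) - h 0 \<le> penalty N (Sc s) - h s"
  shows "penalty M (Sc' 0) = h' 0"
    and "0 \<le> penalty M l - (norm (Sc' 0 - trace (Sc' 0) *\<^sub>R M))\<^sup>2 / (2 * trace (Sc 0)) - k"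
proof -
  define R where "R = Sc' 0 - trace (Sc' 0) *\<^sub>R M"
  define s where "s = trace (Sc 0)"
  define K where "K = (1 / s) *\<^sub>R R"
  let ?M = "\<lambda>\<sigma>. M + \<sigma> *\<^sub>R K" and ?I = "mat 1 :: real^'n^'n"
  define f where "f \<sigma> = - (penalty (?M \<sigma>) (Sc \<sigma>) - h \<sigma>)" for \<sigma>
  define f' where "f' \<sigma> = - (((1 + ?M \<sigma> \<bullet> ?M \<sigma> / 4) * (?I \<bullet> Sc' \<sigma>) + (?M \<sigma> \<bullet> K / 2) * (?I \<bullet> Sc \<sigma>))
      - (?M \<sigma> \<bullet> Sc' \<sigma> + K \<bullet> Sc \<sigma>) / 2 - h' \<sigma>)" for \<sigma>
  \<comment> \<open>Short enough for \<open>?M\<close> to stay within norm 2, the range in which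
    minimality is known.\<close>
  define d1 where "d1 = min d (1 / (1 + norm K))"
  have d1: "d1 > 0" "d1 \<le> d" using d by (auto simp: d1_def add_pos_nonneg)
  have dM: "(?M has_vector_derivative K) (at \<sigma>)" for \<sigma>
    by (auto intro!: derivative_eq_intros simp: has_vector_derivative_def)
  have dc: "((\<lambda>_. c) has_vector_derivative 0) (at \<sigma>)" for c :: "real^'n^'n" and \<sigma> :: real by simp
  have df: "(f has_real_derivative f' \<sigma>) (at \<sigma>)" if "\<bar>\<sigma>\<bar> < d1" for \<sigma>
  proof -
    have \<sigma>: "\<bar>\<sigma>\<bar> < d" using that d1 by simp
    show ?thesis
      unfolding f_def f'_def penalty_def
      by (rule derivative_eq_intros has_real_derivative_inner dM dc S[OF \<sigma>] h[OF \<sigma>] refl | simp add: inner_commute inner_add_left inner_add_right field_simps)+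
  qed
  have df': "(f' has_real_derivative - (((1 + M \<bullet> M / 4) * (?I \<bullet> l) + (M \<bullet> K / 2) * (?I \<bullet> Sc' 0) + (M \<bullet> K / 2) * (?I \<bullet> Sc' 0)
       + (K \<bullet> K / 2) * (?I \<bullet> Sc 0)) - (M \<bullet> l + K \<bullet> Sc' 0 + K \<bullet> Sc' 0) / 2 - k)) (at 0)"
    unfolding f'_def
    by (rule derivative_eq_intros has_real_derivative_inner dM dc S S' h' refl | simp add: inner_commute inner_add_left inner_add_right field_simps d)+
  have max: "f \<sigma> \<le> f 0" if "\<bar>\<sigma>\<bar> < d1" for \<sigma>
  proof -
    have "\<bar>\<sigma>\<bar> * norm K \<le> 1 / (1 + norm K) * norm K" using that by (intro mult_right_mono) (auto simp: d1_def)
    also have "\<dots> \<le> 1" by (simp add: divide_le_eq add_pos_nonneg)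
    finally have "norm (?M \<sigma>) \<le> 2" using norm_triangle_ineq[of M "\<sigma> *\<^sub>R K"] M(3) by simp
    then show ?thesis using min[of \<sigma> "?M \<sigma>"] that d1 by (simp add: f_def)
  qed
  note sd = second_derivative_max[OF d1(1) df df' max]
  have KS: "X \<bullet> Sc 0 = s * (X \<bullet> M)" for X
    by (metis M(2) inner_scaleR_right s_def)
  have s: "s > 0" using M(1) by (simp add: s_def)
  show "penalty M (Sc' 0) = h' 0"
    using sd(1) KS[of K] s_def by (simp add: f'_def penalty_def inner_mat_1 inner_commute[of M K] field_simps)
  define m where "m = (norm R)\<^sup>2 / (2 * s)"
  have "K \<bullet> R = 2 * m" "s * (K \<bullet> K) = 2 * m"
    using s by (simp_all add: K_def m_def power2_norm_eq_inner)
  moreover have "K \<bullet> Sc' 0 = K \<bullet> R + trace (Sc' 0) * (K \<bullet> M)" by (simp add: R_def inner_diff_right)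
  ultimately have "0 \<le> penalty M l - m - k"
    using sd(2) by (simp add: penalty_def inner_mat_1 inner_commute[of M K] s_def[symmetric] field_simps)
  then have "0 \<le> penalty M l - (norm R)\<^sup>2 / (2 * s) - k" by (simp add: m_def)
  then show "0 \<le> penalty M l - (norm (Sc' 0 - trace (Sc' 0) *\<^sub>R M))\<^sup>2 / (2 * trace (Sc 0)) - k"
    by (simp add: R_def s_def)
qed

lemma penalty_matrix:
  fixes M Z :: "real^'n^'n"
  shows "((1 + M \<bullet> M / 4) *\<^sub>R mat 1 - (1 / 2) *\<^sub>R M) \<bullet> Z = penalty M Z"
  by (simp add: penalty_def inner_diff_left)

lemma card_orthonormal_basis:
  fixes E :: "(real^'n) set"
  assumes "orthonormal_basis E"
  shows "card E = CARD('n)"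
proof -
  have "real (card E) = (\<Sum>e\<in>E. e \<bullet> (mat 1 *v e))"
    using assms by (simp add: orthonormal_basis_def norm_eq_1)
  also have "\<dots> = real CARD('n)"
    using trace_orthonormal_basis[OF assms, of "mat 1"] by (simp add: trace_I)
  finally show ?thesis by simp
qed

text \<open>The inequality for \<open>S2\<close> is tested on eigenvectors of the matrix
  \<open>A\<close> representing \<open>penalty M\<close>, whose eigenvalues are nonnegative with sum
  at most \<open>5 / 4 * n\<close>. The first derivatives of \<open>S\<close> split into a part
  transversal to \<open>M\<close>, absorbed by the negative term in \<open>conv\<close>, and a
  trace, which criticality controls.\<close>

lemma minimum_principle_at_point:
  fixes S M :: "real^'n^'n" and S1 S2 :: "real^'n \<Rightarrow> real^'n^'n"
  assumes E: "orthonormal_basis E" and \<mu>: "\<And>g. g \<in> E \<Longrightarrow> c \<le> \<mu> g" and c: "c > 0" and C: "C \<ge> 0"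
    and S: "transpose S = S" "\<And>x. 0 \<le> x \<bullet> (S *v x)" "trace S > 0" "trace S *\<^sub>R M = S"
    and ineq: "\<And>b. norm b \<le> 1 \<Longrightarrow> (\<Sum>g\<in>E. \<mu> g * (b \<bullet> (S2 g *v b))) \<le> C * (norm S + (\<Sum>g\<in>E. norm (S1 g)))"
    and \<epsilon>: "\<epsilon> > 0" and h: "3 / 4 * trace S \<le> \<epsilon> * h0"
    and crit: "\<And>g. g \<in> E \<Longrightarrow> penalty M (S1 g) = \<epsilon> * h1 g"
    and conv: "\<And>g. g \<in> E \<Longrightarrow> 0 \<le> penalty M (S2 g) - (norm (S1 g - trace (S1 g) *\<^sub>R M))\<^sup>2 / (2 * trace S) - \<epsilon> * h2 g"
    and C1: "C1 = 5 / 4 * real CARD('n) * C"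
  shows "(\<Sum>g\<in>E. \<mu> g * h2 g) \<le> 4 / 3 * (C1 + real CARD('n) * (2 * C1\<^sup>2 / c)) * h0 + 2 * C1 * (\<Sum>g\<in>E. \<bar>h1 g\<bar>)"
proof -
  define s where "s = trace S"
  define n where "n = real CARD('n)"
  define R where "R g = norm (S1 g - trace (S1 g) *\<^sub>R M)" for g
  have s: "s > 0" using S(3) by (simp add: s_def)
  have nS: "norm S \<le> s" unfolding s_def by (rule norm_le_trace_psd[OF S(1,2)])
  have M: "M = (1 / s) *\<^sub>R S" using S(4)[folded s_def] s by (metis divide_self_if less_irrefl scaleR_one scaleR_scaleR times_divide_eq_left mult_1)
  have nM: "norm M \<le> 1" unfolding M using nS s by (simp add: divide_le_eq)
  have trM: "trace M = 1" unfolding M trace_scaleR using s by (simp add: s_def)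
  have symM: "transpose M = M" unfolding M transpose_scaleR S(1) ..
  have MM: "M \<bullet> M \<le> 1" using power_mono[OF nM, of 2] by (simp add: power2_norm_eq_inner)
  define A where "A = (1 + M \<bullet> M / 4) *\<^sub>R mat 1 - (1 / 2) *\<^sub>R M"
  have "transpose A = A" by (simp add: A_def transpose_diff transpose_scaleR symM)
  then obtain F where F: "orthonormal_basis F" "\<And>e. e \<in> F \<Longrightarrow> A *v e = (e \<bullet> (A *v e)) *\<^sub>R e"
    using spectral_theorem by blast
  have pen: "penalty M Z = (\<Sum>e\<in>F. (e \<bullet> (A *v e)) * (e \<bullet> (Z *v e)))" for Z
    using inner_matrix_spectral[OF F, of Z] by (simp add: A_def penalty_matrix)
  have eF: "norm e = 1" if "e \<in> F" for e using F(1) that by (simp add: orthonormal_basis_def)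
  have aF: "0 \<le> e \<bullet> (A *v e)" if "e \<in> F" for e
  proof -
    have "e \<bullet> (M *v e) \<le> norm e * (norm M * norm e)"
      by (rule order_trans[OF norm_cauchy_schwarz]) (simp add: norm_matrix_vector_le mult_left_mono)
    then have "e \<bullet> (M *v e) \<le> 1" using eF[OF that] nM by simp
    moreover have ee: "e \<bullet> e = 1" using eF[OF that] by (simp add: norm_eq_1)
    moreover have "0 \<le> M \<bullet> M" by simp
    moreover have "0 \<le> (1 + m / 4) * 1 - 1 / 2 * x" if "x \<le> 1" "0 \<le> m" for x m :: real using that by simp
    ultimately show ?thesis
      unfolding A_def matrix_vector_simps inner_diff_right inner_scaleR_right matrix_vector_mul_lid ee by blast
  qed
  have trA: "(\<Sum>e\<in>F. e \<bullet> (A *v e)) \<le> 5 / 4 * n"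
  proof -
    have "(\<Sum>e\<in>F. e \<bullet> (A *v e)) = (1 + M \<bullet> M / 4) * n - 1 / 2"
      unfolding trace_orthonormal_basis[OF F(1), symmetric]
      by (simp add: A_def trace_sub trace_scaleR trM trace_I n_def)
    moreover have "(1 + M \<bullet> M / 4) * n \<le> (5 / 4) * n" using MM by (intro mult_right_mono) (auto simp: n_def)
    ultimately show ?thesis by linarith
  qed
  define \<Sigma> where "\<Sigma> = norm S + (\<Sum>g\<in>E. norm (S1 g))"
  have \<Sigma>0: "C * \<Sigma> \<ge> 0" using C by (simp add: \<Sigma>_def sum_nonneg)
  have n0: "n > 0" by (simp add: n_def)
  have C10: "C1 \<ge> 0" using C by (simp add: C1)
  have "(\<Sum>g\<in>E. \<mu> g * penalty M (S2 g)) = (\<Sum>e\<in>F. (e \<bullet> (A *v e)) * (\<Sum>g\<in>E. \<mu> g * (e \<bullet> (S2 g *v e))))"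
    unfolding pen sum_distrib_left by (subst sum.swap) (simp add: mult.left_commute)
  also have "\<dots> \<le> (\<Sum>e\<in>F. (e \<bullet> (A *v e)) * (C * \<Sigma>))"
    unfolding \<Sigma>_def by (intro sum_mono mult_left_mono ineq aF) (simp_all add: eF)
  also have "\<dots> \<le> (5 / 4 * n) * (C * \<Sigma>)"
    unfolding sum_distrib_right[symmetric] using trA \<Sigma>0 by (rule mult_right_mono)
  finally have second: "(\<Sum>g\<in>E. \<mu> g * penalty M (S2 g)) \<le> C1 * \<Sigma>" by (simp add: C1 n_def mult.assoc)
  \<comment> \<open>In the critical equation the trace of \<open>S1 g\<close> has the coefficient
    \<open>1 - M \<bullet> M / 4\<close>, at least \<open>3 / 4\<close>; so it is bounded by
    \<open>R g\<close> and \<open>\<epsilon> * \<bar>h1 g\<bar>\<close>.\<close>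
  have S1: "norm (S1 g) \<le> 2 * R g + 2 * (\<epsilon> * \<bar>h1 g\<bar>)" if "g \<in> E" for g
  proof -
    let ?T = "trace (S1 g)" and ?R = "S1 g - trace (S1 g) *\<^sub>R M"
    have "M \<bullet> S1 g = M \<bullet> ?R + ?T * (M \<bullet> M)" by (simp add: inner_diff_right)
    then have "?T * (1 - M \<bullet> M / 4) = \<epsilon> * h1 g + (M \<bullet> ?R) / 2"
      using crit[OF that] by (simp add: penalty_def inner_mat_1 field_simps)
    then have "\<bar>?T\<bar> * (1 - M \<bullet> M / 4) = \<bar>\<epsilon> * h1 g + (M \<bullet> ?R) / 2\<bar>"
      using MM by (metis abs_mult abs_of_nonneg diff_ge_0_iff_ge divide_le_eq_1 order_trans[OF MM] zero_less_numeral one_le_numeral)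
    moreover have "\<bar>M \<bullet> ?R\<bar> \<le> R g"
      using order_trans[OF Cauchy_Schwarz_ineq2 mult_right_mono[OF nM norm_ge_zero]] by (simp add: R_def)
    moreover have "\<bar>\<epsilon> * h1 g\<bar> = \<epsilon> * \<bar>h1 g\<bar>" using \<epsilon> by (simp add: abs_mult)
    ultimately have "\<bar>?T\<bar> * (1 - M \<bullet> M / 4) \<le> \<epsilon> * \<bar>h1 g\<bar> + R g / 2" by linarith
    moreover have "\<bar>?T\<bar> * (3 / 4) \<le> \<bar>?T\<bar> * (1 - M \<bullet> M / 4)" using MM by (intro mult_left_mono) auto
    ultimately have T: "\<bar>?T\<bar> \<le> 4 / 3 * (\<epsilon> * \<bar>h1 g\<bar>) + 2 / 3 * R g" by linarith
    have "norm (S1 g) \<le> norm ?R + norm (?T *\<^sub>R M)" using norm_triangle_ineq[of ?R "?T *\<^sub>R M"] by simp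
    also have "norm (?T *\<^sub>R M) \<le> \<bar>?T\<bar>" using mult_left_mono[OF nM, of "\<bar>?T\<bar>"] by simp
    finally have "norm (S1 g) \<le> R g + \<bar>?T\<bar>" by (simp add: R_def)
    moreover have "R g \<ge> 0" "0 \<le> \<epsilon> * \<bar>h1 g\<bar>" using \<epsilon> by (simp_all add: R_def)
    ultimately show ?thesis using T by linarith
  qed
  \<comment> \<open>Young's inequality, weighted so that exactly the available quadratic term is
    spent and only a multiple of \<open>s\<close> remains.\<close>
  have absorb: "2 * C1 * R g - c * (R g)\<^sup>2 / (2 * s) \<le> 2 * C1\<^sup>2 / c * s" for g
  proof -
    have "0 \<le> (c * R g - 2 * C1 * s)\<^sup>2 / (2 * s * c)" using s c by simp
    also have "\<dots> = c * (R g)\<^sup>2 / (2 * s) - 2 * C1 * R g + 2 * C1\<^sup>2 / c * s"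
      using s c by (simp add: power2_eq_square field_simps)
    finally show ?thesis by linarith
  qed
  have \<epsilon>h: "s \<le> 4 / 3 * (\<epsilon> * h0)" using h by (simp add: s_def)
  have "0 \<le> (\<Sum>g\<in>E. \<mu> g * (penalty M (S2 g) - (R g)\<^sup>2 / (2 * s) - \<epsilon> * h2 g))"
    using conv c \<mu> unfolding R_def s_def by (intro sum_nonneg mult_nonneg_nonneg) (auto intro: order_trans less_imp_le)
  also have "\<dots> = (\<Sum>g\<in>E. \<mu> g * penalty M (S2 g)) - (\<Sum>g\<in>E. \<mu> g * ((R g)\<^sup>2 / (2 * s))) - \<epsilon> * (\<Sum>g\<in>E. \<mu> g * h2 g)"
    by (simp add: right_diff_distrib sum_subtractf sum_distrib_left mult.left_commute)
  also have "\<dots> \<le> C1 * \<Sigma> - (\<Sum>g\<in>E. c * ((R g)\<^sup>2 / (2 * s))) - \<epsilon> * (\<Sum>g\<in>E. \<mu> g * h2 g)"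
  proof -
    have "(\<Sum>g\<in>E. c * ((R g)\<^sup>2 / (2 * s))) \<le> (\<Sum>g\<in>E. \<mu> g * ((R g)\<^sup>2 / (2 * s)))"
      using s by (intro sum_mono mult_right_mono \<mu>) auto
    then show ?thesis using second by linarith
  qed
  also have "C1 * \<Sigma> \<le> C1 * (s + (\<Sum>g\<in>E. 2 * R g + 2 * (\<epsilon> * \<bar>h1 g\<bar>)))"
    unfolding \<Sigma>_def by (intro mult_left_mono add_mono nS sum_mono S1 C10)
  also have "C1 * (s + (\<Sum>g\<in>E. 2 * R g + 2 * (\<epsilon> * \<bar>h1 g\<bar>))) - (\<Sum>g\<in>E. c * ((R g)\<^sup>2 / (2 * s)))
     = C1 * s + (\<Sum>g\<in>E. 2 * C1 * R g - c * (R g)\<^sup>2 / (2 * s)) + 2 * C1 * (\<epsilon> * (\<Sum>g\<in>E. \<bar>h1 g\<bar>))"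
    by (simp add: sum.distrib sum_subtractf sum_distrib_left algebra_simps)
  also have "(\<Sum>g\<in>E. 2 * C1 * R g - c * (R g)\<^sup>2 / (2 * s)) \<le> (\<Sum>g\<in>E. 2 * C1\<^sup>2 / c * s)"
    by (intro sum_mono absorb)
  also have "(\<Sum>g\<in>E. 2 * C1\<^sup>2 / c * s) = n * (2 * C1\<^sup>2 / c) * s"
    by (simp add: card_orthonormal_basis[OF E] n_def)
  finally have "\<epsilon> * (\<Sum>g\<in>E. \<mu> g * h2 g) \<le> (C1 + n * (2 * C1\<^sup>2 / c)) * s + 2 * C1 * (\<epsilon> * (\<Sum>g\<in>E. \<bar>h1 g\<bar>))"
    by (simp add: algebra_simps)
  also have "\<dots> \<le> (C1 + n * (2 * C1\<^sup>2 / c)) * (4 / 3 * (\<epsilon> * h0)) + 2 * C1 * (\<epsilon> * (\<Sum>g\<in>E. \<bar>h1 g\<bar>))"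
    using \<epsilon>h C10 n0 c by (intro add_right_mono mult_left_mono) auto
  also have "\<dots> = \<epsilon> * (4 / 3 * (C1 + n * (2 * C1\<^sup>2 / c)) * h0 + 2 * C1 * (\<Sum>g\<in>E. \<bar>h1 g\<bar>))"
    by (simp add: algebra_simps)
  finally show ?thesis using \<epsilon> by (simp add: n_def)
qed

section \<open>Ingredients of Hopf's argument\<close>

lemma exists_large_parameter:
  fixes a b d :: real
  assumes "a > 0"
  shows "\<exists>\<alpha>>0. b + d * \<alpha> < a * \<alpha>\<^sup>2"
proof -
  define \<alpha> where "\<alpha> = 1 + (\<bar>b\<bar> + \<bar>d\<bar>) / a"
  have \<alpha>: "\<alpha> \<ge> 1" "a * \<alpha> = a + \<bar>b\<bar> + \<bar>d\<bar>" using assms by (auto simp: \<alpha>_def field_simps)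
  have "b \<le> \<bar>b\<bar> * \<alpha>" using mult_left_mono[OF \<alpha>(1), of "\<bar>b\<bar>"] by linarith
  moreover have "d * \<alpha> \<le> \<bar>d\<bar> * \<alpha>" using \<alpha>(1) by (intro mult_right_mono) auto
  moreover have "a * \<alpha>\<^sup>2 = (a + \<bar>b\<bar> + \<bar>d\<bar>) * \<alpha>" by (simp add: \<alpha>(2)[symmetric] power2_eq_square)
  moreover have "0 < a * \<alpha>" using assms \<alpha>(1) by simp
  ultimately have "b + d * \<alpha> < a * \<alpha>\<^sup>2" by (simp add: distrib_right)
  then show ?thesis using \<alpha>(1) by (intro exI[of _ \<alpha>]) auto
qed

lemma gaussian_line_derivatives:
  fixes x y g :: "real^'n"
  shows "((\<lambda>s. exp (- \<alpha> * ((x + s *\<^sub>R g - y) \<bullet> (x + s *\<^sub>R g - y))))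
      has_real_derivative - 2 * \<alpha> * ((x + s *\<^sub>R g - y) \<bullet> g) * exp (- \<alpha> * ((x + s *\<^sub>R g - y) \<bullet> (x + s *\<^sub>R g - y)))) (at s)"
    and "norm g = 1 \<Longrightarrow> ((\<lambda>s. - 2 * \<alpha> * ((x + s *\<^sub>R g - y) \<bullet> g) * exp (- \<alpha> * ((x + s *\<^sub>R g - y) \<bullet> (x + s *\<^sub>R g - y))))
      has_real_derivative (4 * \<alpha>\<^sup>2 * ((x - y) \<bullet> g)\<^sup>2 - 2 * \<alpha>) * exp (- \<alpha> * ((x - y) \<bullet> (x - y)))) (at 0)"
proof -
  have l: "((\<lambda>s. x + s *\<^sub>R g - y) has_vector_derivative g) (at s)" for s
    by (auto intro!: derivative_eq_intros simp: has_vector_derivative_def)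
  have lg: "((\<lambda>s. (x + s *\<^sub>R g - y) \<bullet> g) has_real_derivative g \<bullet> g) (at s)" for s
    using has_real_derivative_inner[OF l has_vector_derivative_const[of g]] by simp
  have ll: "((\<lambda>s. (x + s *\<^sub>R g - y) \<bullet> (x + s *\<^sub>R g - y)) has_real_derivative 2 * ((x + s *\<^sub>R g - y) \<bullet> g)) (at s)" for s
    using has_real_derivative_inner[OF l l, of s] by (simp add: inner_commute)
  show e: "((\<lambda>s. exp (- \<alpha> * ((x + s *\<^sub>R g - y) \<bullet> (x + s *\<^sub>R g - y))))
      has_real_derivative - 2 * \<alpha> * ((x + s *\<^sub>R g - y) \<bullet> g) * exp (- \<alpha> * ((x + s *\<^sub>R g - y) \<bullet> (x + s *\<^sub>R g - y)))) (at s)" for s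
    using DERIV_fun_exp[OF DERIV_cmult[OF ll, of "- \<alpha>"]] by (simp add: mult_ac)
  assume "norm g = 1"
  then have "g \<bullet> g = 1" by (simp add: norm_eq_1)
  then show "((\<lambda>s. - 2 * \<alpha> * ((x + s *\<^sub>R g - y) \<bullet> g) * exp (- \<alpha> * ((x + s *\<^sub>R g - y) \<bullet> (x + s *\<^sub>R g - y))))
      has_real_derivative (4 * \<alpha>\<^sup>2 * ((x - y) \<bullet> g)\<^sup>2 - 2 * \<alpha>) * exp (- \<alpha> * ((x - y) \<bullet> (x - y)))) (at 0)"
    using DERIV_mult[OF DERIV_cmult[OF lg, of "- 2 * \<alpha>"] e, of 0] by (simp add: power2_eq_square algebra_simps)
qed

text \<open>The ball with diameter from \<open>y\<close> to \<open>x1\<close> lies in the ball about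
  \<open>y\<close> through \<open>x1\<close> and meets its sphere only at \<open>x1\<close>. This
  makes the touching point unique.\<close>

lemma internally_tangent_ball:
  fixes y x1 x :: "real^'n"
  assumes "x \<noteq> x1" "norm (x - (1 / 2) *\<^sub>R (x1 + y)) \<le> norm (x1 - y) / 2"
  shows "norm (x - y) < norm (x1 - y)"
proof (rule ccontr)
  define a e where "a = x - (1 / 2) *\<^sub>R (x1 + y)" and "e = (1 / 2) *\<^sub>R (x1 - y)"
  have hh: "z = (1 / 2) *\<^sub>R z + (1 / 2) *\<^sub>R z" for z :: "real^'n" by (simp flip: scaleR_left_distrib)
  have xy: "x - y = a + e" "x - x1 = a - e" "x1 - y = 2 *\<^sub>R e"
    using hh[of y] hh[of x1] by (simp_all add: a_def e_def scaleR_add_right scaleR_diff_right algebra_simps)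
  have "norm a \<le> norm e" using assms(2) by (simp add: a_def xy(3))
  then have "a \<bullet> a \<le> e \<bullet> e" by (simp add: norm_le)
  moreover assume "\<not> ?thesis"
  then have "(2 *\<^sub>R e) \<bullet> (2 *\<^sub>R e) \<le> (a + e) \<bullet> (a + e)" unfolding xy by (simp only: norm_le not_less)
  ultimately have "(a - e) \<bullet> (a - e) \<le> 0"
    by (simp add: inner_add_left inner_add_right inner_diff_left inner_diff_right inner_commute)
  then show False using assms(1) xy(2) by (metis inner_gt_zero_iff not_less right_minus_eq)
qed

text \<open>Hopf's argument for \<open>penalty M (S x) - \<epsilon> h x\<close>, minimised jointly in \<open>x\<close> and \<open>M\<close>: the bound
  on second derivatives may involve \<open>|S'|\<close> without any smallness, because the variation of \<open>M\<close>
  controls it.\<close>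

lemma strong_minimum_principle:
  fixes S :: "real^'n \<Rightarrow> real^'n^'n" and S1 S2 :: "real^'n \<Rightarrow> real^'n \<Rightarrow> real^'n^'n"
  assumes r: "r > 0" and c: "c > 0" and C: "C \<ge> 0"
    and sym: "\<And>x. x \<in> ball x0 r \<Longrightarrow> transpose (S x) = S x"
    and psd: "\<And>x b. x \<in> ball x0 r \<Longrightarrow> 0 \<le> b \<bullet> (S x *v b)"
    and d1: "\<And>x g. x \<in> ball x0 r \<Longrightarrow> ((\<lambda>s. S (x + s *\<^sub>R g)) has_vector_derivative S1 x g) (at 0)"
    and d2: "\<And>x g. x \<in> ball x0 r \<Longrightarrow> ((\<lambda>s. S1 (x + s *\<^sub>R g) g) has_vector_derivative S2 x g) (at 0)"
    and cont: "continuous_on (ball x0 r) S"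
    and ineq: "\<And>x. x \<in> ball x0 r \<Longrightarrow> \<exists>E \<mu>. orthonormal_basis E \<and> (\<forall>g\<in>E. c \<le> \<mu> g \<and> \<mu> g \<le> L) \<and>
       (\<forall>b. norm b \<le> 1 \<longrightarrow> (\<Sum>g\<in>E. \<mu> g * (b \<bullet> (S2 x g *v b))) \<le> C * (norm (S x) + (\<Sum>g\<in>E. norm (S1 x g))))"
    and S0: "S x0 = 0" and y: "y \<in> ball x0 (r / 4)"
  shows "S y = 0"
proof (rule ccontr)
  assume Sy: "S y \<noteq> 0"
  \<comment> \<open>Hopf's argument is carried out at the zero nearest to \<open>y\<close>. The
    radii \<open>r / 4\<close> and \<open>r / 2\<close> keep all points used later inside
    \<open>ball x0 r\<close>.\<close>
  define Z where "Z = {x \<in> cball x0 (r / 2). S x = 0}"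
  have sub: "cball x0 (r / 2) \<subseteq> ball x0 r" using r by auto
  have "closed Z"
    unfolding Z_def using continuous_closed_preimage_constant[OF continuous_on_subset[OF cont sub] closed_cball, of 0] by simp
  moreover have "Z \<noteq> {}" using S0 r by (auto simp: Z_def intro!: exI[of _ x0])
  ultimately obtain x1 where x1: "x1 \<in> Z" "\<And>z. z \<in> Z \<Longrightarrow> dist y x1 \<le> dist y z"
    using distance_attains_inf by blast
  define \<rho> where "\<rho> = norm (x1 - y) / 2"
  have Sx1: "S x1 = 0" using x1(1) by (simp add: Z_def)
  have \<rho>0: "\<rho> > 0" using Sx1 Sy by (auto simp: \<rho>_def)
  have yx0: "dist y x0 < r / 4" using y by (simp add: dist_commute)
  have "dist y x1 \<le> dist y x0" using x1(2)[of x0] S0 r by (simp add: Z_def)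
  then have y1: "2 * \<rho> < r / 4" using yx0 by (simp add: \<rho>_def dist_norm norm_minus_commute)
  define y' where "y' = (1 / 2) *\<^sub>R (x1 + y)"
  have hh: "z = (1 / 2) *\<^sub>R z + (1 / 2) *\<^sub>R z" for z :: "real^'n" by (simp flip: scaleR_left_distrib)
  have x1y': "x1 - y' = (1 / 2) *\<^sub>R (x1 - y)" using hh[of x1] by (simp add: y'_def algebra_simps)
  have nx1y': "norm (x1 - y') = \<rho>" by (simp add: x1y' \<rho>_def)
  have tan: "S x \<noteq> 0" if "x \<noteq> x1" "norm (x - y') \<le> \<rho>" for x
  proof
    assume "S x = 0"
    have lt: "dist y x < dist y x1"
      using internally_tangent_ball[OF that(1), of y] that(2) by (simp add: y'_def \<rho>_def dist_norm norm_minus_commute)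
    have "dist x0 x \<le> dist y x0 + dist y x" using dist_triangle[of x0 x y] by (simp add: dist_commute)
    then have "dist x0 x \<le> r / 2" using lt yx0 y1 by (simp add: \<rho>_def dist_norm norm_minus_commute)
    then have "x \<in> Z" using \<open>S x = 0\<close> by (simp add: Z_def)
    then show False using x1(2) lt by force
  qed
  define D where "D = cball x1 (\<rho> / 2)"
  have D: "D \<subseteq> ball x0 r"
  proof
    fix x assume "x \<in> D"
    then have "dist x1 x \<le> \<rho> / 2" by (simp add: D_def)
    moreover have "dist x0 x1 \<le> r / 2" using x1(1) by (simp add: Z_def)
    ultimately show "x \<in> ball x0 r" using dist_triangle[of x0 x x1] y1 \<rho>0 by simp
  qed
  define n where "n = real CARD('n)"
  define C1 where "C1 = 5 / 4 * n * C"
  define K where "K = 4 / 3 * (C1 + n * (2 * C1\<^sup>2 / c))"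
  have n0: "n > 0" by (simp add: n_def)
  have C10: "C1 \<ge> 0" using C n0 by (simp add: C1_def)
  have K0: "K \<ge> 0" using C10 n0 c by (simp add: K_def)
  \<comment> \<open>The coefficients of the final comparison: \<open>K\<close> from the term of
    order zero, the bracket from the terms linear in \<alpha>, and \<open>\<rho>\<^sup>2 * c\<close>
    from ellipticity, since the distance to \<open>y'\<close> is at least \<open>\<rho> / 2\<close>
    on \<open>D\<close>.\<close>
  obtain \<alpha> where \<alpha>: "\<alpha> > 0" "K + (4 * C1 * n * \<rho> + 2 * L * n + 0) * \<alpha> < (\<rho>\<^sup>2 * c) * \<alpha>\<^sup>2"
    using exists_large_parameter[of "\<rho>\<^sup>2 * c" K "4 * C1 * n * \<rho> + 2 * L * n + 0"] \<rho>0 c by auto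
  define \<eta> where "\<eta> x = exp (- \<alpha> * ((x - y') \<bullet> (x - y')))" for x
  define h where "h x = \<eta> x - exp (- \<alpha> * \<rho>\<^sup>2)" for x
  have hpos: "h x > 0 \<longleftrightarrow> norm (x - y') < \<rho>" for x
  proof -
    have "h x > 0 \<longleftrightarrow> (norm (x - y'))\<^sup>2 < \<rho>\<^sup>2" using \<alpha>(1) by (simp add: h_def \<eta>_def power2_norm_eq_inner)
    also have "\<dots> \<longleftrightarrow> norm (x - y') < \<rho>" using \<rho>0 power2_less_imp_less[of "norm (x - y')" \<rho>] power_strict_mono[of "norm (x - y')" \<rho> 2] by auto
    finally show ?thesis .
  qed
  have h1: "h x < 1" for x
  proof -
    have "\<eta> x \<le> 1" using \<alpha>(1) by (simp add: \<eta>_def)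
    then show ?thesis using exp_gt_zero[of "- \<alpha> * \<rho>\<^sup>2"] unfolding h_def by linarith
  qed
  have hx1: "h x1 = 0" by (simp add: h_def \<eta>_def nx1y'[symmetric] power2_norm_eq_inner)
  have conth: "continuous_on A h" for A unfolding h_def \<eta>_def by (intro continuous_intros)
  have nle: "norm (S x) \<le> trace (S x)" if "x \<in> D" for x
    by (rule norm_le_trace_psd) (use sym psd D that in blast)+
  have trpos: "trace (S x) > 0" if "x \<in> D" "S x \<noteq> 0" for x
    using nle[OF that(1)] that(2) by (meson less_le_trans zero_less_norm_iff)
  have trnn: "trace (S x) \<ge> 0" if "x \<in> D" for x
    using order_trans[OF norm_ge_zero nle[OF that]] .
  have pen: "3 / 4 * trace (S x) \<le> penalty N (S x)" if "x \<in> D" for x N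
    by (rule penalty_ge) (use sym psd D that in blast)+
  define Kx where "Kx = sphere x1 (\<rho> / 2) \<inter> cball y' \<rho>"
  have KxD: "Kx \<subseteq> D" by (auto simp: Kx_def D_def)
  have contD: "continuous_on D S" by (rule continuous_on_subset[OF cont D])
  have conttr: "continuous_on A (\<lambda>x. trace (S x))" if "A \<subseteq> D" for A
    unfolding inner_mat_1[symmetric] by (intro continuous_intros continuous_on_subset[OF contD that])
  obtain m where m: "m > 0" "\<And>x. x \<in> Kx \<Longrightarrow> m \<le> trace (S x)"
  proof (cases "Kx = {}")
    case False
    moreover have "compact Kx" unfolding Kx_def by (intro compact_Int compact_sphere compact_cball)
    ultimately obtain z where z: "z \<in> Kx" "\<And>x. x \<in> Kx \<Longrightarrow> trace (S z) \<le> trace (S x)"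
      using continuous_attains_inf[OF _ _ conttr[OF KxD]] by blast
    have "S z \<noteq> 0" using z(1) \<rho>0 by (intro tan) (auto simp: Kx_def dist_norm norm_minus_commute)
    then show ?thesis using that[of "trace (S z)"] trpos[of z] z KxD by blast
  qed (use that[of 1] in auto)
  \<comment> \<open>On \<open>Kx\<close>, the part of the sphere on which \<open>h\<close> can be
    positive, the penalty is at least \<open>3 / 4 * m\<close> and so exceeds
    \<open>\<epsilon> * h\<close>.\<close>
  define \<epsilon> where "\<epsilon> = m / 2"
  have \<epsilon>0: "\<epsilon> > 0" using m(1) by (simp add: \<epsilon>_def)
  define \<phi> where "\<phi> z = penalty (snd z) (S (fst z)) - \<epsilon> * h (fst z)" for z
  \<comment> \<open>Radius 2 for the matrix gives compactness and leaves room around the optimal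
    matrix, whose norm is at most 1.\<close>
  have "continuous_on (D \<times> cball 0 2) \<phi>"
    unfolding \<phi>_def penalty_def
    by (intro continuous_intros continuous_on_compose2[OF contD continuous_on_fst[OF continuous_on_id]]
        continuous_on_compose2[OF conth continuous_on_fst[OF continuous_on_id]]) auto
  moreover have "compact (D \<times> cball (0 :: real^'n^'n) 2)" unfolding D_def by (intro compact_Times compact_cball)
  moreover have "(x1, 0 :: real^'n^'n) \<in> D \<times> cball 0 2" using \<rho>0 by (simp add: D_def)
  ultimately have "\<exists>z\<in>D \<times> cball 0 2. \<forall>w\<in>D \<times> cball (0 :: real^'n^'n) 2. \<phi> z \<le> \<phi> w"
    by (intro continuous_attains_inf) blast+
  then obtain z where z: "z \<in> D \<times> cball 0 2" "\<And>w. w \<in> D \<times> cball 0 2 \<Longrightarrow> \<phi> z \<le> \<phi> w" by blast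
  have z2: "\<phi> z \<le> \<phi> (x, N)" if "x \<in> D" "norm N \<le> 2" for x N
    using z(2)[of "(x, N)"] that by simp
  have line: "\<exists>d>0. \<forall>s. \<bar>s\<bar> < d \<longrightarrow> x + s *\<^sub>R g \<in> D" if "x \<in> ball x1 (\<rho> / 2)" for x g
  proof -
    define d where "d = (\<rho> / 2 - dist x1 x) / (1 + norm g)"
    have ng: "1 + norm g > 0" by (simp add: add_pos_nonneg)
    have "x + s *\<^sub>R g \<in> D" if s: "\<bar>s\<bar> < d" for s
    proof -
      have "\<bar>s\<bar> * (1 + norm g) \<le> \<rho> / 2 - dist x1 x" using s ng by (simp add: d_def pos_less_divide_eq)
      moreover have "dist x (x + s *\<^sub>R g) = \<bar>s\<bar> * norm g" by (simp add: dist_norm)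
      ultimately have "dist x1 x + dist x (x + s *\<^sub>R g) \<le> \<rho> / 2" by (simp add: distrib_left)
      then show ?thesis using dist_triangle[of x1 "x + s *\<^sub>R g" x] by (simp add: D_def)
    qed
    moreover have "d > 0" using that ng by (simp add: d_def)
    ultimately show ?thesis by blast
  qed
  have shift: "((\<lambda>s. F (x + s *\<^sub>R g)) has_vector_derivative F') (at s)"
    if "((\<lambda>t. F ((x + s *\<^sub>R g) + t *\<^sub>R g)) has_vector_derivative F') (at 0)" for F :: "real^'n \<Rightarrow> real^'n^'n" and F' x g s
  proof -
    have "((\<lambda>\<sigma>. \<sigma> - s) has_vector_derivative 1) (at s)" by (auto intro!: derivative_eq_intros)
    from vector_diff_chain_at[OF this, of "\<lambda>t. F ((x + s *\<^sub>R g) + t *\<^sub>R g)" F'] that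
    show ?thesis by (simp add: o_def algebra_simps flip: scaleR_left_distrib)
  qed
  show False
  proof (cases "\<phi> z < 0")
    \<comment> \<open>With the matrix 0, nonnegativity of \<phi> gives
      \<open>trace (S x) \<ge> \<epsilon> * h x\<close> near \<open>x1\<close>, with equality at
      \<open>x1\<close>. But the trace has derivative 0 at its minimum \<open>x1\<close>, while
      \<open>h\<close> strictly increases towards \<open>y'\<close>.\<close>
    case False
    define g where "g = y' - x1"
    have x1D: "x1 \<in> ball x1 (\<rho> / 2)" "x1 \<in> D" using \<rho>0 by (simp_all add: D_def)
    obtain d where d: "d > 0" "\<And>s. \<bar>s\<bar> < d \<Longrightarrow> x1 + s *\<^sub>R g \<in> D" using line[OF x1D(1)] by blast
    have dS: "((\<lambda>s. trace (S (x1 + s *\<^sub>R g))) has_real_derivative trace (S1 x1 g)) (at 0)"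
      using has_real_derivative_inner[OF has_vector_derivative_const[of "mat 1"] d1[of x1 g]] x1D(2) D
      by (auto simp: inner_mat_1)
    have dh: "((\<lambda>s. h (x1 + s *\<^sub>R g)) has_real_derivative - 2 * \<alpha> * ((x1 - y') \<bullet> g) * \<eta> x1) (at 0)"
      using DERIV_diff[OF gaussian_line_derivatives(1)[of \<alpha> x1 g y' 0] DERIV_const] unfolding h_def \<eta>_def by simp
    have "trace (S1 x1 g) = 0"
      by (rule DERIV_local_min[OF dS d(1)]) (use d(2) trnn[unfolded inner_mat_1[symmetric]] Sx1 in \<open>auto simp: inner_mat_1[symmetric]\<close>)
    moreover have "trace (S1 x1 g) - \<epsilon> * (- 2 * \<alpha> * ((x1 - y') \<bullet> g) * \<eta> x1) = 0"
    proof (rule DERIV_local_min[OF DERIV_diff[OF dS DERIV_cmult[OF dh]] d(1)], intro allI impI)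
      fix s :: real assume "\<bar>0 - s\<bar> < d"
      then have "\<phi> z \<le> \<phi> (x1 + s *\<^sub>R g, 0)" using d(2)[of s] z2 by simp
      then show "trace (S (x1 + 0 *\<^sub>R g)) - \<epsilon> * h (x1 + 0 *\<^sub>R g) \<le> trace (S (x1 + s *\<^sub>R g)) - \<epsilon> * h (x1 + s *\<^sub>R g)"
        using False by (simp add: \<phi>_def penalty_def inner_mat_1[symmetric] Sx1 hx1)
    qed
    moreover have "(x1 - y') \<bullet> g = - \<rho>\<^sup>2"
      unfolding nx1y'[symmetric] power2_norm_eq_inner g_def by (simp add: inner_diff_right)
    ultimately show False using \<epsilon>0 \<alpha>(1) \<rho>0 by (simp add: \<eta>_def)
  next
    \<comment> \<open>A negative minimum lies where \<open>h\<close> is positive and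
      \<open>S\<close> does not vanish, and in the interior of \<open>D\<close>. There the matrix
      may be replaced by the optimal one, and the inequality at the point contradicts the choice of
      \<alpha>.\<close>
    case True
    define x where "x = fst z"
    have xD: "x \<in> D" "norm (snd z) \<le> 2" using z(1) by (auto simp: x_def)
    have "0 \<le> penalty (snd z) (S x)" using pen[OF xD(1)] trnn[OF xD(1)] by (meson order_trans mult_nonneg_nonneg zero_le_divide_iff zero_le_numeral)
    then have "\<epsilon> * h x > 0" using True by (simp add: \<phi>_def x_def)
    then have "h x > 0" using \<epsilon>0 by (simp add: zero_less_mult_iff)
    then have xy': "norm (x - y') < \<rho>" using hpos by simp
    then have Sx: "S x \<noteq> 0" using nx1y' by (intro tan) auto
    have xint: "x \<in> ball x1 (\<rho> / 2)"
    proof (rule ccontr)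
      assume "x \<notin> ball x1 (\<rho> / 2)"
      then have "x \<in> Kx" using xD(1) xy' by (auto simp: D_def Kx_def dist_norm norm_minus_commute)
      from m(2)[OF this] have "3 / 4 * m \<le> penalty (snd z) (S x)" using pen[OF xD(1), of "snd z"] by linarith
      moreover have "\<epsilon> * h x \<le> \<epsilon>" using h1[of x] \<epsilon>0 by simp
      ultimately show False using True m(1) unfolding \<phi>_def x_def[symmetric] \<epsilon>_def by simp
    qed
    define s where "s = trace (S x)"
    have s: "s > 0" using trpos[OF xD(1) Sx] by (simp add: s_def)
    define M where "M = (1 / s) *\<^sub>R S x"
    have sM: "s *\<^sub>R M = S x" using s by (simp add: M_def)
    have xr: "x \<in> ball x0 r" using xD(1) D by blast
    have nM: "norm M \<le> 1" using norm_le_trace_psd[OF sym[OF xr] psd[OF xr]] s by (simp add: M_def s_def[symmetric] divide_le_eq)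
    have pM: "penalty M (S x) \<le> penalty N (S x)" for N
      by (rule penalty_min) (use s sM in \<open>simp_all add: s_def\<close>)
    have zM: "penalty M (S x) - \<epsilon> * h x \<le> \<phi> z" using pM[of "snd z"] by (simp add: \<phi>_def x_def)
    obtain E \<mu> where E0: "orthonormal_basis E \<and> (\<forall>g\<in>E. c \<le> \<mu> g \<and> \<mu> g \<le> L) \<and>
       (\<forall>b. norm b \<le> 1 \<longrightarrow> (\<Sum>g\<in>E. \<mu> g * (b \<bullet> (S2 x g *v b))) \<le> C * (norm (S x) + (\<Sum>g\<in>E. norm (S1 x g))))"
      using ineq[OF xr] by (elim exE) (rule that)
    then have E: "orthonormal_basis E" "\<And>g. g \<in> E \<Longrightarrow> c \<le> \<mu> g" "\<And>g. g \<in> E \<Longrightarrow> \<mu> g \<le> L"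
      "\<And>b. norm b \<le> 1 \<Longrightarrow> (\<Sum>g\<in>E. \<mu> g * (b \<bullet> (S2 x g *v b))) \<le> C * (norm (S x) + (\<Sum>g\<in>E. norm (S1 x g)))"
      by simp_all
    define k1 where "k1 g = - 2 * \<alpha> * ((x - y') \<bullet> g) * \<eta> x" for g
    define k2 where "k2 g = (4 * \<alpha>\<^sup>2 * ((x - y') \<bullet> g)\<^sup>2 - 2 * \<alpha>) * \<eta> x" for g
    have var: "penalty M (S1 x g) = \<epsilon> * k1 g"
      "0 \<le> penalty M (S2 x g) - (norm (S1 x g - trace (S1 x g) *\<^sub>R M))\<^sup>2 / (2 * trace (S x)) - \<epsilon> * k2 g" if "g \<in> E" for g
    proof -
      have ng: "norm g = 1" using E(1) that by (simp add: orthonormal_basis_def)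
      obtain d where d: "d > 0" "\<And>s. \<bar>s\<bar> < d \<Longrightarrow> x + s *\<^sub>R g \<in> D" using line[OF xint] by blast
      let ?k = "\<lambda>s. - 2 * \<alpha> * ((x + s *\<^sub>R g - y') \<bullet> g) * exp (- \<alpha> * ((x + s *\<^sub>R g - y') \<bullet> (x + s *\<^sub>R g - y')))"
      have a1: "((\<lambda>s. S (x + s *\<^sub>R g)) has_vector_derivative S1 (x + s *\<^sub>R g) g) (at s)" if "\<bar>s\<bar> < d" for s
        by (rule shift[OF d1]) (use d(2)[OF that] D in blast)
      have a3: "((\<lambda>s. \<epsilon> * h (x + s *\<^sub>R g)) has_real_derivative \<epsilon> * ?k s) (at s)" for s
        unfolding h_def \<eta>_def using DERIV_diff[OF gaussian_line_derivatives(1)[of \<alpha> x g y' s] DERIV_const]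
        by (intro DERIV_cmult) simp
      have a4: "((\<lambda>s. \<epsilon> * ?k s) has_real_derivative \<epsilon> * k2 g) (at 0)"
        unfolding k2_def \<eta>_def by (intro DERIV_cmult gaussian_line_derivatives(2) ng)
      have a5: "penalty M (S (x + 0 *\<^sub>R g)) - \<epsilon> * h (x + 0 *\<^sub>R g) \<le> penalty N (S (x + s *\<^sub>R g)) - \<epsilon> * h (x + s *\<^sub>R g)"
        if "\<bar>s\<bar> < d" "norm N \<le> 2" for s N
        using zM z2[OF d(2)[OF that(1)] that(2)] by (simp add: \<phi>_def)
      note v = penalty_variation[OF d(1) a1 d2[OF xr] a3 a4 _ _ nM a5]
      show "penalty M (S1 x g) = \<epsilon> * k1 g"
        "0 \<le> penalty M (S2 x g) - (norm (S1 x g - trace (S1 x g) *\<^sub>R M))\<^sup>2 / (2 * trace (S x)) - \<epsilon> * k2 g"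
        using v s sM by (simp_all add: s_def k1_def \<eta>_def)
    qed
    have h34: "3 / 4 * trace (S x) \<le> \<epsilon> * h x"
      using pen[OF xD(1), of M] zM True by linarith
    have main: "(\<Sum>g\<in>E. \<mu> g * k2 g) \<le> K * h x + 2 * C1 * (\<Sum>g\<in>E. \<bar>k1 g\<bar>)"
      unfolding K_def n_def
      by (rule minimum_principle_at_point[OF E(1,2) c C sym[OF xr] psd[OF xr] _ _ E(4) \<epsilon>0 h34 var])
         (use s sM in \<open>simp_all add: s_def C1_def n_def\<close>)
    have \<eta>0: "\<eta> x > 0" by (simp add: \<eta>_def)
    have low: "\<rho> / 2 \<le> norm (x - y')"
      using xint nx1y' norm_triangle_ineq[of "x1 - x" "x - y'"] by (simp add: dist_norm)
    have "(\<Sum>g\<in>E. \<bar>k1 g\<bar>) \<le> (\<Sum>g\<in>E. 2 * \<alpha> * \<rho> * \<eta> x)"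
    proof (rule sum_mono)
      fix g assume "g \<in> E"
      then have "norm g = 1" using E(1) by (simp add: orthonormal_basis_def)
      then have "\<bar>(x - y') \<bullet> g\<bar> \<le> \<rho>" using Cauchy_Schwarz_ineq2[of "x - y'" g] xy' by simp
      then have "2 * \<alpha> * \<bar>(x - y') \<bullet> g\<bar> * \<eta> x \<le> 2 * \<alpha> * \<rho> * \<eta> x"
        using \<alpha>(1) \<eta>0 by (intro mult_right_mono mult_left_mono) auto
      then show "\<bar>k1 g\<bar> \<le> 2 * \<alpha> * \<rho> * \<eta> x" using \<alpha>(1) \<eta>0 by (simp add: k1_def abs_mult)
    qed
    then have k1: "(\<Sum>g\<in>E. \<bar>k1 g\<bar>) \<le> n * (2 * \<alpha> * \<rho> * \<eta> x)" by (simp add: card_orthonormal_basis[OF E(1)] n_def)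
    have k2: "(c * (4 * \<alpha>\<^sup>2 * (\<rho> / 2)\<^sup>2) - L * (2 * \<alpha>) * n) * \<eta> x \<le> (\<Sum>g\<in>E. \<mu> g * k2 g)"
    proof -
      have "c * (4 * \<alpha>\<^sup>2 * (\<rho> / 2)\<^sup>2) \<le> c * (4 * \<alpha>\<^sup>2 * (norm (x - y'))\<^sup>2)"
        using low \<rho>0 c by (intro mult_left_mono power_mono) auto
      also have "\<dots> = (\<Sum>g\<in>E. c * (4 * \<alpha>\<^sup>2 * ((x - y') \<bullet> g)\<^sup>2))"
        unfolding power2_norm_eq_inner inner_orthonormal_basis[OF E(1), of "x - y'" "x - y'"] sum_distrib_left
        by (simp add: power2_eq_square)
      also have "\<dots> \<le> (\<Sum>g\<in>E. \<mu> g * (4 * \<alpha>\<^sup>2 * ((x - y') \<bullet> g)\<^sup>2))"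
        by (intro sum_mono mult_right_mono E(2)) auto
      finally have "c * (4 * \<alpha>\<^sup>2 * (\<rho> / 2)\<^sup>2) \<le> (\<Sum>g\<in>E. \<mu> g * (4 * \<alpha>\<^sup>2 * ((x - y') \<bullet> g)\<^sup>2))" .
      moreover have "(\<Sum>g\<in>E. \<mu> g * (2 * \<alpha>)) \<le> (\<Sum>g\<in>E. L * (2 * \<alpha>))"
        using \<alpha>(1) by (intro sum_mono mult_right_mono E(3)) auto
      then have "(\<Sum>g\<in>E. \<mu> g * (2 * \<alpha>)) \<le> L * (2 * \<alpha>) * n"
        by (simp add: card_orthonormal_basis[OF E(1)] n_def mult_ac)
      ultimately have "c * (4 * \<alpha>\<^sup>2 * (\<rho> / 2)\<^sup>2) - L * (2 * \<alpha>) * n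
          \<le> (\<Sum>g\<in>E. \<mu> g * (4 * \<alpha>\<^sup>2 * ((x - y') \<bullet> g)\<^sup>2)) - (\<Sum>g\<in>E. \<mu> g * (2 * \<alpha>))" by linarith
      from mult_right_mono[OF this less_imp_le[OF \<eta>0]] show ?thesis
        by (simp only: k2_def sum_subtractf[symmetric] sum_distrib_right right_diff_distrib[symmetric] mult.assoc)
    qed
    have "h x \<le> \<eta> x" by (simp add: h_def)
    then have "K * h x \<le> K * \<eta> x" using K0 by (rule mult_left_mono)
    moreover have "2 * C1 * (\<Sum>g\<in>E. \<bar>k1 g\<bar>) \<le> 2 * C1 * (n * (2 * \<alpha> * \<rho> * \<eta> x))"
      using k1 C10 by (intro mult_left_mono) auto
    ultimately have "(c * (4 * \<alpha>\<^sup>2 * (\<rho> / 2)\<^sup>2) - L * (2 * \<alpha>) * n) * \<eta> x \<le> (K + 2 * C1 * (n * (2 * \<alpha> * \<rho>))) * \<eta> x"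
      using main k2 by (simp add: algebra_simps)
    then have "c * (4 * \<alpha>\<^sup>2 * (\<rho> / 2)\<^sup>2) - L * (2 * \<alpha>) * n \<le> K + 2 * C1 * (n * (2 * \<alpha> * \<rho>))"
      using \<eta>0 by simp
    then show False using \<alpha>(2) by (simp add: power2_eq_square algebra_simps)
  qed
qed

section \<open>Third and fourth derivatives\<close>

lemma Ck_on_dirD: "Ck_on (Suc k) S f \<Longrightarrow> Ck_on k S (dirD f h)"
  by (simp add: Ck_on_Suc)

lemma Ck_on_differentiable: "Ck_on (Suc k) S f \<Longrightarrow> x \<in> S \<Longrightarrow> f differentiable (at x)"
  by (simp add: Ck_on_Suc)

lemma dirD_rotate:
  fixes f :: "'a::real_normed_vector \<Rightarrow> real"
  assumes S: "open S" "x \<in> S" and C: "Ck_on (Suc (Suc (Suc 0))) S f"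
  shows "dirD (dirD (dirD f a) b) g x = dirD (dirD (dirD f g) a) b x"
proof -
  have C2: "Ck_on 2 S f" "Ck_on 2 S (dirD f h)" for h
    using Ck_on_dirD[OF C] Ck_on_SucD[OF C] by (simp_all add: numeral_2_eq_2)
  have "dirD (dirD (dirD f a) b) g x = dirD (dirD (dirD f a) g) b x"
    by (rule dirD_commute[OF S C2(2)])
  also have "\<dots> = dirD (dirD (dirD f g) a) b x"
    by (rule dirD_cong_open[OF S dirD_commute[OF S(1) _ C2(1)]])
       (rule Ck_on_differentiable[OF Ck_on_dirD[OF Ck_on_dirD[OF C]] S(2)] | assumption)+
  finally show ?thesis .
qed

lemma dirD_pairs_commute:
  fixes f :: "'a::real_normed_vector \<Rightarrow> real"
  assumes S: "open S" "x \<in> S" and C: "Ck_on (Suc (Suc (Suc (Suc 0)))) S f"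
  shows "dirD (dirD (dirD (dirD f a) a) b) b x = dirD (dirD (dirD (dirD f b) b) a) a x"
proof -
  have "dirD (dirD (dirD (dirD f a) a) b) b x = dirD (dirD (dirD (dirD f b) a) a) b x"
    by (rule dirD_cong_open[OF S dirD_rotate[OF S(1) _ Ck_on_SucD[OF C]]])
       (rule Ck_on_differentiable[OF Ck_on_dirD[OF Ck_on_dirD[OF Ck_on_dirD[OF C]]] S(2)] | assumption)+
  also have "\<dots> = dirD (dirD (dirD (dirD f b) b) a) a x"
    by (rule dirD_rotate[OF S Ck_on_dirD[OF C]])
  finally show ?thesis .
qed

text \<open>Symmetry of the third derivative tensor: the direction of differentiation and the
  argument of the Hessian change places. The next lemma does the same for fourth derivatives with
  paired arguments.\<close>

lemma hessian_dirD_swap: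
  assumes S: "open S" "x \<in> S" and C: "Ck_on (Suc (Suc (Suc 0))) S f"
  shows "hessian (dirD f a) x *v b = hessian (dirD f b) x *v a"
proof (rule vector_eq_rdot[THEN iffD1], rule allI)
  have C2: "Ck_on 2 S (dirD f h)" for h using Ck_on_dirD[OF C] by (simp add: numeral_2_eq_2)
  fix z
  show "(hessian (dirD f a) x *v b) \<bullet> z = (hessian (dirD f b) x *v a) \<bullet> z"
    unfolding inner_commute[of _ z] gradient_has_derivative(2)[OF S C2]
    using dirD_rotate[OF S C, of z b a] dirD_rotate[OF S C, of z a b] dirD_commute[OF S C2, of z a b]
    by simp
qed

lemma hessian_dirD_pairs_swap:
  assumes S: "open S" "x \<in> S" and C: "Ck_on (Suc (Suc (Suc (Suc 0)))) S f"
  shows "b \<bullet> (hessian (dirD (dirD f a) a) x *v b) = a \<bullet> (hessian (dirD (dirD f b) b) x *v a)"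
proof -
  have C2: "Ck_on 2 S (dirD (dirD f h) h)" for h
    using Ck_on_dirD[OF Ck_on_dirD[OF C]] by (simp add: numeral_2_eq_2)
  show ?thesis unfolding gradient_has_derivative(2)[OF S C2] by (rule dirD_pairs_commute[OF S C])
qed

lemma hessian_line_derivative:
  assumes S: "open S" "x \<in> S" and C: "Ck_on (Suc (Suc (Suc 0))) S f"
  shows "((\<lambda>s. hessian f (x + s *\<^sub>R g)) has_vector_derivative hessian (dirD f g) x) (at 0)"
proof -
  have C2: "Ck_on 2 S f" "Ck_on 2 S (dirD f g)"
    using Ck_on_dirD[OF C] Ck_on_SucD[OF C] by (simp_all add: numeral_2_eq_2)
  obtain d where d: "d > 0" "\<And>s. \<bar>s\<bar> < d \<Longrightarrow> x + s *\<^sub>R g \<in> S" using open_line_segment[OF S] by blast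
  have "((\<lambda>s. hessian f (x + s *\<^sub>R g) $ i $ j) has_real_derivative hessian (dirD f g) x $ i $ j) (at 0)" for i j
  proof -
    have "dirD (dirD f (axis i 1)) (axis j 1) differentiable (at (x + 0 *\<^sub>R g))"
      using Ck_on_differentiable[OF Ck_on_dirD[OF Ck_on_dirD[OF C]] S(2)] by simp
    from DERIV_line[OF this]
    have "((\<lambda>s. dirD (dirD f (axis i 1)) (axis j 1) (x + s *\<^sub>R g)) has_real_derivative hessian (dirD f g) x $ i $ j) (at 0)"
      by (simp add: hessian_entry[OF S C2(2)] dirD_rotate[OF S C])
    then show ?thesis
      by (rule DERIV_cong_ev[OF refl _ refl, THEN iffD2, rotated])
         (use d in \<open>auto simp: eventually_nhds_metric dist_real_def hessian_entry[OF S(1) _ C2(1)]\<close>)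
  qed
  then have "((\<lambda>s. \<chi> i j. hessian f (x + s *\<^sub>R g) $ i $ j) has_vector_derivative (\<chi> i j. hessian (dirD f g) x $ i $ j)) (at 0)"
    unfolding has_real_derivative_iff_has_vector_derivative has_vector_derivative_def
    by (subst has_derivative_componentwise_within)
       (auto simp: Basis_vec_def inner_axis intro!: has_derivative_eq_rhs)
  then show ?thesis by simp
qed

section \<open>Differentiating the inverse matrix\<close>

lemma has_vector_derivative_at_0_iff:
  fixes f :: "real \<Rightarrow> 'a::real_normed_vector"
  shows "(f has_vector_derivative f') (at 0) \<longleftrightarrow> ((\<lambda>s. (1 / s) *\<^sub>R (f s - f 0)) \<longlongrightarrow> f') (at 0)"
proof -
  have "norm ((1 / s) *\<^sub>R (f s - f 0) - f') = norm (f s - f 0 - s *\<^sub>R f') / norm s" if "s \<noteq> 0" for s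
  proof -
    have "(1 / s) *\<^sub>R (f s - f 0) - f' = (1 / s) *\<^sub>R (f s - f 0 - s *\<^sub>R f')"
      using that by (simp add: scaleR_diff_right)
    then show ?thesis by simp
  qed
  then have "((\<lambda>s. norm ((1 / s) *\<^sub>R (f s - f 0) - f')) \<longlongrightarrow> 0) (at 0) \<longleftrightarrow>
      ((\<lambda>s. norm (f s - f 0 - s *\<^sub>R f') / norm s) \<longlongrightarrow> 0) (at 0)"
    by (intro filterlim_cong refl) (auto simp: eventually_at intro!: exI[of _ 1])
  then show ?thesis
    unfolding has_vector_derivative_def has_derivative_at
    by (simp add: bounded_linear_scaleR_left tendsto_norm_zero_iff Lim_null[of _ f'])
qed

text \<open>The resolvent identity \<open>X s - X 0 = - (X s ** (A s - A 0) ** X 0)\<close>, divided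
  by \<open>s\<close>, together with the continuity of \<open>X\<close> at 0.\<close>

lemma matrix_inverse_line_derivative:
  fixes A X :: "real \<Rightarrow> real^'n^'n"
  assumes A: "(A has_vector_derivative A') (at 0)" and X: "(X \<longlongrightarrow> X 0) (at 0)"
    and inv: "d > 0" "\<And>s. \<bar>s\<bar> < d \<Longrightarrow> A s ** X s = mat 1 \<and> X s ** A s = mat 1"
  shows "(X has_vector_derivative - (X 0 ** A' ** X 0)) (at 0)"
  unfolding has_vector_derivative_at_0_iff
proof (rule Lim_transform_eventually)
  note ms = bounded_bilinear.tendsto[OF bounded_bilinear_matrix_matrix]
  show "((\<lambda>s. - (X s ** ((1 / s) *\<^sub>R (A s - A 0)) ** X 0)) \<longlongrightarrow> - (X 0 ** A' ** X 0)) (at 0)"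
    by (intro tendsto_minus ms X tendsto_const A[unfolded has_vector_derivative_at_0_iff])
  have "- (X s ** ((1 / s) *\<^sub>R (A s - A 0)) ** X 0) = (1 / s) *\<^sub>R (X s - X 0)" if "\<bar>s\<bar> < d" for s
  proof -
    have "X s ** (A s - A 0) ** X 0 = (X s ** A s) ** X 0 - X s ** (A 0 ** X 0)"
      by (simp add: matrix_mult_simps matrix_mul_assoc)
    also have "\<dots> = X 0 - X s" using inv(2)[OF that] inv(2)[of 0] inv(1) by simp
    finally show ?thesis by (simp add: matrix_mult_simps scaleR_minus_right[symmetric] del: scaleR_minus_right)
  qed
  then show "\<forall>\<^sub>F s in at 0. - (X s ** ((1 / s) *\<^sub>R (A s - A 0)) ** X 0) = (1 / s) *\<^sub>R (X s - X 0)"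
    using inv(1) by (auto simp: eventually_at dist_real_def)
qed

section \<open>Bounds for inverses, kernels and linear functionals\<close>

lemma norm_le_sum_basis:
  fixes A :: "real^'n^'n"
  assumes E: "orthonormal_basis E"
  shows "norm A \<le> (\<Sum>e\<in>E. norm (A *v e))"
proof -
  have f: "finite E" using E by (simp add: orthonormal_basis_def)
  have "(norm A)\<^sup>2 = (\<Sum>e\<in>E. norm (A *v e) * norm (A *v e))"
    unfolding power2_norm_eq_inner inner_matrix_orthonormal_basis[OF E]
    by (simp add: dot_square_norm power2_eq_square)
  also have "\<dots> \<le> (\<Sum>e\<in>E. norm (A *v e) * (\<Sum>e\<in>E. norm (A *v e)))"
    by (intro sum_mono mult_left_mono member_le_sum f) auto
  also have "\<dots> = (\<Sum>e\<in>E. norm (A *v e))\<^sup>2" by (simp add: sum_distrib_right power2_eq_square)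
  finally show ?thesis by (rule power2_le_imp_le) (simp add: sum_nonneg)
qed

lemma exists_orthonormal_basis: "\<exists>E. orthonormal_basis (E :: (real^'n) set)"
  using spectral_theorem[of "mat 1 :: real^'n^'n"] transpose_mat by blast

lemma norm_matrix_inv_le:
  fixes A :: "real^'n^'n"
  assumes A: "pos_def A" and c: "c > 0" "\<And>z. c * (norm z)\<^sup>2 \<le> z \<bullet> (A *v z)"
  shows "norm (matrix_inv A) \<le> real CARD('n) / c"
proof -
  let ?X = "matrix_inv A"
  obtain E :: "(real^'n) set" where E: "orthonormal_basis E" using exists_orthonormal_basis by blast
  have "norm (?X *v e) \<le> 1 / c" if "e \<in> E" for e
  proof -
    have Ae: "A *v (?X *v e) = e" using pos_def_invertible(1)[OF A] by (simp add: matrix_vector_mul_assoc)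
    have e: "norm e = 1" using E that by (simp add: orthonormal_basis_def)
    have "c * (norm (?X *v e))\<^sup>2 \<le> (?X *v e) \<bullet> e" using c(2)[of "?X *v e"] by (simp add: Ae)
    also have "\<dots> \<le> norm (?X *v e)" using norm_cauchy_schwarz[of "?X *v e" e] e by simp
    finally have "norm (?X *v e) * (c * norm (?X *v e)) \<le> norm (?X *v e) * 1" by (simp add: power2_eq_square mult_ac)
    then show ?thesis using c(1) by (cases "?X *v e = 0") (simp_all add: field_simps)
  qed
  then have "(\<Sum>e\<in>E. norm (?X *v e)) \<le> (\<Sum>e\<in>E. 1 / c)" by (rule sum_mono)
  then show ?thesis using norm_le_sum_basis[OF E, of ?X] by (simp add: card_orthonormal_basis[OF E])
qed

lemma pos_def_lower_bound:
  fixes A :: "real^'n^'n"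
  assumes "pos_def A"
  shows "\<exists>c>0. \<forall>z. c * (norm z)\<^sup>2 \<le> z \<bullet> (A *v z)"
proof -
  have "continuous_on (sphere 0 1) (\<lambda>z. z \<bullet> (A *v z))"
    by (intro continuous_intros bounded_bilinear.continuous_on[OF bounded_bilinear_matrix_vector])
  moreover have "axis undefined 1 \<in> sphere (0 :: real^'n) 1" by simp
  ultimately obtain e where e: "e \<in> sphere 0 1" "\<And>z. z \<in> sphere 0 1 \<Longrightarrow> e \<bullet> (A *v e) \<le> z \<bullet> (A *v z)"
    using continuous_attains_inf[of "sphere 0 1" "\<lambda>z. z \<bullet> (A *v z)"] by (metis compact_sphere empty_iff)
  let ?c = "e \<bullet> (A *v e)"
  have "?c > 0" using e(1) assms unfolding pos_def_def by (metis dist_0_norm mem_sphere norm_zero zero_neq_one)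
  moreover have "?c * (norm z)\<^sup>2 \<le> z \<bullet> (A *v z)" for z
  proof (cases "z = 0")
    case False
    then have "?c \<le> (z /\<^sub>R norm z) \<bullet> (A *v (z /\<^sub>R norm z))" by (intro e(2)) simp
    then show ?thesis using False by (simp add: matrix_vector_simps power2_eq_square field_simps)
  qed simp
  ultimately show ?thesis by blast
qed

lemma psd_kernel:
  fixes A :: "real^'n^'n"
  assumes A: "transpose A = A" "\<And>x. 0 \<le> x \<bullet> (A *v x)" and z: "z \<bullet> (A *v z) = 0"
  shows "A *v z = 0"
proof -
  obtain E where E: "orthonormal_basis E" "\<And>e. e \<in> E \<Longrightarrow> A *v e = (e \<bullet> (A *v e)) *\<^sub>R e"
    using spectral_theorem[OF A(1)] by blast
  have f: "finite E" using E(1) by (simp add: orthonormal_basis_def)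
  have Az: "(A *v z) \<bullet> e = (e \<bullet> (A *v e)) * (z \<bullet> e)" if "e \<in> E" for e
    using sym_matrix_inner[OF A(1), of e z] E(2)[OF that] inner_scaleR_right[of z "e \<bullet> (A *v e)" e]
    by (simp add: inner_commute)
  have "(\<Sum>e\<in>E. (e \<bullet> (A *v e)) * (z \<bullet> e)\<^sup>2) = 0"
    using z inner_orthonormal_basis[OF E(1), of z "A *v z"] by (simp add: Az power2_eq_square mult.left_commute)
  then have "(e \<bullet> (A *v e)) * (z \<bullet> e)\<^sup>2 = 0" if "e \<in> E" for e
    using sum_nonneg_eq_0_iff[OF f, of "\<lambda>e. (e \<bullet> (A *v e)) * (z \<bullet> e)\<^sup>2"] A(2) that by simp
  then have "(A *v z) \<bullet> e = 0" if "e \<in> E" for e using Az[OF that] that by fastforce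
  then have "(\<Sum>e\<in>E. ((A *v z) \<bullet> e) *\<^sub>R e) = 0" by simp
  then show ?thesis by (simp add: orthonormal_basis_expand[OF E(1)])
qed

lemma inner_transpose: "transpose A \<bullet> B = A \<bullet> transpose B" for A B :: "real^'n^'n"
  by (simp add: inner_vec_def transpose_def) (rule sum.swap)

text \<open>On symmetric arguments the representing matrix may be symmetrised. It can then be
  diagonalised, which turns the linearised operator into a weighted sum over an orthonormal
  basis.\<close>

lemma linear_functional_symmetric_matrix:
  fixes F :: "real^'n^'n \<Rightarrow> real"
  assumes "linear F"
  shows "\<exists>\<F>. transpose \<F> = \<F> \<and> (\<forall>Z. transpose Z = Z \<longrightarrow> F Z = \<F> \<bullet> Z)"
proof -
  define G where "G = (\<Sum>b\<in>Basis. F b *\<^sub>R b)"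
  have G: "F Z = G \<bullet> Z" for Z
  proof -
    have "F Z = F (\<Sum>b\<in>Basis. (Z \<bullet> b) *\<^sub>R b)" by (simp only: euclidean_representation)
    also have "\<dots> = G \<bullet> Z"
      by (simp add: linear_sum[OF assms] linear_cmul[OF assms] G_def inner_sum_left inner_sum_right inner_commute[of _ Z] mult.commute)
    finally show ?thesis .
  qed
  have "F Z = ((1 / 2) *\<^sub>R (G + transpose G)) \<bullet> Z" if "transpose Z = Z" for Z
    using that by (simp add: G inner_add_left inner_transpose)
  moreover have "transpose ((1 / 2) *\<^sub>R (G + transpose G)) = (1 / 2) *\<^sub>R (G + transpose G)"
    by (simp add: transpose_scaleR transpose_add add.commute)
  ultimately show ?thesis by blast
qed

section \<open>Local constancy of the rank\<close>

lemma has_derivative_line: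
  fixes F :: "'a::real_normed_vector \<Rightarrow> 'b::real_normed_vector"
  assumes "(F has_derivative F') (at y)"
  shows "((\<lambda>s. F (y + s *\<^sub>R w)) has_vector_derivative F' w) (at 0)"
proof -
  have "((\<lambda>s. F (y + s *\<^sub>R w)) has_derivative (\<lambda>s. F' (s *\<^sub>R w))) (at 0)"
    by (rule has_derivative_compose[where g = F and f = "\<lambda>s. y + s *\<^sub>R w" and f' = "\<lambda>s. s *\<^sub>R w" and g' = F'])
       (auto intro!: derivative_eq_intros assms)
  then show ?thesis
    unfolding has_vector_derivative_def by (simp add: linear_cmul[OF has_derivative_linear[OF assms]])
qed

context curvature_solution
begin

section \<open>The equation differentiated along lines\<close>

definition vjet :: "real^'n \<Rightarrow> (real^'n) \<times> real \<times> (real^'n^'n)" where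
  "vjet x = (gradient v x, - v x, hessian v x)"

lemma C3_v: "Ck_on (Suc (Suc (Suc 0))) \<Omega> v" and C4'_v: "Ck_on (Suc (Suc (Suc (Suc 0)))) \<Omega> v"
proof -
  show "Ck_on (Suc (Suc (Suc (Suc 0)))) \<Omega> v" using C4_v by (simp add: eval_nat_numeral)
  then show "Ck_on (Suc (Suc (Suc 0))) \<Omega> v" by (rule Ck_on_SucD)
qed

lemma C3_dv: "Ck_on (Suc (Suc (Suc 0))) \<Omega> (dirD v w)"
  by (rule Ck_on_dirD[OF C4'_v])

lemma C2_dv: "Ck_on 2 \<Omega> (dirD v w)" "Ck_on 2 \<Omega> (dirD (dirD v w) w')"
  using Ck_on_SucD[OF C3_dv] Ck_on_dirD[OF C3_dv] by (simp_all add: numeral_2_eq_2)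

lemma vjet_line:
  assumes "x \<in> \<Omega>"
  shows "((\<lambda>s. vjet (x + s *\<^sub>R w)) has_vector_derivative
      (hessian v x *v w, - (gradient v x \<bullet> w), hessian (dirD v w) x)) (at 0)"
proof -
  have d: "v differentiable (at x)" using Ck_on_differentiable[OF C3_v assms] .
  show ?thesis unfolding vjet_def
    by (intro has_vector_derivative_Pair has_derivative_line[OF gradient_has_derivative(1)[OF open_dom assms C2_v]]
        hessian_line_derivative[OF open_dom assms C3_v] has_vector_derivative_minus)
       (use has_derivative_line[OF has_derivative_dirD[OF d], of w] in \<open>simp add: gradient_inner[OF d]\<close>)
qed

lemma FFz_vjet: "x \<in> \<Omega> \<Longrightarrow> FFz (vjet x) = 1"
  using pde_v(1) by (simp add: FFz_def vjet_def)

lemma pde_first_derivative: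
  assumes jet: "jet FFz f1 f2" and x: "x \<in> \<Omega>"
  shows "f1 (vjet x) (hessian v x *v w, - (gradient v x \<bullet> w), hessian (dirD v w) x) = 0"
proof -
  obtain d where d: "d > 0" "\<And>s. \<bar>s\<bar> < d \<Longrightarrow> x + s *\<^sub>R w \<in> \<Omega>" using open_line_segment[OF open_dom x] by blast
  have "((\<lambda>s. FFz (vjet (x + s *\<^sub>R w))) has_real_derivative
      f1 (vjet (x + 0 *\<^sub>R w)) (hessian v x *v w, - (gradient v x \<bullet> w), hessian (dirD v w) x)) (at 0)"
    by (rule jetD(3)[OF jet vjet_line[OF x]])
  moreover have "\<forall>s. \<bar>0 - s\<bar> < d \<longrightarrow> FFz (vjet (x + 0 *\<^sub>R w)) = FFz (vjet (x + s *\<^sub>R w))"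
    using FFz_vjet[OF x] FFz_vjet[OF d(2)] by simp
  ultimately show ?thesis using DERIV_local_const[OF _ d(1)] by fastforce
qed

lemma pde_second_derivative:
  assumes jet: "jet FFz f1 f2" and x: "x \<in> \<Omega>"
  shows "f2 (vjet x) (hessian v x *v w, - (gradient v x \<bullet> w), hessian (dirD v w) x)
     (hessian (dirD v w) x *v w, - (w \<bullet> (hessian v x *v w)), hessian (dirD (dirD v w) w) x) = 0"
proof -
  obtain d where d: "d > 0" "\<And>s. \<bar>s\<bar> < d \<Longrightarrow> x + s *\<^sub>R w \<in> \<Omega>" using open_line_segment[OF open_dom x] by blast
  let ?\<gamma> = "\<lambda>s. vjet (x + s *\<^sub>R w)"
  let ?\<gamma>1 = "\<lambda>s. (hessian v (x + s *\<^sub>R w) *v w, - (gradient v (x + s *\<^sub>R w) \<bullet> w), hessian (dirD v w) (x + s *\<^sub>R w))"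
  have 1: "(?\<gamma> has_vector_derivative ?\<gamma>1 0) (at 0)" using vjet_line[OF x, of w] by simp
  have 2: "(?\<gamma>1 has_vector_derivative
      (hessian (dirD v w) x *v w, - ((hessian v x *v w) \<bullet> w), hessian (dirD (dirD v w) w) x)) (at 0)"
    by (intro has_vector_derivative_Pair has_vector_derivative_minus
        hessian_line_derivative[OF open_dom x C3_dv]
        bounded_linear.has_vector_derivative[OF bounded_bilinear.bounded_linear_left[OF bounded_bilinear_matrix_vector]]
        bounded_linear.has_vector_derivative[OF bounded_linear_inner_left]
        hessian_line_derivative[OF open_dom x C3_v] has_derivative_line[OF gradient_has_derivative(1)[OF open_dom x C2_v]])
  have D: "((\<lambda>s. f1 (?\<gamma> s) (?\<gamma>1 s)) has_real_derivative f2 (?\<gamma> 0) (?\<gamma>1 0)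
      (hessian (dirD v w) x *v w, - ((hessian v x *v w) \<bullet> w), hessian (dirD (dirD v w) w) x)) (at 0)"
    using jetD(4)[OF jet, of ?\<gamma> ?\<gamma>1 0, OF 1 2] .
  have eq: "\<forall>s. \<bar>0 - s\<bar> < d \<longrightarrow> f1 (?\<gamma> 0) (?\<gamma>1 0) = f1 (?\<gamma> s) (?\<gamma>1 s)"
    using pde_first_derivative[OF jet d(2)] d(1) pde_first_derivative[OF jet x] by simp
  have "f2 (?\<gamma> 0) (?\<gamma>1 0)
      (hessian (dirD v w) x *v w, - ((hessian v x *v w) \<bullet> w), hessian (dirD (dirD v w) w) x) = 0"
    by (rule DERIV_local_const[OF D d(1) eq])
  then show ?thesis by (simp add: inner_commute)
qed

text \<open>Ellipticity of the linearised equation: the operator is affine in the coefficient of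
  \<open>tensor g g\<close>, with positive slope.\<close>

lemma linearization_tensor_pos:
  assumes jet: "jet FFz f1 f2" and x: "x \<in> \<Omega>" and g: "g \<noteq> 0"
  shows "f1 (vjet x) (0, 0, tensor g g) > 0"
proof -
  obtain d where d: "d > 0" "\<And>\<tau>. FF (gradient v x) (- v x) (hessian v x + \<tau> *\<^sub>R tensor g g) = 1 + \<tau> * d"
    using pde_v(3)[OF x g] by blast
  have "((\<lambda>\<tau>. (gradient v x, - v x, hessian v x + \<tau> *\<^sub>R tensor g g)) has_vector_derivative (0, 0, tensor g g)) (at 0)"
    by (intro has_vector_derivative_Pair) (auto intro!: derivative_eq_intros simp: has_vector_derivative_def)
  from jetD(3)[OF jet this] have "((\<lambda>\<tau>. 1 + \<tau> * d) has_real_derivative f1 (vjet x) (0, 0, tensor g g)) (at 0)"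
    by (simp add: FFz_def d(2) vjet_def)
  moreover have "((\<lambda>\<tau>. 1 + \<tau> * d) has_real_derivative d) (at 0)" by (auto intro!: derivative_eq_intros)
  ultimately show ?thesis using d(1) DERIV_unique by blast
qed

lemma pos_def_neighbourhood:
  assumes x0: "x0 \<in> \<Omega>" and P: "pos_def (hessian v x0 + P)" "transpose P = P"
  shows "\<exists>c>0. \<exists>r>0. cball x0 r \<subseteq> \<Omega> \<and>
    (\<forall>x\<in>cball x0 r. pos_def (hessian v x + P) \<and> (\<forall>z. c * (norm z)\<^sup>2 \<le> z \<bullet> ((hessian v x + P) *v z)))"
proof -
  obtain c where c: "c > 0" "\<And>z. c * (norm z)\<^sup>2 \<le> z \<bullet> ((hessian v x0 + P) *v z)"
    using pos_def_lower_bound[OF P(1)] by blast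
  obtain r1 where r1: "r1 > 0" "cball x0 r1 \<subseteq> \<Omega>" using open_dom x0 open_contains_cball by blast
  obtain r2 where r2: "r2 > 0" "\<And>x. x \<in> \<Omega> \<Longrightarrow> dist x x0 < r2 \<Longrightarrow> dist (hessian v x) (hessian v x0) < c / 2"
    using continuous_on_hessian[OF open_dom C2_v] c(1) x0 unfolding continuous_on_iff by (metis half_gt_zero)
  define r where "r = min r1 (r2 / 2)"
  have r: "r > 0" "r \<le> r1" "r < r2" using r1(1) r2(1) by (auto simp: r_def)
  have low: "c / 2 * (norm z)\<^sup>2 \<le> z \<bullet> ((hessian v x + P) *v z)" if x: "x \<in> cball x0 r" for x z
  proof -
    have "x \<in> \<Omega>" using x r(2) r1(2) by auto
    then have n: "norm (hessian v x - hessian v x0) \<le> c / 2"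
      using r2(2)[of x] x r(3) by (simp add: dist_norm dist_commute less_imp_le norm_minus_commute)
    have "\<bar>z \<bullet> ((hessian v x - hessian v x0) *v z)\<bar> \<le> norm z * norm ((hessian v x - hessian v x0) *v z)"
      by (rule Cauchy_Schwarz_ineq2)
    also have "\<dots> \<le> norm z * (c / 2 * norm z)"
      by (intro mult_left_mono order_trans[OF norm_matrix_vector_le mult_right_mono[OF n]]) auto
    finally have "\<bar>z \<bullet> ((hessian v x - hessian v x0) *v z)\<bar> \<le> c / 2 * (norm z)\<^sup>2" by (simp add: power2_eq_square mult_ac)
    moreover have "z \<bullet> ((hessian v x + P) *v z) = z \<bullet> ((hessian v x0 + P) *v z) + z \<bullet> ((hessian v x - hessian v x0) *v z)"
      by (simp add: matrix_vector_simps inner_add_right inner_diff_right)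
    ultimately show ?thesis using c(2)[of z] by (simp add: abs_le_iff)
  qed
  have "pos_def (hessian v x + P)" if x: "x \<in> cball x0 r" for x
  proof -
    have "x \<in> \<Omega>" using x r(2) r1(2) by auto
    then have "transpose (hessian v x + P) = hessian v x + P" using hessian_v_sym P(2) by (simp add: transpose_add)
    moreover have "0 < z \<bullet> ((hessian v x + P) *v z)" if "z \<noteq> 0" for z
      using less_le_trans[OF _ low[OF x, of z]] that c(1) by simp
    ultimately show ?thesis by (simp add: pos_def_def)
  qed
  then show ?thesis using low c(1) r r1(2) by (intro exI[of _ "c / 2"] conjI exI[of _ r]) auto
qed

end

lemma continuous_on_cball_bounded:
  fixes F :: "'a::euclidean_space \<Rightarrow> 'b::real_normed_vector"
  assumes "continuous_on (cball x r) F"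
  shows "\<exists>R\<ge>0. \<forall>y\<in>cball x r. norm (F y) \<le> R"
proof -
  have "bounded (F ` cball x r)" using assms by (intro compact_imp_bounded compact_continuous_image) auto
  then obtain R where "\<forall>y\<in>cball x r. norm (F y) \<le> R" unfolding bounded_iff by auto
  then show ?thesis by (intro exI[of _ "max R 0"]) (auto simp: le_max_iff_disj)
qed

lemma continuous_on_tensor: "continuous_on A (\<lambda>z. tensor (f z) (f z))" if "continuous_on A f"
  unfolding tensor_def by (intro continuous_on_vec_lambda continuous_intros that)

lemma continuous_on_matrix_inv:
  fixes A :: "'a::metric_space \<Rightarrow> real^'n^'n"
  assumes A: "continuous_on T A" and pos: "\<And>x. x \<in> T \<Longrightarrow> pos_def (A x)"
    and K: "\<And>x. x \<in> T \<Longrightarrow> norm (matrix_inv (A x)) \<le> K"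
  shows "continuous_on T (\<lambda>x. matrix_inv (A x))"
  unfolding continuous_on_iff
proof (intro ballI allI impI)
  fix x and e :: real assume x: "x \<in> T" and e: "e > 0"
  have K0: "K \<ge> 0" using order_trans[OF norm_ge_zero K[OF x]] .
  have K1: "K * K + 1 > 0" using K0 by (simp add: add_nonneg_pos)
  then obtain d where d: "d > 0" "\<And>y. y \<in> T \<Longrightarrow> dist y x < d \<Longrightarrow> dist (A y) (A x) < e / (K * K + 1)"
    using A x e unfolding continuous_on_iff by (metis divide_pos_pos)
  have "dist (matrix_inv (A y)) (matrix_inv (A x)) < e" if y: "y \<in> T" "dist y x < d" for y
  proof -
    let ?X = "matrix_inv (A x)" and ?Y = "matrix_inv (A y)"
    have "?Y ** (A x - A y) ** ?X = ?Y ** (A x ** ?X) - (?Y ** A y) ** ?X"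
      by (simp add: matrix_mult_simps matrix_mul_assoc)
    then have eq: "?Y - ?X = ?Y ** (A x - A y) ** ?X"
      using pos_def_invertible[OF pos[OF x]] pos_def_invertible[OF pos[OF y(1)]] by simp
    have "norm (?Y - ?X) \<le> norm ?Y * norm (A x - A y) * norm ?X"
      unfolding eq by (rule order_trans[OF norm_matrix_matrix_le mult_right_mono[OF norm_matrix_matrix_le]]) simp
    also have "\<dots> \<le> K * norm (A x - A y) * K"
      using K[OF x] K[OF y(1)] K0 by (intro mult_mono) auto
    also have "\<dots> = K * K * dist (A y) (A x)" by (simp add: dist_norm norm_minus_commute)
    also have "\<dots> \<le> K * K * (e / (K * K + 1))"
      using d(2)[OF y] K0 by (intro mult_left_mono) auto
    also have "\<dots> < e" using e K1 by (simp add: field_simps)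
    finally show ?thesis by (simp add: dist_norm)
  qed
  then show "\<exists>d>0. \<forall>y\<in>T. dist y x < d \<longrightarrow> dist (matrix_inv (A y)) (matrix_inv (A x)) < e"
    using d(1) by blast
qed

context curvature_solution
begin

section \<open>Uniform bounds on compact balls\<close>

lemma cont_vjet: "continuous_on \<Omega> (gradient v)" "continuous_on \<Omega> v" "continuous_on \<Omega> (hessian v)"
  using continuous_on_gradient[of \<Omega> v] Ck_on_mono[OF C2_v, of 1] Ck_on_imp_continuous_on[OF C2_v]
    continuous_on_hessian[OF open_dom C2_v] by simp_all

text \<open>By symmetry the columns of \<open>hessian (dirD v w) x\<close> are finitely many fixed
  Hessians applied to \<open>w\<close>, which gives a bound uniform in \<open>w\<close>.\<close>

lemma third_derivative_bound:
  assumes "cball x0 r \<subseteq> \<Omega>"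
  shows "\<exists>R\<ge>0. \<forall>x\<in>cball x0 r. \<forall>w. norm (hessian (dirD v w) x) \<le> R * norm w"
proof -
  obtain E :: "(real^'n) set" where E: "orthonormal_basis E" using exists_orthonormal_basis by blast
  have "continuous_on (cball x0 r) (\<lambda>x. \<Sum>e\<in>E. norm (hessian (dirD v e) x))"
    by (intro continuous_intros continuous_on_subset[OF continuous_on_hessian[OF open_dom C2_dv(1)] assms])
  then obtain R where R: "R \<ge> 0" "\<And>x. x \<in> cball x0 r \<Longrightarrow> norm (\<Sum>e\<in>E. norm (hessian (dirD v e) x)) \<le> R"
    using continuous_on_cball_bounded by blast
  have "norm (hessian (dirD v w) x) \<le> R * norm w" if x: "x \<in> cball x0 r" for x w
  proof -
    have x\<Omega>: "x \<in> \<Omega>" using x assms by blast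
    have "norm (hessian (dirD v w) x) \<le> (\<Sum>e\<in>E. norm (hessian (dirD v w) x *v e))"
      by (rule norm_le_sum_basis[OF E])
    also have "\<dots> = (\<Sum>e\<in>E. norm (hessian (dirD v e) x *v w))"
      by (simp only: hessian_dirD_swap[OF open_dom x\<Omega> C3_v, of w])
    also have "\<dots> \<le> (\<Sum>e\<in>E. norm (hessian (dirD v e) x) * norm w)"
      by (intro sum_mono norm_matrix_vector_le)
    also have "\<dots> \<le> R * norm w"
      using R(2)[OF x] unfolding sum_distrib_right[symmetric] by (intro mult_right_mono) auto
    finally show ?thesis .
  qed
  then show ?thesis using R(1) by blast
qed

lemma linearization_bounds:
  assumes jet: "jet FFz f1 f2" and sub: "cball x0 r \<subseteq> \<Omega>" and r: "r > 0"
  shows "\<exists>c>0. \<exists>L. \<forall>x\<in>cball x0 r. \<forall>g. norm g = 1 \<longrightarrow>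
     c \<le> f1 (vjet x) (0, 0, tensor g g) \<and> f1 (vjet x) (0, 0, tensor g g) \<le> L"
proof -
  let ?T = "cball x0 r \<times> sphere (0 :: real^'n) 1"
  let ?F = "\<lambda>z. f1 (vjet (fst z)) (0, 0, tensor (snd z) (snd z))"
  have sub': "fst ` ?T \<subseteq> \<Omega>" using sub by auto
  have "continuous_on UNIV (\<lambda>z. f1 (fst z) (snd z))"
    using jetD(1)[OF jet] by (intro continuous_at_imp_continuous_on ballI continuous_real_polymonial_function)
  moreover have "continuous_on ?T (\<lambda>z. ((gradient v (fst z), - v (fst z), hessian v (fst z)), (0 :: real^'n, 0 :: real, tensor (snd z) (snd z))))"
    by (intro continuous_intros continuous_on_tensor continuous_on_compose2[OF cont_vjet(1) _ sub']
        continuous_on_compose2[OF cont_vjet(2) _ sub'] continuous_on_compose2[OF cont_vjet(3) _ sub'])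
  ultimately have cont: "continuous_on ?T ?F"
    unfolding vjet_def by (rule continuous_on_compose2[THEN continuous_on_eq]) auto
  have comp: "compact ?T" by (intro compact_Times compact_cball compact_sphere)
  have "(x0, axis undefined 1) \<in> ?T" using r by simp
  then have ne: "?T \<noteq> {}" by blast
  obtain a where a: "a \<in> ?T" "\<And>z. z \<in> ?T \<Longrightarrow> ?F a \<le> ?F z"
    using continuous_attains_inf[OF comp ne cont] by blast
  obtain b where b: "\<And>z. z \<in> ?T \<Longrightarrow> ?F z \<le> ?F b"
    using continuous_attains_sup[OF comp ne cont] by blast
  have "?F a > 0" using a(1) sub by (intro linearization_tensor_pos[OF jet]) auto
  moreover have "?F a \<le> f1 (vjet x) (0, 0, tensor g g) \<and> f1 (vjet x) (0, 0, tensor g g) \<le> ?F b"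
    if "x \<in> cball x0 r" "norm g = 1" for x g
    using a(2)[of "(x, g)"] b[of "(x, g)"] that by simp
  ultimately show ?thesis by blast
qed

end

context curvature_solution
begin

text \<open>\<open>P - P X P\<close> vanishes exactly where the rank of the Hessian equals its value at \<open>x0\<close>. Its second
  derivatives are \<open>P X (T4 - 2 T3 X T3) X P\<close>; the symmetry of \<open>T3\<close> and \<open>T4\<close> in all arguments
  exchanges the direction of differentiation with the test vector.\<close>

lemma rank_locally_constant:
  assumes x0: "x0 \<in> \<Omega>" and P: "transpose P = P" "P ** P = P"
    and ker: "\<And>z. hessian v x0 *v (P *v z) = 0" "\<And>z. hessian v x0 *v z = 0 \<Longrightarrow> P *v z = z"
  shows "\<exists>r>0. \<forall>x\<in>ball x0 r. x \<in> \<Omega> \<and> pos_def (hessian v x + P) \<and>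
     P - P ** matrix_inv (hessian v x + P) ** P = 0"
proof -
  let ?H = "hessian v"
  have PP: "z \<bullet> (P *v z) = (norm (P *v z))\<^sup>2" for z
    using inner_transpose_matrix[of z P "P *v z"] P
    by (simp add: matrix_vector_mul_assoc dot_square_norm del: transpose_matrix_vector)
  have "pos_def (?H x0 + P)"
    unfolding pos_def_def
  proof (intro conjI allI impI)
    show "transpose (?H x0 + P) = ?H x0 + P" by (simp add: transpose_add hessian_v_sym[OF x0] P(1))
    fix z :: "real^'n" assume z: "z \<noteq> 0"
    have "z \<bullet> ((?H x0 + P) *v z) = z \<bullet> (?H x0 *v z) + (norm (P *v z))\<^sup>2"
      by (simp add: matrix_vector_simps inner_add_right PP)
    moreover have "z \<bullet> (?H x0 *v z) \<noteq> 0 \<or> P *v z \<noteq> 0"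
      using psd_kernel[OF hessian_v_sym[OF x0] v_convex[OF x0], of z] ker(2)[of z] z by auto
    moreover have "0 \<le> z \<bullet> (?H x0 *v z)" by (rule v_convex[OF x0])
    ultimately show "0 < z \<bullet> ((?H x0 + P) *v z)"
      by (metis add_nonneg_pos add_pos_nonneg less_eq_real_def zero_le_power2 zero_less_norm_iff zero_less_power)
  qed
  from pos_def_neighbourhood[OF x0 this P(1)] obtain c r0 where c: "c > 0" and r0: "r0 > 0" "cball x0 r0 \<subseteq> \<Omega>"
    and nb: "\<forall>x\<in>cball x0 r0. pos_def (?H x + P) \<and> (\<forall>z. c * (norm z)\<^sup>2 \<le> z \<bullet> ((?H x + P) *v z))"
    by (elim exE conjE) (rule that)
  then have pd: "pos_def (?H x + P)" and low: "c * (norm z)\<^sup>2 \<le> z \<bullet> ((?H x + P) *v z)" if "x \<in> cball x0 r0" for x z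
    using that by blast+
  define X where "X x = matrix_inv (?H x + P)" for x
  define S where "S x = P - P ** X x ** P" for x
  define K where "K = real CARD('n) / c"
  have XK: "norm (X x) \<le> K" if "x \<in> cball x0 r0" for x
    unfolding X_def K_def by (rule norm_matrix_inv_le[OF pd[OF that] c low[OF that]])
  have inv: "(?H x + P) ** X x = mat 1" "X x ** (?H x + P) = mat 1" if "x \<in> cball x0 r0" for x
    unfolding X_def by (rule pos_def_invertible[OF pd[OF that]])+
  have symX: "transpose (X x) = X x" if "x \<in> cball x0 r0" for x
    using pos_def_matrix_inv[OF pd[OF that]] by (simp add: X_def pos_def_def)
  note contH = continuous_on_subset[OF cont_vjet(3) r0(2)]
  have contX: "continuous_on (cball x0 r0) X"
    unfolding X_def
    by (rule continuous_on_matrix_inv[OF _ pd XK[unfolded X_def]]) (intro continuous_intros contH)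
  have contS: "continuous_on (cball x0 r0) S"
    unfolding S_def by (intro continuous_intros contX bounded_bilinear.continuous_on[OF bounded_bilinear_matrix_matrix])
  have x0r: "x0 \<in> cball x0 r0" using r0(1) by simp
  have S0: "S x0 = 0"
  proof -
    have "?H x0 ** P = 0"
      by (rule matrix_eq_inner) (simp add: ker(1) flip: matrix_vector_mul_assoc)
    then have "(?H x0 + P) ** P = P" by (simp add: matrix_mult_simps P(2))
    then have "X x0 ** P = X x0 ** (?H x0 + P) ** P" by (metis matrix_mul_assoc)
    then show ?thesis using inv(2)[OF x0r] P(2) by (simp add: S_def flip: matrix_mul_assoc)
  qed
  obtain f1 f2 where jet: "jet (FFz :: (real^'n) \<times> real \<times> (real^'n^'n) \<Rightarrow> real) f1 f2"
    using jet_exists[OF FFz_polynomial] by blast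
  have contF: "continuous_on (cball x0 r0) (\<lambda>x. FF (gradient v x) (- v x) (?H x - S x))"
  proof -
    have "continuous_on UNIV (FFz :: (real^'n) \<times> real \<times> (real^'n^'n) \<Rightarrow> real)"
      using FFz_polynomial by (intro continuous_at_imp_continuous_on ballI continuous_real_polymonial_function)
    moreover have "continuous_on (cball x0 r0) (\<lambda>x. (gradient v x, - v x, ?H x - S x))"
      by (intro continuous_intros contH contS continuous_on_subset[OF cont_vjet(1) r0(2)] continuous_on_subset[OF cont_vjet(2) r0(2)])
    ultimately show ?thesis
      by (rule continuous_on_compose2[THEN continuous_on_eq]) (auto simp: FFz_def)
  qed
  have FF0: "FF (gradient v x0) (- v x0) (?H x0 - S x0) = 1" using pde_v(1)[OF x0] by (simp add: S0)
  have half: "(1 :: real) / 2 > 0" by simp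
  \<comment> \<open>The pointwise inequality evaluates \<open>FF\<close> at
    \<open>?H x - S x\<close> and asks for a value of at least 1/2; at \<open>x0\<close> the value
    is 1, and continuity gives the rest.\<close>
  obtain r1 where r1: "r1 > 0" "\<forall>x\<in>cball x0 r0. dist x x0 < r1 \<longrightarrow>
      dist (FF (gradient v x) (- v x) (?H x - S x)) (FF (gradient v x0) (- v x0) (?H x0 - S x0)) < 1 / 2"
    using contF[unfolded continuous_on_iff, rule_format, OF x0r half] by (elim exE conjE) (rule that)
  define r where "r = min r0 r1"
  have r: "r > 0" "r \<le> r0" "r \<le> r1" using r0(1) r1(1) by (auto simp: r_def)
  have br: "x \<in> cball x0 r0" "x \<in> \<Omega>" "FF (gradient v x) (- v x) (?H x - S x) \<ge> 1 / 2" if "x \<in> ball x0 r" for x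
    using that r r0(2) r1(2)[rule_format, of x] unfolding FF0 dist_real_def abs_diff_less_iff by (auto simp: dist_commute)
  define T3 where "T3 g x = hessian (dirD v g) x" for g x
  define T4 where "T4 g x = hessian (dirD (dirD v g) g) x" for g x
  have symT: "transpose (T3 g x) = T3 g x" "transpose (T4 g x) = T4 g x" if "x \<in> \<Omega>" for g x
    unfolding T3_def T4_def by (rule gradient_has_derivative(3)[OF open_dom that C2_dv(1)], rule gradient_has_derivative(3)[OF open_dom that C2_dv(2)])
  define S1 where "S1 x g = P ** X x ** T3 g x ** X x ** P" for x g
  define S2 where "S2 x g = P ** X x ** (T4 g x - 2 *\<^sub>R (T3 g x ** X x ** T3 g x)) ** X x ** P" for x g
  note hvm = bounded_bilinear.has_vector_derivative[OF bounded_bilinear_matrix_matrix]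
  have dX: "((\<lambda>s. X (x + s *\<^sub>R g)) has_vector_derivative - (X x ** T3 g x ** X x)) (at 0)" if x: "x \<in> ball x0 r" for x g
  proof -
    obtain d where d: "d > 0" "\<And>s. \<bar>s\<bar> < d \<Longrightarrow> x + s *\<^sub>R g \<in> ball x0 r" using open_line_segment[OF open_ball x] by blast
    have "isCont X x" using contX x r(2)
      by (intro continuous_on_interior) (auto simp: interior_cball)
    then have "(X \<longlongrightarrow> X (x + 0 *\<^sub>R g)) (at (x + 0 *\<^sub>R g))" by (simp add: isCont_def)
    then have lim: "((\<lambda>s. X (x + s *\<^sub>R g)) \<longlongrightarrow> X (x + 0 *\<^sub>R g)) (at 0)"
      using \<open>isCont X x\<close> by (intro isCont_tendsto_compose[of _ X]) (auto intro!: tendsto_eq_intros)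
    have dA: "((\<lambda>s. ?H (x + s *\<^sub>R g) + P) has_vector_derivative T3 g x) (at 0)"
      using has_vector_derivative_add[OF hessian_line_derivative[OF open_dom br(2)[OF x] C3_v, of g] has_vector_derivative_const[of P]]
      by (simp add: T3_def)
    have "((\<lambda>s. X (x + s *\<^sub>R g)) has_vector_derivative - (X (x + 0 *\<^sub>R g) ** T3 g x ** X (x + 0 *\<^sub>R g))) (at 0)"
      by (rule matrix_inverse_line_derivative[OF dA lim d(1)]) (use inv[OF br(1)[OF d(2)]] in simp)
    then show ?thesis by simp
  qed
  have S_S1: "((\<lambda>s. S (x + s *\<^sub>R g)) has_vector_derivative S1 x g) (at 0)" if x: "x \<in> ball x0 r" for x g
    using has_vector_derivative_diff[OF has_vector_derivative_const[of P]
        hvm[OF hvm[OF has_vector_derivative_const[of P] dX[OF x, of g]] has_vector_derivative_const[of P]]]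
    by (simp add: S_def S1_def matrix_mult_simps matrix_mul_assoc bounded_bilinear.minus_left[OF bounded_bilinear_matrix_matrix]
        bounded_bilinear.minus_right[OF bounded_bilinear_matrix_matrix] bounded_bilinear.zero_left[OF bounded_bilinear_matrix_matrix]
        bounded_bilinear.zero_right[OF bounded_bilinear_matrix_matrix])
  have S1_S2: "((\<lambda>s. S1 (x + s *\<^sub>R g) g) has_vector_derivative S2 x g) (at 0)" if x: "x \<in> ball x0 r" for x g
  proof -
    have dT: "((\<lambda>s. T3 g (x + s *\<^sub>R g)) has_vector_derivative T4 g x) (at 0)"
      unfolding T3_def T4_def by (rule hessian_line_derivative[OF open_dom br(2)[OF x] C3_dv])
    note c = has_vector_derivative_const[of P]
    note zero = bounded_bilinear.zero_left[OF bounded_bilinear_matrix_matrix] bounded_bilinear.zero_right[OF bounded_bilinear_matrix_matrix]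
      bounded_bilinear.minus_left[OF bounded_bilinear_matrix_matrix] bounded_bilinear.minus_right[OF bounded_bilinear_matrix_matrix]
    have "((\<lambda>s. S1 (x + s *\<^sub>R g) g) has_vector_derivative
        P ** X x ** T3 g x ** - (X x ** T3 g x ** X x) ** P +
        (P ** X x ** T4 g x + P ** - (X x ** T3 g x ** X x) ** T3 g x) ** X x ** P) (at 0)"
      using hvm[OF hvm[OF hvm[OF hvm[OF c dX[OF x, of g]] dT] dX[OF x, of g]] c]
      unfolding S1_def by (simp add: zero matrix_mult_simps)
    also have "P ** X x ** T3 g x ** - (X x ** T3 g x ** X x) ** P +
        (P ** X x ** T4 g x + P ** - (X x ** T3 g x ** X x) ** T3 g x) ** X x ** P = S2 x g"
      unfolding S2_def scaleR_2 zero matrix_mult_simps matrix_mul_assoc by simp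
    finally show ?thesis .
  qed
  have symS: "transpose (S x) = S x" if "x \<in> ball x0 r" for x
    using symX[OF br(1)[OF that]] by (simp add: S_def transpose_diff matrix_transpose_mul P(1) matrix_mul_assoc)
  \<comment> \<open>With \<open>w = X x *v (P *v b)\<close> the form of \<open>S x\<close> at
    \<open>b\<close> equals \<open>|P (b - w)|\<^sup>2\<close> plus the form of the Hessian at
    \<open>w\<close>.\<close>
  have psdS: "0 \<le> b \<bullet> (S x *v b)" if x: "x \<in> ball x0 r" for x b
  proof -
    define w where "w = X x *v (P *v b)"
    have "(?H x + P) *v w = P *v b"
      unfolding w_def using inv(1)[OF br(1)[OF x]] by (simp add: matrix_vector_mul_assoc matrix_mul_assoc)
    then have Hw: "?H x *v w = P *v (b - w)" by (simp add: matrix_vector_simps algebra_simps)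
    have "S x *v b = P *v (b - w)"
      by (simp add: S_def w_def matrix_vector_simps flip: matrix_vector_mul_assoc)
    then have "b \<bullet> (S x *v b) = (b - w) \<bullet> (P *v (b - w)) + w \<bullet> (?H x *v w)"
      by (simp add: Hw inner_diff_left)
    then show ?thesis using v_convex[OF br(2)[OF x], of w] by (simp add: PP)
  qed
  obtain c1 L where c1: "c1 > 0" "\<forall>x\<in>cball x0 r0. \<forall>g. norm g = 1 \<longrightarrow>
      c1 \<le> f1 (vjet x) (0, 0, tensor g g) \<and> f1 (vjet x) (0, 0, tensor g g) \<le> L"
    using linearization_bounds[OF jet r0(2,1)] by (elim exE conjE) (rule that)
  obtain R3 where R3: "R3 \<ge> 0" "\<And>x w. x \<in> cball x0 r0 \<Longrightarrow> norm (T3 w x) \<le> R3 * norm w"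
    using third_derivative_bound[OF r0(2)] unfolding T3_def by blast
  obtain Rq Rt RB where Rq: "Rq \<ge> 0" "\<forall>y\<in>cball x0 r0. norm (gradient v y) \<le> Rq"
    and Rt: "Rt \<ge> 0" "\<forall>y\<in>cball x0 r0. norm (- v y) \<le> Rt"
    and RB: "RB \<ge> 0" "\<forall>y\<in>cball x0 r0. norm (?H y) \<le> RB"
    using continuous_on_cball_bounded[OF continuous_on_subset[OF cont_vjet(1) r0(2)]]
      continuous_on_cball_bounded[OF continuous_on_minus[OF continuous_on_subset[OF cont_vjet(2) r0(2)]]]
      continuous_on_cball_bounded[OF contH] by blast
  have K0: "K \<ge> 0" using c by (simp add: K_def)
  define R where "R = Rq + Rt + RB + norm P + K + R3 * (K * norm P)"
  have R: "R \<ge> 0" "Rq \<le> R" "Rt \<le> R" "RB \<le> R" "norm P \<le> R" "K \<le> R" "R3 * (K * norm P) \<le> R"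
    using Rq(1) Rt(1) RB(1) K0 R3(1) by (simp_all add: R_def)
  obtain C where C: "C \<ge> 0" and keyC: "\<forall>q t B P X Y W b. norm q \<le> R \<and> norm t \<le> R \<and> norm B \<le> R \<and> norm P \<le> R \<and> norm X \<le> R \<and> norm Y \<le> R \<and>
    norm b \<le> 1 \<and> t > 0 \<and> transpose P = P \<and> transpose Y = Y \<and> P ** P = P \<and>
    pos_def (B + P) \<and> (B + P) ** X = mat 1 \<and> X ** (B + P) = mat 1 \<and> FF q t (B - (P - P ** X ** P)) \<ge> 1 / 2 \<and>
    f1 (q, t, B) (B *v (X *v (P *v b)), - (q \<bullet> (X *v (P *v b))), Y) = 0 \<and>
    f2 (q, t, B) (B *v (X *v (P *v b)), - (q \<bullet> (X *v (P *v b))), Y)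
       (Y *v (X *v (P *v b)), - ((X *v (P *v b)) \<bullet> (B *v (X *v (P *v b)))), W) = 0 \<longrightarrow>
    f1 (q, t, B) (0, 0, W - 2 *\<^sub>R (Y ** X ** Y)) \<le> C * (norm (P - P ** X ** P) + norm (Y ** X ** P))"
    using key_inequality[OF jet R(1)] by (elim exE conjE) (rule that)
  have ineq: "\<exists>E \<mu>. orthonormal_basis E \<and> (\<forall>g\<in>E. c1 \<le> \<mu> g \<and> \<mu> g \<le> L) \<and>
       (\<forall>b. norm b \<le> 1 \<longrightarrow> (\<Sum>g\<in>E. \<mu> g * (b \<bullet> (S2 x g *v b))) \<le> C * (norm (S x) + (\<Sum>g\<in>E. norm (S1 x g))))"
    if x: "x \<in> ball x0 r" for x
  proof -
    note x' = br[OF x]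
    have "linear (\<lambda>Z. f1 (vjet x) (0, 0, Z))"
      using linear_compose[OF _ jetD(6)[OF jet, of "vjet x"], of "\<lambda>Z. (0, 0, Z)"]
      by (simp add: o_def linear_iff)
    then obtain \<F> where \<F>: "transpose \<F> = \<F>" "\<And>Z. transpose Z = Z \<Longrightarrow> f1 (vjet x) (0, 0, Z) = \<F> \<bullet> Z"
      using linear_functional_symmetric_matrix by blast
    obtain E where E: "orthonormal_basis E" "\<And>e. e \<in> E \<Longrightarrow> \<F> *v e = (e \<bullet> (\<F> *v e)) *\<^sub>R e"
      using spectral_theorem[OF \<F>(1)] by blast
    have \<mu>: "f1 (vjet x) (0, 0, tensor g g) = g \<bullet> (\<F> *v g)" for g
    proof -
      have "\<F> \<bullet> tensor g g = trace (\<F> ** tensor g g)" by (simp add: inner_matrix_trace \<F>(1))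
      then show ?thesis by (simp add: \<F>(2) transpose_tensor matrix_mult_tensor trace_tensor inner_commute)
    qed
    have bounds: "c1 \<le> g \<bullet> (\<F> *v g) \<and> g \<bullet> (\<F> *v g) \<le> L" if "g \<in> E" for g
      using c1(2)[rule_format, OF x'(1), of g] E(1) that by (simp add: \<mu> orthonormal_basis_def)
    have "(\<Sum>g\<in>E. (g \<bullet> (\<F> *v g)) * (b \<bullet> (S2 x g *v b))) \<le> C * (norm (S x) + (\<Sum>g\<in>E. norm (S1 x g)))"
      if b: "norm b \<le> 1" for b
    proof -
      define w where "w = X x *v (P *v b)"
      define Y where "Y = T3 w x"
      define Z where "Z = T4 w x - 2 *\<^sub>R (Y ** X x ** Y)"
      have nw: "norm w \<le> K * norm P"
      proof -
        have "norm w \<le> norm (X x) * (norm P * norm b)"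
          unfolding w_def by (rule order_trans[OF norm_matrix_vector_le mult_left_mono[OF norm_matrix_vector_le]]) simp
        also have "\<dots> \<le> K * (norm P * 1)"
          using XK[OF x'(1)] b K0 by (intro mult_mono) auto
        finally show ?thesis by simp
      qed
      have "norm Y \<le> R3 * (K * norm P)"
        unfolding Y_def by (rule order_trans[OF R3(2)[OF x'(1)] mult_left_mono[OF nw R3(1)]])
      then have nY: "norm Y \<le> R" using R(7) by linarith
      have symY: "transpose Y = Y" unfolding Y_def by (rule symT(1)[OF x'(2)])
      have Yg: "Y *v g = T3 g x *v w" for g
        unfolding Y_def T3_def by (rule hessian_dirD_swap[OF open_dom x'(2) C3_v])
      have conj: "z \<bullet> ((P ** X x ** M ** X x ** P) *v y) = (X x *v (P *v z)) \<bullet> (M *v (X x *v (P *v y)))" for z M y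
        using sym_matrix_inner[OF P(1), of z "X x *v (M *v (X x *v (P *v y)))"]
          sym_matrix_inner[OF symX[OF x'(1)], of "P *v z" "M *v (X x *v (P *v y))"]
        by (simp add: inner_commute flip: matrix_vector_mul_assoc)
      have swap: "w \<bullet> ((M ** X x ** M) *v w) = (M *v w) \<bullet> (X x *v (M *v w))" if "transpose M = M" for M w
        using sym_matrix_inner[OF that, of w "X x *v (M *v w)"]
        by (simp add: inner_commute flip: matrix_vector_mul_assoc)
      \<comment> \<open>\<open>Z\<close> involves derivatives of the Hessian in the single direction
        \<open>w\<close> only, so it can be estimated by differentiating the equation along
        \<open>w\<close>.\<close>
      have "b \<bullet> (S2 x g *v b) = g \<bullet> (Z *v g)" for g
      proof -
        have "b \<bullet> (S2 x g *v b) = w \<bullet> (T4 g x *v w) - 2 * (w \<bullet> ((T3 g x ** X x ** T3 g x) *v w))"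
          unfolding S2_def conj w_def[symmetric] by (simp add: matrix_vector_simps inner_diff_right)
        also have "\<dots> = g \<bullet> (T4 w x *v g) - 2 * (g \<bullet> ((Y ** X x ** Y) *v g))"
          using hessian_dirD_pairs_swap[OF open_dom x'(2) C4'_v, of w g] swap[OF symT(1)[OF x'(2)], of w g]
            swap[of Y g] symT(1)[OF x'(2), of w]
          by (simp add: T4_def Yg flip: Y_def)
        finally show ?thesis by (simp add: Z_def matrix_vector_simps inner_diff_right)
      qed
      then have "(\<Sum>g\<in>E. (g \<bullet> (\<F> *v g)) * (b \<bullet> (S2 x g *v b))) = \<F> \<bullet> Z"
        by (simp add: inner_matrix_spectral[OF E])
      also have "\<dots> = f1 (vjet x) (0, 0, Z)"
      proof -
        have "transpose Z = Z"
          using symT[OF x'(2)] symX[OF x'(1)]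
          by (simp add: Z_def Y_def transpose_diff transpose_scaleR matrix_transpose_mul matrix_mul_assoc)
        then show ?thesis by (simp add: \<F>(2))
      qed
      also have "\<dots> \<le> C * (norm (S x) + norm (Y ** X x ** P))"
      proof -
        have "norm (gradient v x) \<le> R" "norm (- v x) \<le> R" "norm (?H x) \<le> R" "norm (X x) \<le> R"
          using Rq(2) Rt(2) RB(2) XK[OF x'(1)] R x'(1) by (meson order_trans)+
        moreover have "- v x > 0" using v_neg[OF x'(2)] by simp
        moreover note pde_first_derivative[OF jet x'(2), of w] pde_second_derivative[OF jet x'(2), of w]
        moreover note symY
        ultimately show ?thesis
          using keyC[rule_format, of "gradient v x" "- v x" "?H x" P "X x" Y b "T4 w x"] R(5) nY b P pd[OF x'(1)] inv[OF x'(1)] x'(3)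
          unfolding S_def Z_def T4_def vjet_def w_def Y_def T3_def by blast
      qed
      \<comment> \<open>The transpose of this matrix sends \<open>g\<close> to
        \<open>S1 x g *v b\<close>, so its norm is controlled by the first derivatives of
        \<open>S\<close>.\<close>
      also have "norm (Y ** X x ** P) \<le> (\<Sum>g\<in>E. norm (S1 x g))"
      proof -
        have tr: "transpose (Y ** X x ** P) *v g = S1 x g *v b" for g
          using symY symX[OF x'(1)] P(1) Yg[of g]
          by (simp add: matrix_transpose_mul S1_def w_def flip: matrix_vector_mul_assoc del: transpose_matrix_vector)
        have "norm (Y ** X x ** P) \<le> (\<Sum>g\<in>E. norm (S1 x g *v b))"
          using norm_le_sum_basis[OF E(1), of "transpose (Y ** X x ** P)"] by (simp only: norm_transpose tr)
        also have "\<dots> \<le> (\<Sum>g\<in>E. norm (S1 x g))"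
        proof (rule sum_mono)
          fix g
          show "norm (S1 x g *v b) \<le> norm (S1 x g)"
            using norm_matrix_vector_le[of "S1 x g" b] mult_left_mono[OF b norm_ge_zero[of "S1 x g"]] by simp
        qed
        finally show ?thesis .
      qed
      finally show ?thesis using C by (simp add: mult_left_mono)
    qed
    then show ?thesis using E(1) bounds by (intro exI[of _ E] exI[of _ "\<lambda>g. g \<bullet> (\<F> *v g)"]) blast
  qed
  have "S x = 0" if "x \<in> ball x0 (r / 4)" for x
    by (rule strong_minimum_principle[OF r(1) c1(1) C symS psdS S_S1 S1_S2 _ ineq S0 that])
       (use continuous_on_subset[OF contS] r(2) in \<open>auto simp: subset_iff\<close>)
  moreover have "ball x0 (r / 4) \<subseteq> ball x0 r" using r(1) by auto
  ultimately show ?thesis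
    using r(1) br pd unfolding S_def X_def by (intro exI[of _ "r / 4"]) (auto simp: subset_iff)
qed

end

context curvature_solution
begin

lemma pos_def_hessian_v:
  assumes "x \<in> \<Omega>"
  shows "pos_def (hessian v x)"
proof (rule ccontr)
  assume npd: "\<not> pos_def (hessian v x)"
  define A B where "A = {x \<in> \<Omega>. pos_def (hessian v x)}" and "B = {x \<in> \<Omega>. \<not> pos_def (hessian v x)}"
  have "open A"
    unfolding open_contains_ball
  proof
    fix y assume "y \<in> A"
    then have "y \<in> \<Omega>" "pos_def (hessian v y + 0)" by (simp_all add: A_def)
    then obtain r where "r > 0" "cball y r \<subseteq> \<Omega>" "\<forall>x\<in>cball y r. pos_def (hessian v x + 0)"
      using pos_def_neighbourhood[of y 0] by (force simp: transpose_def vec_eq_iff)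
    then show "\<exists>e>0. ball y e \<subseteq> A" by (intro exI[of _ r]) (auto simp: A_def subset_iff)
  qed
  moreover have "open B"
    unfolding open_contains_ball
  proof
    fix y assume "y \<in> B"
    then have y: "y \<in> \<Omega>" "\<not> pos_def (hessian v y)" by (simp_all add: B_def)
    have "subspace {z. hessian v y *v z = 0}"
      by (simp add: subspace_def matrix_vector_simps)
    then obtain P where P: "transpose P = P" "P ** P = P" "\<And>z. P *v z \<in> {z. hessian v y *v z = 0}"
      "\<And>z. z \<in> {z. hessian v y *v z = 0} \<Longrightarrow> P *v z = z"
      using exists_projection_matrix by blast
    obtain z where z: "z \<noteq> 0" "\<not> 0 < z \<bullet> (hessian v y *v z)"
      using y hessian_v_sym unfolding pos_def_def by blast
    have "z \<bullet> (hessian v y *v z) = 0" using z(2) v_convex[OF y(1), of z] by linarith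
    then have Pz: "P *v z = z" using psd_kernel[OF hessian_v_sym v_convex, OF y(1) y(1)] P(4) by simp
    obtain r where r: "r > 0" "\<forall>x\<in>ball y r. x \<in> \<Omega> \<and> pos_def (hessian v x + P) \<and> P - P ** matrix_inv (hessian v x + P) ** P = 0"
      using rank_locally_constant[OF y(1) P(1,2)] P(3,4) by blast
    \<comment> \<open>The kernel vector \<open>z\<close> at \<open>y\<close> yields one at
      \<open>x\<close>: with \<open>P = P ** X ** P\<close> the vector \<open>w = X *v z\<close>
      satisfies \<open>P *v w = z\<close>, while the Hessian plus \<open>P\<close> also sends
      \<open>w\<close> to \<open>z\<close>.\<close>
    have "\<not> pos_def (hessian v x)" if x: "x \<in> ball y r" for x
    proof -
      define w where "w = matrix_inv (hessian v x + P) *v z"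
      have pd: "pos_def (hessian v x + P)" and S: "P = P ** matrix_inv (hessian v x + P) ** P" using r(2) x by auto
      have "(hessian v x + P) *v w = z"
        unfolding w_def using pos_def_invertible(1)[OF pd] by (simp add: matrix_vector_mul_assoc)
      moreover have "P *v w = z"
        using arg_cong[OF S, of "\<lambda>M. M *v z"] by (simp add: w_def Pz flip: matrix_vector_mul_assoc)
      ultimately have "hessian v x *v w = 0" "w \<noteq> 0" using z(1) by (auto simp: matrix_vector_simps)
      then show ?thesis unfolding pos_def_def by force
    qed
    then show "\<exists>e>0. ball y e \<subseteq> B" using r by (intro exI[of _ r]) (auto simp: B_def)
  qed
  moreover have "\<Omega> \<subseteq> A \<union> B" "A \<inter> B \<inter> \<Omega> = {}" by (auto simp: A_def B_def)
  moreover have "A \<inter> \<Omega> \<noteq> {}" using exists_pos_def_point by (auto simp: A_def)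
  moreover have "B \<inter> \<Omega> \<noteq> {}" using assms npd by (auto simp: B_def)
  ultimately show False using conn unfolding connected_def by blast
qed

end

theorem theorem1p1:
  fixes \<Omega> :: "(real^'n) set" and u v :: "real^'n \<Rightarrow> real"
  assumes "CARD('n) \<ge> 3"
    and "open \<Omega>" and "connected \<Omega>" and "\<Omega> \<noteq> {}" and "bounded \<Omega>"
    and "smooth_boundary \<Omega>" and "uniformly_convex \<Omega>"
    and "smooth_on \<Omega> u" and "C11_closure \<Omega> u"
    and "Gamma2_admissible \<Omega> u"
    and "\<forall>x\<in>\<Omega>. sigma2 (graph_curvatures u x) = (1 + (norm (gradient u x))\<^sup>2) powi (-2)"
    and "\<forall>x\<in>frontier \<Omega>. u x = 0"
    and "v = (\<lambda>x. - sqrt (- u x))"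
  shows "(\<forall>x\<in>\<Omega>. u x < 0) \<and> strictly_convex_in \<Omega> v"
proof -
  interpret S: curvature_solution \<Omega> u
    using assms convex_domain[OF assms(2,3,6,7)]
    by unfold_locales (auto simp: smooth_on_def C11_closure_def)
  have "v = S.v" using assms(13) by (simp add: S.v_def)
  then show ?thesis
    using S.u_neg S.pos_def_hessian_v by (simp add: strictly_convex_in_def)
qed

end
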